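(* Let $E$ and $X$ be objects of $\mathsf{D}(\Lambda)$. If $E\ne 0$ and $X\otimes^L_\Lambda E=0$, then $\mathrm{RHom}_\Lambda(X,\Lambda)=0$ and $\mathrm{Hom}_{\mathsf{D}(\Lambda)}(X,\Lambda)=0$.
   Context: Fix a countable field $k$ and integers $n_i\ge 2$ for all $i\ge 1$. Let $\Lambda = k[x_1,x_2,x_3,\dots]/(x_i^{n_i}\ \text{for all } i)$, graded by $\deg x_i = 2^i$. All modules are graded; $\mathsf{D}(\Lambda)$ is the unbounded derived category of (cochain complexes of) graded $\Lambda$-modules with degree-preserving maps, and $\otimes^L_\Lambda$ is the derived tensor product. $\mathrm{RHom}_\Lambda$ is the graded (bigraded) derived Hom, so its cohomology consists of the groups $\mathrm{Hom}_{\mathsf{D}(\Lambda)}(\Sigma^{i,j}X,\Lambda)$ for all integers $i,j$, where $\Sigma^{i,j}$ shifts a complex by $i$ in the homological grading and by $j$ in the internal grading of modules. *)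

theory Defs
  imports
    "HOL-Algebra.Module"
    "HOL-Algebra.QuotRing"
    "HOL-Algebra.Free_Abelian_Groups"
    "HOL-Algebra.Elementary_Groups"
    "HOL-Library.Poly_Mapping"
    "HOL-Library.Countable_Set"
    "HOL-Library.Disjoint_Sets"
begin

section \<open>The graded ring \<open>\<Lambda>\<close>\<close>

text \<open>Polynomials in \<open>x\<^sub>1, x\<^sub>2, \<dots>\<close> over \<open>'k\<close>. The variable \<open>x\<^sub>i\<close> (\<open>i \<ge> 1\<close>) occupies slot \<open>i - 1\<close> of an
  exponent vector, so that there is no variable \<open>x\<^sub>0\<close>.\<close>

type_synonym 'k inf_poly = "(nat \<Rightarrow>\<^sub>0 nat) \<Rightarrow>\<^sub>0 'k"

definition poly_ring :: "'k::field inf_poly ring" where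
  "poly_ring = \<lparr>carrier = UNIV, monoid.mult = (*), one = 1, ring.zero = 0, add = (+)\<rparr>"

definition xvar :: "nat \<Rightarrow> 'k::field inf_poly" where
  "xvar i = Poly_Mapping.single (Poly_Mapping.single (i - 1) 1) 1"

definition weight :: "(nat \<Rightarrow>\<^sub>0 nat) \<Rightarrow> nat" where
  "weight m = (\<Sum>s\<in>Poly_Mapping.keys m. Poly_Mapping.lookup m s * 2 ^ (s + 1))"

definition homogeneous_polys :: "int \<Rightarrow> 'k::field inf_poly set" where
  "homogeneous_polys d = {p. \<forall>m\<in>Poly_Mapping.keys p. int (weight m) = d}"

definition trunc_ideal :: "(nat \<Rightarrow> nat) \<Rightarrow> 'k::field inf_poly set" where
  "trunc_ideal n = Idl\<^bsub>poly_ring\<^esub> {xvar i ^ n i |i. 1 \<le> i}"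

type_synonym 'k lam = "'k inf_poly set"

definition Lam :: "(nat \<Rightarrow> nat) \<Rightarrow> 'k::field lam ring" where
  "Lam n = poly_ring Quot (trunc_ideal n)"

definition Lam_grade :: "(nat \<Rightarrow> nat) \<Rightarrow> int \<Rightarrow> 'k::field lam set" where
  "Lam_grade n d = (\<lambda>p. trunc_ideal n +>\<^bsub>poly_ring\<^esub> p) ` homogeneous_polys d"


section \<open>Graded modules and cochain complexes\<close>

record ('a, 'm) gmodule = "('a, 'm) module" +
  grade :: "int \<Rightarrow> 'm set"

definition graded_module :: "(nat \<Rightarrow> nat) \<Rightarrow> ('k::field lam, 'm) gmodule \<Rightarrow> bool" where
  "graded_module n M \<longleftrightarrow>
     module (Lam n) M \<and>
     (\<forall>j. additive_subgroup (grade M j) M) \<and>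
     (\<forall>x\<in>carrier M. \<exists>!c. (\<forall>j. c j \<in> grade M j) \<and> finite {j. c j \<noteq> \<zero>\<^bsub>M\<^esub>} \<and>
        x = (\<Oplus>\<^bsub>M\<^esub>j\<in>{j. c j \<noteq> \<zero>\<^bsub>M\<^esub>}. c j)) \<and>
     (\<forall>d j. \<forall>a\<in>Lam_grade n d. \<forall>x\<in>grade M j. a \<odot>\<^bsub>M\<^esub> x \<in> grade M (d + j))"

definition graded_hom ::
  "(nat \<Rightarrow> nat) \<Rightarrow> ('k::field lam, 'm) gmodule \<Rightarrow> ('k lam, 'l) gmodule \<Rightarrow> ('m \<Rightarrow> 'l) set" where
  "graded_hom n M N =
     {f. f \<in> hom (add_monoid M) (add_monoid N) \<and>
         (\<forall>a\<in>carrier (Lam n). \<forall>x\<in>carrier M. f (a \<odot>\<^bsub>M\<^esub> x) = a \<odot>\<^bsub>N\<^esub> f x) \<and>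
         (\<forall>j. f ` grade M j \<subseteq> grade N j)}"

record ('a, 'm) gcomplex =
  obj :: "int \<Rightarrow> ('a, 'm) gmodule"
  diff :: "int \<Rightarrow> 'm \<Rightarrow> 'm"

definition complex :: "(nat \<Rightarrow> nat) \<Rightarrow> ('k::field lam, 'm) gcomplex \<Rightarrow> bool" where
  "complex n X \<longleftrightarrow>
     (\<forall>i. graded_module n (obj X i) \<and>
          diff X i \<in> graded_hom n (obj X i) (obj X (i + 1)) \<and>
          (\<forall>x\<in>carrier (obj X i). diff X (i + 1) (diff X i x) = \<zero>\<^bsub>obj X (i + 2)\<^esub>))"

definition chain_map ::
  "(nat \<Rightarrow> nat) \<Rightarrow> ('k::field lam, 'm) gcomplex \<Rightarrow> ('k lam, 'l) gcomplex \<Rightarrow> (int \<Rightarrow> 'm \<Rightarrow> 'l) set" where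
  "chain_map n X Y =
     {f. \<forall>i. f i \<in> graded_hom n (obj X i) (obj Y i) \<and>
             (\<forall>x\<in>carrier (obj X i). f (i + 1) (diff X i x) = diff Y i (f i x))}"

definition homotopic ::
  "(nat \<Rightarrow> nat) \<Rightarrow> ('k::field lam, 'm) gcomplex \<Rightarrow> ('k lam, 'l) gcomplex \<Rightarrow>
   (int \<Rightarrow> 'm \<Rightarrow> 'l) \<Rightarrow> (int \<Rightarrow> 'm \<Rightarrow> 'l) \<Rightarrow> bool" where
  "homotopic n X Y f g \<longleftrightarrow>
     (\<exists>h. (\<forall>i. h i \<in> graded_hom n (obj X i) (obj Y (i - 1))) \<and>
          (\<forall>i. \<forall>x\<in>carrier (obj X i).
             f i x \<ominus>\<^bsub>obj Y i\<^esub> g i x = diff Y (i - 1) (h i x) \<oplus>\<^bsub>obj Y i\<^esub> h (i + 1) (diff X i x)))"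

definition cocycles :: "('a, 'm) gcomplex \<Rightarrow> int \<Rightarrow> 'm set" where
  "cocycles X i = {x \<in> carrier (obj X i). diff X i x = \<zero>\<^bsub>obj X (i + 1)\<^esub>}"

definition coboundaries :: "('a, 'm) gcomplex \<Rightarrow> int \<Rightarrow> 'm set" where
  "coboundaries X i = diff X (i - 1) ` carrier (obj X (i - 1))"

definition cohomology :: "('a, 'm) gcomplex \<Rightarrow> int \<Rightarrow> 'm set monoid" where
  "cohomology X i = (add_monoid (obj X i)\<lparr>carrier := cocycles X i\<rparr>) Mod coboundaries X i"

definition cohomology_map ::
  "('a, 'l) gcomplex \<Rightarrow> (int \<Rightarrow> 'm \<Rightarrow> 'l) \<Rightarrow> int \<Rightarrow> 'm set \<Rightarrow> 'l set" where
  "cohomology_map Y f i C = coboundaries Y i <+>\<^bsub>obj Y i\<^esub> f i ` C"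

definition quasi_iso ::
  "(nat \<Rightarrow> nat) \<Rightarrow> ('k::field lam, 'm) gcomplex \<Rightarrow> ('k lam, 'l) gcomplex \<Rightarrow> (int \<Rightarrow> 'm \<Rightarrow> 'l) set" where
  "quasi_iso n X Y =
     {f \<in> chain_map n X Y. \<forall>i. cohomology_map Y f i \<in> iso (cohomology X i) (cohomology Y i)}"

text \<open>The derived category is the Verdier quotient of the homotopy category by the acyclic
  complexes; a complex is a zero object of it precisely when it is acyclic.\<close>

definition zero_object :: "('a, 'm) gcomplex \<Rightarrow> bool" where
  "zero_object X \<longleftrightarrow> (\<forall>i. trivial_group (cohomology X i))"

text \<open>\<open>\<Sigma>\<^sup>i\<^sup>,\<^sup>j\<close>: homological degree is minus cohomological degree, so raising the former by \<open>i\<close> means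
  \<open>(\<Sigma>\<^sup>i\<^sup>,\<^sup>j X)\<^sup>p\<^sub>q = X\<^sup>p\<^sup>+\<^sup>i\<^sub>q\<^sub>-\<^sub>j\<close>, with differential multiplied by \<open>(-1)\<^sup>i\<close>.\<close>

definition shift :: "int \<Rightarrow> int \<Rightarrow> ('a, 'm) gcomplex \<Rightarrow> ('a, 'm) gcomplex" where
  "shift i j X =
     \<lparr>obj = (\<lambda>p. (obj X (p + i))\<lparr>grade := (\<lambda>q. grade (obj X (p + i)) (q - j))\<rparr>),
      diff = (\<lambda>p x. if even i then diff X (p + i) x
                    else \<ominus>\<^bsub>obj X (p + i + 1)\<^esub> diff X (p + i) x)\<rparr>"

definition Lam_module :: "(nat \<Rightarrow> nat) \<Rightarrow> ('k::field lam, 'k lam) gmodule" where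
  "Lam_module n = \<lparr>carrier = carrier (Lam n), monoid.mult = monoid.mult (Lam n), one = \<one>\<^bsub>Lam n\<^esub>,
     ring.zero = \<zero>\<^bsub>Lam n\<^esub>, add = add (Lam n), smult = monoid.mult (Lam n), grade = Lam_grade n\<rparr>"

text \<open>\<open>\<Lambda>\<close> as a complex concentrated in cohomological degree \<open>0\<close>.\<close>

definition Lam_complex :: "(nat \<Rightarrow> nat) \<Rightarrow> ('k::field lam, 'k lam) gcomplex" where
  "Lam_complex n =
     \<lparr>obj = (\<lambda>i. if i = 0 then Lam_module n
                 else (Lam_module n)\<lparr>carrier := {\<zero>\<^bsub>Lam n\<^esub>}, grade := (\<lambda>_. {\<zero>\<^bsub>Lam n\<^esub>})\<rparr>),
      diff = (\<lambda>_ _. \<zero>\<^bsub>Lam n\<^esub>)\<rparr>"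


section \<open>Morphisms in the derived category\<close>

text \<open>Every complex of graded modules is isomorphic to one whose elements come from some type \<open>'u\<close>, and
  \<open>'u\<close> plays the role of the universe: the morphisms \<open>X \<rightarrow> Y\<close> in the derived category are fractions
  \<open>X \<leftarrow> W \<rightarrow> Y\<close> with \<open>W\<close> carried by \<open>'u\<close>. Whenever \<open>'u\<close> is infinite and at least as large as \<open>\<Lambda>\<close> (for
  countable \<open>'k\<close>: whenever \<open>'u\<close> is infinite), every complex carried by \<open>'u\<close> has a semi-free
  resolution carried by \<open>'u\<close>; these are cofinal among all quasi-isomorphisms into \<open>X\<close>, so that
  restricting \<open>W\<close> (and \<open>V\<close> below) to \<open>'u\<close> does not change the Hom set. The target \<open>Y\<close> may live
  on any type, since only fractions out of \<open>X\<close> are formed.\<close>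

type_synonym ('k, 'u, 'l) fraction =
  "('k lam, 'u) gcomplex \<times> (int \<Rightarrow> 'u \<Rightarrow> 'u) \<times> (int \<Rightarrow> 'u \<Rightarrow> 'l)"

definition fractions ::
  "(nat \<Rightarrow> nat) \<Rightarrow> ('k::field lam, 'u) gcomplex \<Rightarrow> ('k lam, 'l) gcomplex \<Rightarrow> ('k, 'u, 'l) fraction set" where
  "fractions n X Y =
     {(W, s, f). complex n W \<and> s \<in> quasi_iso n W X \<and> f \<in> chain_map n W Y}"

definition fraction_equiv ::
  "(nat \<Rightarrow> nat) \<Rightarrow> ('k::field lam, 'u) gcomplex \<Rightarrow> ('k lam, 'l) gcomplex \<Rightarrow>
   (('k, 'u, 'l) fraction \<times> ('k, 'u, 'l) fraction) set" where
  "fraction_equiv n X Y =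
     {((W, s, f), (W', s', f')). (W, s, f) \<in> fractions n X Y \<and> (W', s', f') \<in> fractions n X Y \<and>
        (\<exists>(V :: ('k lam, 'u) gcomplex) t t'. complex n V \<and>
           t \<in> chain_map n V W \<and> t' \<in> chain_map n V W' \<and>
           (\<lambda>i. s i \<circ> t i) \<in> quasi_iso n V X \<and>
           homotopic n V X (\<lambda>i. s i \<circ> t i) (\<lambda>i. s' i \<circ> t' i) \<and>
           homotopic n V Y (\<lambda>i. f i \<circ> t i) (\<lambda>i. f' i \<circ> t' i))}"

definition Hom_D ::
  "(nat \<Rightarrow> nat) \<Rightarrow> ('k::field lam, 'u) gcomplex \<Rightarrow> ('k lam, 'l) gcomplex \<Rightarrow> ('k, 'u, 'l) fraction set set" where
  "Hom_D n X Y = fractions n X Y // fraction_equiv n X Y"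

definition zero_D ::
  "(nat \<Rightarrow> nat) \<Rightarrow> ('k::field lam, 'u) gcomplex \<Rightarrow> ('k lam, 'l) gcomplex \<Rightarrow> ('k, 'u, 'l) fraction set" where
  "zero_D n X Y = fraction_equiv n X Y `` {(X, (\<lambda>i x. x), (\<lambda>i x. \<zero>\<^bsub>obj Y i\<^esub>))}"

text \<open>The cohomology of the bigraded derived Hom complex, in each bidegree; the complex is zero in
  the derived category precisely when all these groups are zero.\<close>

definition RHom_cohomology ::
  "(nat \<Rightarrow> nat) \<Rightarrow> ('k::field lam, 'u) gcomplex \<Rightarrow> ('k lam, 'l) gcomplex \<Rightarrow> int \<Rightarrow> int \<Rightarrow>
   ('k, 'u, 'l) fraction set set" where
  "RHom_cohomology n X Y i j = Hom_D n (shift i j X) Y"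

definition RHom_zero ::
  "(nat \<Rightarrow> nat) \<Rightarrow> ('k::field lam, 'u) gcomplex \<Rightarrow> ('k lam, 'l) gcomplex \<Rightarrow> bool" where
  "RHom_zero n X Y \<longleftrightarrow> (\<forall>i j. RHom_cohomology n X Y i j = {zero_D n (shift i j X) Y})"


section \<open>The tensor product of complexes\<close>

text \<open>\<open>(P \<otimes> E)\<^sup>i = \<Oplus>\<^sub>p P\<^sup>p \<otimes> E\<^sup>i\<^sup>-\<^sup>p\<close> is the free abelian group on symbols \<open>(p, x, e)\<close>, standing for
  \<open>x \<otimes> e\<close> with \<open>x \<in> P\<^sup>p\<close> and \<open>e \<in> E\<^sup>i\<^sup>-\<^sup>p\<close>, modulo the \<open>\<Lambda>\<close>-bilinearity relations.\<close>

definition tensor_symbols ::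
  "('a, 'm) gcomplex \<Rightarrow> ('a, 'l) gcomplex \<Rightarrow> int \<Rightarrow> (int \<times> 'm \<times> 'l) set" where
  "tensor_symbols P E i = {(p, x, e). x \<in> carrier (obj P p) \<and> e \<in> carrier (obj E (i - p))}"

abbreviation tensor_free ::
  "('a, 'm) gcomplex \<Rightarrow> ('a, 'l) gcomplex \<Rightarrow> int \<Rightarrow> ((int \<times> 'm \<times> 'l) \<Rightarrow>\<^sub>0 int) monoid" where
  "tensor_free P E i \<equiv> free_Abelian_group (tensor_symbols P E i)"

definition tensor_relations ::
  "(nat \<Rightarrow> nat) \<Rightarrow> ('k::field lam, 'm) gcomplex \<Rightarrow> ('k lam, 'l) gcomplex \<Rightarrow> int \<Rightarrow>
   ((int \<times> 'm \<times> 'l) \<Rightarrow>\<^sub>0 int) set" where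
  "tensor_relations n P E i = generate (tensor_free P E i)
     ({frag_of (p, x \<oplus>\<^bsub>obj P p\<^esub> y, e) - frag_of (p, x, e) - frag_of (p, y, e) |p x y e.
         x \<in> carrier (obj P p) \<and> y \<in> carrier (obj P p) \<and> e \<in> carrier (obj E (i - p))} \<union>
      {frag_of (p, x, e \<oplus>\<^bsub>obj E (i - p)\<^esub> e') - frag_of (p, x, e) - frag_of (p, x, e') |p x e e'.
         x \<in> carrier (obj P p) \<and> e \<in> carrier (obj E (i - p)) \<and> e' \<in> carrier (obj E (i - p))} \<union>
      {frag_of (p, a \<odot>\<^bsub>obj P p\<^esub> x, e) - frag_of (p, x, a \<odot>\<^bsub>obj E (i - p)\<^esub> e) |p a x e.
         a \<in> carrier (Lam n) \<and> x \<in> carrier (obj P p) \<and> e \<in> carrier (obj E (i - p))})"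

text \<open>The map on residue classes induced by a map defined on symbols.\<close>

definition tensor_induced ::
  "(nat \<Rightarrow> nat) \<Rightarrow> ('k::field lam, 'm) gcomplex \<Rightarrow> ('k lam, 'l) gcomplex \<Rightarrow> int \<Rightarrow>
   (int \<times> 'm \<times> 'l \<Rightarrow> (int \<times> 'm \<times> 'l) \<Rightarrow>\<^sub>0 int) \<Rightarrow>
   ((int \<times> 'm \<times> 'l) \<Rightarrow>\<^sub>0 int) set \<Rightarrow> ((int \<times> 'm \<times> 'l) \<Rightarrow>\<^sub>0 int) set" where
  "tensor_induced n P E i \<phi> C =
     tensor_relations n P E i <#>\<^bsub>tensor_free P E i\<^esub> frag_extend \<phi> ` C"

definition tensor_module ::
  "(nat \<Rightarrow> nat) \<Rightarrow> ('k::field lam, 'm) gcomplex \<Rightarrow> ('k lam, 'l) gcomplex \<Rightarrow> int \<Rightarrow>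
   ('k lam, ((int \<times> 'm \<times> 'l) \<Rightarrow>\<^sub>0 int) set) gmodule" where
  "tensor_module n P E i =
     (let T = tensor_free P E i Mod tensor_relations n P E i in
      \<lparr>carrier = carrier T,
       monoid.mult = (\<lambda>_ _. \<one>\<^bsub>T\<^esub>), one = \<one>\<^bsub>T\<^esub>,  \<comment> \<open>fields of the record without meaning for modules\<close>
       ring.zero = \<one>\<^bsub>T\<^esub>,
       add = monoid.mult T,
       smult = (\<lambda>a. tensor_induced n P E i (\<lambda>(p, x, e). frag_of (p, a \<odot>\<^bsub>obj P p\<^esub> x, e))),
       grade = (\<lambda>q. generate T
         {tensor_relations n P E i #>\<^bsub>tensor_free P E i\<^esub> frag_of (p, x, e) |p j x e.
            x \<in> grade (obj P p) j \<and> e \<in> grade (obj E (i - p)) (q - j)})\<rparr>)"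

definition tensor ::
  "(nat \<Rightarrow> nat) \<Rightarrow> ('k::field lam, 'm) gcomplex \<Rightarrow> ('k lam, 'l) gcomplex \<Rightarrow>
   ('k lam, ((int \<times> 'm \<times> 'l) \<Rightarrow>\<^sub>0 int) set) gcomplex" where
  "tensor n P E =
     \<lparr>obj = tensor_module n P E,
      diff = (\<lambda>i. tensor_induced n P E (i + 1)
        (\<lambda>(p, x, e). frag_of (p + 1, diff P p x, e) +
           (if even p then frag_of (p, x, diff E (i - p) e)
            else - frag_of (p, x, diff E (i - p) e))))\<rparr>"


section \<open>Semi-free resolutions and the derived tensor product\<close>

definition free_basis :: "'a ring \<Rightarrow> ('a, 'm) gmodule \<Rightarrow> 'm set \<Rightarrow> bool" where
  "free_basis R M B \<longleftrightarrow> B \<subseteq> carrier M \<and>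
     (\<forall>x\<in>carrier M. \<exists>!c. (\<forall>b. c b \<in> carrier R) \<and> {b. c b \<noteq> \<zero>\<^bsub>R\<^esub>} \<subseteq> B \<and> finite {b. c b \<noteq> \<zero>\<^bsub>R\<^esub>} \<and>
        x = (\<Oplus>\<^bsub>M\<^esub>b\<in>{b. c b \<noteq> \<zero>\<^bsub>R\<^esub>}. c b \<odot>\<^bsub>M\<^esub> b))"

definition lin_span :: "'a ring \<Rightarrow> ('a, 'm) gmodule \<Rightarrow> 'm set \<Rightarrow> 'm set" where
  "lin_span R M S =
     {\<Oplus>\<^bsub>M\<^esub>b\<in>F. c b \<odot>\<^bsub>M\<^esub> b |c F. finite F \<and> F \<subseteq> S \<and> c \<in> F \<rightarrow> carrier R}"

text \<open>A semi-basis \<open>B\<close>: for each \<open>p\<close> the sets \<open>B 0 p, B 1 p, \<dots>\<close> are disjoint and together form a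
  homogeneous basis of \<open>P\<^sup>p\<close>, and the differential maps \<open>B l\<close> into the span of \<open>B 0, \<dots>, B (l - 1)\<close>.\<close>

definition semi_free :: "(nat \<Rightarrow> nat) \<Rightarrow> ('k::field lam, 'm) gcomplex \<Rightarrow> bool" where
  "semi_free n P \<longleftrightarrow> complex n P \<and>
     (\<exists>B :: nat \<Rightarrow> int \<Rightarrow> 'm set.
        (\<forall>p. (\<forall>l. B l p \<subseteq> (\<Union>j. grade (obj P p) j)) \<and>
             disjoint_family (\<lambda>l. B l p) \<and>
             free_basis (Lam n) (obj P p) (\<Union>l. B l p) \<and>
             (\<forall>l. diff P p ` B l p \<subseteq> lin_span (Lam n) (obj P (p + 1)) (\<Union>l'<l. B l' (p + 1)))))"

text \<open>\<open>T\<close> is the derived tensor product of \<open>X\<close> and \<open>E\<close>, computed from some semi-free resolution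
  \<open>P \<rightarrow> X\<close>. It is determined up to isomorphism in the derived category, hence a relation.\<close>

definition derived_tensor ::
  "(nat \<Rightarrow> nat) \<Rightarrow> ('k::field lam, 'u) gcomplex \<Rightarrow> ('k lam, 'l) gcomplex \<Rightarrow>
   ('k lam, ((int \<times> 'u \<times> 'l) \<Rightarrow>\<^sub>0 int) set) gcomplex \<Rightarrow> bool" where
  "derived_tensor n X E T \<longleftrightarrow>
     (\<exists>(P :: ('k lam, 'u) gcomplex) r. semi_free n P \<and> r \<in> quasi_iso n P X \<and> T = tensor n P E)"

end

theory Submission
  imports "HOL.Vector_Spaces" "HOL-Library.Product_Plus" Defs
begin

text \<open>Let \<open>P\<close> be a semi-free resolution of \<open>X\<close>, so that \<open>P \<otimes>\<^sub>\<Lambda> E\<close> is acyclic while some cocycle \<open>e\<close> of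
  \<open>E\<close> is not a coboundary. Everything follows from one fact: a homomorphism \<open>f\<close> from \<open>P\<^sup>i\<close> to
  \<open>\<Lambda>\<close> that vanishes on the coboundaries vanishes on all cocycles. The
  reason is that each element of \<open>\<Lambda>\<close> involves only finitely many variables.

  The acyclicity of \<open>P \<otimes>\<^sub>\<Lambda> E\<close> is used in dual form. A \<open>k\<close>-linear functional on \<open>P \<otimes>\<^sub>\<Lambda> E\<close> is a
  bilinear form on \<open>P\<close> and \<open>E\<close> for which every variable can be moved from one side to the other, and over
  the field \<open>k\<close> the complex of these forms is exact (\<open>forms_exact_tensor\<close>). It stays exact if
  finitely many variables are exempted from the balancing, that is, if \<open>\<Lambda>\<close> is replaced by the
  subring that the other variables generate (\<open>forms_exact_all\<close>). To exempt one variable \<open>\<xi>\<close>,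
  with \<open>\<xi>\<^sup>N = 0\<close>, let \<open>y\<close> be the difference of its actions on the two sides. Since \<open>P\<close> is free, the
  kernel and the cokernel of \<open>y\<close> on the forms without balancing for \<open>\<xi>\<close> are both the complex of the
  forms with balancing, which is exact. Therefore \<open>y\<close> is injective on the cohomology of the larger
  complex; as \<open>y\<close> is also nilpotent, this cohomology is zero.

  Now suppose that \<open>f z \<noteq> 0\<close> for a cocycle \<open>z\<close>. The element \<open>f z\<close> is a polynomial in the first
  \<open>S\<close> variables; pick a monomial \<open>\<mu>\<close> in it, and let \<open>c\<close> be the operation that takes the coefficient of
  \<open>\<mu>\<close> with respect to these \<open>S\<close> variables. Let \<open>\<phi>\<close> be a functional on \<open>E\<close> that vanishes on
  coboundaries and is \<open>1\<close> at \<open>e\<close>. The form that sends \<open>(x, e')\<close> to \<open>\<phi> (c (f x) e')\<close> is closed,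
  and it is balanced for all variables except the first \<open>S\<close>. It is therefore exact, so that it vanishes
  at the pair of cocycles \<open>(z, e)\<close>, where its value is the coefficient of \<open>\<mu>\<close> in \<open>f z\<close>
  (\<open>hom_to_Lam_kills_cocycles\<close>).

  It remains to pass from cocycles to morphisms in the derived category. As a graded module over itself,
  \<open>\<Lambda>\<close> is injective (\<open>Lam_injective\<close>), because homomorphisms into it amount to functionals on a
  directed colimit of vector spaces. Hence a chain map from a shift of \<open>P\<close> to \<open>\<Lambda>\<close>, which vanishes on cocycles by the
  above, is null-homotopic. Every fraction that represents a morphism to \<open>\<Lambda>\<close> can be
  pulled back to the shift of \<open>P\<close> (\<open>semi_free_lift\<close>), so it is equivalent to the zero fraction
  (\<open>Hom_D_trivial\<close>).\<close>

section \<open>Polynomials and their residue classes in \<open>\<Lambda>\<close>\<close>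

lemma poly_mapping_sum_singles:
  fixes p :: "'a \<Rightarrow>\<^sub>0 'b::comm_monoid_add"
  shows "p = (\<Sum>m\<in>Poly_Mapping.keys p. Poly_Mapping.single m (Poly_Mapping.lookup p m))"
proof (rule poly_mapping_eqI)
  fix k
  show "Poly_Mapping.lookup p k
    = Poly_Mapping.lookup (\<Sum>m\<in>Poly_Mapping.keys p. Poly_Mapping.single m (Poly_Mapping.lookup p m)) k"
    by (simp add: lookup_sum lookup_single when_def in_keys_iff)
qed

lemma poly_mapping_add_induct [case_names zero add single]:
  fixes p :: "'a \<Rightarrow>\<^sub>0 'b::comm_monoid_add"
  assumes "Q 0" and "\<And>p q. Q p \<Longrightarrow> Q q \<Longrightarrow> Q (p + q)" and "\<And>m c. Q (Poly_Mapping.single m c)"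
  shows "Q p"
proof -
  have "Q (\<Sum>m\<in>F. Poly_Mapping.single m (Poly_Mapping.lookup p m))" if "finite F" for F
    using that by (induction F) (auto intro: assms)
  then show ?thesis using poly_mapping_sum_singles[of p] finite_keys[of p] by metis
qed

abbreviation cst :: "'k \<Rightarrow> 'k::field inf_poly" where
  "cst c \<equiv> Poly_Mapping.single 0 c"

abbreviation mon :: "(nat \<Rightarrow>\<^sub>0 nat) \<Rightarrow> 'k::field inf_poly" where
  "mon m \<equiv> Poly_Mapping.single m 1"

abbreviation evar :: "nat \<Rightarrow> (nat \<Rightarrow>\<^sub>0 nat)" where
  "evar s \<equiv> Poly_Mapping.single s (Suc 0)"

abbreviation var :: "nat \<Rightarrow> 'k::field inf_poly" where
  "var s \<equiv> mon (evar s)"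

lemma poly_var_induct [case_names const add var]:
  fixes p :: "'k::field inf_poly"
  assumes "\<And>c. Q (cst c)" and "\<And>p q. Q p \<Longrightarrow> Q q \<Longrightarrow> Q (p + q)" and "\<And>s p. Q p \<Longrightarrow> Q (var s * p)"
  shows "Q p"
proof (induction p rule: poly_mapping_add_induct)
  case zero
  show ?case using assms(1)[of 0] by simp
next
  case (add p q)
  then show ?case by (rule assms(2))
next
  case (single m c)
  have "\<forall>m'. Q (Poly_Mapping.single m' c) \<longrightarrow> Q (Poly_Mapping.single (m + m') c)"
  proof (induction m rule: poly_mapping_add_induct)
    case (add p q)
    then show ?case by (simp add: add.assoc)
  next
    case (single s e)
    show ?case
    proof (induction e)
      case (Suc e)
      show ?case
      proof (intro allI impI)
        fix m' assume "Q (Poly_Mapping.single m' c)"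
        then have "Q (var s * Poly_Mapping.single (Poly_Mapping.single s e + m') c)"
          using Suc assms(3) by blast
        moreover have "evar s + (Poly_Mapping.single s e + m') = Poly_Mapping.single s (Suc e) + m'"
          by (simp flip: single_add add.assoc)
        ultimately show "Q (Poly_Mapping.single (Poly_Mapping.single s (Suc e) + m') c)"
          by (simp add: mult_single)
      qed
    qed simp
  qed simp
  from this[rule_format, of 0] show ?case using assms(1)[of c] by simp
qed

lemma lookup_single_mult:
  fixes p :: "'k::field inf_poly"
  shows "Poly_Mapping.lookup (Poly_Mapping.single t c * p) m =
    (if \<forall>s. Poly_Mapping.lookup t s \<le> Poly_Mapping.lookup m s then c * Poly_Mapping.lookup p (m - t) else 0)"
proof (induction p rule: poly_mapping_add_induct)
  case zero
  show ?case by simp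
next
  case (add p q)
  then show ?case by (simp add: lookup_add distrib_left)
next
  case (single m' c')
  have "t + m' = m \<longleftrightarrow> (\<forall>s. Poly_Mapping.lookup t s \<le> Poly_Mapping.lookup m s) \<and> m' = m - t"
    unfolding poly_mapping_eq_iff fun_eq_iff lookup_add lookup_minus
    by (metis add_diff_cancel_left' le_add1 le_add_diff_inverse)
  then show ?case by (auto simp: mult_single lookup_single when_def)
qed

lemma poly_ring_simps [simp]:
  "carrier poly_ring = UNIV" "mult poly_ring = (*)" "one poly_ring = 1" "ring.zero poly_ring = 0" "add poly_ring = (+)"
  by (simp_all add: poly_ring_def)

lemma cring_poly_ring: "cring (poly_ring :: 'k::field inf_poly ring)"
proof (rule cringI)
  show "abelian_group (poly_ring :: 'k inf_poly ring)"
    by (rule abelian_groupI) (auto simp: algebra_simps intro: exI[of _ "- x" for x])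
  show "comm_monoid (poly_ring :: 'k inf_poly ring)"
    by (rule comm_monoidI) (auto simp: algebra_simps)
qed (auto simp: algebra_simps)

definition lam :: "(nat \<Rightarrow> nat) \<Rightarrow> 'k::field inf_poly \<Rightarrow> 'k lam" where
  "lam n p = trunc_ideal n +>\<^bsub>poly_ring\<^esub> p"

lemma ideal_trunc_ideal: "ideal (trunc_ideal n) (poly_ring :: 'k::field inf_poly ring)"
proof -
  interpret cring "poly_ring :: 'k inf_poly ring" by (rule cring_poly_ring)
  show ?thesis unfolding trunc_ideal_def by (rule genideal_ideal) simp
qed

lemma ring_hom_lam: "ring_hom_cring (poly_ring :: 'k::field inf_poly ring) (Lam n) (lam n)"
  unfolding Lam_def lam_def[abs_def] by (rule ideal.rcos_ring_hom_cring[OF ideal_trunc_ideal cring_poly_ring])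

lemma cring_Lam: "cring (Lam n :: 'k::field lam ring)"
  using ring_hom_lam ring_hom_cring_def by blast

lemma
  fixes p q :: "'k::field inf_poly"
  shows lam_add: "lam n (p + q) = lam n p \<oplus>\<^bsub>Lam n\<^esub> lam n q"
  and lam_mult: "lam n (p * q) = lam n p \<otimes>\<^bsub>Lam n\<^esub> lam n q"
proof -
  interpret ring_hom_cring "poly_ring :: 'k inf_poly ring" "Lam n" "lam n" by (rule ring_hom_lam)
  show "lam n (p + q) = lam n p \<oplus>\<^bsub>Lam n\<^esub> lam n q" "lam n (p * q) = lam n p \<otimes>\<^bsub>Lam n\<^esub> lam n q"
    using hom_add[of p q] hom_mult[of p q] by simp_all
qed

lemma lam_one: "lam n (1 :: 'k::field inf_poly) = \<one>\<^bsub>Lam n\<^esub>"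
  and lam_zero: "lam n (0 :: 'k inf_poly) = \<zero>\<^bsub>Lam n\<^esub>"
proof -
  interpret ring_hom_cring "poly_ring :: 'k inf_poly ring" "Lam n" "lam n" by (rule ring_hom_lam)
  show "lam n (1 :: 'k inf_poly) = \<one>\<^bsub>Lam n\<^esub>" "lam n (0 :: 'k inf_poly) = \<zero>\<^bsub>Lam n\<^esub>" using hom_one hom_zero by simp_all
qed

lemma carrier_Lam: "carrier (Lam n) = range (lam n)"
  by (auto simp: Lam_def FactRing_def A_RCOSETS_def RCOSETS_def lam_def[abs_def] a_r_coset_def poly_ring_def)

lemma lam_closed [simp]: "lam n p \<in> carrier (Lam n)"
  by (simp add: carrier_Lam)

definition box :: "(nat \<Rightarrow> nat) \<Rightarrow> (nat \<Rightarrow>\<^sub>0 nat) set" where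
  "box n = {m. \<forall>s. Poly_Mapping.lookup m s < n (Suc s)}"

lemma var_power: "(var s :: 'k::field inf_poly) ^ e = mon (Poly_Mapping.single s e)"
  by (induction e) (auto simp: mult_single simp flip: single_add)

lemma xvar_eq: "xvar i = var (i - 1)"
  by (simp add: xvar_def)

text \<open>The ideal of relations is spanned by the monomials outside the box, so that the monomials in
  the box form a basis of \<open>\<Lambda>\<close>. Every computation in \<open>\<Lambda>\<close> below is a comparison of coefficients on
  the box.\<close>

lemma trunc_ideal_iff:
  "p \<in> trunc_ideal n \<longleftrightarrow> (\<forall>m\<in>box n. Poly_Mapping.lookup (p :: 'k::field inf_poly) m = 0)"
proof
  interpret R: cring "poly_ring :: 'k inf_poly ring" by (rule cring_poly_ring)
  let ?J = "{p :: 'k inf_poly. \<forall>m\<in>box n. Poly_Mapping.lookup p m = 0}"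
  let ?G = "{xvar i ^ n i |i. 1 \<le> i} :: 'k inf_poly set"
  have mult: "q * p \<in> ?J" if "p \<in> ?J" for p q :: "'k inf_poly"
  proof (induction q rule: poly_mapping_add_induct)
    case (single t c)
    have "m - t \<in> box n" if "m \<in> box n" for m
      using that by (fastforce simp: box_def lookup_minus intro: le_less_trans[OF diff_le_self])
    then show ?case using that by (simp add: lookup_single_mult)
  qed (auto simp: lookup_add distrib_right)
  have "ideal ?J poly_ring"
  proof (rule idealI[OF R.ring_axioms])
    show "subgroup ?J (add_monoid (poly_ring :: 'k inf_poly ring))"
    proof (rule R.add.subgroupI)
      fix a assume a: "a \<in> ?J"
      have "\<ominus>\<^bsub>poly_ring\<^esub> a = - a" by (rule R.minus_equality) auto
      then show "\<ominus>\<^bsub>poly_ring\<^esub> a \<in> ?J" using a by simp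
    qed (auto simp: lookup_add intro: exI[of _ 0])
  qed (use mult in \<open>auto simp: mult.commute\<close>)
  moreover have "?G \<subseteq> ?J"
  proof -
    have "Poly_Mapping.lookup (xvar i ^ n i :: 'k inf_poly) m = 0" if "m \<in> box n" "1 \<le> i" for i m
    proof -
      have "Poly_Mapping.single (i - 1) (n i) \<noteq> m"
      proof
        assume "Poly_Mapping.single (i - 1) (n i) = m"
        moreover have "Suc (i - 1) = i" using that by simp
        ultimately have "Poly_Mapping.lookup m (i - 1) = n (Suc (i - 1))" by auto
        moreover have "Poly_Mapping.lookup m (i - 1) < n (Suc (i - 1))" using \<open>m \<in> box n\<close> by (auto simp: box_def)
        ultimately show False by linarith
      qed
      then show ?thesis by (simp add: xvar_eq var_power lookup_single when_def)
    qed
    then show ?thesis by auto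
  qed
  ultimately have "trunc_ideal n \<subseteq> ?J" unfolding trunc_ideal_def by (rule R.genideal_minimal)
  then show "p \<in> trunc_ideal n \<Longrightarrow> \<forall>m\<in>box n. Poly_Mapping.lookup p m = 0" by blast
  assume p: "\<forall>m\<in>box n. Poly_Mapping.lookup p m = 0"
  interpret I: ideal "trunc_ideal n" "poly_ring :: 'k inf_poly ring" by (rule ideal_trunc_ideal)
  have out: "Poly_Mapping.single m c \<in> trunc_ideal n" if m: "m \<notin> box n" for m and c :: 'k
  proof -
    obtain s where s: "n (Suc s) \<le> Poly_Mapping.lookup m s" using m by (auto simp: box_def not_less)
    let ?t = "Poly_Mapping.single s (n (Suc s))"
    have "m = ?t + (m - ?t)"
      using s by (auto simp: poly_mapping_eq_iff fun_eq_iff lookup_add lookup_minus lookup_single when_def)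
    then have "Poly_Mapping.single m c = xvar (Suc s) ^ n (Suc s) * Poly_Mapping.single (m - ?t) c"
      by (simp add: xvar_eq var_power mult_single)
    moreover have "xvar (Suc s) ^ n (Suc s) \<in> (trunc_ideal n :: 'k inf_poly set)"
      unfolding trunc_ideal_def by (rule subsetD[OF R.genideal_self]) auto
    ultimately show ?thesis using I.I_r_closed[of "xvar (Suc s) ^ n (Suc s)" "Poly_Mapping.single (m - ?t) c"] by simp
  qed
  have "(\<Sum>m\<in>F. Poly_Mapping.single m (Poly_Mapping.lookup p m)) \<in> trunc_ideal n"
    if "finite F" "F \<subseteq> - box n" for F
    using that
  proof (induction F)
    case empty
    show ?case using I.additive_subgroup_axioms additive_subgroup.zero_closed by fastforce
  next
    case (insert m F)
    then show ?case using out[of m] I.a_closed by simp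
  qed
  moreover have "Poly_Mapping.keys p \<subseteq> - box n" using p by (auto simp: in_keys_iff)
  ultimately show "p \<in> trunc_ideal n" using poly_mapping_sum_singles[of p] by (metis finite_keys)
qed

lemma lam_eq_iff:
  "lam n p = lam n q \<longleftrightarrow> (\<forall>m\<in>box n. Poly_Mapping.lookup p m = Poly_Mapping.lookup (q :: 'k::field inf_poly) m)"
proof -
  interpret I: ideal "trunc_ideal n" "poly_ring :: 'k inf_poly ring" by (rule ideal_trunc_ideal)
  have "\<ominus>\<^bsub>poly_ring\<^esub> q = - q" by (rule I.minus_equality) auto
  then have "p \<ominus>\<^bsub>poly_ring\<^esub> q = p - q" by (simp add: a_minus_def)
  moreover have "lam n p = lam n q \<longleftrightarrow> p \<ominus>\<^bsub>poly_ring\<^esub> q \<in> trunc_ideal n"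
    unfolding lam_def using I.quotient_eq_iff_same_a_r_cos[OF ideal_trunc_ideal, of p q] by simp
  ultimately show ?thesis by (simp add: trunc_ideal_iff lookup_minus)
qed

definition coef :: "(nat \<Rightarrow> nat) \<Rightarrow> 'k::field lam \<Rightarrow> (nat \<Rightarrow>\<^sub>0 nat) \<Rightarrow> 'k" where
  "coef n a m = (if m \<in> box n then Poly_Mapping.lookup (SOME p. a = lam n p) m else 0)"

lemma coef_lam: "coef n (lam n p) m = (if m \<in> box n then Poly_Mapping.lookup p m else 0)"
proof -
  have "lam n p = lam n (SOME q. lam n p = lam n q)" by (rule someI) simp
  then show ?thesis by (auto simp: coef_def lam_eq_iff)
qed

lemma Lam_eqI:
  assumes "a \<in> carrier (Lam n)" "b \<in> carrier (Lam n)" "\<And>m. m \<in> box n \<Longrightarrow> coef n a m = coef n b m"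
  shows "a = b"
proof -
  obtain p q where "a = lam n p" "b = lam n q" using assms(1,2) by (auto simp: carrier_Lam)
  then show ?thesis using assms(3) by (simp add: lam_eq_iff coef_lam)
qed

section \<open>Linear systems over a field\<close>

definition pscale :: "'k \<Rightarrow> ('v \<Rightarrow>\<^sub>0 'k::field) \<Rightarrow> ('v \<Rightarrow>\<^sub>0 'k)" where
  "pscale a r = Poly_Mapping.map ((*) a) r"

lemma lookup_pscale [simp]: "Poly_Mapping.lookup (pscale a r) v = a * Poly_Mapping.lookup r v"
  by (simp add: pscale_def Poly_Mapping.map.rep_eq when_def)

lemma pscale_simps [simp]:
  "pscale a 0 = 0" "pscale a (r + s) = pscale a r + pscale a s"
  "pscale a (Poly_Mapping.single v c) = Poly_Mapping.single v (a * c)"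
  by (auto intro!: poly_mapping_eqI simp: lookup_add distrib_left lookup_single when_def)

definition pair :: "('v \<Rightarrow>\<^sub>0 'k::field) \<Rightarrow> ('v \<Rightarrow> 'k) \<Rightarrow> 'k" where
  "pair r \<phi> = (\<Sum>v\<in>Poly_Mapping.keys r. Poly_Mapping.lookup r v * \<phi> v)"

lemma pair_superset:
  assumes "finite A" "Poly_Mapping.keys r \<subseteq> A"
  shows "pair r \<phi> = (\<Sum>v\<in>A. Poly_Mapping.lookup r v * \<phi> v)"
  unfolding pair_def using assms by (intro sum.mono_neutral_left) (auto simp: in_keys_iff)

lemma pair_simps [simp]:
  "pair 0 \<phi> = 0" "pair (r + s) \<phi> = pair r \<phi> + pair s \<phi>" "pair (r - s) \<phi> = pair r \<phi> - pair s \<phi>"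
  "pair (Poly_Mapping.single v c) \<phi> = c * \<phi> v"
proof -
  let ?A = "Poly_Mapping.keys r \<union> Poly_Mapping.keys s"
  have "Poly_Mapping.keys (r + s) \<subseteq> ?A" "Poly_Mapping.keys (r - s) \<subseteq> ?A"
    by (auto simp: in_keys_iff lookup_add lookup_minus)
  then show "pair (r + s) \<phi> = pair r \<phi> + pair s \<phi>" "pair (r - s) \<phi> = pair r \<phi> - pair s \<phi>"
    by (simp_all add: pair_superset[where A = ?A] lookup_add lookup_minus algebra_simps
        sum.distrib sum_subtractf)
qed (simp_all add: pair_def)

text \<open>A linear system over a field is solvable as soon as it is consistent, whatever the number of
  its unknowns and equations: if the equation \<open>0 = 1\<close> is outside of a subspace \<open>I\<close> that contains the
  equations, then some functional on the space of all equations vanishes on \<open>I\<close> but not at \<open>0 = 1\<close>,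
  and its values at the unknowns form a solution. Existence of functionals, of forms and of
  homomorphisms into \<open>\<Lambda>\<close> is derived from this statement; \<open>I\<close> is then the set of the equations that
  hold after a suitable map, for which \<open>0 = 1\<close> is visibly excluded.\<close>

lemma linear_system_solvable:
  fixes S I :: "(('v \<Rightarrow>\<^sub>0 'k::field) \<times> 'k) set"
  assumes "S \<subseteq> I" and zero: "(0, 0) \<in> I"
    and add: "\<And>r c s d. (r, c) \<in> I \<Longrightarrow> (s, d) \<in> I \<Longrightarrow> (r + s, c + d) \<in> I"
    and scale: "\<And>a r c. (r, c) \<in> I \<Longrightarrow> (pscale a r, a * c) \<in> I"
    and consistent: "(0, 1) \<notin> I"
  shows "\<exists>\<phi>. \<forall>(r, c)\<in>S. pair r \<phi> = c"
proof -
  let ?sc = "\<lambda>a (p :: ('v \<Rightarrow>\<^sub>0 'k) \<times> 'k). (pscale a (fst p), a * snd p)"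
  interpret V: vector_space ?sc
    by unfold_locales
      (simp_all add: prod_eq_iff poly_mapping_eq_iff fun_eq_iff lookup_add algebra_simps)
  interpret K: vector_space "(*) :: 'k \<Rightarrow> 'k \<Rightarrow> 'k"
    by unfold_locales (auto simp: algebra_simps)
  interpret VK: vector_space_pair ?sc "(*) :: 'k \<Rightarrow> 'k \<Rightarrow> 'k" ..
  have I: "V.subspace I"
  proof (rule V.subspaceI)
    show "0 \<in> I" using zero by (simp add: zero_prod_def)
    show "x + y \<in> I" if "x \<in> I" "y \<in> I" for x y
      using add[of "fst x" "snd x" "fst y" "snd y"] that by (simp add: plus_prod_def)
    show "?sc a x \<in> I" if "x \<in> I" for a x
      using scale[of "fst x" "snd x" a] that by simp
  qed
  obtain B where B: "B \<subseteq> I" "V.independent B" "I \<subseteq> V.span B"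
    by (rule V.maximal_independent_subset[of I])
  have "V.span B = I" using V.span_minimal[OF B(1) I] B(3) by (rule subset_antisym)
  then have "(0, 1) \<notin> V.span B" using consistent by simp
  then have ind: "V.independent (insert (0, 1) B)" using B(2) by (rule V.independent_insertI)
  \<comment> \<open>With the value \<open>- 1\<close> at \<open>(0, 1)\<close> the functional at \<open>(r, c)\<close> becomes \<open>pair r \<phi> - c\<close>.\<close>
  let ?f = "\<lambda>x. if x \<in> B then 0 else - 1 :: 'k"
  have "\<exists>l. Vector_Spaces.linear ?sc (*) l \<and> (\<forall>x\<in>insert (0, 1) B. l x = ?f x)"
    by (rule VK.linear_independent_extend[OF ind])
  then obtain l where l: "Vector_Spaces.linear ?sc (*) l" "\<forall>x\<in>insert (0, 1) B. l x = ?f x"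
    by (elim exE conjE)
  interpret l: Vector_Spaces.linear ?sc "(*)" l by (rule l(1))
  have l0: "l x = 0" if "x \<in> I" for x
  proof (rule VK.linear_eq_0_on_span[OF l(1), of B])
    show "x \<in> V.span B" using that \<open>V.span B = I\<close> by simp
  qed (use l(2) in simp)
  have l1: "l (0, 1) = - 1" using l(2) consistent B(1) by auto
  define \<phi> where "\<phi> v = l (Poly_Mapping.single v 1, 0)" for v
  have "l (r, 0) = pair r \<phi>" for r
  proof (induction r rule: poly_mapping_add_induct)
    case (add p q)
    then show ?case using l.add[of "(p, 0)" "(q, 0)"] by simp
  next
    case (single v c)
    then show ?case using l.scale[of c "(Poly_Mapping.single v 1, 0)"] by (simp add: \<phi>_def)
  qed (use l.zero in \<open>simp add: zero_prod_def\<close>)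
  then have "l (r, c) = pair r \<phi> - c" for r c
    using l.add[of "(r, 0)" "(0, c)"] l.scale[of c "(0, 1)"] l1 by simp
  then have "pair r \<phi> = c" if "(r, c) \<in> S" for r c
    using l0[of "(r, c)"] that \<open>S \<subseteq> I\<close> by auto
  then show ?thesis by blast
qed

section \<open>Sums in abelian groups with carrier\<close>

definition gsum :: "('a, 'b) ring_scheme \<Rightarrow> ('v \<Rightarrow> 'k \<Rightarrow> 'a) \<Rightarrow> ('v \<Rightarrow>\<^sub>0 'k::field) \<Rightarrow> 'a" where
  "gsum G t r = (\<Oplus>\<^bsub>G\<^esub>v\<in>Poly_Mapping.keys r. t v (Poly_Mapping.lookup r v))"

locale gsum_terms = abelian_group G for G (structure) +
  fixes t :: "'v \<Rightarrow> 'k::field \<Rightarrow> 'a"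
  assumes term_closed [simp]: "t v a \<in> carrier G" and term_add: "t v (a + b) = t v a \<oplus> t v b"
begin

lemma term_zero [simp]: "t v 0 = \<zero>"
proof -
  have "t v 0 \<oplus> t v 0 = t v 0" using term_add[of v 0 0] by simp
  then show ?thesis by (simp add: add.l_cancel_one)
qed

lemma gsum_superset:
  assumes "finite A" "Poly_Mapping.keys r \<subseteq> A"
  shows "gsum G t r = (\<Oplus>v\<in>A. t v (Poly_Mapping.lookup r v))"
  unfolding gsum_def using assms
  by (intro add.finprod_mono_neutral_cong_left) (auto simp: in_keys_iff)

lemma gsum_closed [simp]: "gsum G t r \<in> carrier G"
  unfolding gsum_def by (rule finsum_closed) auto

lemma gsum_zero [simp]: "gsum G t 0 = \<zero>"
  by (simp add: gsum_def)

lemma gsum_add: "gsum G t (r + s) = gsum G t r \<oplus> gsum G t s"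
proof -
  let ?A = "Poly_Mapping.keys r \<union> Poly_Mapping.keys s"
  have "Poly_Mapping.keys (r + s) \<subseteq> ?A" by (auto simp: in_keys_iff lookup_add)
  then show ?thesis
    by (simp add: gsum_superset[where A = ?A] lookup_add term_add finsum_addf)
qed

lemma gsum_single [simp]: "gsum G t (Poly_Mapping.single v c) = t v c"
  by (simp add: gsum_superset[where A = "{v}"])

lemma gsum_uminus: "gsum G t (- r) = \<ominus> gsum G t r"
  using gsum_add[of r "- r"] by (intro minus_equality[symmetric]) (auto simp: a_comm)

lemma gsum_diff: "gsum G t (r - s) = gsum G t r \<ominus> gsum G t s"
  using gsum_add[of r "- s"] by (simp add: a_minus_def gsum_uminus)

end

section \<open>Modules over \<open>\<Lambda>\<close>\<close>

context
  fixes n :: "nat \<Rightarrow> nat" and M :: "('k::field lam, 'm, 'c) module_scheme"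
  assumes M: "Module.module (Lam n) M"
begin

interpretation Module.module "Lam n" M by (rule M)

lemma act_closed: "x \<in> carrier M \<Longrightarrow> lam n p \<odot>\<^bsub>M\<^esub> x \<in> carrier M"
  and act_add: "x \<in> carrier M \<Longrightarrow> lam n (p + q) \<odot>\<^bsub>M\<^esub> x = lam n p \<odot>\<^bsub>M\<^esub> x \<oplus>\<^bsub>M\<^esub> lam n q \<odot>\<^bsub>M\<^esub> x"
  and act_distr: "x \<in> carrier M \<Longrightarrow> y \<in> carrier M \<Longrightarrow>
    lam n p \<odot>\<^bsub>M\<^esub> (x \<oplus>\<^bsub>M\<^esub> y) = lam n p \<odot>\<^bsub>M\<^esub> x \<oplus>\<^bsub>M\<^esub> lam n p \<odot>\<^bsub>M\<^esub> y"
  and act_mult: "x \<in> carrier M \<Longrightarrow> lam n (p * q) \<odot>\<^bsub>M\<^esub> x = lam n p \<odot>\<^bsub>M\<^esub> (lam n q \<odot>\<^bsub>M\<^esub> x)"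
  and act_one: "x \<in> carrier M \<Longrightarrow> lam n 1 \<odot>\<^bsub>M\<^esub> x = x"
  and act_zero: "x \<in> carrier M \<Longrightarrow> lam n 0 \<odot>\<^bsub>M\<^esub> x = \<zero>\<^bsub>M\<^esub>"
  and act_null: "lam n p \<odot>\<^bsub>M\<^esub> \<zero>\<^bsub>M\<^esub> = \<zero>\<^bsub>M\<^esub>"
  and act_minus: "x \<in> carrier M \<Longrightarrow> lam n p \<odot>\<^bsub>M\<^esub> (\<ominus>\<^bsub>M\<^esub> x) = \<ominus>\<^bsub>M\<^esub> (lam n p \<odot>\<^bsub>M\<^esub> x)"
  by (simp_all add: lam_add lam_mult lam_one lam_zero smult_l_distr smult_r_distr smult_assoc1 smult_r_minus)

end

lemma module_group: "Module.module R M \<Longrightarrow> abelian_group M"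
  by (rule Module.module.axioms(2))

section \<open>Complexes and their cohomology\<close>

lemma graded_homD:
  assumes "f \<in> graded_hom n M N"
  shows graded_hom_closed: "x \<in> carrier M \<Longrightarrow> f x \<in> carrier N"
    and graded_hom_add: "x \<in> carrier M \<Longrightarrow> y \<in> carrier M \<Longrightarrow> f (x \<oplus>\<^bsub>M\<^esub> y) = f x \<oplus>\<^bsub>N\<^esub> f y"
    and graded_hom_act: "x \<in> carrier M \<Longrightarrow> f (lam n p \<odot>\<^bsub>M\<^esub> x) = lam n p \<odot>\<^bsub>N\<^esub> f x"
    and graded_hom_grade: "x \<in> grade M j \<Longrightarrow> f x \<in> grade N j"
  using assms by (auto simp: graded_hom_def hom_def Pi_def image_subset_iff)

lemma graded_homI:
  assumes "\<And>x. x \<in> carrier M \<Longrightarrow> f x \<in> carrier N"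
    and "\<And>x y. x \<in> carrier M \<Longrightarrow> y \<in> carrier M \<Longrightarrow> f (x \<oplus>\<^bsub>M\<^esub> y) = f x \<oplus>\<^bsub>N\<^esub> f y"
    and "\<And>p x. x \<in> carrier M \<Longrightarrow> f (lam n p \<odot>\<^bsub>M\<^esub> x) = lam n p \<odot>\<^bsub>N\<^esub> f x"
    and "\<And>j x. x \<in> grade M j \<Longrightarrow> f x \<in> grade N j"
  shows "f \<in> graded_hom n M N"
  using assms by (auto simp: graded_hom_def hom_def carrier_Lam image_subset_iff)

lemma additive_zero:
  assumes "abelian_group M" "abelian_group N" "\<And>x. x \<in> carrier M \<Longrightarrow> f x \<in> carrier N"
    and "\<And>x y. x \<in> carrier M \<Longrightarrow> y \<in> carrier M \<Longrightarrow> f (x \<oplus>\<^bsub>M\<^esub> y) = f x \<oplus>\<^bsub>N\<^esub> f y"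
  shows "f \<zero>\<^bsub>M\<^esub> = \<zero>\<^bsub>N\<^esub>"
proof -
  interpret M: abelian_group M by fact
  interpret N: abelian_group N by fact
  have "f \<zero>\<^bsub>M\<^esub> \<oplus>\<^bsub>N\<^esub> f \<zero>\<^bsub>M\<^esub> = f \<zero>\<^bsub>M\<^esub>" using assms(4)[of "\<zero>\<^bsub>M\<^esub>" "\<zero>\<^bsub>M\<^esub>"] by simp
  then show ?thesis using assms(3)[of "\<zero>\<^bsub>M\<^esub>"] by (simp add: N.add.l_cancel_one)
qed

lemma additive_uminus:
  assumes "abelian_group M" "abelian_group N" "\<And>x. x \<in> carrier M \<Longrightarrow> f x \<in> carrier N"
    and "\<And>x y. x \<in> carrier M \<Longrightarrow> y \<in> carrier M \<Longrightarrow> f (x \<oplus>\<^bsub>M\<^esub> y) = f x \<oplus>\<^bsub>N\<^esub> f y"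
    and x: "x \<in> carrier M"
  shows "f (\<ominus>\<^bsub>M\<^esub> x) = \<ominus>\<^bsub>N\<^esub> f x"
proof -
  interpret M: abelian_group M by fact
  interpret N: abelian_group N by fact
  have "f (\<ominus>\<^bsub>M\<^esub> x) \<oplus>\<^bsub>N\<^esub> f x = \<zero>\<^bsub>N\<^esub>"
    using assms(4)[of "\<ominus>\<^bsub>M\<^esub> x" x] x additive_zero[OF assms(1-4)] by (simp add: M.l_neg)
  then show ?thesis using assms(3) x by (intro N.minus_equality[symmetric]) auto
qed

locale cx =
  fixes n :: "nat \<Rightarrow> nat" and X :: "('k::field lam, 'm) gcomplex"
  assumes complex: "complex n X"
begin

lemma graded [simp]: "graded_module n (obj X i)"
  and diff_hom: "diff X i \<in> graded_hom n (obj X i) (obj X (i + 1))"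
  and diff_diff': "x \<in> carrier (obj X i) \<Longrightarrow> diff X (i + 1) (diff X i x) = \<zero>\<^bsub>obj X (i + 2)\<^esub>"
  using complex by (auto simp: complex_def)

lemma mod [simp]: "Module.module (Lam n) (obj X i)"
  using graded by (simp add: graded_module_def)

lemma grp [simp]: "abelian_group (obj X i)"
  by (rule module_group[OF mod])

lemma obj_closed [simp]:
  "x \<in> carrier (obj X i) \<Longrightarrow> y \<in> carrier (obj X i) \<Longrightarrow> x \<oplus>\<^bsub>obj X i\<^esub> y \<in> carrier (obj X i)"
  "\<zero>\<^bsub>obj X i\<^esub> \<in> carrier (obj X i)"
  "x \<in> carrier (obj X i) \<Longrightarrow> \<ominus>\<^bsub>obj X i\<^esub> x \<in> carrier (obj X i)"
  "x \<in> carrier (obj X i) \<Longrightarrow> lam n p \<odot>\<^bsub>obj X i\<^esub> x \<in> carrier (obj X i)"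
proof -
  interpret abelian_group "obj X i" by simp
  show "x \<in> carrier (obj X i) \<Longrightarrow> y \<in> carrier (obj X i) \<Longrightarrow> x \<oplus>\<^bsub>obj X i\<^esub> y \<in> carrier (obj X i)"
    "\<zero>\<^bsub>obj X i\<^esub> \<in> carrier (obj X i)"
    "x \<in> carrier (obj X i) \<Longrightarrow> \<ominus>\<^bsub>obj X i\<^esub> x \<in> carrier (obj X i)"
    "x \<in> carrier (obj X i) \<Longrightarrow> lam n p \<odot>\<^bsub>obj X i\<^esub> x \<in> carrier (obj X i)"
    by (auto intro: act_closed)
qed

lemma minus_zero: "x \<in> carrier (obj X i) \<Longrightarrow> x \<ominus>\<^bsub>obj X i\<^esub> \<zero>\<^bsub>obj X i\<^esub> = x"
proof -
  interpret A: abelian_group "obj X i" by simp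
  have "\<ominus>\<^bsub>obj X i\<^esub> \<zero>\<^bsub>obj X i\<^esub> = \<zero>\<^bsub>obj X i\<^esub>" by (rule A.minus_equality) simp_all
  then show "x \<in> carrier (obj X i) \<Longrightarrow> x \<ominus>\<^bsub>obj X i\<^esub> \<zero>\<^bsub>obj X i\<^esub> = x"
    by (simp only: A.minus_eq A.r_zero)
qed

lemma diff_closed [simp]: "x \<in> carrier (obj X i) \<Longrightarrow> i + 1 = j \<Longrightarrow> diff X i x \<in> carrier (obj X j)"
  using graded_hom_closed[OF diff_hom] by blast

lemma diff_add: "x \<in> carrier (obj X i) \<Longrightarrow> y \<in> carrier (obj X i) \<Longrightarrow> i + 1 = j \<Longrightarrow>
    diff X i (x \<oplus>\<^bsub>obj X i\<^esub> y) = diff X i x \<oplus>\<^bsub>obj X j\<^esub> diff X i y"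
  using graded_hom_add[OF diff_hom] by blast

lemma diff_act: "x \<in> carrier (obj X i) \<Longrightarrow> i + 1 = j \<Longrightarrow>
    diff X i (lam n p \<odot>\<^bsub>obj X i\<^esub> x) = lam n p \<odot>\<^bsub>obj X j\<^esub> diff X i x"
  using graded_hom_act[OF diff_hom] by blast

lemma diff_grade: "x \<in> grade (obj X i) q \<Longrightarrow> i + 1 = j \<Longrightarrow> diff X i x \<in> grade (obj X j) q"
  using graded_hom_grade[OF diff_hom] by blast

lemma diff_diff: "x \<in> carrier (obj X i) \<Longrightarrow> i + 1 = j \<Longrightarrow> j + 1 = l \<Longrightarrow> diff X j (diff X i x) = \<zero>\<^bsub>obj X l\<^esub>"
proof -
  assume x: "x \<in> carrier (obj X i)" and j: "i + 1 = j" and "j + 1 = l"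
  then have "l = i + 2" by simp
  then show ?thesis using diff_diff'[OF x] j by simp
qed

lemma diff_zero: "i + 1 = j \<Longrightarrow> diff X i \<zero>\<^bsub>obj X i\<^esub> = \<zero>\<^bsub>obj X j\<^esub>"
  by (rule additive_zero) (auto simp: diff_add)

lemma diff_uminus: "x \<in> carrier (obj X i) \<Longrightarrow> i + 1 = j \<Longrightarrow>
    diff X i (\<ominus>\<^bsub>obj X i\<^esub> x) = \<ominus>\<^bsub>obj X j\<^esub> diff X i x"
  by (rule additive_uminus) (auto simp: diff_add)

lemma diff_minus: "x \<in> carrier (obj X i) \<Longrightarrow> y \<in> carrier (obj X i) \<Longrightarrow> i + 1 = j \<Longrightarrow>
    diff X i (x \<ominus>\<^bsub>obj X i\<^esub> y) = diff X i x \<ominus>\<^bsub>obj X j\<^esub> diff X i y"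
proof -
  interpret A: abelian_group "obj X i" by simp
  interpret B: abelian_group "obj X j" by simp
  show "x \<in> carrier (obj X i) \<Longrightarrow> y \<in> carrier (obj X i) \<Longrightarrow> i + 1 = j \<Longrightarrow>
    diff X i (x \<ominus>\<^bsub>obj X i\<^esub> y) = diff X i x \<ominus>\<^bsub>obj X j\<^esub> diff X i y"
    unfolding A.minus_eq B.minus_eq by (simp add: diff_add[of _ i _ j] diff_uminus[of _ i j])
qed

end

section \<open>Balanced bilinear forms on a pair of complexes\<close>

text \<open>A form of degree \<open>m\<close> pairs \<open>P\<^sup>p\<close> with \<open>E\<^sup>q\<close> for \<open>p + q = m\<close>; only its values there matter. It is
  balanced for the variables in the slots from \<open>S\<close> on. The forms with \<open>S = 0\<close> are the
  functionals on \<open>P \<otimes>\<^sub>\<Lambda> E\<close>, and those with larger \<open>S\<close> are the functionals on the tensor product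
  over the subring of \<open>\<Lambda>\<close> that the remaining variables generate.\<close>

definition bform ::
  "(nat \<Rightarrow> nat) \<Rightarrow> ('k::field lam, 'm) gcomplex \<Rightarrow> ('k lam, 'l) gcomplex \<Rightarrow> nat \<Rightarrow> int \<Rightarrow>
   (int \<Rightarrow> 'm \<Rightarrow> 'l \<Rightarrow> 'k) \<Rightarrow> bool" where
  "bform n P E S m \<beta> \<longleftrightarrow> (\<forall>p q x e. p + q = m \<longrightarrow> x \<in> carrier (obj P p) \<longrightarrow> e \<in> carrier (obj E q) \<longrightarrow>
     (\<forall>y\<in>carrier (obj P p). \<beta> p (x \<oplus>\<^bsub>obj P p\<^esub> y) e = \<beta> p x e + \<beta> p y e) \<and>
     (\<forall>e'\<in>carrier (obj E q). \<beta> p x (e \<oplus>\<^bsub>obj E q\<^esub> e') = \<beta> p x e + \<beta> p x e') \<and>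
     (\<forall>c. \<beta> p (lam n (cst c) \<odot>\<^bsub>obj P p\<^esub> x) e = c * \<beta> p x e) \<and>
     (\<forall>c. \<beta> p x (lam n (cst c) \<odot>\<^bsub>obj E q\<^esub> e) = c * \<beta> p x e) \<and>
     (\<forall>s\<ge>S. \<beta> p (lam n (var s) \<odot>\<^bsub>obj P p\<^esub> x) e = \<beta> p x (lam n (var s) \<odot>\<^bsub>obj E q\<^esub> e)))"

lemma bformI:
  assumes "\<And>p q x y e. p + q = m \<Longrightarrow> x \<in> carrier (obj P p) \<Longrightarrow> y \<in> carrier (obj P p) \<Longrightarrow> e \<in> carrier (obj E q) \<Longrightarrow>
      \<beta> p (x \<oplus>\<^bsub>obj P p\<^esub> y) e = \<beta> p x e + \<beta> p y e"
    and "\<And>p q x e e'. p + q = m \<Longrightarrow> x \<in> carrier (obj P p) \<Longrightarrow> e \<in> carrier (obj E q) \<Longrightarrow> e' \<in> carrier (obj E q) \<Longrightarrow>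
      \<beta> p x (e \<oplus>\<^bsub>obj E q\<^esub> e') = \<beta> p x e + \<beta> p x e'"
    and "\<And>p q x e c. p + q = m \<Longrightarrow> x \<in> carrier (obj P p) \<Longrightarrow> e \<in> carrier (obj E q) \<Longrightarrow>
      \<beta> p (lam n (cst c) \<odot>\<^bsub>obj P p\<^esub> x) e = c * \<beta> p x e"
    and "\<And>p q x e c. p + q = m \<Longrightarrow> x \<in> carrier (obj P p) \<Longrightarrow> e \<in> carrier (obj E q) \<Longrightarrow>
      \<beta> p x (lam n (cst c) \<odot>\<^bsub>obj E q\<^esub> e) = c * \<beta> p x e"
    and "\<And>p q x e s. p + q = m \<Longrightarrow> x \<in> carrier (obj P p) \<Longrightarrow> e \<in> carrier (obj E q) \<Longrightarrow> S \<le> s \<Longrightarrow>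
      \<beta> p (lam n (var s) \<odot>\<^bsub>obj P p\<^esub> x) e = \<beta> p x (lam n (var s) \<odot>\<^bsub>obj E q\<^esub> e)"
  shows "bform n P E S m \<beta>"
  unfolding bform_def by (intro allI impI conjI ballI) (rule assms; assumption)+

lemma
  assumes "bform n P E S m \<beta>" "p + q = m" "x \<in> carrier (obj P p)" "e \<in> carrier (obj E q)"
  shows bform_add_left: "y \<in> carrier (obj P p) \<Longrightarrow> \<beta> p (x \<oplus>\<^bsub>obj P p\<^esub> y) e = \<beta> p x e + \<beta> p y e"
    and bform_add_right: "e' \<in> carrier (obj E q) \<Longrightarrow> \<beta> p x (e \<oplus>\<^bsub>obj E q\<^esub> e') = \<beta> p x e + \<beta> p x e'"
    and bform_cst_left: "\<beta> p (lam n (cst c) \<odot>\<^bsub>obj P p\<^esub> x) e = c * \<beta> p x e"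
    and bform_cst_right: "\<beta> p x (lam n (cst c) \<odot>\<^bsub>obj E q\<^esub> e) = c * \<beta> p x e"
    and bform_var: "S \<le> s \<Longrightarrow> \<beta> p (lam n (var s) \<odot>\<^bsub>obj P p\<^esub> x) e = \<beta> p x (lam n (var s) \<odot>\<^bsub>obj E q\<^esub> e)"
  using assms unfolding bform_def by blast+

definition delta ::
  "('a, 'm) gcomplex \<Rightarrow> ('a, 'l) gcomplex \<Rightarrow> int \<Rightarrow> (int \<Rightarrow> 'm \<Rightarrow> 'l \<Rightarrow> 'k::field) \<Rightarrow> int \<Rightarrow> 'm \<Rightarrow> 'l \<Rightarrow> 'k" where
  "delta P E k \<beta> p x e = \<beta> (p + 1) (diff P p x) e +
     (if even p then \<beta> p x (diff E (k - p) e) else - \<beta> p x (diff E (k - p) e))"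

definition form_eq ::
  "('a, 'm) gcomplex \<Rightarrow> ('a, 'l) gcomplex \<Rightarrow> int \<Rightarrow> (int \<Rightarrow> 'm \<Rightarrow> 'l \<Rightarrow> 'k::field) \<Rightarrow> (int \<Rightarrow> 'm \<Rightarrow> 'l \<Rightarrow> 'k) \<Rightarrow> bool" where
  "form_eq P E m \<beta> \<gamma> \<longleftrightarrow> (\<forall>p x e. x \<in> carrier (obj P p) \<longrightarrow> e \<in> carrier (obj E (m - p)) \<longrightarrow> \<beta> p x e = \<gamma> p x e)"

definition forms_exact ::
  "(nat \<Rightarrow> nat) \<Rightarrow> ('k::field lam, 'm) gcomplex \<Rightarrow> ('k lam, 'l) gcomplex \<Rightarrow> nat \<Rightarrow> bool" where
  "forms_exact n P E S \<longleftrightarrow> (\<forall>m \<beta>. bform n P E S m \<beta> \<longrightarrow>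
     form_eq P E (m - 1) (delta P E (m - 1) \<beta>) (\<lambda>p x e. 0) \<longrightarrow>
     (\<exists>\<gamma>. bform n P E S (m + 1) \<gamma> \<and> form_eq P E m \<beta> (delta P E m \<gamma>)))"

section \<open>Forms on an acyclic tensor product\<close>

locale tensor_cx = P: cx n P + E: cx n E
  for n and P :: "('k::field lam, 'm) gcomplex" and E :: "('k lam, 'l) gcomplex"
begin

abbreviation "tsym i \<equiv> tensor_symbols P E i"
abbreviation "Rel i \<equiv> tensor_relations n P E i"

definition tdiff :: "int \<Rightarrow> int \<times> 'm \<times> 'l \<Rightarrow> (int \<times> 'm \<times> 'l) \<Rightarrow>\<^sub>0 int" where
  "tdiff i = (\<lambda>(p, x, e). frag_of (p + 1, diff P p x, e) +
     (if even p then frag_of (p, x, diff E (i - p) e) else - frag_of (p, x, diff E (i - p) e)))"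

lemma mem_tsym: "(p, x, e) \<in> tsym i \<longleftrightarrow> x \<in> carrier (obj P p) \<and> e \<in> carrier (obj E (i - p))"
  by (simp add: tensor_symbols_def)

inductive_set rel_gen :: "int \<Rightarrow> ((int \<times> 'm \<times> 'l) \<Rightarrow>\<^sub>0 int) set" for i where
  left: "x \<in> carrier (obj P p) \<Longrightarrow> y \<in> carrier (obj P p) \<Longrightarrow> e \<in> carrier (obj E (i - p)) \<Longrightarrow>
    frag_of (p, x \<oplus>\<^bsub>obj P p\<^esub> y, e) - frag_of (p, x, e) - frag_of (p, y, e) \<in> rel_gen i"
| right: "x \<in> carrier (obj P p) \<Longrightarrow> e \<in> carrier (obj E (i - p)) \<Longrightarrow> e' \<in> carrier (obj E (i - p)) \<Longrightarrow>
    frag_of (p, x, e \<oplus>\<^bsub>obj E (i - p)\<^esub> e') - frag_of (p, x, e) - frag_of (p, x, e') \<in> rel_gen i"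
| bal: "x \<in> carrier (obj P p) \<Longrightarrow> e \<in> carrier (obj E (i - p)) \<Longrightarrow>
    frag_of (p, lam n a \<odot>\<^bsub>obj P p\<^esub> x, e) - frag_of (p, x, lam n a \<odot>\<^bsub>obj E (i - p)\<^esub> e) \<in> rel_gen i"

lemma Rel_eq: "Rel i = generate (tensor_free P E i) (rel_gen i)"
proof -
  have gen: "rel_gen i =
      {frag_of (p, x \<oplus>\<^bsub>obj P p\<^esub> y, e) - frag_of (p, x, e) - frag_of (p, y, e) |p x y e.
         x \<in> carrier (obj P p) \<and> y \<in> carrier (obj P p) \<and> e \<in> carrier (obj E (i - p))} \<union>
      {frag_of (p, x, e \<oplus>\<^bsub>obj E (i - p)\<^esub> e') - frag_of (p, x, e) - frag_of (p, x, e') |p x e e'.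
         x \<in> carrier (obj P p) \<and> e \<in> carrier (obj E (i - p)) \<and> e' \<in> carrier (obj E (i - p))} \<union>
      {frag_of (p, a \<odot>\<^bsub>obj P p\<^esub> x, e) - frag_of (p, x, a \<odot>\<^bsub>obj E (i - p)\<^esub> e) |p a x e.
         a \<in> carrier (Lam n) \<and> x \<in> carrier (obj P p) \<and> e \<in> carrier (obj E (i - p))}"
    (is "_ = ?L \<union> ?R \<union> ?B")
  proof (rule equalityI; rule subsetI)
    fix z assume "z \<in> rel_gen i"
    then show "z \<in> ?L \<union> ?R \<union> ?B"
    proof cases
      case bal
      then have "z \<in> ?B" using lam_closed by blast
      then show ?thesis by simp
    qed blast+
  next
    fix z assume "z \<in> ?L \<union> ?R \<union> ?B"
    then consider "z \<in> ?L" | "z \<in> ?R" | "z \<in> ?B" by blast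
    then show "z \<in> rel_gen i"
      by cases (auto simp: carrier_Lam intro: rel_gen.intros)
  qed
  show ?thesis unfolding tensor_relations_def gen ..
qed

lemma keys_frag_combs:
  "u \<in> S \<Longrightarrow> v \<in> S \<Longrightarrow> Poly_Mapping.keys (frag_of u - frag_of v) \<subseteq> S"
  "u \<in> S \<Longrightarrow> v \<in> S \<Longrightarrow> w \<in> S \<Longrightarrow> Poly_Mapping.keys (frag_of u - frag_of v - frag_of w) \<subseteq> S"
  by (auto simp: in_keys_iff lookup_minus lookup_single split: if_splits)

lemma rel_gen_keys: "z \<in> rel_gen i \<Longrightarrow> Poly_Mapping.keys z \<subseteq> tsym i"
proof (induction rule: rel_gen.induct)
  case (left x p y e)
  then show ?case by (intro keys_frag_combs) (auto simp: mem_tsym)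
next
  case (right x p e e')
  then show ?case by (intro keys_frag_combs) (auto simp: mem_tsym)
next
  case (bal x p e a)
  then show ?case by (intro keys_frag_combs) (auto simp: mem_tsym)
qed

lemma Rel_subgroup: "subgroup (Rel i) (tensor_free P E i)"
  unfolding Rel_eq by (rule group.generate_is_subgroup) (use rel_gen_keys in auto)

lemma Rel_keys: "z \<in> Rel i \<Longrightarrow> Poly_Mapping.keys z \<subseteq> tsym i"
  using subgroup.subset[OF Rel_subgroup] by force

lemma Rel_zero [simp]: "0 \<in> Rel i"
  and Rel_add: "z \<in> Rel i \<Longrightarrow> w \<in> Rel i \<Longrightarrow> z + w \<in> Rel i"
  and Rel_uminus: "z \<in> Rel i \<Longrightarrow> - z \<in> Rel i"
  using subgroup.one_closed[OF Rel_subgroup[of i]] subgroup.m_closed[OF Rel_subgroup[of i], of z w]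
    subgroup.m_inv_closed[OF Rel_subgroup[of i], of z] Rel_keys[of z i]
  by auto

lemma Rel_diff: "z \<in> Rel i \<Longrightarrow> w \<in> Rel i \<Longrightarrow> z - w \<in> Rel i"
  using Rel_add[of z i "- w"] Rel_uminus[of w i] by simp

lemma Rel_gen: "z \<in> rel_gen i \<Longrightarrow> z \<in> Rel i"
  unfolding Rel_eq by (rule generate.incl)

lemma Rel_induct [consumes 1, case_names gen zero add uminus]:
  assumes "z \<in> Rel i" and gen: "\<And>z. z \<in> rel_gen i \<Longrightarrow> Q z" and "Q 0"
    and "\<And>z w. Q z \<Longrightarrow> Q w \<Longrightarrow> Q (z + w)" and "\<And>z. Q z \<Longrightarrow> Q (- z)"
  shows "Q z"
  using assms(1) unfolding Rel_eq
  by (induction rule: generate.induct) (use assms rel_gen_keys in auto)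

lemma tdiff_Rel: "z \<in> Rel i \<Longrightarrow> frag_extend (tdiff i) z \<in> Rel (i + 1)"
proof (induction rule: Rel_induct)
  case (gen z)
  then show ?case
  proof (cases rule: rel_gen.cases)
    case (left x p y e)
    let ?a = "frag_of (p + 1, diff P p x \<oplus>\<^bsub>obj P (p + 1)\<^esub> diff P p y, e) - frag_of (p + 1, diff P p x, e) - frag_of (p + 1, diff P p y, e)"
    let ?b = "frag_of (p, x \<oplus>\<^bsub>obj P p\<^esub> y, diff E (i - p) e) - frag_of (p, x, diff E (i - p) e) - frag_of (p, y, diff E (i - p) e)"
    have "?a \<in> Rel (i + 1)" using left by (intro Rel_gen rel_gen.left) auto
    moreover have "?b \<in> Rel (i + 1)" using left by (intro Rel_gen rel_gen.left) auto
    moreover have "frag_extend (tdiff i) z = (if even p then ?a + ?b else ?a - ?b)"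
      using left P.diff_add[of x p y "p + 1"] by (simp add: frag_extend_diff tdiff_def)
    ultimately show ?thesis by (simp add: Rel_add Rel_diff)
  next
    case (right x p e e')
    let ?a = "frag_of (p + 1, diff P p x, e \<oplus>\<^bsub>obj E (i - p)\<^esub> e') - frag_of (p + 1, diff P p x, e) - frag_of (p + 1, diff P p x, e')"
    let ?b = "frag_of (p, x, diff E (i - p) e \<oplus>\<^bsub>obj E (i + 1 - p)\<^esub> diff E (i - p) e') - frag_of (p, x, diff E (i - p) e) - frag_of (p, x, diff E (i - p) e')"
    have "?a \<in> Rel (i + 1)"
      using right rel_gen.right[of "diff P p x" "p + 1" e "i + 1" e'] by (intro Rel_gen) auto
    moreover have "?b \<in> Rel (i + 1)" using right by (intro Rel_gen rel_gen.right) auto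
    moreover have "frag_extend (tdiff i) z = (if even p then ?a + ?b else ?a - ?b)"
      using right E.diff_add[of e "i - p" e' "i + 1 - p"] by (simp add: frag_extend_diff tdiff_def)
    ultimately show ?thesis by (simp add: Rel_add Rel_diff)
  next
    case (bal x p e a)
    let ?a = "frag_of (p + 1, lam n a \<odot>\<^bsub>obj P (p + 1)\<^esub> diff P p x, e) - frag_of (p + 1, diff P p x, lam n a \<odot>\<^bsub>obj E (i - p)\<^esub> e)"
    let ?b = "frag_of (p, lam n a \<odot>\<^bsub>obj P p\<^esub> x, diff E (i - p) e) - frag_of (p, x, lam n a \<odot>\<^bsub>obj E (i + 1 - p)\<^esub> diff E (i - p) e)"
    have "?a \<in> Rel (i + 1)"
      using bal rel_gen.bal[of "diff P p x" "p + 1" e "i + 1" a] by (intro Rel_gen) auto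
    moreover have "?b \<in> Rel (i + 1)" using bal by (intro Rel_gen rel_gen.bal) auto
    moreover have "frag_extend (tdiff i) z = (if even p then ?a + ?b else ?a - ?b)"
      using bal P.diff_act[of x p "p + 1" a] E.diff_act[of e "i - p" "i + 1 - p" a]
      by (simp add: frag_extend_diff tdiff_def)
    ultimately show ?thesis by (simp add: Rel_add Rel_diff)
  qed
qed (simp_all add: frag_extend_add frag_extend_minus Rel_add Rel_uminus)

end

context tensor_cx
begin

definition cls :: "int \<Rightarrow> ((int \<times> 'm \<times> 'l) \<Rightarrow>\<^sub>0 int) \<Rightarrow> ((int \<times> 'm \<times> 'l) \<Rightarrow>\<^sub>0 int) set" where
  "cls i z = (\<lambda>r. r + z) ` Rel i"

lemma cls_eq_iff: "cls i z = cls i w \<longleftrightarrow> z - w \<in> Rel i"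
proof
  assume "cls i z = cls i w"
  then have "0 + z \<in> cls i w" unfolding cls_def using Rel_zero by blast
  then show "z - w \<in> Rel i" by (auto simp: cls_def)
next
  assume zw: "z - w \<in> Rel i"
  have "r + z \<in> cls i w" if "r \<in> Rel i" for r
    using Rel_add[OF that zw] by (auto simp: cls_def intro: image_eqI[of _ _ "r + (z - w)"])
  moreover have "r + w \<in> cls i z" if "r \<in> Rel i" for r
    using Rel_diff[OF that zw] by (auto simp: cls_def intro: image_eqI[of _ _ "r - (z - w)"])
  ultimately show "cls i z = cls i w" by (auto simp: cls_def)
qed

lemma cls_zero: "cls i 0 = Rel i"
  by (auto simp: cls_def)

lemma carrier_tensor: "carrier (obj (tensor n P E) i) = cls i ` {z. Poly_Mapping.keys z \<subseteq> tsym i}"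
proof -
  have "Rel i #>\<^bsub>tensor_free P E i\<^esub> z = cls i z" for z by (auto simp: r_coset_def cls_def)
  then show ?thesis by (auto simp: tensor_def tensor_module_def Let_def FactGroup_def RCOSETS_def)
qed

lemma zero_tensor: "\<zero>\<^bsub>obj (tensor n P E) i\<^esub> = cls i 0"
  by (simp add: tensor_def tensor_module_def Let_def FactGroup_def cls_zero)

lemma add_tensor: "cls i z \<oplus>\<^bsub>obj (tensor n P E) i\<^esub> cls i w = cls i (z + w)"
proof -
  have "cls i z <#>\<^bsub>tensor_free P E i\<^esub> cls i w = cls i (z + w)"
  proof (intro equalityI subsetI)
    fix u assume "u \<in> cls i z <#>\<^bsub>tensor_free P E i\<^esub> cls i w"
    then obtain r s where "r \<in> Rel i" "s \<in> Rel i" "u = r + z + (s + w)"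
      by (auto simp: set_mult_def cls_def)
    then show "u \<in> cls i (z + w)"
      using Rel_add[of r i s] by (auto simp: cls_def intro!: image_eqI[of _ _ "r + s"] simp: algebra_simps)
  next
    fix u assume "u \<in> cls i (z + w)"
    then obtain r where r: "r \<in> Rel i" "u = (r + z) + (0 + w)" by (auto simp: cls_def algebra_simps)
    moreover have "r + z \<in> cls i z" "0 + w \<in> cls i w"
      unfolding cls_def using r(1) Rel_zero by (blast intro: imageI)+
    ultimately show "u \<in> cls i z <#>\<^bsub>tensor_free P E i\<^esub> cls i w" by (auto simp: set_mult_def)
  qed
  then show ?thesis by (simp add: tensor_def tensor_module_def Let_def FactGroup_def)
qed

lemma diff_tensor: "diff (tensor n P E) i (cls i z) = cls (i + 1) (frag_extend (tdiff i) z)"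
proof -
  have "diff (tensor n P E) i (cls i z) = Rel (i + 1) <#>\<^bsub>tensor_free P E (i + 1)\<^esub> frag_extend (tdiff i) ` cls i z"
    by (simp add: tensor_def tensor_induced_def tdiff_def)
  also have "\<dots> = cls (i + 1) (frag_extend (tdiff i) z)"
  proof (intro equalityI subsetI)
    fix u assume "u \<in> Rel (i + 1) <#>\<^bsub>tensor_free P E (i + 1)\<^esub> frag_extend (tdiff i) ` cls i z"
    then obtain r s where "r \<in> Rel (i + 1)" "s \<in> Rel i" "u = r + frag_extend (tdiff i) (s + z)"
      by (auto simp: set_mult_def cls_def)
    then show "u \<in> cls (i + 1) (frag_extend (tdiff i) z)"
      using Rel_add[OF _ tdiff_Rel, of r i s]
      by (auto simp: cls_def frag_extend_add intro!: image_eqI[of _ _ "r + frag_extend (tdiff i) s"])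
  next
    fix u assume "u \<in> cls (i + 1) (frag_extend (tdiff i) z)"
    then obtain r where "r \<in> Rel (i + 1)" "u = r + frag_extend (tdiff i) (0 + z)"
      by (auto simp: cls_def)
    moreover have "frag_extend (tdiff i) (0 + z) \<in> frag_extend (tdiff i) ` cls i z"
      unfolding cls_def using Rel_zero by (blast intro: imageI)
    ultimately show "u \<in> Rel (i + 1) <#>\<^bsub>tensor_free P E (i + 1)\<^esub> frag_extend (tdiff i) ` cls i z"
      unfolding set_mult_def mult_free_Abelian_group by blast
  qed
  finally show ?thesis .
qed

text \<open>Acyclicity of the tensor product in terms of representatives: cycles modulo the relations are
  boundaries modulo the relations.\<close>

lemma tensor_exact:
  assumes T: "zero_object (tensor n P E)" and z: "Poly_Mapping.keys z \<subseteq> tsym i"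
    and dz: "frag_extend (tdiff i) z \<in> Rel (i + 1)"
  shows "\<exists>w. Poly_Mapping.keys w \<subseteq> tsym (i - 1) \<and> z - frag_extend (tdiff (i - 1)) w \<in> Rel i"
proof -
  let ?T = "tensor n P E"
  let ?G = "add_monoid (obj ?T i)\<lparr>carrier := cocycles ?T i\<rparr>"
  have triv: "carrier (?G Mod coboundaries ?T i) = {coboundaries ?T i}"
    using T by (simp add: zero_object_def trivial_group_def cohomology_def FactGroup_def)
  have "cls (i + 1) (frag_extend (tdiff i) z) = cls (i + 1) 0"
    using dz by (simp add: cls_eq_iff)
  then have "cls i z \<in> cocycles ?T i"
    using z by (simp add: cocycles_def carrier_tensor diff_tensor zero_tensor)
  then have "coboundaries ?T i #>\<^bsub>?G\<^esub> cls i z \<in> carrier (?G Mod coboundaries ?T i)"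
    by (auto simp: FactGroup_def RCOSETS_def)
  then have coset: "coboundaries ?T i #>\<^bsub>?G\<^esub> cls i z = coboundaries ?T i" using triv by simp
  have bd: "coboundaries ?T i = {cls i (frag_extend (tdiff (i - 1)) w) |w. Poly_Mapping.keys w \<subseteq> tsym (i - 1)}"
    using diff_tensor[of "i - 1"] by (auto simp: coboundaries_def carrier_tensor)
  have "cls i (frag_extend (tdiff (i - 1)) 0) \<in> coboundaries ?T i"
    unfolding bd by (intro CollectI exI[of _ 0]) simp
  then have "cls i 0 \<oplus>\<^bsub>obj ?T i\<^esub> cls i z \<in> coboundaries ?T i #>\<^bsub>?G\<^esub> cls i z"
    by (auto simp: r_coset_def)
  then have "cls i z \<in> coboundaries ?T i" unfolding coset add_tensor by simp
  then show ?thesis unfolding bd by (auto simp: cls_eq_iff)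
qed

definition fpair :: "(int \<Rightarrow> 'm \<Rightarrow> 'l \<Rightarrow> 'k) \<Rightarrow> ((int \<times> 'm \<times> 'l) \<Rightarrow>\<^sub>0 int) \<Rightarrow> 'k" where
  "fpair \<beta> z = (\<Sum>(p, x, e)\<in>Poly_Mapping.keys z. of_int (Poly_Mapping.lookup z (p, x, e)) * \<beta> p x e)"

lemma fpair_superset:
  assumes "finite A" "Poly_Mapping.keys z \<subseteq> A"
  shows "fpair \<beta> z = (\<Sum>(p, x, e)\<in>A. of_int (Poly_Mapping.lookup z (p, x, e)) * \<beta> p x e)"
  unfolding fpair_def using assms by (intro sum.mono_neutral_left) (auto simp: in_keys_iff)

lemma fpair_simps [simp]:
  "fpair \<beta> 0 = 0" "fpair \<beta> (z + w) = fpair \<beta> z + fpair \<beta> w" "fpair \<beta> (z - w) = fpair \<beta> z - fpair \<beta> w"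
  "fpair \<beta> (- z) = - fpair \<beta> z" "fpair \<beta> (frag_of (p, x, e)) = \<beta> p x e"
proof -
  let ?A = "Poly_Mapping.keys z \<union> Poly_Mapping.keys w"
  have "Poly_Mapping.keys (z + w) \<subseteq> ?A" "Poly_Mapping.keys (z - w) \<subseteq> ?A"
    by (auto simp: in_keys_iff lookup_add lookup_minus)
  then show "fpair \<beta> (z + w) = fpair \<beta> z + fpair \<beta> w" "fpair \<beta> (z - w) = fpair \<beta> z - fpair \<beta> w"
    by (simp_all add: fpair_superset[where A = ?A] lookup_add lookup_minus algebra_simps
        sum.distrib sum_subtractf case_prod_beta)
qed (simp_all add: fpair_def sum_negf case_prod_beta)

lemma bform_balanced:
  assumes \<beta>: "bform n P E 0 m \<beta>" and pq: "p + q = m"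
  shows "x \<in> carrier (obj P p) \<Longrightarrow> e \<in> carrier (obj E q) \<Longrightarrow>
    \<beta> p (lam n a \<odot>\<^bsub>obj P p\<^esub> x) e = \<beta> p x (lam n a \<odot>\<^bsub>obj E q\<^esub> e)"
proof (induction a arbitrary: x e rule: poly_var_induct)
  case (const c)
  then show ?case using bform_cst_left[OF \<beta> pq] bform_cst_right[OF \<beta> pq] by simp
next
  case (add a b)
  then show ?case
    by (simp add: act_add[OF P.mod] act_add[OF E.mod] bform_add_left[OF \<beta> pq] bform_add_right[OF \<beta> pq])
next
  case (var s a)
  have "\<beta> p (lam n (var s * a) \<odot>\<^bsub>obj P p\<^esub> x) e = \<beta> p (lam n a \<odot>\<^bsub>obj P p\<^esub> x) (lam n (var s) \<odot>\<^bsub>obj E q\<^esub> e)"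
    using var.prems by (simp add: act_mult[OF P.mod] bform_var[OF \<beta> pq])
  also have "\<dots> = \<beta> p x (lam n (a * var s) \<odot>\<^bsub>obj E q\<^esub> e)"
    using var.prems by (simp add: var.IH act_mult[OF E.mod])
  finally show ?case by (simp add: mult.commute)
qed

lemma fpair_Rel:
  assumes \<beta>: "bform n P E 0 m \<beta>" and z: "z \<in> Rel m"
  shows "fpair \<beta> z = 0"
  using z
proof (induction rule: Rel_induct)
  case (gen z)
  have pq: "p + (m - p) = m" for p by simp
  from gen show ?case
    by cases (use bform_add_left[OF \<beta> pq] bform_add_right[OF \<beta> pq] bform_balanced[OF \<beta> pq] in simp_all)
qed simp_all

lemma fpair_tdiff:
  assumes "Poly_Mapping.keys z \<subseteq> tsym i"
  shows "fpair \<beta> (frag_extend (tdiff i) z) = fpair (delta P E i \<beta>) z"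
  using assms
proof (induction z rule: frag_induction)
  case (one v)
  then show ?case by (cases v) (simp add: tdiff_def delta_def)
qed (simp_all add: frag_extend_diff)

end

text \<open>This turns a \<open>k\<close>-linear combination of symbols into an integral one, by letting each coefficient act
  on its symbol. Additivity in \<open>r\<close> then holds only modulo the relations \<open>R\<close>.\<close>

definition psum :: "('v \<Rightarrow> 'k \<Rightarrow> 'b) \<Rightarrow> ('v \<Rightarrow>\<^sub>0 'k::zero) \<Rightarrow> 'b::ab_group_add" where
  "psum t r = (\<Sum>v\<in>Poly_Mapping.keys r. t v (Poly_Mapping.lookup r v))"

lemma psum_mod:
  fixes t :: "'v \<Rightarrow> 'k::field \<Rightarrow> 'b::ab_group_add" and R :: "'b set"
  assumes R: "0 \<in> R" "\<And>u v. u \<in> R \<Longrightarrow> v \<in> R \<Longrightarrow> u - v \<in> R"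
    and t: "\<And>v a b. t v (a + b) - t v a - t v b \<in> R"
  shows psum_add_mod: "psum t (r + s) - psum t r - psum t s \<in> R"
    and psum_single_mod: "psum t (Poly_Mapping.single v a) - t v a \<in> R"
proof -
  have um: "- u \<in> R" if "u \<in> R" for u using R(2)[OF R(1) that] by simp
  have ad: "u + v \<in> R" if "u \<in> R" "v \<in> R" for u v using R(2)[OF that(1) um[OF that(2)]] by simp
  have sum: "(\<Sum>v\<in>A. f v) \<in> R" if "\<And>v. v \<in> A \<Longrightarrow> f v \<in> R" for f :: "'v \<Rightarrow> 'b" and A
    using that by (induction A rule: infinite_finite_induct) (auto intro: R ad)
  have t0: "t v 0 \<in> R" for v using um[OF t[of v 0 0]] by simp
  have super: "(\<Sum>v\<in>A. t v (Poly_Mapping.lookup r v)) - psum t r \<in> R"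
    if "finite A" "Poly_Mapping.keys r \<subseteq> A" for A r
  proof -
    have "(\<Sum>v\<in>A. t v (Poly_Mapping.lookup r v)) - psum t r
        = (\<Sum>v\<in>A - Poly_Mapping.keys r. t v (Poly_Mapping.lookup r v))"
      using that by (simp add: psum_def sum_diff)
    also have "\<dots> \<in> R" by (rule sum) (auto simp: in_keys_iff t0)
    finally show ?thesis .
  qed
  let ?A = "Poly_Mapping.keys r \<union> Poly_Mapping.keys s"
  let ?s = "\<lambda>r. \<Sum>v\<in>?A. t v (Poly_Mapping.lookup r v)"
  have A: "Poly_Mapping.keys (r + s) \<subseteq> ?A" by (auto simp: in_keys_iff lookup_add)
  have "?s (r + s) - ?s r - ?s s \<in> R"
    using sum[of ?A "\<lambda>v. t v (Poly_Mapping.lookup r v + Poly_Mapping.lookup s v) - t v (Poly_Mapping.lookup r v) - t v (Poly_Mapping.lookup s v)"] t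
    by (simp add: lookup_add sum_subtractf)
  then have "((?s (r + s) - ?s r - ?s s) - (?s (r + s) - psum t (r + s))) + ((?s r - psum t r) + (?s s - psum t s)) \<in> R"
    using super[of ?A] A by (intro ad[OF R(2) ad]) auto
  then show "psum t (r + s) - psum t r - psum t s \<in> R" by (simp add: algebra_simps)
  show "psum t (Poly_Mapping.single v a) - t v a \<in> R"
    using um[OF super[of "{v}" "Poly_Mapping.single v a"]] by simp
qed

lemma pscale_diff [simp]: "pscale a (r - s) = pscale a r - pscale a (s :: 'v \<Rightarrow>\<^sub>0 'k::field)"
  by (rule poly_mapping_eqI) (simp add: lookup_minus right_diff_distrib)

lemma pscale_pscale [simp]: "pscale a (pscale b r) = pscale (a * b) r"
  by (rule poly_mapping_eqI) (simp add: mult.assoc)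

context tensor_cx
begin

text \<open>A cocycle in the complex of forms is a functional that is closed for the differential of
  \<open>P \<otimes> E\<close>, and over a field a closed functional on an exact complex is a coboundary. The functional
  sought is the solution of a linear system whose unknowns are its values at the symbols. The set \<open>I\<close>
  consists of the equations that the prescribed values on coboundaries force. Since only the abelian
  group underlying \<open>P \<otimes> E\<close> is at hand, the condition is imposed on all multiples of an equation.\<close>

theorem forms_exact_tensor:
  assumes T: "zero_object (tensor n P E)"
  shows "forms_exact n P E 0"
  unfolding forms_exact_def
proof (intro allI impI)
  fix m :: int and \<beta> :: "int \<Rightarrow> 'm \<Rightarrow> 'l \<Rightarrow> 'k"
  assume \<beta>: "bform n P E 0 m \<beta>" and closed: "form_eq P E (m - 1) (delta P E (m - 1) \<beta>) (\<lambda>p x e. 0)"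
  define t where "t v a = (if v \<in> tsym (m + 1) then
      (case v of (p, x, e) \<Rightarrow> frag_of (p, lam n (cst a) \<odot>\<^bsub>obj P p\<^esub> x, e)) else 0)" for v and a :: 'k
  have t_simp: "t (p, x, e) a = frag_of (p, lam n (cst a) \<odot>\<^bsub>obj P p\<^esub> x, e)"
    if "p + q = m + 1" "x \<in> carrier (obj P p)" "e \<in> carrier (obj E q)" for p q x e a
    using that by (auto simp: t_def mem_tsym algebra_simps dest!: sym[of "p + q"])
  let ?R = "Rel (m + 1)"
  define cg where "cg u v \<longleftrightarrow> u - v \<in> ?R" for u v
  let ?\<theta> = "psum t"
  have t_add: "t v (a + b) - t v a - t v b \<in> ?R" for v a b
  proof (cases "v \<in> tsym (m + 1)")
    case True
    obtain p x e where v: "v = (p, x, e)" by (cases v)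
    then show ?thesis
      using True rel_gen.left[of "lam n (cst a) \<odot>\<^bsub>obj P p\<^esub> x" p "lam n (cst b) \<odot>\<^bsub>obj P p\<^esub> x" e "m + 1"]
      by (auto simp: t_def mem_tsym single_add act_add[OF P.mod] intro!: Rel_gen)
  qed (simp add: t_def)
  note psum_mods = psum_mod[of ?R t, OF Rel_zero Rel_diff t_add]
  have cg_trans: "cg u w" if "cg u v" "cg v w" for u v w
    using Rel_add[of "u - v" "m + 1" "v - w"] that by (simp add: cg_def)
  have cg_add: "cg (?\<theta> (r + s)) (u + v)" if "cg (?\<theta> r) u" "cg (?\<theta> s) v" for r s u v
    using Rel_add[OF psum_mods(1)[of r s] Rel_add[of "?\<theta> r - u" "m + 1" "?\<theta> s - v"]] that
    by (simp add: cg_def algebra_simps)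
  have cg_diff: "cg (?\<theta> (r - s)) (u - v)" if "cg (?\<theta> r) u" "cg (?\<theta> s) v" for r s u v
    using Rel_diff[OF Rel_diff[of "?\<theta> r - u" "m + 1" "?\<theta> s - v"] psum_mods(1)[of "r - s" s]] that
    by (simp add: cg_def algebra_simps)
  have cg_single: "cg (?\<theta> (Poly_Mapping.single v a)) (t v a)" for v a
    using psum_mods(2) by (simp add: cg_def)
  note cg_rules = cg_add cg_diff cg_single
  define I where "I = {(r, c :: 'k). \<forall>a. \<exists>z. Poly_Mapping.keys z \<subseteq> tsym m \<and>
      cg (?\<theta> (pscale a r)) (frag_extend (tdiff m) z) \<and> fpair \<beta> z = a * c}"
  have I0: "(r, 0) \<in> I" if "\<And>a. cg (?\<theta> (pscale a r)) 0" for r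
    using that unfolding I_def by (auto intro!: exI[of _ 0])
  let ?single = "\<lambda>p x e. Poly_Mapping.single (p, x, e) 1 :: (int \<times> 'm \<times> 'l) \<Rightarrow>\<^sub>0 'k"
  let ?add_left = "{(?single p (x \<oplus>\<^bsub>obj P p\<^esub> y) e - ?single p x e - ?single p y e, 0 :: 'k) |p q x y e.
      p + q = m + 1 \<and> x \<in> carrier (obj P p) \<and> y \<in> carrier (obj P p) \<and> e \<in> carrier (obj E q)}"
  let ?add_right = "{(?single p x (e \<oplus>\<^bsub>obj E q\<^esub> e') - ?single p x e - ?single p x e', 0 :: 'k) |p q x e e'.
      p + q = m + 1 \<and> x \<in> carrier (obj P p) \<and> e \<in> carrier (obj E q) \<and> e' \<in> carrier (obj E q)}"
  let ?scale = "{(?single p (lam n (cst c) \<odot>\<^bsub>obj P p\<^esub> x) e - Poly_Mapping.single (p, x, e) c, 0 :: 'k) |p q x e c.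
      p + q = m + 1 \<and> x \<in> carrier (obj P p) \<and> e \<in> carrier (obj E q)}"
  let ?bal = "{(?single p (lam n b \<odot>\<^bsub>obj P p\<^esub> x) e - ?single p x (lam n b \<odot>\<^bsub>obj E q\<^esub> e), 0 :: 'k) |p q x e b.
      p + q = m + 1 \<and> x \<in> carrier (obj P p) \<and> e \<in> carrier (obj E q)}"
  let ?diff = "{(if even p then ?single (p + 1) (diff P p x) e + ?single p x (diff E (m - p) e)
        else ?single (p + 1) (diff P p x) e - ?single p x (diff E (m - p) e), \<beta> p x e) |p x e.
      x \<in> carrier (obj P p) \<and> e \<in> carrier (obj E (m - p))}"
  have "\<exists>\<phi>. \<forall>(r, c) \<in> ?add_left \<union> ?add_right \<union> ?scale \<union> ?bal \<union> ?diff. pair r \<phi> = c"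
  proof (rule linear_system_solvable[where I = I])
    show "(0, 0) \<in> I" by (rule I0) (simp add: cg_def psum_def)
  next
    fix r c s d assume rc: "(r, c) \<in> I" "(s, d) \<in> I"
    show "(r + s, c + d) \<in> I"
      unfolding I_def mem_Collect_eq prod.case
    proof
      fix a
      obtain z where z: "Poly_Mapping.keys z \<subseteq> tsym m" "cg (?\<theta> (pscale a r)) (frag_extend (tdiff m) z)" "fpair \<beta> z = a * c"
        using rc(1) unfolding I_def by blast
      obtain w where w: "Poly_Mapping.keys w \<subseteq> tsym m" "cg (?\<theta> (pscale a s)) (frag_extend (tdiff m) w)" "fpair \<beta> w = a * d"
        using rc(2) unfolding I_def by blast
      have "Poly_Mapping.keys (z + w) \<subseteq> tsym m" using z(1) w(1) keys_add[of z w] by blast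
      moreover have "cg (?\<theta> (pscale a (r + s))) (frag_extend (tdiff m) (z + w))"
        using cg_add[OF z(2) w(2)] by (simp add: frag_extend_add)
      moreover have "fpair \<beta> (z + w) = a * (c + d)" using z(3) w(3) by (simp add: distrib_left)
      ultimately show "\<exists>z. Poly_Mapping.keys z \<subseteq> tsym m \<and>
          cg (?\<theta> (pscale a (r + s))) (frag_extend (tdiff m) z) \<and> fpair \<beta> z = a * (c + d)" by blast
    qed
  next
    fix b r c assume "(r, c) \<in> I"
    then show "(pscale b r, b * c) \<in> I" by (simp add: I_def mult.assoc[symmetric])
  next
    show "(0, 1) \<notin> I"
    proof
      assume "(0, 1) \<in> I"
      then obtain z where z: "Poly_Mapping.keys z \<subseteq> tsym m" "cg 0 (frag_extend (tdiff m) z)" "fpair \<beta> z = 1"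
        unfolding I_def by (auto simp: psum_def dest!: spec[of _ 1])
      have "frag_extend (tdiff m) z \<in> ?R" using Rel_uminus[OF z(2)[unfolded cg_def]] by simp
      then obtain w where w: "Poly_Mapping.keys w \<subseteq> tsym (m - 1)" "z - frag_extend (tdiff (m - 1)) w \<in> Rel m"
        using tensor_exact[OF T z(1)] by blast
      have "fpair \<beta> (z - frag_extend (tdiff (m - 1)) w) = 0" by (rule fpair_Rel[OF \<beta> w(2)])
      then have "fpair \<beta> z = fpair (delta P E (m - 1) \<beta>) w" by (simp add: fpair_tdiff[OF w(1)])
      also have "\<dots> = 0"
        unfolding fpair_def using closed w(1) by (intro sum.neutral) (auto simp: form_eq_def mem_tsym)
      finally show False using z(3) by simp
    qed
  next
    have add_left: "?add_left \<subseteq> I"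
    proof clarify
      fix p q x y e assume v: "p + q = m + 1" "x \<in> carrier (obj P p)" "y \<in> carrier (obj P p)" "e \<in> carrier (obj E q)"
      show "(?single p (x \<oplus>\<^bsub>obj P p\<^esub> y) e - ?single p x e - ?single p y e, 0) \<in> I"
      proof (rule I0)
        fix a :: 'k
        let ?a = "\<lambda>x. lam n (cst a) \<odot>\<^bsub>obj P p\<^esub> x"
        have "cg (?\<theta> (pscale a (?single p (x \<oplus>\<^bsub>obj P p\<^esub> y) e - ?single p x e - ?single p y e)))
           (t (p, x \<oplus>\<^bsub>obj P p\<^esub> y, e) a - t (p, x, e) a - t (p, y, e) a)"
          by (simp, intro cg_rules)
        moreover have "cg (t (p, x \<oplus>\<^bsub>obj P p\<^esub> y, e) a - t (p, x, e) a - t (p, y, e) a) 0"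
          using v Rel_gen[OF rel_gen.left[of "?a x" p "?a y" e "m + 1"]]
          by (auto simp: t_simp[OF v(1)] act_distr[OF P.mod] cg_def algebra_simps dest!: sym[of "p + q"])
        ultimately show "cg (?\<theta> (pscale a (?single p (x \<oplus>\<^bsub>obj P p\<^esub> y) e - ?single p x e - ?single p y e))) 0"
          by (rule cg_trans)
      qed
    qed
    have add_right: "?add_right \<subseteq> I"
    proof clarify
      fix p q x e e' assume v: "p + q = m + 1" "x \<in> carrier (obj P p)" "e \<in> carrier (obj E q)" "e' \<in> carrier (obj E q)"
      then have q: "q = m + 1 - p" by simp
      show "(?single p x (e \<oplus>\<^bsub>obj E q\<^esub> e') - ?single p x e - ?single p x e', 0) \<in> I"
      proof (rule I0)
        fix a :: 'k
        let ?a = "\<lambda>x. lam n (cst a) \<odot>\<^bsub>obj P p\<^esub> x"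
        have "cg (?\<theta> (pscale a (?single p x (e \<oplus>\<^bsub>obj E q\<^esub> e') - ?single p x e - ?single p x e')))
           (t (p, x, e \<oplus>\<^bsub>obj E q\<^esub> e') a - t (p, x, e) a - t (p, x, e') a)"
          by (simp, intro cg_rules)
        moreover have "cg (t (p, x, e \<oplus>\<^bsub>obj E q\<^esub> e') a - t (p, x, e) a - t (p, x, e') a) 0"
          using v Rel_gen[OF rel_gen.right[of "?a x" p e "m + 1" e']]
          by (simp add: t_simp[OF v(1)] cg_def q[symmetric])
        ultimately show "cg (?\<theta> (pscale a (?single p x (e \<oplus>\<^bsub>obj E q\<^esub> e') - ?single p x e - ?single p x e'))) 0"
          by (rule cg_trans)
      qed
    qed
    have scale: "?scale \<subseteq> I"
    proof clarify
      fix p q x e and c :: 'k assume v: "p + q = m + 1" "x \<in> carrier (obj P p)" "e \<in> carrier (obj E q)"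
      show "(?single p (lam n (cst c) \<odot>\<^bsub>obj P p\<^esub> x) e - Poly_Mapping.single (p, x, e) c, 0) \<in> I"
      proof (rule I0)
        fix a :: 'k
        have "cg (?\<theta> (pscale a (?single p (lam n (cst c) \<odot>\<^bsub>obj P p\<^esub> x) e - Poly_Mapping.single (p, x, e) c)))
           (t (p, lam n (cst c) \<odot>\<^bsub>obj P p\<^esub> x, e) a - t (p, x, e) (a * c))"
          by (simp, intro cg_rules)
        moreover have "cg (t (p, lam n (cst c) \<odot>\<^bsub>obj P p\<^esub> x, e) a - t (p, x, e) (a * c)) 0"
          using v act_mult[OF P.mod, of x p "cst a" "cst c"] by (simp add: t_simp[OF v(1)] cg_def mult_single)
        ultimately show "cg (?\<theta> (pscale a (?single p (lam n (cst c) \<odot>\<^bsub>obj P p\<^esub> x) e - Poly_Mapping.single (p, x, e) c))) 0"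
          by (rule cg_trans)
      qed
    qed
    have bal: "?bal \<subseteq> I"
    proof clarify
      fix p q x e and b :: "'k inf_poly" assume v: "p + q = m + 1" "x \<in> carrier (obj P p)" "e \<in> carrier (obj E q)"
      then have q: "q = m + 1 - p" by simp
      show "(?single p (lam n b \<odot>\<^bsub>obj P p\<^esub> x) e - ?single p x (lam n b \<odot>\<^bsub>obj E q\<^esub> e), 0) \<in> I"
      proof (rule I0)
        fix a :: 'k
        let ?a = "\<lambda>x. lam n (cst a) \<odot>\<^bsub>obj P p\<^esub> x"
        have "cg (?\<theta> (pscale a (?single p (lam n b \<odot>\<^bsub>obj P p\<^esub> x) e - ?single p x (lam n b \<odot>\<^bsub>obj E q\<^esub> e))))
           (t (p, lam n b \<odot>\<^bsub>obj P p\<^esub> x, e) a - t (p, x, lam n b \<odot>\<^bsub>obj E q\<^esub> e) a)"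
          by (simp, intro cg_rules)
        moreover have "lam n (cst a) \<odot>\<^bsub>obj P p\<^esub> (lam n b \<odot>\<^bsub>obj P p\<^esub> x) = lam n b \<odot>\<^bsub>obj P p\<^esub> (lam n (cst a) \<odot>\<^bsub>obj P p\<^esub> x)"
          using v act_mult[OF P.mod, of x p "cst a" b] act_mult[OF P.mod, of x p b "cst a"] by (simp add: mult.commute)
        then have "cg (t (p, lam n b \<odot>\<^bsub>obj P p\<^esub> x, e) a - t (p, x, lam n b \<odot>\<^bsub>obj E q\<^esub> e) a) 0"
          using v Rel_gen[OF rel_gen.bal[of "?a x" p e "m + 1" b]]
          by (simp add: t_simp[OF v(1)] cg_def q[symmetric])
        ultimately show "cg (?\<theta> (pscale a (?single p (lam n b \<odot>\<^bsub>obj P p\<^esub> x) e - ?single p x (lam n b \<odot>\<^bsub>obj E q\<^esub> e)))) 0"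
          by (rule cg_trans)
      qed
    qed
    have diff: "?diff \<subseteq> I"
    proof clarify
      fix p x e assume v: "x \<in> carrier (obj P p)" "e \<in> carrier (obj E (m - p))"
      let ?r = "if even p then ?single (p + 1) (diff P p x) e + ?single p x (diff E (m - p) e)
        else ?single (p + 1) (diff P p x) e - ?single p x (diff E (m - p) e)"
      let ?u = "\<lambda>a. if even p then t (p + 1, diff P p x, e) a + t (p, x, diff E (m - p) e) a
        else t (p + 1, diff P p x, e) a - t (p, x, diff E (m - p) e) a"
      show "(?r, \<beta> p x e) \<in> I"
        unfolding I_def mem_Collect_eq prod.case
      proof
        fix a
        let ?z = "frag_of (p, lam n (cst a) \<odot>\<^bsub>obj P p\<^esub> x, e)"
        have "Poly_Mapping.keys ?z \<subseteq> tsym m" using v by (simp add: mem_tsym)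
        moreover have "cg (?\<theta> (pscale a ?r)) (?u a)"
          by (simp, intro conjI impI cg_rules)
        then have "cg (?\<theta> (pscale a ?r)) (frag_extend (tdiff m) ?z)"
          using v P.diff_act[of x p "p + 1" "cst a"]
          by (simp add: t_simp[of "p + 1" "m - p"] t_simp[of p "m - p + 1"] tdiff_def split: if_splits)
        moreover have "fpair \<beta> ?z = a * \<beta> p x e"
          using bform_cst_left[OF \<beta> _ v] by simp
        ultimately show "\<exists>z. Poly_Mapping.keys z \<subseteq> tsym m \<and>
          cg (?\<theta> (pscale a ?r)) (frag_extend (tdiff m) z) \<and> fpair \<beta> z = a * \<beta> p x e" by blast
      qed
    qed
    show "?add_left \<union> ?add_right \<union> ?scale \<union> ?bal \<union> ?diff \<subseteq> I"
      using add_left add_right scale bal diff by (intro Un_least)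
  qed
  then obtain \<phi> where \<phi>: "\<forall>(r, c) \<in> ?add_left \<union> ?add_right \<union> ?scale \<union> ?bal \<union> ?diff. pair r \<phi> = c" ..
  define \<gamma> where "\<gamma> p x e = \<phi> (p, x, e)" for p x e
  have solve: "pair r \<phi> = c" if "(r, c) \<in> ?add_left \<union> ?add_right \<union> ?scale \<union> ?bal \<union> ?diff" for r c
    using bspec[OF \<phi> that] by simp
  have add_left: "\<gamma> p (x \<oplus>\<^bsub>obj P p\<^esub> y) e = \<gamma> p x e + \<gamma> p y e"
    if "p + q = m + 1" "x \<in> carrier (obj P p)" "y \<in> carrier (obj P p)" "e \<in> carrier (obj E q)" for p q x y e
  proof -
    have "(?single p (x \<oplus>\<^bsub>obj P p\<^esub> y) e - ?single p x e - ?single p y e, 0) \<in> ?add_left" using that by blast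
    then have "pair (?single p (x \<oplus>\<^bsub>obj P p\<^esub> y) e - ?single p x e - ?single p y e) \<phi> = 0" by (intro solve UnI1)
    then show ?thesis by (simp add: \<gamma>_def algebra_simps)
  qed
  have add_right: "\<gamma> p x (e \<oplus>\<^bsub>obj E q\<^esub> e') = \<gamma> p x e + \<gamma> p x e'"
    if "p + q = m + 1" "x \<in> carrier (obj P p)" "e \<in> carrier (obj E q)" "e' \<in> carrier (obj E q)" for p q x e e'
  proof -
    have "(?single p x (e \<oplus>\<^bsub>obj E q\<^esub> e') - ?single p x e - ?single p x e', 0) \<in> ?add_right" using that by blast
    then have "pair (?single p x (e \<oplus>\<^bsub>obj E q\<^esub> e') - ?single p x e - ?single p x e') \<phi> = 0"
      by (intro solve UnI1 UnI2[of _ _ ?add_left])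
    then show ?thesis by (simp add: \<gamma>_def algebra_simps)
  qed
  have scale: "\<gamma> p (lam n (cst c) \<odot>\<^bsub>obj P p\<^esub> x) e = c * \<gamma> p x e"
    if "p + q = m + 1" "x \<in> carrier (obj P p)" "e \<in> carrier (obj E q)" for p q x e c
  proof -
    have "(?single p (lam n (cst c) \<odot>\<^bsub>obj P p\<^esub> x) e - Poly_Mapping.single (p, x, e) c, 0) \<in> ?scale" using that by blast
    then have "pair (?single p (lam n (cst c) \<odot>\<^bsub>obj P p\<^esub> x) e - Poly_Mapping.single (p, x, e) c) \<phi> = 0"
      by (intro solve UnI1 UnI2[of _ _ "?add_left \<union> ?add_right"])
    then show ?thesis by (simp add: \<gamma>_def)
  qed
  have bal: "\<gamma> p (lam n b \<odot>\<^bsub>obj P p\<^esub> x) e = \<gamma> p x (lam n b \<odot>\<^bsub>obj E q\<^esub> e)"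
    if "p + q = m + 1" "x \<in> carrier (obj P p)" "e \<in> carrier (obj E q)" for p q x e b
  proof -
    have "(?single p (lam n b \<odot>\<^bsub>obj P p\<^esub> x) e - ?single p x (lam n b \<odot>\<^bsub>obj E q\<^esub> e), 0) \<in> ?bal" using that by blast
    then have "pair (?single p (lam n b \<odot>\<^bsub>obj P p\<^esub> x) e - ?single p x (lam n b \<odot>\<^bsub>obj E q\<^esub> e)) \<phi> = 0"
      by (intro solve UnI1 UnI2[of _ _ "?add_left \<union> ?add_right \<union> ?scale"])
    then show ?thesis by (simp add: \<gamma>_def)
  qed
  have diff: "\<beta> p x e = delta P E m \<gamma> p x e"
    if "x \<in> carrier (obj P p)" "e \<in> carrier (obj E (m - p))" for p x e
  proof -
    let ?r = "if even p then ?single (p + 1) (diff P p x) e + ?single p x (diff E (m - p) e)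
        else ?single (p + 1) (diff P p x) e - ?single p x (diff E (m - p) e)"
    have "(?r, \<beta> p x e) \<in> ?diff" using that by blast
    then have "pair ?r \<phi> = \<beta> p x e" by (intro solve UnI2)
    then show ?thesis by (simp add: \<gamma>_def delta_def split: if_splits)
  qed
  have scale_right: "\<gamma> p x (lam n (cst c) \<odot>\<^bsub>obj E q\<^esub> e) = c * \<gamma> p x e"
    if "p + q = m + 1" "x \<in> carrier (obj P p)" "e \<in> carrier (obj E q)" for p q x e c
    using bal[OF that, of "cst c"] scale[OF that] by simp
  show "\<exists>\<gamma>. bform n P E 0 (m + 1) \<gamma> \<and> form_eq P E m \<beta> (delta P E m \<gamma>)"
  proof (intro exI conjI)
    show "bform n P E 0 (m + 1) \<gamma>"
      by (rule bformI) (simp_all add: add_left add_right scale scale_right bal)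
    show "form_eq P E m \<beta> (delta P E m \<gamma>)" using diff by (simp add: form_eq_def)
  qed
qed

end

section \<open>Free modules\<close>

lemma free_basis_induct [consumes 3, case_names zero add gen]:
  assumes M: "Module.module (Lam n) M" and B: "free_basis (Lam n) M B" and x: "x \<in> carrier M"
    and "Q \<zero>\<^bsub>M\<^esub>" and "\<And>x y. x \<in> carrier M \<Longrightarrow> y \<in> carrier M \<Longrightarrow> Q x \<Longrightarrow> Q y \<Longrightarrow> Q (x \<oplus>\<^bsub>M\<^esub> y)"
    and "\<And>p b. b \<in> B \<Longrightarrow> Q (lam n p \<odot>\<^bsub>M\<^esub> b)"
  shows "Q x"
proof -
  interpret Module.module "Lam n" M by (rule M)
  have BM: "B \<subseteq> carrier M" using B by (simp add: free_basis_def)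
  obtain c where c: "\<forall>b. c b \<in> carrier (Lam n)" "{b. c b \<noteq> \<zero>\<^bsub>Lam n\<^esub>} \<subseteq> B" "finite {b. c b \<noteq> \<zero>\<^bsub>Lam n\<^esub>}"
      "x = (\<Oplus>\<^bsub>M\<^esub>b\<in>{b. c b \<noteq> \<zero>\<^bsub>Lam n\<^esub>}. c b \<odot>\<^bsub>M\<^esub> b)"
    using B x unfolding free_basis_def by (auto elim!: ballE[of _ _ x] ex1E)
  have "Q (\<Oplus>\<^bsub>M\<^esub>b\<in>F. c b \<odot>\<^bsub>M\<^esub> b) \<and> (\<Oplus>\<^bsub>M\<^esub>b\<in>F. c b \<odot>\<^bsub>M\<^esub> b) \<in> carrier M" if "finite F" "F \<subseteq> B" for F
    using that
  proof (induction F)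
    case empty
    then show ?case using assms(4) by simp
  next
    case (insert b F)
    obtain p where p: "c b = lam n p" using c(1) by (auto simp: carrier_Lam)
    have *: "(\<lambda>b. c b \<odot>\<^bsub>M\<^esub> b) \<in> F \<rightarrow> carrier M" "c b \<odot>\<^bsub>M\<^esub> b \<in> carrier M"
      using insert.prems BM c(1) by auto
    then show ?case using insert assms(5) assms(6)[of b p] p by simp
  qed
  from this[OF c(3,2)] show ?thesis using c(4) by simp
qed

text \<open>A free module is the direct sum of copies of \<open>\<Lambda>\<close>, so that additive maps out of it, which need
  not be \<open>\<Lambda>\<close>-linear, can be prescribed on each copy.\<close>

lemma free_basis_extend:
  fixes g :: "'m \<Rightarrow> 'k::field lam \<Rightarrow> 'b"
  assumes M: "Module.module (Lam n) M" and B: "free_basis (Lam n) M B" and N: "abelian_group N"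
    and g: "\<And>b c. b \<in> B \<Longrightarrow> c \<in> carrier (Lam n) \<Longrightarrow> g b c \<in> carrier N"
    and g_add: "\<And>b c d. b \<in> B \<Longrightarrow> c \<in> carrier (Lam n) \<Longrightarrow> d \<in> carrier (Lam n) \<Longrightarrow>
      g b (c \<oplus>\<^bsub>Lam n\<^esub> d) = g b c \<oplus>\<^bsub>N\<^esub> g b d"
  shows "\<exists>t. (\<forall>x\<in>carrier M. t x \<in> carrier N) \<and>
    (\<forall>x\<in>carrier M. \<forall>y\<in>carrier M. t (x \<oplus>\<^bsub>M\<^esub> y) = t x \<oplus>\<^bsub>N\<^esub> t y) \<and>
    (\<forall>b\<in>B. \<forall>c\<in>carrier (Lam n). t (c \<odot>\<^bsub>M\<^esub> b) = g b c)"
proof -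
  interpret Module.module "Lam n" M by (rule M)
  interpret N: abelian_group N by (rule N)
  let ?R = "Lam n :: 'k lam ring"
  let ?s = "\<lambda>c. {b. c b \<noteq> \<zero>\<^bsub>?R\<^esub>}"
  define C where "C = {c. (\<forall>b. c b \<in> carrier ?R) \<and> ?s c \<subseteq> B \<and> finite (?s c)}"
  define ev where "ev c = (\<Oplus>\<^bsub>M\<^esub>b\<in>?s c. c b \<odot>\<^bsub>M\<^esub> b)" for c
  define tv where "tv c = (\<Oplus>\<^bsub>N\<^esub>b\<in>?s c. g b (c b))" for c
  have BM: "B \<subseteq> carrier M" using B by (simp add: free_basis_def)
  have uniq: "\<exists>!c. c \<in> C \<and> x = ev c" if "x \<in> carrier M" for x
  proof -
    have "\<exists>!c. (\<forall>b. c b \<in> carrier ?R) \<and> ?s c \<subseteq> B \<and> finite (?s c) \<and> x = ev c"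
      using B that unfolding free_basis_def ev_def by (elim conjE bspec)
    then show ?thesis unfolding C_def mem_Collect_eq conj_assoc .
  qed
  have g0: "g b \<zero>\<^bsub>?R\<^esub> = \<zero>\<^bsub>N\<^esub>" if "b \<in> B" for b
    using g_add[OF that, of "\<zero>\<^bsub>?R\<^esub>" "\<zero>\<^bsub>?R\<^esub>"] g[OF that, of "\<zero>\<^bsub>?R\<^esub>"] by (simp add: N.add.l_cancel_one)
  have ev_super: "ev c = (\<Oplus>\<^bsub>M\<^esub>b\<in>A. c b \<odot>\<^bsub>M\<^esub> b)" if "c \<in> C" "finite A" "?s c \<subseteq> A" "A \<subseteq> B" for c A
    unfolding ev_def using that BM by (intro M.add.finprod_mono_neutral_cong_left) (auto simp: C_def)
  have tv_super: "tv c = (\<Oplus>\<^bsub>N\<^esub>b\<in>A. g b (c b))" if "c \<in> C" "finite A" "?s c \<subseteq> A" "A \<subseteq> B" for c A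
    unfolding tv_def using that by (intro N.add.finprod_mono_neutral_cong_left) (auto simp: C_def g g0)
  have add: "(\<lambda>b. c b \<oplus>\<^bsub>?R\<^esub> d b) \<in> C \<and> ev (\<lambda>b. c b \<oplus>\<^bsub>?R\<^esub> d b) = ev c \<oplus>\<^bsub>M\<^esub> ev d \<and>
      tv (\<lambda>b. c b \<oplus>\<^bsub>?R\<^esub> d b) = tv c \<oplus>\<^bsub>N\<^esub> tv d" if c: "c \<in> C" and d: "d \<in> C" for c d
  proof -
    let ?cd = "\<lambda>b. c b \<oplus>\<^bsub>?R\<^esub> d b"
    define A where "A = ?s c \<union> ?s d"
    have carr [simp]: "c b \<in> carrier ?R" "d b \<in> carrier ?R" for b using c d by (auto simp: C_def)
    have A: "finite A" "A \<subseteq> B" using c d by (auto simp: A_def C_def)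
    have sub: "?s c \<subseteq> A" "?s d \<subseteq> A" "?s ?cd \<subseteq> A"
    proof -
      show "?s c \<subseteq> A" "?s d \<subseteq> A" by (auto simp: A_def)
      have "?cd b = \<zero>\<^bsub>?R\<^esub>" if "b \<notin> A" for b using that by (simp add: A_def)
      then show "?s ?cd \<subseteq> A" by blast
    qed
    have AM [simp]: "b \<in> A \<Longrightarrow> b \<in> carrier M" "b \<in> A \<Longrightarrow> b \<in> B" for b using A(2) BM by auto
    have cd: "?cd \<in> C"
      unfolding C_def using finite_subset[OF sub(3) A(1)] order_trans[OF sub(3) A(2)] by simp
    have "ev ?cd = (\<Oplus>\<^bsub>M\<^esub>b\<in>A. c b \<odot>\<^bsub>M\<^esub> b \<oplus>\<^bsub>M\<^esub> d b \<odot>\<^bsub>M\<^esub> b)"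
      unfolding ev_super[OF cd A(1) sub(3) A(2)] by (intro M.add.finprod_cong') (simp_all add: smult_l_distr Pi_def)
    also have "\<dots> = ev c \<oplus>\<^bsub>M\<^esub> ev d"
      unfolding ev_super[OF c A(1) sub(1) A(2)] ev_super[OF d A(1) sub(2) A(2)]
      by (intro M.finsum_addf) (simp_all add: Pi_def)
    finally have 1: "ev ?cd = ev c \<oplus>\<^bsub>M\<^esub> ev d" .
    have "tv ?cd = (\<Oplus>\<^bsub>N\<^esub>b\<in>A. g b (c b) \<oplus>\<^bsub>N\<^esub> g b (d b))"
      unfolding tv_super[OF cd A(1) sub(3) A(2)] by (intro N.add.finprod_cong') (simp_all add: g g_add Pi_def)
    also have "\<dots> = tv c \<oplus>\<^bsub>N\<^esub> tv d"
      unfolding tv_super[OF c A(1) sub(1) A(2)] tv_super[OF d A(1) sub(2) A(2)]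
      by (intro N.finsum_addf) (simp_all add: g Pi_def)
    finally show ?thesis using 1 cd by simp
  qed
  define cf where "cf x = (THE c. c \<in> C \<and> x = ev c)" for x
  have cf: "cf x \<in> C" "x = ev (cf x)" if "x \<in> carrier M" for x
    using theI'[OF uniq[OF that]] unfolding cf_def by auto
  have cf_eq: "cf x = c" if "x \<in> carrier M" "c \<in> C" "x = ev c" for x c
    using uniq[OF that(1)] cf[OF that(1)] that(2,3) by blast
  have tv_closed: "tv c \<in> carrier N" if "c \<in> C" for c
    unfolding tv_def using that by (intro N.finsum_closed) (auto simp: C_def intro!: g)
  show ?thesis
  proof (intro exI[of _ "\<lambda>x. tv (cf x)"] conjI ballI)
    fix x assume "x \<in> carrier M"
    then show "tv (cf x) \<in> carrier N" by (simp add: tv_closed cf)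
  next
    fix x y assume xy: "x \<in> carrier M" "y \<in> carrier M"
    have "cf (x \<oplus>\<^bsub>M\<^esub> y) = (\<lambda>b. cf x b \<oplus>\<^bsub>?R\<^esub> cf y b)"
      by (rule cf_eq) (use xy add[of "cf x" "cf y"] cf[of x] cf[of y] in auto)
    then show "tv (cf (x \<oplus>\<^bsub>M\<^esub> y)) = tv (cf x) \<oplus>\<^bsub>N\<^esub> tv (cf y)"
      using add[of "cf x" "cf y"] cf(1) xy by simp
  next
    fix b c assume bc: "b \<in> B" "c \<in> carrier ?R"
    let ?c = "\<lambda>b'. if b' = b then c else \<zero>\<^bsub>?R\<^esub>"
    have A: "finite {b}" "?s ?c \<subseteq> {b}" "{b} \<subseteq> B" using bc by auto
    have C: "?c \<in> C" using bc by (auto simp: C_def intro: finite_subset[OF A(2,1)])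
    have "b \<in> carrier M" using bc BM by auto
    then have "cf (c \<odot>\<^bsub>M\<^esub> b) = ?c" using bc by (intro cf_eq C) (simp_all add: ev_super[OF C A])
    then show "tv (cf (c \<odot>\<^bsub>M\<^esub> b)) = g b c" using bc g by (simp add: tv_super[OF C A])
  qed
qed

section \<open>The coefficient of the top power of a variable\<close>

text \<open>The coefficient of the monomial \<open>\<mu>\<close> in \<open>p\<close>, when the variables in the slots \<open>A\<close> are treated as
  unknowns and the others as constants.\<close>

definition slice :: "nat set \<Rightarrow> (nat \<Rightarrow>\<^sub>0 nat) \<Rightarrow> 'k::field inf_poly \<Rightarrow> 'k inf_poly" where
  "slice A \<mu> p = Abs_poly_mapping (\<lambda>m. if \<forall>s\<in>A. Poly_Mapping.lookup m s = 0
     then Poly_Mapping.lookup p (m + \<mu>) else 0)"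

lemma lookup_slice:
  "Poly_Mapping.lookup (slice A \<mu> p) m = (if \<forall>s\<in>A. Poly_Mapping.lookup m s = 0
     then Poly_Mapping.lookup p (m + \<mu>) else 0)"
proof -
  have "{m. (if \<forall>s\<in>A. Poly_Mapping.lookup m s = 0 then Poly_Mapping.lookup p (m + \<mu>) else 0) \<noteq> 0}
      \<subseteq> (\<lambda>m. m - \<mu>) ` Poly_Mapping.keys p"
  proof
    fix m assume "m \<in> {m. (if \<forall>s\<in>A. Poly_Mapping.lookup m s = 0 then Poly_Mapping.lookup p (m + \<mu>) else 0) \<noteq> 0}"
    then have "m + \<mu> \<in> Poly_Mapping.keys p" by (auto simp: in_keys_iff split: if_splits)
    then show "m \<in> (\<lambda>m. m - \<mu>) ` Poly_Mapping.keys p" by (rule rev_image_eqI) simp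
  qed
  then show ?thesis unfolding slice_def
    by (subst lookup_Abs_poly_mapping) (simp_all add: finite_subset[OF _ finite_imageI[OF finite_keys]])
qed

lemma slice_add: "slice A \<mu> (p + q) = slice A \<mu> p + slice A \<mu> q"
  by (rule poly_mapping_eqI) (simp add: lookup_slice lookup_add)

lemma slice_single_mult:
  assumes t: "\<And>s. s \<in> A \<Longrightarrow> Poly_Mapping.lookup t s = 0" and \<mu>: "Poly_Mapping.keys \<mu> \<subseteq> A"
  shows "slice A \<mu> (Poly_Mapping.single t c * p) = Poly_Mapping.single t c * slice A \<mu> p"
proof (rule poly_mapping_eqI)
  fix m
  have \<mu>0: "Poly_Mapping.lookup \<mu> s = 0" if "s \<notin> A" for s using \<mu> that by (auto simp: in_keys_iff)
  have le: "(\<forall>s. Poly_Mapping.lookup t s \<le> Poly_Mapping.lookup (m + \<mu>) s) \<longleftrightarrow>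
      (\<forall>s. Poly_Mapping.lookup t s \<le> Poly_Mapping.lookup m s)"
  proof (intro all_cong1)
    fix s
    show "Poly_Mapping.lookup t s \<le> Poly_Mapping.lookup (m + \<mu>) s \<longleftrightarrow> Poly_Mapping.lookup t s \<le> Poly_Mapping.lookup m s"
      using t[of s] \<mu>0[of s] by (cases "s \<in> A") (simp_all add: lookup_add)
  qed
  have diff: "m + \<mu> - t = (m - t) + \<mu>"
  proof (rule poly_mapping_eqI)
    fix s
    show "Poly_Mapping.lookup (m + \<mu> - t) s = Poly_Mapping.lookup (m - t + \<mu>) s"
      using t[of s] \<mu>0[of s] by (cases "s \<in> A") (simp_all add: lookup_add lookup_minus)
  qed
  show "Poly_Mapping.lookup (slice A \<mu> (Poly_Mapping.single t c * p)) m =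
      Poly_Mapping.lookup (Poly_Mapping.single t c * slice A \<mu> p) m"
    using t by (simp add: lookup_slice lookup_single_mult le diff lookup_minus)
qed

lemma slice_cong:
  assumes "\<mu> \<in> box n" "Poly_Mapping.keys \<mu> \<subseteq> A" and "lam n p = lam n q"
  shows "lam n (slice A \<mu> p) = lam n (slice A \<mu> q)"
proof -
  have "m + \<mu> \<in> box n" if "m \<in> box n" "\<forall>s\<in>A. Poly_Mapping.lookup m s = 0" for m
    unfolding box_def mem_Collect_eq
  proof
    fix s
    show "Poly_Mapping.lookup (m + \<mu>) s < n (Suc s)"
    proof (cases "s \<in> A")
      case True
      then show ?thesis using that assms(1) by (simp add: box_def lookup_add)
    next
      case False
      then have "Poly_Mapping.lookup \<mu> s = 0" using assms(2) by (auto simp: in_keys_iff)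
      then show ?thesis using that by (simp add: box_def lookup_add)
    qed
  qed
  then show ?thesis using assms(3) by (simp add: lam_eq_iff lookup_slice)
qed

definition lam_slice :: "(nat \<Rightarrow> nat) \<Rightarrow> nat set \<Rightarrow> (nat \<Rightarrow>\<^sub>0 nat) \<Rightarrow> 'k::field lam \<Rightarrow> 'k lam" where
  "lam_slice n A \<mu> c = lam n (slice A \<mu> (SOME p. c = lam n p))"

lemma lam_slice:
  assumes "\<mu> \<in> box n" "Poly_Mapping.keys \<mu> \<subseteq> A"
  shows "lam_slice n A \<mu> (lam n p) = lam n (slice A \<mu> p)"
proof -
  have "lam n p = lam n (SOME q. lam n p = lam n q)" by (rule someI) simp
  then show ?thesis unfolding lam_slice_def by (rule slice_cong[OF assms, symmetric])
qed

abbreviation top_coeff :: "(nat \<Rightarrow> nat) \<Rightarrow> nat \<Rightarrow> 'k::field inf_poly \<Rightarrow> 'k inf_poly" where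
  "top_coeff n j \<equiv> slice {j} (Poly_Mapping.single j (n (Suc j) - 1))"

text \<open>Writing \<open>\<xi>\<close> for the variable, \<open>N\<close> for its bound and \<open>\<pi>\<close> for the coefficient of \<open>\<xi>\<close> to the power
  \<open>N - 1\<close>, the coefficient of \<open>\<xi>\<close> to the power \<open>i\<close> in \<open>p\<close> is \<open>\<pi> (\<xi>\<^sup>N\<^sup>-\<^sup>1\<^sup>-\<^sup>i p)\<close>. This is the
  statement that \<open>k[\<xi>] / (\<xi>\<^sup>N)\<close> is a Frobenius algebra with the functional \<open>\<pi>\<close>.\<close>

lemma top_coeff_expansion:
  assumes n: "1 \<le> n (Suc j)"
  shows "lam n p = lam n (\<Sum>i<n (Suc j). var j ^ i * top_coeff n j (var j ^ (n (Suc j) - 1 - i) * p))"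
  unfolding lam_eq_iff
proof
  fix m assume "m \<in> box n"
  then have m: "Poly_Mapping.lookup m j < n (Suc j)" by (simp add: box_def)
  let ?N = "n (Suc j)" and ?s = "Poly_Mapping.single j :: nat \<Rightarrow> (nat \<Rightarrow>\<^sub>0 nat)"
  let ?k = "Poly_Mapping.lookup m j"
  have single_le: "(\<forall>s. Poly_Mapping.lookup (?s i) s \<le> Poly_Mapping.lookup m' s) \<longleftrightarrow> i \<le> Poly_Mapping.lookup m' j" for i m'
    by (auto simp: lookup_single when_def)
  have coeff_at: "Poly_Mapping.lookup (var j ^ i * top_coeff n j (var j ^ (?N - 1 - i) * p)) m =
      (if i = ?k then Poly_Mapping.lookup p m else 0)" if "i < ?N" for i
  proof (cases "i = ?k")
    case True
    have *: "m - ?s i + ?s (?N - 1) - ?s (?N - 1 - i) = m"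
      using that True by (intro poly_mapping_eqI) (auto simp: lookup_add lookup_minus lookup_single when_def)
    have "Poly_Mapping.lookup (var j ^ i * top_coeff n j (var j ^ (?N - 1 - i) * p)) m =
        Poly_Mapping.lookup (top_coeff n j (mon (?s (?N - 1 - i)) * p)) (m - ?s i)"
      using True by (simp add: var_power lookup_single_mult single_le)
    also have "\<dots> = Poly_Mapping.lookup (mon (?s (?N - 1 - i)) * p) (m - ?s i + ?s (?N - 1))"
      using True by (simp add: lookup_slice lookup_minus)
    also have "\<dots> = Poly_Mapping.lookup p (m - ?s i + ?s (?N - 1) - ?s (?N - 1 - i))"
    proof -
      have "?N - 1 - i \<le> Poly_Mapping.lookup (m - ?s i + ?s (?N - 1)) j"
        unfolding lookup_add lookup_single_eq by linarith
      then show ?thesis unfolding lookup_single_mult single_le by (simp only: if_True mult_1)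
    qed
    finally show ?thesis using True * by simp
  next
    case False
    then show ?thesis
      using that by (auto simp: var_power lookup_single_mult single_le lookup_slice lookup_minus)
  qed
  show "Poly_Mapping.lookup p m = Poly_Mapping.lookup (\<Sum>i<?N. var j ^ i * top_coeff n j (var j ^ (?N - 1 - i) * p)) m"
  proof -
    have "Poly_Mapping.lookup (\<Sum>i<?N. var j ^ i * top_coeff n j (var j ^ (?N - 1 - i) * p)) m =
        (\<Sum>i<?N. if i = ?k then Poly_Mapping.lookup p m else 0)"
      unfolding lookup_sum by (rule sum.cong[OF refl], rule coeff_at, simp)
    then show ?thesis using m by simp
  qed
qed

text \<open>Endomorphisms of the abelian group \<open>M\<close> that are linear over the subring generated by the
  variables in the slots from \<open>S\<close> on.\<close>

definition endo :: "(nat \<Rightarrow> nat) \<Rightarrow> ('k::field lam, 'm, 'c) module_scheme \<Rightarrow> nat \<Rightarrow> ('m \<Rightarrow> 'm) \<Rightarrow> bool" where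
  "endo n M S f \<longleftrightarrow> (\<forall>x\<in>carrier M. f x \<in> carrier M \<and>
     (\<forall>y\<in>carrier M. f (x \<oplus>\<^bsub>M\<^esub> y) = f x \<oplus>\<^bsub>M\<^esub> f y) \<and>
     (\<forall>c. f (lam n (cst c) \<odot>\<^bsub>M\<^esub> x) = lam n (cst c) \<odot>\<^bsub>M\<^esub> f x) \<and>
     (\<forall>s\<ge>S. f (lam n (var s) \<odot>\<^bsub>M\<^esub> x) = lam n (var s) \<odot>\<^bsub>M\<^esub> f x))"

lemma endo_comp: "endo n M S f \<Longrightarrow> endo n M S g \<Longrightarrow> endo n M S (\<lambda>x. f (g x))"
  by (simp add: endo_def)

lemma endo_lam: "Module.module (Lam n) M \<Longrightarrow> endo n M S (\<lambda>x. lam n p \<odot>\<^bsub>M\<^esub> x)"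
  unfolding endo_def
  by (simp add: act_closed act_distr flip: act_mult) (simp add: mult.commute)

text \<open>On a free module the top coefficient is taken in each coordinate. The expansion is stated below an
  additive functional \<open>F\<close>, which will be a bilinear form with its second argument fixed; this avoids
  sums in \<open>M\<close>.\<close>

lemma top_coeff_operator:
  fixes M :: "('k::field lam, 'm) gmodule"
  assumes n': "\<And>i. 1 \<le> n (Suc i)" and M: "Module.module (Lam n) M" and B: "free_basis (Lam n) M B"
  shows "\<exists>\<pi>. endo n M (Suc j) \<pi> \<and>
    (\<forall>F :: 'm \<Rightarrow> 'k. (\<forall>x\<in>carrier M. \<forall>y\<in>carrier M. F (x \<oplus>\<^bsub>M\<^esub> y) = F x + F y) \<longrightarrow>
      (\<forall>x\<in>carrier M. F x = (\<Sum>i<n (Suc j). F (lam n (var j ^ i) \<odot>\<^bsub>M\<^esub> \<pi> (lam n (var j ^ (n (Suc j) - 1 - i)) \<odot>\<^bsub>M\<^esub> x)))))"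
proof -
  interpret Module.module "Lam n" M by (rule M)
  have BM: "b \<in> carrier M" if "b \<in> B" for b using that B by (auto simp: free_basis_def)
  have n: "1 \<le> n (Suc j)" by (rule n')
  let ?\<mu> = "Poly_Mapping.single j (n (Suc j) - 1)"
  have \<mu>: "?\<mu> \<in> box n" "Poly_Mapping.keys ?\<mu> \<subseteq> {j}"
  proof -
    have "0 < n (Suc i)" for i using n'[of i] by linarith
    then show "?\<mu> \<in> box n" by (simp add: box_def lookup_single when_def)
  qed simp
  define g where "g b c = lam_slice n {j} ?\<mu> c \<odot>\<^bsub>M\<^esub> b" for b c
  have g: "g b (lam n p) = lam n (top_coeff n j p) \<odot>\<^bsub>M\<^esub> b" for b p
    by (simp only: g_def lam_slice[OF \<mu>])
  have "\<exists>t. (\<forall>x\<in>carrier M. t x \<in> carrier M) \<and>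
    (\<forall>x\<in>carrier M. \<forall>y\<in>carrier M. t (x \<oplus>\<^bsub>M\<^esub> y) = t x \<oplus>\<^bsub>M\<^esub> t y) \<and>
    (\<forall>b\<in>B. \<forall>c\<in>carrier (Lam n). t (c \<odot>\<^bsub>M\<^esub> b) = g b c)"
    by (rule free_basis_extend[OF M B module_group[OF M]])
      (auto simp: carrier_Lam g BM act_add[OF M] slice_add simp flip: lam_add)
  then obtain t where t: "\<And>x. x \<in> carrier M \<Longrightarrow> t x \<in> carrier M"
      "\<And>x y. x \<in> carrier M \<Longrightarrow> y \<in> carrier M \<Longrightarrow> t (x \<oplus>\<^bsub>M\<^esub> y) = t x \<oplus>\<^bsub>M\<^esub> t y"
      "\<And>b p. b \<in> B \<Longrightarrow> t (lam n p \<odot>\<^bsub>M\<^esub> b) = lam n (top_coeff n j p) \<odot>\<^bsub>M\<^esub> b"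
    using g by (metis lam_closed)
  have t0: "t \<zero>\<^bsub>M\<^esub> = \<zero>\<^bsub>M\<^esub>" by (rule additive_zero) (use module_group[OF M] t in auto)
  have semi: "t (lam n (Poly_Mapping.single s c) \<odot>\<^bsub>M\<^esub> x) = lam n (Poly_Mapping.single s c) \<odot>\<^bsub>M\<^esub> t x"
    if "x \<in> carrier M" "Poly_Mapping.lookup s j = 0" for s x and c :: 'k
    using M B that(1)
  proof (induction x rule: free_basis_induct)
    case zero
    show ?case by (simp add: t0 act_null[OF M])
  next
    case (add x y)
    then show ?case by (simp add: act_distr[OF M] t act_closed[OF M])
  next
    case (gen p b)
    have "top_coeff n j (Poly_Mapping.single s c * p) = Poly_Mapping.single s c * top_coeff n j p"
      by (rule slice_single_mult[OF _ \<mu>(2)]) (simp add: that(2))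
    then show ?case using gen by (simp only: t BM act_mult[OF M, symmetric])
  qed
  have "endo n M (Suc j) t"
    unfolding endo_def using t semi by (auto simp: lookup_single)
  moreover have "F x = (\<Sum>i<n (Suc j). F (lam n (var j ^ i) \<odot>\<^bsub>M\<^esub> t (lam n (var j ^ (n (Suc j) - 1 - i)) \<odot>\<^bsub>M\<^esub> x)))"
    if F: "\<forall>x\<in>carrier M. \<forall>y\<in>carrier M. F (x \<oplus>\<^bsub>M\<^esub> y) = F x + F y" and "x \<in> carrier M" for F :: "'m \<Rightarrow> 'k" and x
  proof -
    have "F \<zero>\<^bsub>M\<^esub> = F \<zero>\<^bsub>M\<^esub> + F \<zero>\<^bsub>M\<^esub>"
      using F[rule_format, OF M.zero_closed M.zero_closed] unfolding M.l_zero[OF M.zero_closed] .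
    then have F0: "F \<zero>\<^bsub>M\<^esub> = 0" unfolding add_cancel_right_right .
    show ?thesis
    using M B that(2)
  proof (induction x rule: free_basis_induct)
    case zero
    have "F \<zero>\<^bsub>M\<^esub> = 0" by (rule F0)
    then show ?case by (simp add: t0 act_null[OF M])
  next
    case (add x y)
    then show ?case by (simp add: act_distr[OF M] t act_closed[OF M] F sum.distrib)
  next
    case (gen p b)
    have sum: "F (lam n (\<Sum>i\<in>A. h i) \<odot>\<^bsub>M\<^esub> b) = (\<Sum>i\<in>A. F (lam n (h i) \<odot>\<^bsub>M\<^esub> b))" if "finite A" for A :: "nat set" and h
      using that by (induction A) (simp_all add: act_zero[OF M] act_add[OF M] act_closed[OF M] F BM[OF gen] F0)
    have "F (lam n p \<odot>\<^bsub>M\<^esub> b) = (\<Sum>i<n (Suc j). F (lam n (var j ^ i * top_coeff n j (var j ^ (n (Suc j) - 1 - i) * p)) \<odot>\<^bsub>M\<^esub> b))"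
      unfolding sum[symmetric, OF finite_lessThan] by (subst top_coeff_expansion[of n j, OF n]) simp
    moreover have "t (lam n q \<odot>\<^bsub>M\<^esub> (lam n p \<odot>\<^bsub>M\<^esub> b)) = lam n (top_coeff n j (q * p)) \<odot>\<^bsub>M\<^esub> b" for q
      using gen by (simp add: t BM flip: act_mult[OF M])
    ultimately show ?case using gen by (simp add: act_mult[OF M] BM)
  qed
  qed
  ultimately show ?thesis by (intro exI[of _ t]) blast
qed

section \<open>Freeing one variable\<close>

lemma forms_add: "bform n P E S m \<beta> \<Longrightarrow> bform n P E S m \<gamma> \<Longrightarrow> bform n P E S m (\<lambda>p x e. \<beta> p x e + \<gamma> p x e)"
  unfolding bform_def by (simp add: algebra_simps)

lemma forms_diff: "bform n P E S m \<beta> \<Longrightarrow> bform n P E S m \<gamma> \<Longrightarrow> bform n P E S m (\<lambda>p x e. \<beta> p x e - \<gamma> p x e)"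
  unfolding bform_def by (simp add: algebra_simps)

lemma forms_zero: "bform n P E S m (\<lambda>p x e. 0)"
  unfolding bform_def by simp

lemma forms_sum: "(\<And>i. i \<in> A \<Longrightarrow> bform n P E S m (\<beta> i)) \<Longrightarrow> bform n P E S m (\<lambda>p x e. \<Sum>i\<in>A. \<beta> i p x e)"
  by (induction A rule: infinite_finite_induct) (simp_all add: forms_zero forms_add)

lemma forms_mono:
  assumes \<beta>: "bform n P E S m \<beta>" and "S \<le> S'"
  shows "bform n P E S' m \<beta>"
proof (rule bformI)
  fix p q x e s assume "p + q = m" "x \<in> carrier (obj P p)" "e \<in> carrier (obj E q)" "S' \<le> s"
  then show "\<beta> p (lam n (var s) \<odot>\<^bsub>obj P p\<^esub> x) e = \<beta> p x (lam n (var s) \<odot>\<^bsub>obj E q\<^esub> e)"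
    using bform_var[OF \<beta>] \<open>S \<le> S'\<close> by simp
qed (simp_all add: bform_add_left[OF \<beta>] bform_add_right[OF \<beta>] bform_cst_left[OF \<beta>] bform_cst_right[OF \<beta>])

lemma bform_SucD:
  assumes \<beta>: "bform n P E (Suc j) m \<beta>"
    and j: "\<And>p q x e. p + q = m \<Longrightarrow> x \<in> carrier (obj P p) \<Longrightarrow> e \<in> carrier (obj E q) \<Longrightarrow>
      \<beta> p (lam n (var j) \<odot>\<^bsub>obj P p\<^esub> x) e = \<beta> p x (lam n (var j) \<odot>\<^bsub>obj E q\<^esub> e)"
  shows "bform n P E j m \<beta>"
proof (rule bformI)
  fix p q x e s assume *: "p + q = m" "x \<in> carrier (obj P p)" "e \<in> carrier (obj E q)" and "j \<le> s"
  then show "\<beta> p (lam n (var s) \<odot>\<^bsub>obj P p\<^esub> x) e = \<beta> p x (lam n (var s) \<odot>\<^bsub>obj E q\<^esub> e)"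
    using bform_var[OF \<beta> *, of s] j[OF *] by (cases "s = j") simp_all
qed (simp_all add: bform_add_left[OF \<beta>] bform_add_right[OF \<beta>] bform_cst_left[OF \<beta>] bform_cst_right[OF \<beta>])

lemma delta_add: "delta P E k (\<lambda>p x e. \<beta> p x e + \<gamma> p x e) = (\<lambda>p x e. delta P E k \<beta> p x e + delta P E k \<gamma> p x e)"
  and delta_diff: "delta P E k (\<lambda>p x e. \<beta> p x e - \<gamma> p x e) = (\<lambda>p x e. delta P E k \<beta> p x e - delta P E k \<gamma> p x e)"
  by (auto simp: delta_def fun_eq_iff)

lemma form_eqD: "form_eq P E m \<beta> \<gamma> \<Longrightarrow> p + q = m \<Longrightarrow> x \<in> carrier (obj P p) \<Longrightarrow> e \<in> carrier (obj E q) \<Longrightarrow> \<beta> p x e = \<gamma> p x e"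
  unfolding form_eq_def by (metis add_diff_cancel_left')

lemma form_eqI:
  assumes "\<And>p q x e. p + q = m \<Longrightarrow> x \<in> carrier (obj P p) \<Longrightarrow> e \<in> carrier (obj E q) \<Longrightarrow> \<beta> p x e = \<gamma> p x e"
  shows "form_eq P E m \<beta> \<gamma>"
  unfolding form_eq_def by (intro allI impI assms[of _ "m - _"]) simp_all

context tensor_cx
begin

lemma delta_eq: "p + q = k \<Longrightarrow> delta P E k \<beta> p x e = \<beta> (p + 1) (diff P p x) e +
    (if even p then \<beta> p x (diff E q e) else - \<beta> p x (diff E q e))"
  by (auto simp: delta_def)

lemma forms_delta:
  assumes \<beta>: "bform n P E S m \<beta>"
  shows "bform n P E S (m - 1) (delta P E (m - 1) \<beta>)"
proof (rule bformI)
  fix p q x e assume pq: "p + q = m - 1" and xe: "x \<in> carrier (obj P p)" "e \<in> carrier (obj E q)"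
  note D = delta_eq[OF pq]
  have "(p + 1) + q = m" "p + (q + 1) = m" using pq by auto
  note left = this(1) and right = this(2)
  {
    fix y assume y: "y \<in> carrier (obj P p)"
    show "delta P E (m - 1) \<beta> p (x \<oplus>\<^bsub>obj P p\<^esub> y) e = delta P E (m - 1) \<beta> p x e + delta P E (m - 1) \<beta> p y e"
      using xe y by (simp add: D P.diff_add[of x p y "p + 1"] bform_add_left[OF \<beta> left] bform_add_left[OF \<beta> right])
  next
    fix e' assume e': "e' \<in> carrier (obj E q)"
    show "delta P E (m - 1) \<beta> p x (e \<oplus>\<^bsub>obj E q\<^esub> e') = delta P E (m - 1) \<beta> p x e + delta P E (m - 1) \<beta> p x e'"
      using xe e' by (simp add: D E.diff_add[of e q e' "q + 1"] bform_add_right[OF \<beta> left] bform_add_right[OF \<beta> right])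
  next
    fix c
    show "delta P E (m - 1) \<beta> p (lam n (cst c) \<odot>\<^bsub>obj P p\<^esub> x) e = c * delta P E (m - 1) \<beta> p x e"
      using xe by (simp add: D P.diff_act[of x p "p + 1"] bform_cst_left[OF \<beta> left] bform_cst_left[OF \<beta> right] distrib_left right_diff_distrib)
    show "delta P E (m - 1) \<beta> p x (lam n (cst c) \<odot>\<^bsub>obj E q\<^esub> e) = c * delta P E (m - 1) \<beta> p x e"
      using xe by (simp add: D E.diff_act[of e q "q + 1"] bform_cst_right[OF \<beta> left] bform_cst_right[OF \<beta> right] distrib_left right_diff_distrib)
  next
    fix s assume s: "S \<le> s"
    show "delta P E (m - 1) \<beta> p (lam n (var s) \<odot>\<^bsub>obj P p\<^esub> x) e = delta P E (m - 1) \<beta> p x (lam n (var s) \<odot>\<^bsub>obj E q\<^esub> e)"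
      using xe s by (simp add: D P.diff_act[of x p "p + 1"] E.diff_act[of e q "q + 1"]
          bform_var[OF \<beta> left _ _ s] bform_var[OF \<beta> right _ _ s])
  }
qed

lemma forms_zero_left: "bform n P E S m \<beta> \<Longrightarrow> p + q = m \<Longrightarrow> e \<in> carrier (obj E q) \<Longrightarrow> \<beta> p \<zero>\<^bsub>obj P p\<^esub> e = 0"
  using bform_cst_left[of n P E S m \<beta> p q "\<zero>\<^bsub>obj P p\<^esub>" e 0] by (simp add: act_null[OF P.mod])

lemma forms_zero_right: "bform n P E S m \<beta> \<Longrightarrow> p + q = m \<Longrightarrow> x \<in> carrier (obj P p) \<Longrightarrow> \<beta> p x \<zero>\<^bsub>obj E q\<^esub> = 0"
  using bform_cst_right[of n P E S m \<beta> p q x "\<zero>\<^bsub>obj E q\<^esub>" 0] by (simp add: act_null[OF E.mod])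

lemma delta_delta:
  assumes "bform n P E S m \<beta>"
  shows "form_eq P E (m - 2) (delta P E (m - 2) (delta P E (m - 1) \<beta>)) (\<lambda>p x e. 0)"
proof (rule form_eqI)
  fix p q x e assume pq: "p + q = m - 2" and xe: "x \<in> carrier (obj P p)" "e \<in> carrier (obj E q)"
  have "(p + 1) + q = m - 1" "p + (q + 1) = m - 1" "2 + p + q = m" "p + (q + 2) = m" using pq by auto
  then show "delta P E (m - 2) (delta P E (m - 1) \<beta>) p x e = 0"
    using xe pq forms_zero_left[OF assms, of "2 + p" q e] forms_zero_right[OF assms, of p "q + 2" x]
    by (simp add: delta_eq[of p q "m - 2"] delta_eq[of "p + 1" q "m - 1"] delta_eq[of p "q + 1" "m - 1"]
        P.diff_diff[of x p "p + 1" "2 + p"] E.diff_diff[of e q "q + 1" "q + 2"])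
qed

lemma delta_cong: "form_eq P E m \<beta> \<gamma> \<Longrightarrow> form_eq P E (m - 1) (delta P E (m - 1) \<beta>) (delta P E (m - 1) \<gamma>)"
proof (rule form_eqI)
  fix p q x e assume eq: "form_eq P E m \<beta> \<gamma>" and pq: "p + q = m - 1"
    and xe: "x \<in> carrier (obj P p)" "e \<in> carrier (obj E q)"
  then show "delta P E (m - 1) \<beta> p x e = delta P E (m - 1) \<gamma> p x e"
    using form_eqD[OF eq, of "p + 1" q "diff P p x" e] form_eqD[OF eq, of p "q + 1" x "diff E q e"]
    by (simp add: delta_eq)
qed

lemma forms_comp:
  assumes \<beta>: "bform n P E S m \<beta>" and a: "\<And>p. endo n (obj P p) S (a p)" and b: "\<And>q. endo n (obj E q) S (b q)"
  shows "bform n P E S m (\<lambda>p x e. \<beta> p (a p x) (b (m - p) e))"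
proof (rule bformI)
  have a': "x \<in> carrier (obj P p) \<Longrightarrow> a p x \<in> carrier (obj P p)" for x p using a by (simp add: endo_def)
  have b': "x \<in> carrier (obj E p) \<Longrightarrow> b p x \<in> carrier (obj E p)" for x p using b by (simp add: endo_def)
  fix p q x e assume pq: "p + q = m" and xe: "x \<in> carrier (obj P p)" "e \<in> carrier (obj E q)"
  then have q: "m - p = q" by simp
  note xe' = a'[OF xe(1)] b'[OF xe(2)]
  {
    fix y assume "y \<in> carrier (obj P p)"
    then show "\<beta> p (a p (x \<oplus>\<^bsub>obj P p\<^esub> y)) (b (m - p) e) = \<beta> p (a p x) (b (m - p) e) + \<beta> p (a p y) (b (m - p) e)"
      using a[of p] xe a' unfolding q endo_def by (simp add: bform_add_left[OF \<beta> pq] xe')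
  next
    fix e' assume "e' \<in> carrier (obj E q)"
    then show "\<beta> p (a p x) (b (m - p) (e \<oplus>\<^bsub>obj E q\<^esub> e')) = \<beta> p (a p x) (b (m - p) e) + \<beta> p (a p x) (b (m - p) e')"
      using b[of q] xe b' unfolding q endo_def by (simp add: bform_add_right[OF \<beta> pq] xe')
  next
    fix c
    show "\<beta> p (a p (lam n (cst c) \<odot>\<^bsub>obj P p\<^esub> x)) (b (m - p) e) = c * \<beta> p (a p x) (b (m - p) e)"
      using a[of p] xe unfolding q endo_def by (simp add: bform_cst_left[OF \<beta> pq] xe')
    show "\<beta> p (a p x) (b (m - p) (lam n (cst c) \<odot>\<^bsub>obj E q\<^esub> e)) = c * \<beta> p (a p x) (b (m - p) e)"
      using b[of q] xe unfolding q endo_def by (simp add: bform_cst_right[OF \<beta> pq] xe')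
  next
    fix s assume "S \<le> s"
    then show "\<beta> p (a p (lam n (var s) \<odot>\<^bsub>obj P p\<^esub> x)) (b (m - p) e) = \<beta> p (a p x) (b (m - p) (lam n (var s) \<odot>\<^bsub>obj E q\<^esub> e))"
      using a[of p] b[of q] xe unfolding q endo_def by (simp add: bform_var[OF \<beta> pq] xe')
  }
qed

end

text \<open>One variable \<open>\<xi>\<close>, in slot \<open>j\<close>, with bound \<open>N\<close>, and operators \<open>\<pi>\<close> on \<open>P\<close> as provided by a
  basis. The forms that need not be balanced for \<open>\<xi>\<close> carry two commuting actions of \<open>\<xi>\<close>, on the left
  and on the right. Their difference \<open>ydiff\<close> is nilpotent, and its kernel consists of the forms
  balanced for \<open>\<xi>\<close>. The map \<open>unorm\<close> is the sum of the products of \<open>i\<close> left and \<open>N - 1 - i\<close> right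
  actions; it comes from the exact sequence \<open>0 \<rightarrow> A \<rightarrow> A \<otimes> A \<rightarrow> A \<otimes> A \<rightarrow> A \<rightarrow> 0\<close> of
  bimodules over \<open>A = k[\<xi>] / (\<xi>\<^sup>N)\<close>.\<close>

locale var_step = tensor_cx n P E
  for n and P :: "('k::field lam, 'm) gcomplex" and E :: "('k lam, 'l) gcomplex" +
  fixes j :: nat and \<pi> :: "int \<Rightarrow> 'm \<Rightarrow> 'm" and N :: nat
  assumes N: "N = n (Suc j)" "1 \<le> N"
    and pi_endo: "endo n (obj P p) (Suc j) (\<pi> p)"
    and pi_expansion: "\<And>F :: 'm \<Rightarrow> 'k. (\<And>x y. x \<in> carrier (obj P p) \<Longrightarrow> y \<in> carrier (obj P p) \<Longrightarrow>
        F (x \<oplus>\<^bsub>obj P p\<^esub> y) = F x + F y) \<Longrightarrow> x \<in> carrier (obj P p) \<Longrightarrow>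
        F x = (\<Sum>i<N. F (lam n (var j ^ i) \<odot>\<^bsub>obj P p\<^esub> \<pi> p (lam n (var j ^ (N - 1 - i)) \<odot>\<^bsub>obj P p\<^esub> x)))"
begin

abbreviation xp :: "int \<Rightarrow> nat \<Rightarrow> 'm \<Rightarrow> 'm" where "xp p i x \<equiv> lam n (var j ^ i) \<odot>\<^bsub>obj P p\<^esub> x"
abbreviation xe :: "int \<Rightarrow> nat \<Rightarrow> 'l \<Rightarrow> 'l" where "xe q i e \<equiv> lam n (var j ^ i) \<odot>\<^bsub>obj E q\<^esub> e"

lemma pi_closed [simp]: "x \<in> carrier (obj P p) \<Longrightarrow> \<pi> p x \<in> carrier (obj P p)"
  using pi_endo by (simp add: endo_def)

lemma lam_var_power: "N \<le> i \<Longrightarrow> lam n (var j ^ i) = lam n (0 :: 'k inf_poly)"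
  using N by (auto simp: lam_eq_iff var_power lookup_single when_def box_def)

lemma xp_comp: "x \<in> carrier (obj P p) \<Longrightarrow> xp p i (xp p l x) = xp p (i + l) x"
  by (simp add: power_add act_mult[OF P.mod])

lemma xe_comp: "e \<in> carrier (obj E q) \<Longrightarrow> xe q i (xe q l e) = xe q (i + l) e"
  by (simp add: power_add act_mult[OF E.mod])

lemma xp_0 [simp]: "x \<in> carrier (obj P p) \<Longrightarrow> lam n 1 \<odot>\<^bsub>obj P p\<^esub> x = x"
  and xe_0 [simp]: "e \<in> carrier (obj E q) \<Longrightarrow> lam n 1 \<odot>\<^bsub>obj E q\<^esub> e = e"
  by (simp_all add: act_one[OF P.mod] act_one[OF E.mod])

lemma xp_N: "x \<in> carrier (obj P p) \<Longrightarrow> N \<le> i \<Longrightarrow> xp p i x = \<zero>\<^bsub>obj P p\<^esub>"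
  and xe_N: "e \<in> carrier (obj E q) \<Longrightarrow> N \<le> i \<Longrightarrow> xe q i e = \<zero>\<^bsub>obj E q\<^esub>"
  by (simp_all add: lam_var_power act_zero[OF P.mod] act_zero[OF E.mod])

definition ydiff :: "int \<Rightarrow> (int \<Rightarrow> 'm \<Rightarrow> 'l \<Rightarrow> 'k) \<Rightarrow> int \<Rightarrow> 'm \<Rightarrow> 'l \<Rightarrow> 'k" where
  "ydiff m \<beta> = (\<lambda>p x e. \<beta> p (xp p 1 x) e - \<beta> p x (xe (m - p) 1 e))"

definition unorm :: "int \<Rightarrow> (int \<Rightarrow> 'm \<Rightarrow> 'l \<Rightarrow> 'k) \<Rightarrow> int \<Rightarrow> 'm \<Rightarrow> 'l \<Rightarrow> 'k" where
  "unorm m \<beta> = (\<lambda>p x e. \<Sum>i<N. \<beta> p (xp p i x) (xe (m - p) (N - 1 - i) e))"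

lemma ydiff_eq: "p + q = m \<Longrightarrow> ydiff m \<beta> p x e = \<beta> p (xp p 1 x) e - \<beta> p x (xe q 1 e)"
  and unorm_eq: "p + q = m \<Longrightarrow> unorm m \<beta> p x e = (\<Sum>i<N. \<beta> p (xp p i x) (xe q (N - 1 - i) e))"
  by (auto simp: ydiff_def unorm_def)

lemma endo_P [simp]: "endo n (obj P p) S (\<lambda>x. lam n a \<odot>\<^bsub>obj P p\<^esub> x)"
  and endo_E [simp]: "endo n (obj E q) S (\<lambda>x. lam n a \<odot>\<^bsub>obj E q\<^esub> x)"
  by (simp_all add: endo_lam)

lemma endo_id [simp]: "endo n M S (\<lambda>x. x)"
  by (simp add: endo_def)

lemma forms_ydiff: "bform n P E S m \<beta> \<Longrightarrow> bform n P E S m (ydiff m \<beta>)"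
  unfolding ydiff_def
  by (intro forms_diff forms_comp[where b = "\<lambda>q x. x" and a = "\<lambda>p. xp p 1"]
      forms_comp[where a = "\<lambda>q x. x" and b = "\<lambda>q. xe q 1"]) simp_all

lemma unorm_telescope:
  assumes \<beta>: "bform n P E (Suc j) m \<beta>" and pq: "p + q = m"
    and x: "x \<in> carrier (obj P p)" and e: "e \<in> carrier (obj E q)"
  shows "(\<Sum>i<N. \<beta> p (xp p (Suc i) x) (xe q (N - 1 - i) e)) = (\<Sum>i<N. \<beta> p (xp p i x) (xe q (N - i) e))"
proof -
  let ?h = "\<lambda>i. \<beta> p (xp p i x) (xe q (N - i) e)"
  have "?h 0 = 0" "?h N = 0"
    using x e by (simp_all add: xp_N xe_N forms_zero_left[OF \<beta> pq] forms_zero_right[OF \<beta> pq] del: One_nat_def)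
  moreover have "(\<Sum>i<Suc N. ?h i) = ?h 0 + (\<Sum>i<N. ?h (Suc i))" by (rule sum.lessThan_Suc_shift)
  moreover have "(\<Sum>i<Suc N. ?h i) = (\<Sum>i<N. ?h i) + ?h N" by (rule sum.lessThan_Suc)
  ultimately show ?thesis by simp
qed

lemma forms_unorm:
  assumes \<beta>: "bform n P E (Suc j) m \<beta>"
  shows "bform n P E j m (unorm m \<beta>)"
proof -
  have u: "bform n P E (Suc j) m (unorm m \<beta>)"
    unfolding unorm_def by (intro forms_sum forms_comp[OF \<beta>, where a = "\<lambda>p. xp p i" and b = "\<lambda>q. xe q (N - 1 - i)" for i]) simp_all
  have "unorm m \<beta> p (lam n (var j) \<odot>\<^bsub>obj P p\<^esub> x) e = unorm m \<beta> p x (lam n (var j) \<odot>\<^bsub>obj E q\<^esub> e)"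
    if pq: "p + q = m" and x: "x \<in> carrier (obj P p)" and e: "e \<in> carrier (obj E q)" for p q x e
  proof -
    have "unorm m \<beta> p (xp p 1 x) e = (\<Sum>i<N. \<beta> p (xp p (Suc i) x) (xe q (N - 1 - i) e))"
      using x by (simp only: unorm_eq[OF pq] xp_comp) simp
    also have "\<dots> = (\<Sum>i<N. \<beta> p (xp p i x) (xe q (N - i) e))" by (rule unorm_telescope[OF \<beta> pq x e])
    also have "\<dots> = unorm m \<beta> p x (xe q 1 e)"
      unfolding unorm_eq[OF pq] xe_comp[OF e]
    proof (intro sum.cong refl)
      fix i assume "i \<in> {..<N}"
      then have "N - 1 - i + 1 = N - i" by auto
      then show "\<beta> p (xp p i x) (xe q (N - i) e) = \<beta> p (xp p i x) (xe q (N - 1 - i + 1) e)" by (simp only:)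
    qed
    finally show ?thesis by simp
  qed
  then show ?thesis by (rule bform_SucD[OF u])
qed

lemma unorm_ydiff:
  assumes \<beta>: "bform n P E (Suc j) m \<beta>"
  shows "form_eq P E m (unorm m (ydiff m \<beta>)) (\<lambda>p x e. 0)"
proof (rule form_eqI)
  fix p q x e assume pq: "p + q = m" and x: "x \<in> carrier (obj P p)" and e: "e \<in> carrier (obj E q)"
  have "unorm m (ydiff m \<beta>) p x e =
      (\<Sum>i<N. \<beta> p (xp p (Suc i) x) (xe q (N - 1 - i) e) - \<beta> p (xp p i x) (xe q (N - i) e))"
    unfolding unorm_eq[OF pq]
  proof (intro sum.cong refl)
    fix i assume "i \<in> {..<N}"
    then have "1 + (N - 1 - i) = N - i" "1 + i = Suc i" by auto
    then show "ydiff m \<beta> p (xp p i x) (xe q (N - 1 - i) e) =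
        \<beta> p (xp p (Suc i) x) (xe q (N - 1 - i) e) - \<beta> p (xp p i x) (xe q (N - i) e)"
      unfolding ydiff_eq[OF pq] xe_comp[OF e] xp_comp[OF x] by (simp only:)
  qed
  then show "unorm m (ydiff m \<beta>) p x e = 0"
    using unorm_telescope[OF \<beta> pq x e] by (simp add: sum_subtractf)
qed

lemma delta_ydiff: "form_eq P E (m - 1) (delta P E (m - 1) (ydiff m \<beta>)) (ydiff (m - 1) (delta P E (m - 1) \<beta>))"
proof (rule form_eqI)
  fix p q x e assume pq: "p + q = m - 1" and x: "x \<in> carrier (obj P p)" and e: "e \<in> carrier (obj E q)"
  then show "delta P E (m - 1) (ydiff m \<beta>) p x e = ydiff (m - 1) (delta P E (m - 1) \<beta>) p x e"
    by (simp add: delta_eq ydiff_eq ydiff_eq[of "p + 1" q m] ydiff_eq[of p "q + 1" m] P.diff_act E.diff_act)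
qed

lemma delta_unorm: "form_eq P E (m - 1) (delta P E (m - 1) (unorm m \<beta>)) (unorm (m - 1) (delta P E (m - 1) \<beta>))"
proof (rule form_eqI)
  fix p q x e assume pq: "p + q = m - 1" and x: "x \<in> carrier (obj P p)" and e: "e \<in> carrier (obj E q)"
  then show "delta P E (m - 1) (unorm m \<beta>) p x e = unorm (m - 1) (delta P E (m - 1) \<beta>) p x e"
    by (simp add: delta_eq unorm_eq unorm_eq[of "p + 1" q m] unorm_eq[of p "q + 1" m] P.diff_act E.diff_act
        sum.distrib sum_negf)
qed

lemma ydiff_cong: "form_eq P E m \<beta> \<gamma> \<Longrightarrow> form_eq P E m (ydiff m \<beta>) (ydiff m \<gamma>)"
  by (rule form_eqI) (simp add: ydiff_eq form_eqD[of P E m \<beta> \<gamma>])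

lemma unorm_cong: "form_eq P E m \<beta> \<gamma> \<Longrightarrow> form_eq P E m (unorm m \<beta>) (unorm m \<gamma>)"
  by (rule form_eqI) (simp add: unorm_eq form_eqD[of P E m \<beta> \<gamma>])

lemma ydiff_kernel:
  assumes \<beta>: "bform n P E (Suc j) m \<beta>" and y: "form_eq P E m (ydiff m \<beta>) (\<lambda>p x e. 0)"
  shows "bform n P E j m \<beta>"
proof -
  have "\<beta> p (lam n (var j) \<odot>\<^bsub>obj P p\<^esub> x) e = \<beta> p x (lam n (var j) \<odot>\<^bsub>obj E q\<^esub> e)"
    if pq: "p + q = m" and x: "x \<in> carrier (obj P p)" and e: "e \<in> carrier (obj E q)" for p q x e
    using form_eqD[OF y pq x e] by (simp add: ydiff_eq[OF pq])
  then show ?thesis by (rule bform_SucD[OF \<beta>])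
qed

text \<open>Precomposition with \<open>\<pi>\<close> is a section of \<open>unorm\<close> on balanced forms, by the expansion in
  powers of \<open>\<xi>\<close>.\<close>

lemma unorm_surjective:
  assumes \<gamma>: "bform n P E j m \<gamma>"
  shows "\<exists>\<gamma>'. bform n P E (Suc j) m \<gamma>' \<and> form_eq P E m (unorm m \<gamma>') \<gamma>"
proof (intro exI conjI)
  show "bform n P E (Suc j) m (\<lambda>p x e. \<gamma> p (\<pi> p x) e)"
    by (rule forms_comp[where a = \<pi> and b = "\<lambda>q x. x"]) (simp_all add: pi_endo forms_mono[OF \<gamma>])
  show "form_eq P E m (unorm m (\<lambda>p x e. \<gamma> p (\<pi> p x) e)) \<gamma>"
  proof (rule form_eqI)
    fix p q x e assume pq: "p + q = m" and x: "x \<in> carrier (obj P p)" and e: "e \<in> carrier (obj E q)"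
    have bal: "\<gamma> p z (xe q i e) = \<gamma> p (xp p i z) e" if "z \<in> carrier (obj P p)" for i z
      using e that
    proof (induction i arbitrary: z e)
      case (Suc i)
      have "\<gamma> p z (xe q (Suc i) e) = \<gamma> p z (xe q i (lam n (var j) \<odot>\<^bsub>obj E q\<^esub> e))"
        by (simp only: power_Suc2 act_mult[OF E.mod Suc.prems(1)])
      also have "\<dots> = \<gamma> p (lam n (var j) \<odot>\<^bsub>obj P p\<^esub> xp p i z) e"
        using Suc by (simp add: bform_var[OF \<gamma> pq])
      finally show ?case using Suc.prems by (simp add: act_mult[OF P.mod])
    qed simp
    have "unorm m (\<lambda>p x e. \<gamma> p (\<pi> p x) e) p x e = (\<Sum>i<N. \<gamma> p (xp p (N - 1 - i) (\<pi> p (xp p i x))) e)"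
      unfolding unorm_eq[OF pq] using x by (simp add: bal)
    also have "\<dots> = (\<Sum>i<N. \<gamma> p (xp p i (\<pi> p (xp p (N - 1 - i) x))) e)"
      by (subst sum.nat_diff_reindex[symmetric]) (intro sum.cong refl, auto)
    also have "\<dots> = \<gamma> p x e"
      by (rule pi_expansion[symmetric, where F = "\<lambda>x. \<gamma> p x e"]) (use x e bform_add_left[OF \<gamma> pq] in auto)
    finally show "unorm m (\<lambda>p x e. \<gamma> p (\<pi> p x) e) p x e = \<gamma> p x e" .
  qed
qed

text \<open>On \<open>P = \<Oplus>\<^sub>i \<xi>\<^sup>i P'\<close> the equation \<open>ydiff \<gamma> = \<beta>\<close> is a recursion for the restrictions of \<open>\<gamma>\<close> to
  the summands, which starts with zero on \<open>P'\<close> and closes up at \<open>\<xi>\<^sup>N = 0\<close> because \<open>unorm \<beta> = 0\<close>.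
  The formula below is its solution.\<close>

lemma unorm_kernel:
  assumes \<beta>: "bform n P E (Suc j) m \<beta>" and u: "form_eq P E m (unorm m \<beta>) (\<lambda>p x e. 0)"
  shows "\<exists>\<gamma>. bform n P E (Suc j) m \<gamma> \<and> form_eq P E m (ydiff m \<gamma>) \<beta>"
proof (intro exI conjI)
  let ?\<gamma> = "\<lambda>p x e. \<Sum>i<N. \<Sum>l<i. \<beta> p (xp p l (\<pi> p (xp p (N - 1 - i) x))) (xe (m - p) (i - 1 - l) e)"
  show "bform n P E (Suc j) m ?\<gamma>"
    by (intro forms_sum forms_comp[OF \<beta>, where a = "\<lambda>p x. xp p l (\<pi> p (xp p (N - 1 - i) x))" and b = "\<lambda>q. xe q (i - 1 - l)" for i l])
      (simp_all add: endo_comp[of _ _ _ "\<lambda>x. xp p l x" for p l] endo_comp[OF pi_endo])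
  show "form_eq P E m (ydiff m ?\<gamma>) \<beta>"
  proof (rule form_eqI)
    fix p q x e assume pq: "p + q = m" and x: "x \<in> carrier (obj P p)" and e: "e \<in> carrier (obj E q)"
    then have q: "m - p = q" by simp
    define A where "A i = (\<Sum>l<i. \<beta> p (xp p l (\<pi> p (xp p (N - i) x))) (xe q (i - 1 - l) e))" for i
    have "?\<gamma> p (xp p 1 x) e = (\<Sum>i<N. A i)"
      unfolding A_def q using x by (intro sum.cong refl) (simp add: xp_comp Suc_diff_Suc flip: power_Suc2 act_mult[OF P.mod])
    moreover have "?\<gamma> p x (xe q 1 e) = (\<Sum>i<N. A (Suc i) - \<beta> p (xp p i (\<pi> p (xp p (N - 1 - i) x))) e)"
    proof (unfold q, intro sum.cong refl)
      fix i
      have "A (Suc i) = (\<Sum>l<i. \<beta> p (xp p l (\<pi> p (xp p (N - 1 - i) x))) (xe q (i - l) e)) + \<beta> p (xp p i (\<pi> p (xp p (N - 1 - i) x))) e"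
        unfolding A_def using e by simp
      moreover have "(\<Sum>l<i. \<beta> p (xp p l (\<pi> p (xp p (N - 1 - i) x))) (xe q (i - 1 - l) (xe q 1 e))) =
          (\<Sum>l<i. \<beta> p (xp p l (\<pi> p (xp p (N - 1 - i) x))) (xe q (i - l) e))"
        unfolding xe_comp[OF e]
      proof (intro sum.cong refl)
        fix l assume "l \<in> {..<i}"
        then have "i - 1 - l + 1 = i - l" by auto
        then show "\<beta> p (xp p l (\<pi> p (xp p (N - 1 - i) x))) (xe q (i - 1 - l + 1) e) =
            \<beta> p (xp p l (\<pi> p (xp p (N - 1 - i) x))) (xe q (i - l) e)" by (simp only:)
      qed
      ultimately show "(\<Sum>l<i. \<beta> p (xp p l (\<pi> p (xp p (N - 1 - i) x))) (xe q (i - 1 - l) (xe q 1 e))) =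
          A (Suc i) - \<beta> p (xp p i (\<pi> p (xp p (N - 1 - i) x))) e" by simp
    qed
    moreover have "\<beta> p x e = (\<Sum>i<N. \<beta> p (xp p i (\<pi> p (xp p (N - 1 - i) x))) e)"
      by (rule pi_expansion[where F = "\<lambda>x. \<beta> p x e"]) (use x e bform_add_left[OF \<beta> pq] in auto)
    moreover have "A N = unorm m \<beta> p (\<pi> p x) e" unfolding unorm_eq[OF pq] A_def using x by simp
    then have "A N = 0" using form_eqD[OF u pq pi_closed[OF x] e] by simp
    moreover have "(\<Sum>i<N. A (Suc i)) = (\<Sum>i<N. A i) + A N - A 0"
      using sum.lessThan_Suc_shift[of A N] by simp
    moreover have "A 0 = 0" by (simp add: A_def)
    ultimately show "ydiff m ?\<gamma> p x e = \<beta> p x e"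
      unfolding ydiff_eq[OF pq] by (simp only: sum_subtractf) simp
  qed
qed

text \<open>The left and the right action of \<open>\<xi>\<close> commute and are nilpotent. The induction measures how many
  further factors \<open>\<xi>\<close> annihilate \<open>x\<close> and \<open>e\<close>.\<close>

lemma ydiff_nilpotent:
  assumes "bform n P E (Suc j) m \<beta>" and pq: "p + q = m"
    and "x \<in> carrier (obj P p)" "e \<in> carrier (obj E q)"
    and "xp p a x = \<zero>\<^bsub>obj P p\<^esub>" "xe q b e = \<zero>\<^bsub>obj E q\<^esub>" "a + b \<le> t"
  shows "(ydiff m ^^ t) \<beta> p x e = 0"
  using assms
proof (induction t arbitrary: x e a b)
  have forms: "bform n P E (Suc j) m ((ydiff m ^^ t) \<beta>)" for t
    by (induction t) (simp_all add: assms(1) forms_ydiff)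
  {
    case 0
    then show ?case using forms_zero_left[OF assms(1) pq, of e] by simp
  next
    case (Suc t)
    note xe = Suc.prems(3,4)
    show ?case
    proof (cases "a = 0 \<or> b = 0")
      case True
      then have "x = \<zero>\<^bsub>obj P p\<^esub> \<or> e = \<zero>\<^bsub>obj E q\<^esub>" using xe Suc.prems(5,6) by auto
      then show ?thesis
        using forms_zero_left[OF forms[of "Suc t"] pq, of e] forms_zero_right[OF forms[of "Suc t"] pq, of x] xe by auto
    next
      case False
      then obtain a' b' where ab: "a = Suc a'" "b = Suc b'" by (meson not0_implies_Suc)
      have "(ydiff m ^^ t) \<beta> p (xp p 1 x) e = 0"
        using Suc.prems ab xp_comp[OF xe(1), of a' 1] by (intro Suc.IH[of _ _ a' b]) auto
      moreover have "(ydiff m ^^ t) \<beta> p x (xe q 1 e) = 0"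
        using Suc.prems ab xe_comp[OF xe(2), of b' 1] by (intro Suc.IH[of _ _ a b']) auto
      ultimately show ?thesis by (simp only: funpow.simps o_def ydiff_eq[OF pq]) simp
    qed
  }
qed

text \<open>Both kernel and cokernel of \<open>ydiff\<close> on the forms with \<open>\<xi>\<close> freed are the exact complex of forms
  balanced for \<open>\<xi>\<close>, the cokernel by means of \<open>unorm\<close>. Two long exact sequences therefore show that
  \<open>ydiff\<close> acts injectively on cohomology; the proof is the corresponding diagram chase.\<close>

lemma ydiff_injective:
  assumes exact: "forms_exact n P E j" and \<beta>: "bform n P E (Suc j) m \<beta>"
    and closed: "form_eq P E (m - 1) (delta P E (m - 1) \<beta>) (\<lambda>p x e. 0)"
    and \<gamma>: "bform n P E (Suc j) (m + 1) \<gamma>" and y: "form_eq P E m (ydiff m \<beta>) (delta P E m \<gamma>)"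
  shows "\<exists>\<gamma>'. bform n P E (Suc j) (m + 1) \<gamma>' \<and> form_eq P E m \<beta> (delta P E m \<gamma>')"
proof -
  have eq_trans: "form_eq P E m f h" if "form_eq P E m f g" "form_eq P E m g h" for m and f g h :: "int \<Rightarrow> 'm \<Rightarrow> 'l \<Rightarrow> 'k"
    using that by (simp add: form_eq_def)
  have eq_sym: "form_eq P E m g f" if "form_eq P E m f g" for m and f g :: "int \<Rightarrow> 'm \<Rightarrow> 'l \<Rightarrow> 'k"
    using that by (simp add: form_eq_def)
  have "form_eq P E m (delta P E m (unorm (m + 1) \<gamma>)) (unorm m (delta P E m \<gamma>))"
    using delta_unorm[of "m + 1"] by simp
  also note [trans] = eq_trans
  have "form_eq P E m (unorm m (delta P E m \<gamma>)) (\<lambda>p x e. 0)"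
    by (rule eq_trans[OF unorm_cong[OF eq_sym[OF y]] unorm_ydiff[OF \<beta>]])
  finally obtain \<epsilon> where \<epsilon>: "bform n P E j (m + 1 + 1) \<epsilon>" "form_eq P E (m + 1) (unorm (m + 1) \<gamma>) (delta P E (m + 1) \<epsilon>)"
    using exact[unfolded forms_exact_def, rule_format, OF forms_unorm[OF \<gamma>]] by auto
  \<comment> \<open>Subtracting \<open>\<delta> \<epsilon>'\<close> from \<open>\<gamma>\<close> leaves \<open>\<delta> \<gamma>\<close> unchanged and makes \<open>unorm\<close> vanish.\<close>
  obtain \<epsilon>' where \<epsilon>': "bform n P E (Suc j) (m + 1 + 1) \<epsilon>'" "form_eq P E (m + 1 + 1) (unorm (m + 1 + 1) \<epsilon>') \<epsilon>"
    using unorm_surjective[OF \<epsilon>(1)] by blast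
  define \<gamma>1 where "\<gamma>1 = (\<lambda>p x e. \<gamma> p x e - delta P E (m + 1) \<epsilon>' p x e)"
  have d\<epsilon>': "bform n P E (Suc j) (m + 1) (delta P E (m + 1) \<epsilon>')"
    using forms_delta[OF \<epsilon>'(1)] unfolding add_diff_cancel_right' .
  have \<gamma>1: "bform n P E (Suc j) (m + 1) \<gamma>1" unfolding \<gamma>1_def by (rule forms_diff[OF \<gamma> d\<epsilon>'])
  have "form_eq P E (m + 1) (unorm (m + 1) (delta P E (m + 1) \<epsilon>')) (unorm (m + 1) \<gamma>)"
    by (rule eq_trans[OF eq_trans[OF eq_sym[OF delta_unorm[of "m + 1 + 1" \<epsilon>', unfolded add_diff_cancel_right']]
            delta_cong[OF \<epsilon>'(2), unfolded add_diff_cancel_right']] eq_sym[OF \<epsilon>(2)]])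
  then have "form_eq P E (m + 1) (unorm (m + 1) \<gamma>1) (\<lambda>p x e. 0)"
    by (simp add: form_eq_def unorm_def \<gamma>1_def sum_subtractf)
  then obtain \<gamma>2 where \<gamma>2: "bform n P E (Suc j) (m + 1) \<gamma>2" "form_eq P E (m + 1) (ydiff (m + 1) \<gamma>2) \<gamma>1"
    using unorm_kernel[OF \<gamma>1] by blast
  have dd: "form_eq P E m (delta P E m (delta P E (m + 1) \<epsilon>')) (\<lambda>p x e. 0)"
  proof -
    have "m + 1 + 1 - 2 = m" by simp
    from delta_delta[OF \<epsilon>'(1), unfolded this add_diff_cancel_right'] show ?thesis .
  qed
  have "form_eq P E m (delta P E m \<gamma>) (delta P E m \<gamma>1)"
    using dd by (simp add: form_eq_def \<gamma>1_def delta_diff)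
  then have "form_eq P E m (ydiff m \<beta>) (ydiff m (delta P E m \<gamma>2))"
    using y delta_cong[OF \<gamma>2(2)] delta_ydiff[of "m + 1" \<gamma>2] by (simp add: form_eq_def)
  then have y0: "form_eq P E m (ydiff m (\<lambda>p x e. \<beta> p x e - delta P E m \<gamma>2 p x e)) (\<lambda>p x e. 0)"
    by (simp add: form_eq_def ydiff_def algebra_simps)
  \<comment> \<open>What remains of \<open>\<beta>\<close> is balanced for \<open>\<xi>\<close>, so the exactness can be used a second time.\<close>
  define \<kappa> where "\<kappa> = (\<lambda>p x e. \<beta> p x e - delta P E m \<gamma>2 p x e)"
  have d\<gamma>2: "bform n P E (Suc j) m (delta P E m \<gamma>2)"
    using forms_delta[OF \<gamma>2(1)] unfolding add_diff_cancel_right' .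
  have "bform n P E j m \<kappa>"
    unfolding \<kappa>_def by (rule ydiff_kernel[OF forms_diff[OF \<beta> d\<gamma>2] y0])
  moreover have "form_eq P E (m - 1) (delta P E (m - 1) (delta P E m \<gamma>2)) (\<lambda>p x e. 0)"
  proof -
    have "m + 1 - 2 = m - 1" by simp
    from delta_delta[OF \<gamma>2(1), unfolded this add_diff_cancel_right'] show ?thesis .
  qed
  then have "form_eq P E (m - 1) (delta P E (m - 1) \<kappa>) (\<lambda>p x e. 0)"
    using closed by (simp add: form_eq_def \<kappa>_def delta_diff)
  ultimately obtain \<eta> where \<eta>: "bform n P E j (m + 1) \<eta>" "form_eq P E m \<kappa> (delta P E m \<eta>)"
    using exact unfolding forms_exact_def by blast
  show ?thesis
  proof (intro exI conjI)
    show "bform n P E (Suc j) (m + 1) (\<lambda>p x e. \<gamma>2 p x e + \<eta> p x e)"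
      by (rule forms_add[OF \<gamma>2(1) forms_mono[OF \<eta>(1)]]) simp
    show "form_eq P E m \<beta> (delta P E m (\<lambda>p x e. \<gamma>2 p x e + \<eta> p x e))"
      using \<eta>(2) by (simp add: form_eq_def \<kappa>_def delta_add algebra_simps)
  qed
qed

text \<open>An operator that is injective and nilpotent can exist on the zero group only.\<close>

lemma forms_exact_step:
  assumes exact: "forms_exact n P E j"
  shows "forms_exact n P E (Suc j)"
proof -
  have nil: "\<exists>\<gamma>. bform n P E (Suc j) (m + 1) \<gamma> \<and> form_eq P E m \<beta> (delta P E m \<gamma>)"
    if "bform n P E (Suc j) m \<beta>" "form_eq P E (m - 1) (delta P E (m - 1) \<beta>) (\<lambda>p x e. 0)"
      "form_eq P E m ((ydiff m ^^ t) \<beta>) (\<lambda>p x e. 0)" for m \<beta> t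
    using that
  proof (induction t arbitrary: \<beta>)
    case 0
    then show ?case by (intro exI[of _ "\<lambda>p x e. 0"]) (simp add: forms_zero form_eq_def delta_def)
  next
    case (Suc t)
    have "form_eq P E (m - 1) (ydiff (m - 1) (delta P E (m - 1) \<beta>)) (ydiff (m - 1) (\<lambda>p x e. 0))"
      by (rule ydiff_cong[OF Suc.prems(2)])
    then have "form_eq P E (m - 1) (delta P E (m - 1) (ydiff m \<beta>)) (\<lambda>p x e. 0)"
      using delta_ydiff[of m \<beta>] by (simp add: form_eq_def ydiff_def)
    then obtain \<gamma> where "bform n P E (Suc j) (m + 1) \<gamma>" "form_eq P E m (ydiff m \<beta>) (delta P E m \<gamma>)"
      using Suc.IH[OF forms_ydiff[OF Suc.prems(1)]] Suc.prems(3) unfolding funpow_Suc_right o_def by blast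
    then show ?case using ydiff_injective[OF exact Suc.prems(1,2)] by blast
  qed
  show ?thesis
    unfolding forms_exact_def
  proof (intro allI impI)
    fix m \<beta> assume \<beta>: "bform n P E (Suc j) m \<beta>" "form_eq P E (m - 1) (delta P E (m - 1) \<beta>) (\<lambda>p x e. 0)"
    have "form_eq P E m ((ydiff m ^^ (N + N)) \<beta>) (\<lambda>p x e. 0)"
      by (rule form_eqI, rule ydiff_nilpotent[OF \<beta>(1), where a = N and b = N]) (assumption | simp only: xp_N xe_N order_refl)+
    then show "\<exists>\<gamma>. bform n P E (Suc j) (m + 1) \<gamma> \<and> form_eq P E m \<beta> (delta P E m \<gamma>)"
      by (rule nil[OF \<beta>])
  qed
qed

end

text \<open>The variables are freed one after the other; a basis of each \<open>P\<^sup>p\<close> provides the operator \<open>\<pi>\<close> for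
  every step. Dually, the tensor product of \<open>P\<close> and \<open>E\<close> over the subring generated by the variables in the
  slots from \<open>S\<close> on is acyclic as well.\<close>

theorem (in tensor_cx) forms_exact_all:
  assumes T: "zero_object (tensor n P E)" and n: "\<And>i. 1 \<le> n (Suc i)"
    and free: "\<And>p. \<exists>B. free_basis (Lam n) (obj P p) B"
  shows "forms_exact n P E S"
proof (induction S)
  case 0
  show ?case by (rule forms_exact_tensor[OF T])
next
  case (Suc j)
  let ?expand = "\<lambda>p \<pi>. \<forall>F :: 'm \<Rightarrow> 'k. (\<forall>x\<in>carrier (obj P p). \<forall>y\<in>carrier (obj P p). F (x \<oplus>\<^bsub>obj P p\<^esub> y) = F x + F y) \<longrightarrow>
      (\<forall>x\<in>carrier (obj P p). F x = (\<Sum>i<n (Suc j). F (lam n (var j ^ i) \<odot>\<^bsub>obj P p\<^esub> \<pi> (lam n (var j ^ (n (Suc j) - 1 - i)) \<odot>\<^bsub>obj P p\<^esub> x))))"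
  have "\<exists>\<pi>. endo n (obj P p) (Suc j) \<pi> \<and> ?expand p \<pi>" for p
  proof -
    obtain B where "free_basis (Lam n) (obj P p) B" using free by blast
    then show ?thesis by (rule top_coeff_operator[where n = n, OF n P.mod])
  qed
  then have "\<exists>\<pi>. \<forall>p. endo n (obj P p) (Suc j) (\<pi> p) \<and> ?expand p (\<pi> p)"
    by (intro choice) (rule allI)
  then obtain \<pi> where \<pi>': "\<forall>p. endo n (obj P p) (Suc j) (\<pi> p) \<and> ?expand p (\<pi> p)" ..
  note \<pi> = conjunct1[OF \<pi>'[rule_format]] conjunct2[OF spec[OF \<pi>']]
  interpret var_step n P E j \<pi> "n (Suc j)"
  proof
    show "n (Suc j) = n (Suc j)" "1 \<le> n (Suc j)" by (rule refl, rule n)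
    show "endo n (obj P p) (Suc j) (\<pi> p)" for p by (rule \<pi>)
    fix p :: int and F :: "'m \<Rightarrow> 'k" and x
    assume "\<And>x y. x \<in> carrier (obj P p) \<Longrightarrow> y \<in> carrier (obj P p) \<Longrightarrow> F (x \<oplus>\<^bsub>obj P p\<^esub> y) = F x + F y"
      and "x \<in> carrier (obj P p)"
    then show "F x = (\<Sum>i<n (Suc j). F (lam n (var j ^ i) \<odot>\<^bsub>obj P p\<^esub> \<pi> p (lam n (var j ^ (n (Suc j) - 1 - i)) \<odot>\<^bsub>obj P p\<^esub> x)))"
      by (intro \<pi>(2)[THEN spec[where x = F], THEN mp, THEN bspec] ballI)
  qed
  show ?case by (rule forms_exact_step[OF Suc])
qed

section \<open>Cohomology classes\<close>

context cx
begin

definition hcl :: "int \<Rightarrow> 'm \<Rightarrow> 'm set" where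
  "hcl i x = (\<lambda>b. b \<oplus>\<^bsub>obj X i\<^esub> x) ` coboundaries X i"

lemma cocycle_iff: "x \<in> cocycles X i \<longleftrightarrow> x \<in> carrier (obj X i) \<and> diff X i x = \<zero>\<^bsub>obj X (i + 1)\<^esub>"
  by (simp add: cocycles_def)

lemma coboundaryI: "w \<in> carrier (obj X l) \<Longrightarrow> l + 1 = i \<Longrightarrow> diff X l w \<in> coboundaries X i"
  by (auto simp: coboundaries_def)

lemma coboundaryE:
  assumes "b \<in> coboundaries X i"
  obtains w where "w \<in> carrier (obj X (i - 1))" "b = diff X (i - 1) w"
  using assms by (auto simp: coboundaries_def)

lemma coboundary_closed: "b \<in> coboundaries X i \<Longrightarrow> b \<in> carrier (obj X i)"
  by (auto simp: coboundaries_def)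

lemma cocycle_closed [simp]: "x \<in> cocycles X i \<Longrightarrow> x \<in> carrier (obj X i)"
  by (simp add: cocycle_iff)

lemma cocycle_zero [simp]: "\<zero>\<^bsub>obj X i\<^esub> \<in> cocycles X i"
  and cocycle_add: "x \<in> cocycles X i \<Longrightarrow> y \<in> cocycles X i \<Longrightarrow> x \<oplus>\<^bsub>obj X i\<^esub> y \<in> cocycles X i"
  and cocycle_act: "x \<in> cocycles X i \<Longrightarrow> lam n p \<odot>\<^bsub>obj X i\<^esub> x \<in> cocycles X i"
  and cocycle_uminus: "x \<in> cocycles X i \<Longrightarrow> \<ominus>\<^bsub>obj X i\<^esub> x \<in> cocycles X i"
proof -
  interpret A: abelian_group "obj X (i + 1)" by simp
  show "\<zero>\<^bsub>obj X i\<^esub> \<in> cocycles X i"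
    "x \<in> cocycles X i \<Longrightarrow> y \<in> cocycles X i \<Longrightarrow> x \<oplus>\<^bsub>obj X i\<^esub> y \<in> cocycles X i"
    "x \<in> cocycles X i \<Longrightarrow> lam n p \<odot>\<^bsub>obj X i\<^esub> x \<in> cocycles X i"
    "x \<in> cocycles X i \<Longrightarrow> \<ominus>\<^bsub>obj X i\<^esub> x \<in> cocycles X i"
    by (auto simp: cocycle_iff diff_zero diff_add[of _ i _ "i + 1"] diff_act[of _ i "i + 1"] diff_uminus[of _ i "i + 1"] act_null[OF mod])
qed

lemma coboundary_zero [simp]: "\<zero>\<^bsub>obj X i\<^esub> \<in> coboundaries X i"
  and coboundary_add: "x \<in> coboundaries X i \<Longrightarrow> y \<in> coboundaries X i \<Longrightarrow> x \<oplus>\<^bsub>obj X i\<^esub> y \<in> coboundaries X i"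
  and coboundary_act: "x \<in> coboundaries X i \<Longrightarrow> lam n p \<odot>\<^bsub>obj X i\<^esub> x \<in> coboundaries X i"
  and coboundary_uminus: "x \<in> coboundaries X i \<Longrightarrow> \<ominus>\<^bsub>obj X i\<^esub> x \<in> coboundaries X i"
proof -
  show "\<zero>\<^bsub>obj X i\<^esub> \<in> coboundaries X i"
    using coboundaryI[of "\<zero>\<^bsub>obj X (i - 1)\<^esub>" "i - 1" i] by (simp add: diff_zero)
  show "x \<in> coboundaries X i \<Longrightarrow> y \<in> coboundaries X i \<Longrightarrow> x \<oplus>\<^bsub>obj X i\<^esub> y \<in> coboundaries X i"
    by (elim coboundaryE) (simp add: coboundaryI flip: diff_add[of _ "i - 1" _ i])
  show "x \<in> coboundaries X i \<Longrightarrow> lam n p \<odot>\<^bsub>obj X i\<^esub> x \<in> coboundaries X i"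
    by (elim coboundaryE) (simp add: coboundaryI flip: diff_act[of _ "i - 1" i])
  show "x \<in> coboundaries X i \<Longrightarrow> \<ominus>\<^bsub>obj X i\<^esub> x \<in> coboundaries X i"
    by (elim coboundaryE) (simp add: coboundaryI flip: diff_uminus[of _ "i - 1" i])
qed

lemma hcl_eq_iff:
  assumes "x \<in> cocycles X i" "y \<in> cocycles X i"
  shows "hcl i x = hcl i y \<longleftrightarrow> x \<ominus>\<^bsub>obj X i\<^esub> y \<in> coboundaries X i"
proof -
  interpret A: abelian_group "obj X i" by simp
  have xy: "x \<in> carrier (obj X i)" "y \<in> carrier (obj X i)" using assms by auto
  have sub: "hcl i x \<subseteq> hcl i y" if "x \<ominus>\<^bsub>obj X i\<^esub> y \<in> coboundaries X i"
    and x: "x \<in> carrier (obj X i)" and y: "y \<in> carrier (obj X i)" for x y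
  proof
    fix z assume "z \<in> hcl i x"
    then obtain b where b: "b \<in> coboundaries X i" "z = b \<oplus>\<^bsub>obj X i\<^esub> x" by (auto simp: hcl_def)
    have "b \<in> carrier (obj X i)" using b(1) by (rule coboundary_closed)
    then have "z = (b \<oplus>\<^bsub>obj X i\<^esub> (x \<ominus>\<^bsub>obj X i\<^esub> y)) \<oplus>\<^bsub>obj X i\<^esub> y"
      using x y b(2) by (simp add: A.minus_eq A.a_assoc A.l_neg)
    then show "z \<in> hcl i y" using coboundary_add[OF b(1) that(1)] by (auto simp: hcl_def)
  qed
  show ?thesis
  proof
    assume "hcl i x = hcl i y"
    moreover have "x \<in> hcl i x"
      unfolding hcl_def using xy by (intro image_eqI[of _ _ "\<zero>\<^bsub>obj X i\<^esub>"]) simp_all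
    ultimately obtain b where b: "b \<in> coboundaries X i" "x = b \<oplus>\<^bsub>obj X i\<^esub> y" by (auto simp: hcl_def)
    then have "x \<ominus>\<^bsub>obj X i\<^esub> y = b"
      using coboundary_closed[OF b(1)] xy by (simp add: A.minus_eq A.a_assoc A.r_neg)
    then show "x \<ominus>\<^bsub>obj X i\<^esub> y \<in> coboundaries X i" using b by simp
  next
    assume *: "x \<ominus>\<^bsub>obj X i\<^esub> y \<in> coboundaries X i"
    have "y \<ominus>\<^bsub>obj X i\<^esub> x = \<ominus>\<^bsub>obj X i\<^esub> (x \<ominus>\<^bsub>obj X i\<^esub> y)"
      using xy by (simp add: A.minus_eq A.minus_add A.a_comm)
    then have "y \<ominus>\<^bsub>obj X i\<^esub> x \<in> coboundaries X i" using coboundary_uminus[OF *] by simp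
    then show "hcl i x = hcl i y" using sub * xy by blast
  qed
qed

lemma carrier_cohomology: "carrier (cohomology X i) = hcl i ` cocycles X i"
  by (auto simp: cohomology_def FactGroup_def RCOSETS_def r_coset_def hcl_def)

lemma one_cohomology: "\<one>\<^bsub>cohomology X i\<^esub> = hcl i \<zero>\<^bsub>obj X i\<^esub>"
proof -
  interpret A: abelian_group "obj X i" by simp
  show ?thesis using coboundary_closed by (force simp: cohomology_def FactGroup_def hcl_def)
qed

lemma mult_cohomology:
  assumes "x \<in> cocycles X i" "y \<in> cocycles X i"
  shows "hcl i x \<otimes>\<^bsub>cohomology X i\<^esub> hcl i y = hcl i (x \<oplus>\<^bsub>obj X i\<^esub> y)"
proof -
  interpret A: abelian_group "obj X i" by simp
  have xy: "x \<in> carrier (obj X i)" "y \<in> carrier (obj X i)" using assms by auto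
  have mult: "hcl i x \<otimes>\<^bsub>cohomology X i\<^esub> hcl i y
      = {(b \<oplus>\<^bsub>obj X i\<^esub> x) \<oplus>\<^bsub>obj X i\<^esub> (c \<oplus>\<^bsub>obj X i\<^esub> y) |b c. b \<in> coboundaries X i \<and> c \<in> coboundaries X i}"
    by (auto simp: cohomology_def FactGroup_def set_mult_def hcl_def)
  have move: "(b \<oplus>\<^bsub>obj X i\<^esub> x) \<oplus>\<^bsub>obj X i\<^esub> (c \<oplus>\<^bsub>obj X i\<^esub> y) = (b \<oplus>\<^bsub>obj X i\<^esub> c) \<oplus>\<^bsub>obj X i\<^esub> (x \<oplus>\<^bsub>obj X i\<^esub> y)"
    if "b \<in> coboundaries X i" "c \<in> coboundaries X i" for b c
    using that[THEN coboundary_closed] xy by (simp add: A.a_ac)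
  show ?thesis
  proof (intro equalityI subsetI)
    fix z assume "z \<in> hcl i x \<otimes>\<^bsub>cohomology X i\<^esub> hcl i y"
    then obtain b c where "b \<in> coboundaries X i" "c \<in> coboundaries X i"
        "z = (b \<oplus>\<^bsub>obj X i\<^esub> x) \<oplus>\<^bsub>obj X i\<^esub> (c \<oplus>\<^bsub>obj X i\<^esub> y)" unfolding mult by blast
    then show "z \<in> hcl i (x \<oplus>\<^bsub>obj X i\<^esub> y)" using coboundary_add[of b i c] move[of b c] by (auto simp: hcl_def)
  next
    fix z assume "z \<in> hcl i (x \<oplus>\<^bsub>obj X i\<^esub> y)"
    then obtain b where b: "b \<in> coboundaries X i" "z = b \<oplus>\<^bsub>obj X i\<^esub> (x \<oplus>\<^bsub>obj X i\<^esub> y)" by (auto simp: hcl_def)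
    then have "z = (b \<oplus>\<^bsub>obj X i\<^esub> x) \<oplus>\<^bsub>obj X i\<^esub> (\<zero>\<^bsub>obj X i\<^esub> \<oplus>\<^bsub>obj X i\<^esub> y)"
      using coboundary_closed[OF b(1)] xy by (simp add: A.a_assoc)
    then show "z \<in> hcl i x \<otimes>\<^bsub>cohomology X i\<^esub> hcl i y" unfolding mult using b(1) coboundary_zero by blast
  qed
qed

lemma group_cohomology: "group (cohomology X i)"
proof (rule groupI)
  interpret A: abelian_group "obj X i" by simp
  fix C D F assume "C \<in> carrier (cohomology X i)" "D \<in> carrier (cohomology X i)" "F \<in> carrier (cohomology X i)"
  then show "C \<otimes>\<^bsub>cohomology X i\<^esub> D \<otimes>\<^bsub>cohomology X i\<^esub> F = C \<otimes>\<^bsub>cohomology X i\<^esub> (D \<otimes>\<^bsub>cohomology X i\<^esub> F)"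
    by (auto simp: carrier_cohomology mult_cohomology cocycle_add A.a_assoc)
next
  interpret A: abelian_group "obj X i" by simp
  fix C assume "C \<in> carrier (cohomology X i)"
  then obtain x where x: "x \<in> cocycles X i" "C = hcl i x" by (auto simp: carrier_cohomology)
  then show "\<one>\<^bsub>cohomology X i\<^esub> \<otimes>\<^bsub>cohomology X i\<^esub> C = C"
    by (simp add: one_cohomology mult_cohomology)
  show "\<exists>D\<in>carrier (cohomology X i). D \<otimes>\<^bsub>cohomology X i\<^esub> C = \<one>\<^bsub>cohomology X i\<^esub>"
    using x by (intro bexI[of _ "hcl i (\<ominus>\<^bsub>obj X i\<^esub> x)"])
      (simp_all add: one_cohomology mult_cohomology cocycle_uminus A.l_neg carrier_cohomology)
qed (auto simp: carrier_cohomology one_cohomology mult_cohomology cocycle_add)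

lemma zero_objectI:
  assumes "\<And>i. cocycles X i \<subseteq> coboundaries X i"
  shows "zero_object X"
  unfolding zero_object_def trivial_group_def
proof (intro allI conjI group_cohomology)
  fix i
  interpret A: abelian_group "obj X i" by simp
  have "hcl i x = hcl i \<zero>\<^bsub>obj X i\<^esub>" if "x \<in> cocycles X i" for x
  proof -
    have "x \<ominus>\<^bsub>obj X i\<^esub> \<zero>\<^bsub>obj X i\<^esub> \<in> coboundaries X i" using assms that by (auto simp: minus_zero)
    then show ?thesis unfolding hcl_eq_iff[OF that cocycle_zero] .
  qed
  then show "carrier (cohomology X i) = {\<one>\<^bsub>cohomology X i\<^esub>}"
    unfolding carrier_cohomology one_cohomology using cocycle_zero by blast
qed

text \<open>The values of the functional form the solution of a linear system, in which \<open>0 = 1\<close> is excluded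
  because no nonzero multiple of \<open>e\<close> is a coboundary.\<close>

lemma functional_exists:
  assumes e: "e \<in> cocycles X q" "e \<notin> coboundaries X q"
  shows "\<exists>\<phi>. (\<forall>x\<in>carrier (obj X q). \<forall>y\<in>carrier (obj X q). \<phi> (x \<oplus>\<^bsub>obj X q\<^esub> y) = \<phi> x + \<phi> y) \<and>
    (\<forall>c. \<forall>x\<in>carrier (obj X q). \<phi> (lam n (cst c) \<odot>\<^bsub>obj X q\<^esub> x) = c * \<phi> x) \<and>
    (\<forall>x\<in>coboundaries X q. \<phi> x = 0) \<and> \<phi> e = (1 :: 'k)"
proof -
  let ?M = "obj X q"
  interpret A: abelian_group ?M by simp
  define t where "t v a = (if v \<in> carrier ?M then lam n (cst a) \<odot>\<^bsub>?M\<^esub> v else \<zero>\<^bsub>?M\<^esub>)" for v and a :: 'k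
  interpret gsum_terms ?M t
    by unfold_locales (auto simp: t_def single_add act_add[OF mod])
  have t: "t v a = lam n (cst a) \<odot>\<^bsub>?M\<^esub> v" if "v \<in> carrier ?M" for v a using that by (simp add: t_def)
  have gsum_scale: "gsum ?M t (pscale a r) = lam n (cst a) \<odot>\<^bsub>?M\<^esub> gsum ?M t r" for a r
  proof (induction r rule: poly_mapping_add_induct)
    case (add p q)
    then show ?case by (simp add: gsum_add act_distr[OF mod])
  next
    case (single v c)
    have "lam n (cst (a * c)) \<odot>\<^bsub>?M\<^esub> v = lam n (cst a) \<odot>\<^bsub>?M\<^esub> (lam n (cst c) \<odot>\<^bsub>?M\<^esub> v)" if "v \<in> carrier ?M"
      using that act_mult[OF mod, of v q "cst a" "cst c"] by (simp add: mult_single)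
    moreover have "t v b = \<zero>\<^bsub>?M\<^esub>" if "v \<notin> carrier ?M" for b using that by (simp add: t_def)
    ultimately show ?case by (cases "v \<in> carrier ?M") (simp_all add: t act_null[OF mod])
  qed (simp add: act_null[OF mod])
  define I where "I = {(r, c :: 'k). \<exists>b\<in>coboundaries X q. gsum ?M t r = lam n (cst c) \<odot>\<^bsub>?M\<^esub> e \<oplus>\<^bsub>?M\<^esub> b}"
  have e': "e \<in> carrier ?M" using e by simp
  have I0: "(r, 0) \<in> I" if "gsum ?M t r \<in> coboundaries X q" for r
    using that e' coboundary_closed[OF that] unfolding I_def
    by (auto simp: act_zero[OF mod] intro!: bexI[of _ "gsum ?M t r"])
  have one: "lam n (cst 1) \<odot>\<^bsub>?M\<^esub> x = x" if "x \<in> carrier ?M" for x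
    using act_one[OF mod that] by simp
  let ?single = "\<lambda>x. Poly_Mapping.single x (1 :: 'k)"
  let ?add = "{(?single (x \<oplus>\<^bsub>?M\<^esub> y) - ?single x - ?single y, 0 :: 'k) |x y. x \<in> carrier ?M \<and> y \<in> carrier ?M}"
  let ?scale = "{(?single (lam n (cst c) \<odot>\<^bsub>?M\<^esub> x) - Poly_Mapping.single x c, 0 :: 'k) |c x. x \<in> carrier ?M}"
  let ?bd = "{(?single x, 0 :: 'k) |x. x \<in> coboundaries X q}"
  have "\<exists>\<phi>. \<forall>(r, c)\<in>?add \<union> ?scale \<union> ?bd \<union> {(?single e, 1)}. pair r \<phi> = c"
  proof (rule linear_system_solvable[where I = I])
    show "(0, 0) \<in> I" by (rule I0) simp
  next
    fix r c s d assume "(r, c) \<in> I" "(s, d) \<in> I"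
    then obtain b b' where b: "b \<in> coboundaries X q" "gsum ?M t r = lam n (cst c) \<odot>\<^bsub>?M\<^esub> e \<oplus>\<^bsub>?M\<^esub> b"
      and b': "b' \<in> coboundaries X q" "gsum ?M t s = lam n (cst d) \<odot>\<^bsub>?M\<^esub> e \<oplus>\<^bsub>?M\<^esub> b'"
      unfolding I_def by blast
    have "gsum ?M t (r + s) = lam n (cst (c + d)) \<odot>\<^bsub>?M\<^esub> e \<oplus>\<^bsub>?M\<^esub> (b \<oplus>\<^bsub>?M\<^esub> b')"
      using b b' e' b(1)[THEN coboundary_closed] b'(1)[THEN coboundary_closed]
      by (simp add: gsum_add single_add act_add[OF mod] A.a_ac)
    then show "(r + s, c + d) \<in> I" unfolding I_def using coboundary_add[OF b(1) b'(1)] by blast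
  next
    fix a r c assume "(r, c) \<in> I"
    then obtain b where b: "b \<in> coboundaries X q" "gsum ?M t r = lam n (cst c) \<odot>\<^bsub>?M\<^esub> e \<oplus>\<^bsub>?M\<^esub> b"
      unfolding I_def by blast
    have "gsum ?M t (pscale a r) = lam n (cst (a * c)) \<odot>\<^bsub>?M\<^esub> e \<oplus>\<^bsub>?M\<^esub> lam n (cst a) \<odot>\<^bsub>?M\<^esub> b"
      using b e' b(1)[THEN coboundary_closed] act_mult[OF mod, of e q "cst a" "cst c"]
      by (simp add: gsum_scale act_distr[OF mod] mult_single)
    then show "(pscale a r, a * c) \<in> I" unfolding I_def using coboundary_act[OF b(1)] by blast
  next
    show "(0, 1) \<notin> I"
    proof
      assume "(0, 1) \<in> I"
      then obtain b where b: "b \<in> coboundaries X q" "\<zero>\<^bsub>?M\<^esub> = e \<oplus>\<^bsub>?M\<^esub> b"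
        unfolding I_def using one[OF e'] by auto
      then have "e = \<ominus>\<^bsub>?M\<^esub> b"
        using e' coboundary_closed[OF b(1)] by (intro A.minus_equality[symmetric]) auto
      then show False using e(2) coboundary_uminus[OF b(1)] by simp
    qed
  next
    have "?add \<subseteq> I"
    proof clarify
      fix x y assume xy: "x \<in> carrier ?M" "y \<in> carrier ?M"
      have "x \<oplus>\<^bsub>?M\<^esub> y \<ominus>\<^bsub>?M\<^esub> x \<ominus>\<^bsub>?M\<^esub> y = \<zero>\<^bsub>?M\<^esub>"
        using xy by (simp add: A.minus_eq A.a_comm[of x y] A.a_assoc A.r_neg)
      then have "gsum ?M t (?single (x \<oplus>\<^bsub>?M\<^esub> y) - ?single x - ?single y) = \<zero>\<^bsub>?M\<^esub>"
        using xy one by (simp only: gsum_diff gsum_single t A.a_closed)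
      then show "(?single (x \<oplus>\<^bsub>?M\<^esub> y) - ?single x - ?single y, 0) \<in> I" by (intro I0) simp
    qed
    moreover have "?scale \<subseteq> I"
    proof clarify
      fix c x assume "x \<in> carrier ?M"
      then show "(?single (lam n (cst c) \<odot>\<^bsub>?M\<^esub> x) - Poly_Mapping.single x c, 0) \<in> I"
        using one[of "lam n (cst c) \<odot>\<^bsub>?M\<^esub> x"] by (intro I0) (simp add: gsum_diff t A.minus_eq A.r_neg)
    qed
    moreover have "?bd \<subseteq> I"
    proof clarify
      fix x assume "x \<in> coboundaries X q"
      then show "(?single x, 0) \<in> I" using coboundary_closed[of x q] one[of x] by (intro I0) (simp add: t)
    qed
    moreover have "(?single e, 1) \<in> I"
      unfolding I_def using e' by (auto simp: t intro!: bexI[of _ "\<zero>\<^bsub>?M\<^esub>"])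
    ultimately show "?add \<union> ?scale \<union> ?bd \<union> {(?single e, 1)} \<subseteq> I" by (intro Un_least) simp_all
  qed
  then obtain \<phi> where \<phi>: "\<forall>(r, c)\<in>?add \<union> ?scale \<union> ?bd \<union> {(?single e, 1)}. pair r \<phi> = c" ..
  have solve: "pair r \<phi> = c" if "(r, c) \<in> ?add \<union> ?scale \<union> ?bd \<union> {(?single e, 1)}" for r c
    using bspec[OF \<phi> that] by simp
  show ?thesis
  proof (intro exI[of _ \<phi>] conjI ballI allI)
    fix x y assume "x \<in> carrier ?M" "y \<in> carrier ?M"
    then have "(?single (x \<oplus>\<^bsub>?M\<^esub> y) - ?single x - ?single y, 0 :: 'k) \<in> ?add" by blast
    then have "pair (?single (x \<oplus>\<^bsub>?M\<^esub> y) - ?single x - ?single y) \<phi> = 0" by (intro solve UnI1)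
    then show "\<phi> (x \<oplus>\<^bsub>?M\<^esub> y) = \<phi> x + \<phi> y" by (simp add: algebra_simps)
  next
    fix c x assume "x \<in> carrier ?M"
    then have "(?single (lam n (cst c) \<odot>\<^bsub>?M\<^esub> x) - Poly_Mapping.single x c, 0 :: 'k) \<in> ?scale" by blast
    then have "pair (?single (lam n (cst c) \<odot>\<^bsub>?M\<^esub> x) - Poly_Mapping.single x c) \<phi> = 0"
      by (intro solve UnI1 UnI2[of _ _ ?add])
    then show "\<phi> (lam n (cst c) \<odot>\<^bsub>?M\<^esub> x) = c * \<phi> x" by simp
  next
    fix x assume "x \<in> coboundaries X q"
    then have "(?single x, 0 :: 'k) \<in> ?bd" by blast
    then have "pair (?single x) \<phi> = 0" by (intro solve UnI1 UnI2[of _ _ "?add \<union> ?scale"])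
    then show "\<phi> x = 0" by simp
  next
    have "pair (?single e) \<phi> = 1" by (intro solve UnI2) simp
    then show "\<phi> e = 1" by simp
  qed
qed

end

section \<open>Homomorphisms to \<open>\<Lambda>\<close> kill the cocycles of an \<open>E\<close>-acyclic complex\<close>

context tensor_cx
begin

text \<open>If \<open>f z\<close> had a nonzero coefficient, at \<open>\<mu>\<close> say, then the form \<open>\<beta>\<close> below would be closed and
  balanced for all but finitely many variables, hence exact, and an exact form vanishes at a pair of cocycles.
  But at \<open>z\<close> and a cocycle \<open>e\<close> that is detected by \<open>\<phi>\<close> its value is that coefficient. Taking the coefficient of
  \<open>\<mu>\<close> in the first \<open>S\<close> variables only is what keeps \<open>\<beta>\<close> balanced for the others.\<close>

theorem hom_to_Lam_kills_cocycles:
  fixes f :: "'m \<Rightarrow> 'k lam"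
  assumes exact: "\<And>S. forms_exact n P E S" and E: "\<not> zero_object E"
    and f: "\<And>x. x \<in> carrier (obj P i) \<Longrightarrow> f x \<in> carrier (Lam n)"
    and f_add: "\<And>x y. x \<in> carrier (obj P i) \<Longrightarrow> y \<in> carrier (obj P i) \<Longrightarrow> f (x \<oplus>\<^bsub>obj P i\<^esub> y) = f x \<oplus>\<^bsub>Lam n\<^esub> f y"
    and f_act: "\<And>a x. x \<in> carrier (obj P i) \<Longrightarrow> f (lam n a \<odot>\<^bsub>obj P i\<^esub> x) = lam n a \<otimes>\<^bsub>Lam n\<^esub> f x"
    and f_bd: "\<And>x. x \<in> coboundaries P i \<Longrightarrow> f x = \<zero>\<^bsub>Lam n\<^esub>"
    and z: "z \<in> cocycles P i"
  shows "f z = \<zero>\<^bsub>Lam n\<^esub>"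
proof (rule ccontr)
  assume "f z \<noteq> \<zero>\<^bsub>Lam n\<^esub>"
  moreover have z': "z \<in> carrier (obj P i)" using z by simp
  obtain g where g: "f z = lam n g" using f[OF z'] by (auto simp: carrier_Lam)
  ultimately obtain \<mu> where \<mu>: "\<mu> \<in> box n" "Poly_Mapping.lookup g \<mu> \<noteq> 0"
    by (auto simp: lam_eq_iff simp flip: lam_zero)
  obtain q e where e: "e \<in> cocycles E q" "e \<notin> coboundaries E q" using E E.zero_objectI by blast
  obtain \<phi> where \<phi>: "\<forall>x\<in>carrier (obj E q). \<forall>y\<in>carrier (obj E q). \<phi> (x \<oplus>\<^bsub>obj E q\<^esub> y) = \<phi> x + \<phi> y"
    "\<forall>c. \<forall>x\<in>carrier (obj E q). \<phi> (lam n (cst c) \<odot>\<^bsub>obj E q\<^esub> x) = c * \<phi> x"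
    "\<forall>x\<in>coboundaries E q. \<phi> x = 0" "\<phi> e = (1 :: 'k)"
    using E.functional_exists[OF e] by (elim exE conjE)
  have e': "e \<in> carrier (obj E q)" using e by simp
  \<comment> \<open>All monomials of \<open>g\<close> are in the variables below the slot \<open>S\<close>, so that the coefficient of \<open>\<mu>\<close> is a constant.\<close>
  have "finite (\<Union>m\<in>Poly_Mapping.keys g. Poly_Mapping.keys m)" by simp
  then obtain S where "(\<Union>m\<in>Poly_Mapping.keys g. Poly_Mapping.keys m) \<subseteq> {..<S}"
    by (rule finite_nat_iff_bounded[THEN iffD1, THEN exE])
  then have S: "Poly_Mapping.keys m \<subseteq> {..<S}" if "m \<in> Poly_Mapping.keys g" for m using that by blast
  have \<mu>S: "Poly_Mapping.keys \<mu> \<subseteq> {..<S}" using S[of \<mu>] \<mu>(2) by (simp add: in_keys_iff)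
  let ?s = "slice {..<S} \<mu>"
  have slice_g: "?s g = cst (Poly_Mapping.lookup g \<mu>)"
  proof (rule poly_mapping_eqI)
    fix m
    have "Poly_Mapping.lookup g (m + \<mu>) = 0" if m0: "m \<noteq> 0" and low: "\<forall>s<S. Poly_Mapping.lookup m s = 0"
    proof (rule ccontr)
      assume "Poly_Mapping.lookup g (m + \<mu>) \<noteq> 0"
      then have "Poly_Mapping.keys (m + \<mu>) \<subseteq> {..<S}" by (intro S) (simp add: in_keys_iff)
      moreover obtain s where "Poly_Mapping.lookup m s \<noteq> 0" using m0 by (auto simp: poly_mapping_eq_iff fun_eq_iff)
      then have "s \<in> Poly_Mapping.keys (m + \<mu>)" "\<not> s < S" using low by (auto simp: in_keys_iff lookup_add)
      ultimately show False by blast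
    qed
    then show "Poly_Mapping.lookup (?s g) m = Poly_Mapping.lookup (cst (Poly_Mapping.lookup g \<mu>)) m"
      by (auto simp: lookup_slice lookup_single when_def)
  qed
  have slice_var: "?s (var s * p) = var s * ?s p" if "S \<le> s" for s and p :: "'k inf_poly"
    using that by (intro slice_single_mult \<mu>S) (simp add: lookup_single)
  have slice_cst: "?s (cst c * p) = cst c * ?s p" for c and p :: "'k inf_poly"
    by (intro slice_single_mult \<mu>S) simp
  let ?sl = "lam_slice n {..<S} \<mu>"
  note sl = lam_slice[OF \<mu>(1) \<mu>S]
  define \<beta> where "\<beta> p x e = (if p = i then \<phi> (?sl (f x) \<odot>\<^bsub>obj E q\<^esub> e) else 0)" for p x e
  have rep: "\<exists>a. f x = lam n a" if "x \<in> carrier (obj P i)" for x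
    using f[OF that] by (auto simp: carrier_Lam)
  have closed: "?sl (f x) \<odot>\<^bsub>obj E q\<^esub> e \<in> carrier (obj E q)" if "x \<in> carrier (obj P i)" "e \<in> carrier (obj E q)" for x e
    using rep[OF that(1)] that(2) by (auto simp: sl)
  have \<beta>: "bform n P E S (i + q) \<beta>"
  proof (rule bformI)
    fix p r x e assume pr: "p + r = i + q" and x: "x \<in> carrier (obj P p)" and e: "e \<in> carrier (obj E r)"
    {
      fix y assume "y \<in> carrier (obj P p)"
      then show "\<beta> p (x \<oplus>\<^bsub>obj P p\<^esub> y) e = \<beta> p x e + \<beta> p y e"
        using pr x e rep[of x] rep[of y] \<phi>(1)
        by (auto simp: \<beta>_def f_add sl slice_add act_add[OF E.mod] simp flip: lam_add)
    next
      fix e' assume "e' \<in> carrier (obj E r)"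
      then show "\<beta> p x (e \<oplus>\<^bsub>obj E r\<^esub> e') = \<beta> p x e + \<beta> p x e'"
        using pr x e rep[of x] \<phi>(1) by (auto simp: \<beta>_def sl act_distr[OF E.mod])
    next
      fix c
      show "\<beta> p (lam n (cst c) \<odot>\<^bsub>obj P p\<^esub> x) e = c * \<beta> p x e"
        using pr x e rep[of x] \<phi>(2) by (auto simp: \<beta>_def f_act sl slice_cst act_mult[OF E.mod] simp flip: lam_mult)
      have "lam n a \<odot>\<^bsub>obj E q\<^esub> (lam n (cst c) \<odot>\<^bsub>obj E q\<^esub> e) = lam n (cst c) \<odot>\<^bsub>obj E q\<^esub> (lam n a \<odot>\<^bsub>obj E q\<^esub> e)"
        if "e \<in> carrier (obj E q)" for a
        using that act_mult[OF E.mod, of e q a "cst c"] act_mult[OF E.mod, of e q "cst c" a] by (simp add: mult.commute)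
      then show "\<beta> p x (lam n (cst c) \<odot>\<^bsub>obj E r\<^esub> e) = c * \<beta> p x e"
        using pr x e rep[of x] \<phi>(2) by (auto simp: \<beta>_def sl)
    next
      fix s assume s: "S \<le> s"
      have "lam n a \<odot>\<^bsub>obj E q\<^esub> (lam n (var s) \<odot>\<^bsub>obj E q\<^esub> e) = lam n (var s * a) \<odot>\<^bsub>obj E q\<^esub> e"
        if "e \<in> carrier (obj E q)" for a
        using that act_mult[OF E.mod, of e q a "var s"] by (simp add: mult.commute)
      then show "\<beta> p (lam n (var s) \<odot>\<^bsub>obj P p\<^esub> x) e = \<beta> p x (lam n (var s) \<odot>\<^bsub>obj E r\<^esub> e)"
        using pr x e rep[of x] by (auto simp: \<beta>_def f_act sl slice_var[OF s] simp flip: lam_mult)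
    }
  qed
  have \<phi>0: "\<phi> \<zero>\<^bsub>obj E q\<^esub> = 0" using \<phi>(3) by simp
  have "form_eq P E (i + q - 1) (delta P E (i + q - 1) \<beta>) (\<lambda>p x e. 0)"
  proof (rule form_eqI)
    fix p r x e assume pr: "p + r = i + q - 1" and x: "x \<in> carrier (obj P p)" and e: "e \<in> carrier (obj E r)"
    have "\<beta> (p + 1) (diff P p x) e = 0"
    proof (cases "p + 1 = i")
      case True
      then have "f (diff P p x) = lam n 0" using f_bd[OF P.coboundaryI[OF x]] by (simp add: lam_zero)
      moreover have "?s (0 :: 'k inf_poly) = 0" by (rule poly_mapping_eqI) (simp add: lookup_slice)
      moreover have "r = q" using pr True by simp
      ultimately show ?thesis using True e \<phi>0 by (simp add: \<beta>_def sl act_zero[OF E.mod])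
    qed (simp add: \<beta>_def)
    moreover have "\<beta> p x (diff E r e) = 0"
    proof (cases "p = i")
      case True
      then have r: "r + 1 = q" using pr by simp
      obtain a where a: "f x = lam n a" using rep x True by blast
      have "lam n (?s a) \<odot>\<^bsub>obj E q\<^esub> diff E r e \<in> coboundaries E q"
        using E.coboundary_act[OF E.coboundaryI[OF e r]] .
      then show ?thesis using \<phi>(3) True by (simp add: \<beta>_def a sl)
    qed (simp add: \<beta>_def)
    ultimately show "delta P E (i + q - 1) \<beta> p x e = 0" by (simp add: delta_eq[OF pr])
  qed
  then obtain \<gamma> where \<gamma>: "bform n P E S (i + q + 1) \<gamma>" "form_eq P E (i + q) \<beta> (delta P E (i + q) \<gamma>)"
    using exact[of S] \<beta> unfolding forms_exact_def by blast
  have "\<beta> i z e = \<gamma> (i + 1) (diff P i z) e + (if even i then \<gamma> i z (diff E q e) else - \<gamma> i z (diff E q e))"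
    using form_eqD[OF \<gamma>(2) _ z' e'] by (simp add: delta_eq[of i q])
  also have "\<dots> = 0"
    using z e z' e' forms_zero_left[OF \<gamma>(1), of "i + 1" q e] forms_zero_right[OF \<gamma>(1), of i "q + 1" z]
    by (simp add: P.cocycle_iff E.cocycle_iff)
  finally have "\<beta> i z e = 0" .
  moreover have "\<beta> i z e = Poly_Mapping.lookup g \<mu>"
    using \<phi>(2,4) e' by (simp add: \<beta>_def g sl slice_g)
  ultimately show False using \<mu>(2) by simp
qed

end

section \<open>Homogeneous components\<close>

lemma additive_finsum:
  assumes "abelian_group M" "abelian_group N" and c: "\<And>j. c j \<in> carrier M"
    and t: "\<And>x. x \<in> carrier M \<Longrightarrow> t x \<in> carrier N"
      "\<And>x y. x \<in> carrier M \<Longrightarrow> y \<in> carrier M \<Longrightarrow> t (x \<oplus>\<^bsub>M\<^esub> y) = t x \<oplus>\<^bsub>N\<^esub> t y"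
    and "finite A"
  shows "t (\<Oplus>\<^bsub>M\<^esub>j\<in>A. c j) = (\<Oplus>\<^bsub>N\<^esub>j\<in>A. t (c j))"
proof -
  interpret M: abelian_group M by fact
  interpret N: abelian_group N by fact
  show ?thesis using \<open>finite A\<close>
  proof (induction A)
    case empty
    show ?case by (simp add: additive_zero[OF assms(1,2) t])
  next
    case (insert j A)
    have "(\<Oplus>\<^bsub>M\<^esub>i\<in>insert j A. c i) = c j \<oplus>\<^bsub>M\<^esub> (\<Oplus>\<^bsub>M\<^esub>i\<in>A. c i)"
      using insert.hyps c by (intro M.finsum_insert) auto
    moreover have "(\<Oplus>\<^bsub>N\<^esub>i\<in>insert j A. t (c i)) = t (c j) \<oplus>\<^bsub>N\<^esub> (\<Oplus>\<^bsub>N\<^esub>i\<in>A. t (c i))"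
      using insert.hyps c t(1) by (intro N.finsum_insert) auto
    ultimately show ?case using insert.IH c t by (simp add: M.finsum_closed)
  qed
qed

lemma additive_finsum_sum:
  fixes F :: "'m \<Rightarrow> 'k::field"
  assumes "abelian_group M" and c: "\<And>j. c j \<in> carrier M"
    and F: "\<And>x y. x \<in> carrier M \<Longrightarrow> y \<in> carrier M \<Longrightarrow> F (x \<oplus>\<^bsub>M\<^esub> y) = F x + F y"
    and "finite A"
  shows "F (\<Oplus>\<^bsub>M\<^esub>j\<in>A. c j) = (\<Sum>j\<in>A. F (c j))"
proof -
  interpret M: abelian_group M by fact
  have "F \<zero>\<^bsub>M\<^esub> = F \<zero>\<^bsub>M\<^esub> + F \<zero>\<^bsub>M\<^esub>"
    using F[OF M.zero_closed M.zero_closed] unfolding M.l_zero[OF M.zero_closed] .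
  then have F0: "F \<zero>\<^bsub>M\<^esub> = 0" unfolding add_cancel_right_right .
  show ?thesis using \<open>finite A\<close>
  proof (induction A)
    case (insert j A)
    have "(\<Oplus>\<^bsub>M\<^esub>i\<in>insert j A. c i) = c j \<oplus>\<^bsub>M\<^esub> (\<Oplus>\<^bsub>M\<^esub>i\<in>A. c i)"
      using insert.hyps c by (intro M.finsum_insert) auto
    then show ?case using insert c F by (simp add: M.finsum_closed)
  qed (simp add: F0)
qed

definition hcomp :: "('a, 'm) gmodule \<Rightarrow> 'm \<Rightarrow> int \<Rightarrow> 'm" where
  "hcomp M x = (THE c. (\<forall>j. c j \<in> grade M j) \<and> finite {j. c j \<noteq> \<zero>\<^bsub>M\<^esub>} \<and>
        x = (\<Oplus>\<^bsub>M\<^esub>j\<in>{j. c j \<noteq> \<zero>\<^bsub>M\<^esub>}. c j))"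

locale gm =
  fixes n :: "nat \<Rightarrow> nat" and M :: "('k::field lam, 'm) gmodule"
  assumes gm: "graded_module n M"
begin

lemma mod: "Module.module (Lam n) M"
  using gm by (simp add: graded_module_def)

sublocale A: abelian_group M
  by (rule module_group[OF mod])

lemma grade_subgroup: "additive_subgroup (grade M j) M"
  using gm by (simp add: graded_module_def)

lemma grade_closed: "x \<in> grade M j \<Longrightarrow> x \<in> carrier M"
  using additive_subgroup.a_subset[OF grade_subgroup] by blast

lemma grade_zero [simp]: "\<zero>\<^bsub>M\<^esub> \<in> grade M j"
  by (rule additive_subgroup.zero_closed[OF grade_subgroup])

lemma grade_add: "x \<in> grade M j \<Longrightarrow> y \<in> grade M j \<Longrightarrow> x \<oplus>\<^bsub>M\<^esub> y \<in> grade M j"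
  by (rule additive_subgroup.a_closed[OF grade_subgroup])

lemma grade_uminus: "x \<in> grade M j \<Longrightarrow> \<ominus>\<^bsub>M\<^esub> x \<in> grade M j"
  using additive_subgroup.a_subgroup[OF grade_subgroup] subgroup.m_inv_closed
  by (fastforce simp: a_inv_def)

lemma grade_act: "a \<in> Lam_grade n d \<Longrightarrow> x \<in> grade M j \<Longrightarrow> a \<odot>\<^bsub>M\<^esub> x \<in> grade M (d + j)"
  using gm by (simp add: graded_module_def)

lemma hcomp_ex1: "x \<in> carrier M \<Longrightarrow> \<exists>!c. (\<forall>j. c j \<in> grade M j) \<and> finite {j. c j \<noteq> \<zero>\<^bsub>M\<^esub>} \<and>
        x = (\<Oplus>\<^bsub>M\<^esub>j\<in>{j. c j \<noteq> \<zero>\<^bsub>M\<^esub>}. c j)"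
  using gm unfolding graded_module_def by (elim conjE bspec)

lemma hcomp:
  assumes "x \<in> carrier M"
  shows hcomp_grade: "hcomp M x j \<in> grade M j" and hcomp_finite: "finite {j. hcomp M x j \<noteq> \<zero>\<^bsub>M\<^esub>}"
    and hcomp_sum: "x = (\<Oplus>\<^bsub>M\<^esub>j\<in>{j. hcomp M x j \<noteq> \<zero>\<^bsub>M\<^esub>}. hcomp M x j)"
  using theI'[OF hcomp_ex1[OF assms]] unfolding hcomp_def[symmetric] by blast+

lemma hcomp_closed: "x \<in> carrier M \<Longrightarrow> hcomp M x j \<in> carrier M"
  by (rule grade_closed[OF hcomp_grade])

lemma hcomp_unique:
  assumes c: "\<And>j. c j \<in> grade M j" and A: "finite A" "\<And>j. j \<notin> A \<Longrightarrow> c j = \<zero>\<^bsub>M\<^esub>"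
    and x: "x = (\<Oplus>\<^bsub>M\<^esub>j\<in>A. c j)"
  shows "hcomp M x = c"
proof -
  have cc: "c j \<in> carrier M" for j by (rule grade_closed[OF c])
  have xc: "x \<in> carrier M" unfolding x using cc by (simp add: A.finsum_closed)
  have sub: "{j. c j \<noteq> \<zero>\<^bsub>M\<^esub>} \<subseteq> A" using A(2) by blast
  have "(\<Oplus>\<^bsub>M\<^esub>j\<in>{j. c j \<noteq> \<zero>\<^bsub>M\<^esub>}. c j) = x"
    unfolding x using sub A cc by (intro A.add.finprod_mono_neutral_cong_left) auto
  then have "(\<forall>j. c j \<in> grade M j) \<and> finite {j. c j \<noteq> \<zero>\<^bsub>M\<^esub>} \<and> x = (\<Oplus>\<^bsub>M\<^esub>j\<in>{j. c j \<noteq> \<zero>\<^bsub>M\<^esub>}. c j)"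
    using c finite_subset[OF sub A(1)] by simp
  then show ?thesis unfolding hcomp_def by (rule the1_equality[OF hcomp_ex1[OF xc]])
qed

lemma hcomp_sum_superset:
  assumes x: "x \<in> carrier M" and A: "finite A" "{j. hcomp M x j \<noteq> \<zero>\<^bsub>M\<^esub>} \<subseteq> A"
  shows "x = (\<Oplus>\<^bsub>M\<^esub>j\<in>A. hcomp M x j)"
proof -
  have "(\<Oplus>\<^bsub>M\<^esub>j\<in>{j. hcomp M x j \<noteq> \<zero>\<^bsub>M\<^esub>}. hcomp M x j) = (\<Oplus>\<^bsub>M\<^esub>j\<in>A. hcomp M x j)"
    using A hcomp_closed[OF x] by (intro A.add.finprod_mono_neutral_cong_left) auto
  then show ?thesis using hcomp_sum[OF x] by simp
qed

lemma hcomp_add: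
  assumes x: "x \<in> carrier M" and y: "y \<in> carrier M"
  shows "hcomp M (x \<oplus>\<^bsub>M\<^esub> y) j = hcomp M x j \<oplus>\<^bsub>M\<^esub> hcomp M y j"
proof -
  define A where "A = {j. hcomp M x j \<noteq> \<zero>\<^bsub>M\<^esub>} \<union> {j. hcomp M y j \<noteq> \<zero>\<^bsub>M\<^esub>}"
  have fin: "finite A" using hcomp_finite[OF x] hcomp_finite[OF y] by (simp add: A_def)
  have out: "hcomp M x i = \<zero>\<^bsub>M\<^esub> \<and> hcomp M y i = \<zero>\<^bsub>M\<^esub>" if "i \<notin> A" for i using that by (simp add: A_def)
  have "hcomp M (x \<oplus>\<^bsub>M\<^esub> y) = (\<lambda>j. hcomp M x j \<oplus>\<^bsub>M\<^esub> hcomp M y j)"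
  proof (rule hcomp_unique[OF _ fin])
    show "x \<oplus>\<^bsub>M\<^esub> y = (\<Oplus>\<^bsub>M\<^esub>j\<in>A. hcomp M x j \<oplus>\<^bsub>M\<^esub> hcomp M y j)"
      using hcomp_sum_superset[OF x fin] hcomp_sum_superset[OF y fin] hcomp_closed[OF x] hcomp_closed[OF y]
      by (subst A.finsum_addf) (auto simp: A_def)
  qed (use out x y in \<open>auto intro: grade_add hcomp_grade\<close>)
  then show ?thesis by simp
qed

lemma hcomp_homogeneous: "x \<in> grade M i \<Longrightarrow> hcomp M x j = (if j = i then x else \<zero>\<^bsub>M\<^esub>)"
  by (subst hcomp_unique[where A = "{i}" and c = "\<lambda>j. if j = i then x else \<zero>\<^bsub>M\<^esub>"]) (auto simp: grade_closed)

end

lemma hcomp_hom: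
  assumes M: "graded_module n M" and N: "graded_module n N"
    and t: "\<And>x. x \<in> carrier M \<Longrightarrow> t x \<in> carrier N"
      "\<And>x y. x \<in> carrier M \<Longrightarrow> y \<in> carrier M \<Longrightarrow> t (x \<oplus>\<^bsub>M\<^esub> y) = t x \<oplus>\<^bsub>N\<^esub> t y"
      "\<And>j x. x \<in> grade M j \<Longrightarrow> t x \<in> grade N (j + w)"
    and x: "x \<in> carrier M"
  shows "hcomp N (t x) (j + w) = t (hcomp M x j)"
proof -
  interpret M: gm n M using M by (simp add: gm_def)
  interpret N: gm n N using N by (simp add: gm_def)
  have t0: "t \<zero>\<^bsub>M\<^esub> = \<zero>\<^bsub>N\<^esub>" by (rule additive_zero[OF M.A.abelian_group_axioms N.A.abelian_group_axioms t(1,2)])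
  define A where "A = {j. hcomp M x j \<noteq> \<zero>\<^bsub>M\<^esub>}"
  have fin: "finite A" unfolding A_def by (rule M.hcomp_finite[OF x])
  have "hcomp N (t x) = (\<lambda>j. t (hcomp M x (j - w)))"
  proof (rule N.hcomp_unique)
    show "t (hcomp M x (j - w)) \<in> grade N j" for j using t(3)[OF M.hcomp_grade[OF x], of "j - w"] by simp
    show "finite ((\<lambda>j. j + w) ` A)" using fin by simp
    show "t (hcomp M x (j - w)) = \<zero>\<^bsub>N\<^esub>" if "j \<notin> (\<lambda>j. j + w) ` A" for j
    proof -
      have "j - w \<notin> A" using that by (auto intro: rev_image_eqI)
      then show ?thesis using t0 by (simp add: A_def)
    qed
    have "t x = (\<Oplus>\<^bsub>N\<^esub>j\<in>A. t (hcomp M x j))"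
      using trans[OF arg_cong[where f = t, OF M.hcomp_sum[OF x]]
          additive_finsum[OF M.A.abelian_group_axioms N.A.abelian_group_axioms M.hcomp_closed[OF x] t(1,2) fin[unfolded A_def]]]
      by (simp only: A_def)
    also have "\<dots> = (\<Oplus>\<^bsub>N\<^esub>j\<in>(\<lambda>j. j + w) ` A. t (hcomp M x (j - w)))"
      using M.hcomp_closed[OF x] t(1) by (subst N.A.add.finprod_reindex) (auto simp: inj_on_def)
    finally show "t x = (\<Oplus>\<^bsub>N\<^esub>j\<in>(\<lambda>j. j + w) ` A. t (hcomp M x (j - w)))" .
  qed
  then show ?thesis by simp
qed

section \<open>Coefficients in \<open>\<Lambda>\<close>\<close>

lemma coef_add: "a \<in> carrier (Lam n) \<Longrightarrow> b \<in> carrier (Lam n) \<Longrightarrow> coef n (a \<oplus>\<^bsub>Lam n\<^esub> b) m = coef n a m + coef n b m"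
  by (auto simp: carrier_Lam coef_lam lookup_add simp flip: lam_add)

lemma box_diff: "m \<in> box n \<Longrightarrow> m - t \<in> box n"
  by (fastforce simp: box_def lookup_minus intro: le_less_trans[OF diff_le_self])

lemma coef_single_mult:
  assumes "a \<in> carrier (Lam n)" "m \<in> box n"
  shows "coef n (lam n (Poly_Mapping.single t c) \<otimes>\<^bsub>Lam n\<^esub> a) m =
    (if \<forall>s. Poly_Mapping.lookup t s \<le> Poly_Mapping.lookup m s then c * coef n a (m - t) else 0)"
  using assms box_diff[OF assms(2), of t]
  by (auto simp: carrier_Lam coef_lam lookup_single_mult simp flip: lam_mult)

lemma coef_zero [simp]: "coef n \<zero>\<^bsub>Lam n\<^esub> m = (0 :: 'k::field)"
  by (simp add: coef_lam flip: lam_zero)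

lemma Lam_grade_iff:
  fixes a :: "'k::field lam"
  shows "a \<in> Lam_grade n d \<longleftrightarrow> a \<in> carrier (Lam n) \<and> (\<forall>m. coef n a m \<noteq> 0 \<longrightarrow> int (weight m) = d)"
proof
  assume "a \<in> Lam_grade n d"
  then obtain p where "a = lam n p" "p \<in> homogeneous_polys d" by (auto simp: Lam_grade_def lam_def)
  then show "a \<in> carrier (Lam n) \<and> (\<forall>m. coef n a m \<noteq> 0 \<longrightarrow> int (weight m) = d)"
    by (auto simp: coef_lam homogeneous_polys_def in_keys_iff split: if_splits)
next
  assume a: "a \<in> carrier (Lam n) \<and> (\<forall>m. coef n a m \<noteq> 0 \<longrightarrow> int (weight m) = d)"
  then obtain p where p: "a = lam n p" by (auto simp: carrier_Lam)
  define q where "q = (\<Sum>m\<in>{m \<in> Poly_Mapping.keys p. int (weight m) = d}. Poly_Mapping.single m (Poly_Mapping.lookup p m))"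
  have q: "Poly_Mapping.lookup q m = (if int (weight m) = d then Poly_Mapping.lookup p m else 0)" for m
    by (auto simp: q_def lookup_sum lookup_single when_def in_keys_iff)
  have "Poly_Mapping.lookup p m = Poly_Mapping.lookup q m" if "m \<in> box n" for m
  proof -
    have "coef n a m = Poly_Mapping.lookup p m" using that by (simp add: p coef_lam)
    then show ?thesis
      using conjunct2[OF a, rule_format, of m] by (cases "int (weight m) = d") (auto simp: q)
  qed
  then have "a = lam n q" unfolding p lam_eq_iff by blast
  moreover have "q \<in> homogeneous_polys d" by (auto simp: homogeneous_polys_def in_keys_iff q split: if_splits)
  ultimately show "a \<in> Lam_grade n d" by (auto simp: Lam_grade_def lam_def)
qed

lemma weight_superset: "finite A \<Longrightarrow> Poly_Mapping.keys m \<subseteq> A \<Longrightarrow> weight m = (\<Sum>s\<in>A. Poly_Mapping.lookup m s * 2 ^ (s + 1))"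
  unfolding weight_def by (intro sum.mono_neutral_left) (auto simp: in_keys_iff)

lemma weight_add: "weight (m + m') = weight m + weight m'"
proof -
  let ?A = "Poly_Mapping.keys m \<union> Poly_Mapping.keys m'"
  have "Poly_Mapping.keys (m + m') \<subseteq> ?A" by (auto simp: in_keys_iff lookup_add)
  then show ?thesis by (simp add: weight_superset[where A = ?A] lookup_add add_mult_distrib sum.distrib)
qed

text \<open>The degrees of the variables tend to infinity, so only finitely many monomials share a degree. For that
  reason a family of coefficients that is prescribed degree by degree defines an element of \<open>\<Lambda>\<close>.\<close>

lemma finite_weight: "finite {m. weight m = q}"
proof -
  let ?F = "{f :: nat \<Rightarrow> nat. \<forall>s. (s \<in> {..q} \<longrightarrow> f s \<in> {..q}) \<and> (s \<notin> {..q} \<longrightarrow> f s = 0)}"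
  have "Poly_Mapping.lookup m \<in> ?F" if "weight m = q" for m
  proof -
    have le: "Poly_Mapping.lookup m s * 2 ^ (s + 1) \<le> q" for s
    proof (cases "s \<in> Poly_Mapping.keys m")
      case True
      then show ?thesis using member_le_sum[of s "Poly_Mapping.keys m" "\<lambda>s. Poly_Mapping.lookup m s * 2 ^ (s + 1)"] that
        by (simp add: weight_def)
    qed (simp add: in_keys_iff)
    have bound: "Poly_Mapping.lookup m s \<le> q" for s
    proof -
      have "Poly_Mapping.lookup m s * 1 \<le> Poly_Mapping.lookup m s * 2 ^ (s + 1)" by (rule mult_le_mono2) simp
      from order_trans[OF this le[of s]] show ?thesis by (simp only: mult_1_right)
    qed
    have high: "Poly_Mapping.lookup m s = 0" if "q < s" for s
    proof (rule ccontr)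
      assume "Poly_Mapping.lookup m s \<noteq> 0"
      then have "1 * 2 ^ (s + 1) \<le> Poly_Mapping.lookup m s * 2 ^ (s + 1)" by (intro mult_le_mono1) simp
      from order_trans[OF this le[of s]] have "2 ^ (s + 1) \<le> q" by (simp only: mult_1_left)
      moreover have "s + 1 < 2 ^ (s + 1)" by (rule less_exp)
      ultimately show False using \<open>q < s\<close> by linarith
    qed
    show ?thesis using bound high by (simp add: not_le)
  qed
  then have "{m. weight m = q} \<subseteq> Poly_Mapping.lookup -` ?F" by (intro subsetI vimageI2) blast
  moreover have "finite (Poly_Mapping.lookup -` ?F :: (nat \<Rightarrow>\<^sub>0 nat) set)"
  proof (rule finite_vimageI)
    show "finite ?F" by (rule finite_set_of_finite_funs) simp_all
    show "inj (Poly_Mapping.lookup :: (nat \<Rightarrow>\<^sub>0 nat) \<Rightarrow> nat \<Rightarrow> nat)"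
      by (rule injI) (simp only: poly_mapping_eq_iff)
  qed
  ultimately show ?thesis by (rule finite_subset)
qed

lemma single_grade: "lam n (Poly_Mapping.single m c) \<in> Lam_grade n (int (weight m))"
  unfolding Lam_grade_iff
proof (intro conjI allI impI lam_closed)
  fix m' assume "coef n (lam n (Poly_Mapping.single m c)) m' \<noteq> 0"
  then have "m = m'" unfolding coef_lam lookup_single when_def by presburger
  then show "int (weight m') = int (weight m)" by simp
qed

section \<open>\<open>\<Lambda>\<close> is injective as a graded module\<close>

definition socle :: "(nat \<Rightarrow> nat) \<Rightarrow> nat \<Rightarrow> (nat \<Rightarrow>\<^sub>0 nat)" where
  "socle n L = (\<Sum>s<L. Poly_Mapping.single s (n (Suc s) - 1))"

lemma lookup_socle: "Poly_Mapping.lookup (socle n L) s = (if s < L then n (Suc s) - 1 else 0)"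
  by (simp add: socle_def lookup_sum lookup_single when_def)

lemma le_socle:
  assumes "\<mu> \<in> box n" "Poly_Mapping.keys \<mu> \<subseteq> {..<L}"
  shows "Poly_Mapping.lookup \<mu> s \<le> Poly_Mapping.lookup (socle n L) s"
proof (cases "s < L")
  case True
  have "Poly_Mapping.lookup \<mu> s < n (Suc s)" using assms(1) by (simp add: box_def)
  then show ?thesis using True by (simp add: lookup_socle)
next
  case False
  then have "s \<notin> Poly_Mapping.keys \<mu>" using assms(2) by auto
  then show ?thesis by (simp add: in_keys_iff)
qed

lemma socle_box:
  assumes "\<And>i. 1 \<le> n (Suc i)"
  shows "socle n L \<in> box n"
proof -
  have "0 < n (Suc s)" for s using assms[of s] by simp
  then show ?thesis by (simp add: box_def lookup_socle)
qed

lemma coef_socle: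
  assumes n: "\<And>i. 1 \<le> n (Suc i)" and \<mu>: "\<mu> \<in> box n" "Poly_Mapping.keys \<mu> \<subseteq> {..<L}" and a: "a \<in> carrier (Lam n)"
  shows "coef n (lam n (Poly_Mapping.single (socle n L - \<mu>) c) \<otimes>\<^bsub>Lam n\<^esub> a) (socle n L) = c * coef n a \<mu>"
proof -
  have "socle n L - (socle n L - \<mu>) = \<mu>"
    using le_socle[OF \<mu>] by (intro poly_mapping_eqI) (simp add: lookup_minus)
  then show ?thesis using coef_single_mult[OF a socle_box[where n = n, OF n], where t = "socle n L - \<mu>" and c = c]
    by (simp add: lookup_minus)
qed

lemma hcomp_act:
  fixes M :: "('k::field lam, 'm) gmodule"
  assumes M: "graded_module n M" and x: "x \<in> carrier M"
  shows "hcomp M (lam n (Poly_Mapping.single t c) \<odot>\<^bsub>M\<^esub> x) (j + int (weight t)) =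
    lam n (Poly_Mapping.single t c) \<odot>\<^bsub>M\<^esub> hcomp M x j"
proof -
  interpret gm n M using M by (simp add: gm_def)
  show ?thesis
    using grade_act[OF single_grade] x
    by (intro hcomp_hom[OF M M]) (simp_all add: act_closed[OF mod] act_distr[OF mod] add.commute)
qed

lemma socle_shift:
  assumes n: "\<And>i. 1 \<le> n (Suc i)" and \<mu>: "\<mu> \<in> box n" "Poly_Mapping.keys \<mu> \<subseteq> {..<L}" and s: "s < L"
  shows "1 \<le> Poly_Mapping.lookup \<mu> s \<Longrightarrow> socle n L - \<mu> + evar s = socle n L - (\<mu> - evar s)"
    and "Poly_Mapping.lookup \<mu> s = 0 \<Longrightarrow> lam n (Poly_Mapping.single (socle n L - \<mu> + evar s) c) = lam n (0 :: 'k::field inf_poly)"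
proof -
  show "socle n L - \<mu> + evar s = socle n L - (\<mu> - evar s)" if "1 \<le> Poly_Mapping.lookup \<mu> s"
  proof (rule poly_mapping_eqI)
    fix i
    show "Poly_Mapping.lookup (socle n L - \<mu> + evar s) i = Poly_Mapping.lookup (socle n L - (\<mu> - evar s)) i"
      using le_socle[OF \<mu>, of i] that by (auto simp: lookup_add lookup_minus lookup_single when_def)
  qed
  assume "Poly_Mapping.lookup \<mu> s = 0"
  then have "\<not> Poly_Mapping.lookup (socle n L - \<mu> + evar s) s < n (Suc s)"
    using s n[of s] by (simp add: lookup_add lookup_minus lookup_socle)
  then have "socle n L - \<mu> + evar s \<notin> box n" by (auto simp: box_def)
  then show "lam n (Poly_Mapping.single (socle n L - \<mu> + evar s) c) = lam n (0 :: 'k inf_poly)"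
    by (auto simp: lam_eq_iff lookup_single when_def)
qed

text \<open>For \<open>\<Lambda>\<close> as a module over itself, the coefficient of \<open>\<mu>\<close> in \<open>a\<close> is the coefficient of the
  socle monomial \<open>\<sigma>\<^sub>L\<close>, the product of the top powers of the variables below the slot \<open>L\<close>, in
  \<open>(\<sigma>\<^sub>L / \<mu>) a\<close>, for all large \<open>L\<close>. A homomorphism into \<open>\<Lambda>\<close> is thereby the same as a compatible
  family of functionals on the homogeneous parts in the degrees of the \<open>\<sigma>\<^sub>L\<close>, that is, a functional on
  their colimit along the multiplications by \<open>\<sigma>\<^sub>L\<^sub>+\<^sub>1 / \<sigma>\<^sub>L\<close>. Directed colimits are exact and functionals extend,
  so homomorphisms into \<open>\<Lambda>\<close> extend. In the linear system below the unknown with index \<open>(\<mu>, w)\<close> is the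
  coefficient of \<open>\<mu>\<close> in the image of \<open>w\<close>, and \<open>I\<close> consists of the equations which hold far out in the
  colimit.\<close>

theorem Lam_injective:
  fixes K :: "('k::field lam, 'm) gmodule" and M :: "('k lam, 'l) gmodule"
  assumes n: "\<And>i. 1 \<le> n (Suc i)" and K: "graded_module n K" and M: "graded_module n M"
    and d: "d \<in> graded_hom n K M" and f: "f \<in> graded_hom n K (Lam_module n)"
    and kernel: "\<And>x. x \<in> carrier K \<Longrightarrow> d x = \<zero>\<^bsub>M\<^esub> \<Longrightarrow> f x = \<zero>\<^bsub>Lam n\<^esub>"
  shows "\<exists>h\<in>graded_hom n M (Lam_module n). \<forall>x\<in>carrier K. h (d x) = f x"
proof -
  interpret K: gm n K using K by (simp add: gm_def)
  interpret M: gm n M using M by (simp add: gm_def)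
  note d_closed = graded_hom_closed[OF d] and d_add = graded_hom_add[OF d] and d_act = graded_hom_act[OF d]
    and d_grade = graded_hom_grade[OF d]
  have f_closed: "f x \<in> carrier (Lam n)" if "x \<in> carrier K" for x
    using graded_hom_closed[OF f that] by (simp add: Lam_module_def)
  have f_add: "f (x \<oplus>\<^bsub>K\<^esub> y) = f x \<oplus>\<^bsub>Lam n\<^esub> f y" if "x \<in> carrier K" "y \<in> carrier K" for x y
    using graded_hom_add[OF f that] by (simp add: Lam_module_def)
  have f_act: "f (lam n p \<odot>\<^bsub>K\<^esub> x) = lam n p \<otimes>\<^bsub>Lam n\<^esub> f x" if "x \<in> carrier K" for x p
    using graded_hom_act[OF f that] by (simp add: Lam_module_def)
  have f_grade: "f x \<in> Lam_grade n j" if "x \<in> grade K j" for x j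
    using graded_hom_grade[OF f that] by (simp add: Lam_module_def)
  have d0: "d \<zero>\<^bsub>K\<^esub> = \<zero>\<^bsub>M\<^esub>"
    by (rule additive_zero[OF K.A.abelian_group_axioms M.A.abelian_group_axioms d_closed d_add])
  have f0: "f \<zero>\<^bsub>K\<^esub> = \<zero>\<^bsub>Lam n\<^esub>" by (rule kernel) (simp_all add: d0)
  have coef_hcomp: "coef n (f (hcomp K x (int (weight \<mu>)))) \<mu> = coef n (f x) \<mu>" if x: "x \<in> carrier K" for x \<mu>
  proof -
    let ?A = "{j. hcomp K x j \<noteq> \<zero>\<^bsub>K\<^esub>}"
    have "coef n (f (\<Oplus>\<^bsub>K\<^esub>j\<in>?A. hcomp K x j)) \<mu> = (\<Sum>j\<in>?A. coef n (f (hcomp K x j)) \<mu>)"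
      by (rule additive_finsum_sum[OF K.A.abelian_group_axioms K.hcomp_closed[OF x] _ K.hcomp_finite[OF x]])
        (simp add: f_add coef_add f_closed)
    then have "coef n (f x) \<mu> = (\<Sum>j\<in>?A. coef n (f (hcomp K x j)) \<mu>)"
      unfolding K.hcomp_sum[OF x, symmetric] .
    also have "\<dots> = (\<Sum>j\<in>?A. if j = int (weight \<mu>) then coef n (f (hcomp K x (int (weight \<mu>)))) \<mu> else 0)"
    proof (intro sum.cong refl)
      fix j
      show "coef n (f (hcomp K x j)) \<mu> = (if j = int (weight \<mu>) then coef n (f (hcomp K x (int (weight \<mu>)))) \<mu> else 0)"
        using f_grade[OF K.hcomp_grade[OF x], of j] by (auto simp: Lam_grade_iff)
    qed
    also have "\<dots> = coef n (f (hcomp K x (int (weight \<mu>)))) \<mu>"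
      using K.hcomp_finite[OF x] by (auto simp: f0)
    finally show ?thesis by simp
  qed
  define t where "t L v a = (case v of (\<mu>, w) \<Rightarrow> if w \<in> carrier M \<and> \<mu> \<in> box n
      then lam n (Poly_Mapping.single (socle n L - \<mu>) a) \<odot>\<^bsub>M\<^esub> hcomp M w (int (weight \<mu>)) else \<zero>\<^bsub>M\<^esub>)"
    for L v and a :: 'k
  have t: "t L (\<mu>, w) a = lam n (Poly_Mapping.single (socle n L - \<mu>) a) \<odot>\<^bsub>M\<^esub> hcomp M w (int (weight \<mu>))"
    if "w \<in> carrier M" "\<mu> \<in> box n" for L \<mu> w a using that by (simp add: t_def)
  have terms: "gsum_terms M (t L)" for L
  proof (unfold_locales)
    fix v :: "(nat \<Rightarrow>\<^sub>0 nat) \<times> 'l" and a b :: 'k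
    obtain \<mu> w where v: "v = (\<mu>, w)" by (cases v)
    show "t L v a \<in> carrier M" "t L v (a + b) = t L v a \<oplus>\<^bsub>M\<^esub> t L v b"
      unfolding v t_def by (simp_all add: M.hcomp_closed act_closed[OF M.mod] single_add act_add[OF M.mod])
  qed
  note gsum_add = gsum_terms.gsum_add[OF terms] and gsum_diff = gsum_terms.gsum_diff[OF terms]
    and gsum_single = gsum_terms.gsum_single[OF terms] and gsum_zero = gsum_terms.gsum_zero[OF terms]
    and term_closed = gsum_terms.term_closed[OF terms]
  have gsum_scale: "gsum M (t L) (pscale a r) = lam n (cst a) \<odot>\<^bsub>M\<^esub> gsum M (t L) r" for L a r
  proof (induction r rule: poly_mapping_add_induct)
    case (add p q)
    then show ?case
      by (simp add: gsum_add act_distr[OF M.mod] gsum_terms.gsum_closed[OF terms])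
  next
    case (single v c)
    obtain \<mu> w where v: "v = (\<mu>, w)" by (cases v)
    have "t L v (a * c) = lam n (cst a) \<odot>\<^bsub>M\<^esub> t L v c"
      unfolding v t_def prod.case
      by (simp add: act_null[OF M.mod] M.hcomp_closed mult_single flip: act_mult[OF M.mod])
    then show ?case by (simp add: gsum_single)
  qed (simp add: gsum_zero act_null[OF M.mod])
  define I where "I = {(r, c :: 'k). \<exists>L0. \<forall>L\<ge>L0. \<exists>y\<in>carrier K. gsum M (t L) r = d y \<and> coef n (f y) (socle n L) = c}"
  have I0: "(r, 0) \<in> I" if "\<And>L. L0 \<le> L \<Longrightarrow> gsum M (t L) r = \<zero>\<^bsub>M\<^esub>" for r L0
    unfolding I_def using that d0 f0 by (auto intro!: exI[of _ L0] bexI[of _ "\<zero>\<^bsub>K\<^esub>"])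
  let ?single = "\<lambda>\<mu> x. Poly_Mapping.single (\<mu>, x) (1 :: 'k)"
  let ?add = "{(?single \<mu> (x \<oplus>\<^bsub>M\<^esub> y) - ?single \<mu> x - ?single \<mu> y, 0 :: 'k) |\<mu> x y.
      \<mu> \<in> box n \<and> x \<in> carrier M \<and> y \<in> carrier M}"
  let ?scale = "{(?single \<mu> (lam n (cst c) \<odot>\<^bsub>M\<^esub> x) - Poly_Mapping.single (\<mu>, x) c, 0 :: 'k) |\<mu> c x.
      \<mu> \<in> box n \<and> x \<in> carrier M}"
  let ?var1 = "{(?single \<mu> (lam n (var s) \<odot>\<^bsub>M\<^esub> x) - ?single (\<mu> - evar s) x, 0 :: 'k) |\<mu> s x.
      \<mu> \<in> box n \<and> x \<in> carrier M \<and> 1 \<le> Poly_Mapping.lookup \<mu> s}"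
  let ?var0 = "{(?single \<mu> (lam n (var s) \<odot>\<^bsub>M\<^esub> x), 0 :: 'k) |\<mu> s x.
      \<mu> \<in> box n \<and> x \<in> carrier M \<and> Poly_Mapping.lookup \<mu> s = 0}"
  let ?deg = "{(?single \<mu> x, 0 :: 'k) |\<mu> x j. \<mu> \<in> box n \<and> x \<in> grade M j \<and> j \<noteq> int (weight \<mu>)}"
  let ?ext = "{(?single \<mu> (d x), coef n (f x) \<mu>) |\<mu> x. \<mu> \<in> box n \<and> x \<in> carrier K}"
  let ?S = "?add \<union> ?scale \<union> ?var1 \<union> ?var0 \<union> ?deg \<union> ?ext"
  have var_t: "t L (\<mu>, lam n (var s) \<odot>\<^bsub>M\<^esub> x) 1 = lam n (mon (socle n L - \<mu> + evar s)) \<odot>\<^bsub>M\<^esub> hcomp M x (int (weight \<mu>) - int (weight (evar s)))"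
    if "\<mu> \<in> box n" "x \<in> carrier M" for L \<mu> s x
  proof -
    have "hcomp M (lam n (var s) \<odot>\<^bsub>M\<^esub> x) (int (weight \<mu>) - int (weight (evar s)) + int (weight (evar s)))
        = lam n (var s) \<odot>\<^bsub>M\<^esub> hcomp M x (int (weight \<mu>) - int (weight (evar s)))"
      by (rule hcomp_act[OF M that(2)])
    then show ?thesis
      using that by (simp add: t act_closed[OF M.mod] M.hcomp_closed mult_single flip: act_mult[OF M.mod])
  qed
  have keys_bound: "\<exists>L0. \<forall>L\<ge>L0. Poly_Mapping.keys \<mu> \<subseteq> {..<L} \<and> s < L" for \<mu> :: "nat \<Rightarrow>\<^sub>0 nat" and s
  proof -
    obtain m where "Poly_Mapping.keys \<mu> \<subseteq> {..<m}" using finite_nat_iff_bounded[of "Poly_Mapping.keys \<mu>"] by auto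
    then have "\<forall>L\<ge>max m (Suc s). Poly_Mapping.keys \<mu> \<subseteq> {..<L} \<and> s < L" by fastforce
    then show ?thesis by blast
  qed
  have "\<exists>\<phi>. \<forall>(r, c)\<in>?S. pair r \<phi> = c"
  proof (rule linear_system_solvable[where I = I])
    show "(0, 0) \<in> I" by (rule I0) (simp add: gsum_zero)
  next
    fix r c s e assume rc: "(r, c) \<in> I" "(s, e) \<in> I"
    obtain L0 where L0: "\<forall>L\<ge>L0. \<exists>y\<in>carrier K. gsum M (t L) r = d y \<and> coef n (f y) (socle n L) = c"
      using rc(1) unfolding I_def by blast
    obtain L1 where L1: "\<forall>L\<ge>L1. \<exists>y\<in>carrier K. gsum M (t L) s = d y \<and> coef n (f y) (socle n L) = e"
      using rc(2) unfolding I_def by blast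
    have "\<exists>y\<in>carrier K. gsum M (t L) (r + s) = d y \<and> coef n (f y) (socle n L) = c + e" if L: "max L0 L1 \<le> L" for L
    proof -
      obtain y where y: "y \<in> carrier K" "gsum M (t L) r = d y" "coef n (f y) (socle n L) = c" using L0 L by auto
      obtain z where z: "z \<in> carrier K" "gsum M (t L) s = d z" "coef n (f z) (socle n L) = e" using L1 L by auto
      show ?thesis
        using y z by (intro bexI[of _ "y \<oplus>\<^bsub>K\<^esub> z"]) (simp_all add: gsum_add d_add f_add coef_add f_closed)
    qed
    then show "(r + s, c + e) \<in> I" unfolding I_def by blast
  next
    fix a r c assume "(r, c) \<in> I"
    then obtain L0 where L0: "\<forall>L\<ge>L0. \<exists>y\<in>carrier K. gsum M (t L) r = d y \<and> coef n (f y) (socle n L) = c"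
      unfolding I_def by blast
    have "\<exists>y\<in>carrier K. gsum M (t L) (pscale a r) = d y \<and> coef n (f y) (socle n L) = a * c" if L: "L0 \<le> L" for L
    proof -
      obtain y where y: "y \<in> carrier K" "gsum M (t L) r = d y" "coef n (f y) (socle n L) = c" using L0 L by auto
      show ?thesis
        using y coef_single_mult[OF f_closed[OF y(1)] socle_box[where n = n, OF n], where t = 0 and c = a]
        by (intro bexI[of _ "lam n (cst a) \<odot>\<^bsub>K\<^esub> y"])
          (simp_all add: gsum_scale d_act f_act act_closed[OF K.mod])
    qed
    then show "(pscale a r, a * c) \<in> I" unfolding I_def by blast
  next
    show "(0, 1) \<notin> I"
    proof
      assume "(0, 1) \<in> I"
      then obtain L y where "y \<in> carrier K" "\<zero>\<^bsub>M\<^esub> = d y" "coef n (f y) (socle n L) = 1"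
        unfolding I_def using gsum_zero by auto
      then show False using kernel[of y] by simp
    qed
  next
    have "?add \<subseteq> I"
    proof clarify
      fix \<mu> x y assume \<mu>: "\<mu> \<in> box n" and xy: "x \<in> carrier M" "y \<in> carrier M"
      have "gsum M (t L) (?single \<mu> (x \<oplus>\<^bsub>M\<^esub> y) - ?single \<mu> x - ?single \<mu> y) = \<zero>\<^bsub>M\<^esub>" for L
      proof -
        have "t L (\<mu>, x \<oplus>\<^bsub>M\<^esub> y) 1 = t L (\<mu>, x) 1 \<oplus>\<^bsub>M\<^esub> t L (\<mu>, y) 1"
          using \<mu> xy by (simp add: t M.hcomp_add M.hcomp_closed act_distr[OF M.mod])
        moreover have "u \<oplus>\<^bsub>M\<^esub> v \<ominus>\<^bsub>M\<^esub> u \<ominus>\<^bsub>M\<^esub> v = \<zero>\<^bsub>M\<^esub>" if "u \<in> carrier M" "v \<in> carrier M" for u v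
          using that by (simp add: M.A.minus_eq M.A.a_comm[of u v] M.A.a_assoc M.A.r_neg)
        ultimately show ?thesis by (simp only: gsum_diff gsum_single term_closed)
      qed
      then show "(?single \<mu> (x \<oplus>\<^bsub>M\<^esub> y) - ?single \<mu> x - ?single \<mu> y, 0) \<in> I" by (rule I0)
    qed
    moreover have "?scale \<subseteq> I"
    proof clarify
      fix \<mu> c x assume \<mu>: "\<mu> \<in> box n" and x: "x \<in> carrier M"
      have "gsum M (t L) (?single \<mu> (lam n (cst c) \<odot>\<^bsub>M\<^esub> x) - Poly_Mapping.single (\<mu>, x) c) = \<zero>\<^bsub>M\<^esub>" for L
      proof -
        have "hcomp M (lam n (cst c) \<odot>\<^bsub>M\<^esub> x) j = lam n (cst c) \<odot>\<^bsub>M\<^esub> hcomp M x j" for j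
          using hcomp_act[OF M x, of 0 c j] by (simp add: weight_def)
        then have "t L (\<mu>, lam n (cst c) \<odot>\<^bsub>M\<^esub> x) 1 = t L (\<mu>, x) c"
          using \<mu> x by (simp add: t M.hcomp_closed act_closed[OF M.mod] mult_single flip: act_mult[OF M.mod])
        then show ?thesis by (simp add: gsum_diff gsum_single term_closed M.A.minus_eq M.A.r_neg)
      qed
      then show "(?single \<mu> (lam n (cst c) \<odot>\<^bsub>M\<^esub> x) - Poly_Mapping.single (\<mu>, x) c, 0) \<in> I" by (rule I0)
    qed
    moreover have "?var1 \<subseteq> I"
    proof clarify
      fix \<mu> s x assume \<mu>: "\<mu> \<in> box n" and x: "x \<in> carrier M" and s: "1 \<le> Poly_Mapping.lookup \<mu> s"
      obtain L0 where L0: "\<forall>L\<ge>L0. Poly_Mapping.keys \<mu> \<subseteq> {..<L} \<and> s < L" using keys_bound by blast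
      have w: "int (weight \<mu>) - int (weight (evar s)) = int (weight (\<mu> - evar s))"
      proof -
        have "\<mu> = (\<mu> - evar s) + evar s"
          using s by (intro poly_mapping_eqI) (auto simp: lookup_add lookup_minus lookup_single when_def)
        then have "weight \<mu> = weight (\<mu> - evar s) + weight (evar s)" by (metis weight_add)
        then show ?thesis by simp
      qed
      have "gsum M (t L) (?single \<mu> (lam n (var s) \<odot>\<^bsub>M\<^esub> x) - ?single (\<mu> - evar s) x) = \<zero>\<^bsub>M\<^esub>" if "L0 \<le> L" for L
      proof -
        have "t L (\<mu>, lam n (var s) \<odot>\<^bsub>M\<^esub> x) 1 = t L (\<mu> - evar s, x) 1"
          using L0 that socle_shift(1)[where n = n, OF n \<mu> _ _ s, of L] unfolding var_t[OF \<mu> x] w t[OF x box_diff[OF \<mu>]] by simp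
        then show ?thesis by (simp add: gsum_diff gsum_single term_closed M.A.minus_eq M.A.r_neg)
      qed
      then show "(?single \<mu> (lam n (var s) \<odot>\<^bsub>M\<^esub> x) - ?single (\<mu> - evar s) x, 0) \<in> I" by (rule I0)
    qed
    moreover have "?var0 \<subseteq> I"
    proof clarify
      fix \<mu> s x assume \<mu>: "\<mu> \<in> box n" and x: "x \<in> carrier M" and s: "Poly_Mapping.lookup \<mu> s = 0"
      obtain L0 where L0: "\<forall>L\<ge>L0. Poly_Mapping.keys \<mu> \<subseteq> {..<L} \<and> s < L" using keys_bound by blast
      have "gsum M (t L) (?single \<mu> (lam n (var s) \<odot>\<^bsub>M\<^esub> x)) = \<zero>\<^bsub>M\<^esub>" if "L0 \<le> L" for L
        using L0 that socle_shift(2)[where n = n and c = "1 :: 'k", OF n \<mu> _ _ s, of L]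
        unfolding gsum_single var_t[OF \<mu> x] by (simp add: act_zero[OF M.mod] M.hcomp_closed x)
      then show "(?single \<mu> (lam n (var s) \<odot>\<^bsub>M\<^esub> x), 0) \<in> I" by (rule I0)
    qed
    moreover have "?deg \<subseteq> I"
    proof clarify
      fix \<mu> x j assume "\<mu> \<in> box n" "x \<in> grade M j" "j \<noteq> int (weight \<mu>)"
      then show "(?single \<mu> x, 0) \<in> I"
        by (intro I0) (simp add: gsum_single t M.grade_closed M.hcomp_homogeneous act_null[OF M.mod])
    qed
    moreover have "?ext \<subseteq> I"
    proof clarify
      fix \<mu> x assume \<mu>: "\<mu> \<in> box n" and x: "x \<in> carrier K"
      obtain L0 where L0: "\<forall>L\<ge>L0. Poly_Mapping.keys \<mu> \<subseteq> {..<L} \<and> 0 < L" using keys_bound by blast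
      have "\<exists>y\<in>carrier K. gsum M (t L) (?single \<mu> (d x)) = d y \<and> coef n (f y) (socle n L) = coef n (f x) \<mu>"
        if "L0 \<le> L" for L
      proof -
        let ?x = "hcomp K x (int (weight \<mu>))"
        let ?y = "lam n (mon (socle n L - \<mu>)) \<odot>\<^bsub>K\<^esub> ?x"
        have x': "?x \<in> carrier K" by (rule K.hcomp_closed[OF x])
        have "hcomp M (d x) (int (weight \<mu>) + 0) = d ?x"
          by (rule hcomp_hom[OF K M d_closed d_add _ x]) (simp_all add: d_grade)
        then have "gsum M (t L) (?single \<mu> (d x)) = d ?y"
          using \<mu> x x' by (simp add: gsum_single t d_closed d_act)
        moreover have "coef n (f ?y) (socle n L) = coef n (f x) \<mu>"
          using coef_socle[where n = n, OF n \<mu> _ f_closed[OF x'], of L 1] L0 that coef_hcomp[OF x] by (simp add: f_act x')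
        moreover have "?y \<in> carrier K" by (rule act_closed[OF K.mod x'])
        ultimately show ?thesis by blast
      qed
      then show "(?single \<mu> (d x), coef n (f x) \<mu>) \<in> I" unfolding I_def by blast
    qed
    ultimately show "?S \<subseteq> I" by (intro Un_least)
  qed
  then obtain \<phi> where \<phi>: "\<forall>(r, c)\<in>?S. pair r \<phi> = c" ..
  have solve: "pair r \<phi> = c" if "(r, c) \<in> ?S" for r c
    using bspec[OF \<phi> that] by simp
  have \<phi>_add: "\<phi> (\<mu>, x \<oplus>\<^bsub>M\<^esub> y) = \<phi> (\<mu>, x) + \<phi> (\<mu>, y)" if "\<mu> \<in> box n" "x \<in> carrier M" "y \<in> carrier M" for \<mu> x y
  proof -
    have "(?single \<mu> (x \<oplus>\<^bsub>M\<^esub> y) - ?single \<mu> x - ?single \<mu> y, 0 :: 'k) \<in> ?add" using that by blast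
    then have "pair (?single \<mu> (x \<oplus>\<^bsub>M\<^esub> y) - ?single \<mu> x - ?single \<mu> y) \<phi> = 0" by (intro solve UnI1)
    then show ?thesis by (simp add: algebra_simps)
  qed
  have \<phi>_scale: "\<phi> (\<mu>, lam n (cst c) \<odot>\<^bsub>M\<^esub> x) = c * \<phi> (\<mu>, x)" if "\<mu> \<in> box n" "x \<in> carrier M" for \<mu> x c
  proof -
    have "(?single \<mu> (lam n (cst c) \<odot>\<^bsub>M\<^esub> x) - Poly_Mapping.single (\<mu>, x) c, 0 :: 'k) \<in> ?scale" using that by blast
    then have "pair (?single \<mu> (lam n (cst c) \<odot>\<^bsub>M\<^esub> x) - Poly_Mapping.single (\<mu>, x) c) \<phi> = 0"
      by (intro solve UnI1 UnI2[of _ _ ?add])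
    then show ?thesis by simp
  qed
  have \<phi>_var: "\<phi> (\<mu>, lam n (var s) \<odot>\<^bsub>M\<^esub> x) = (if 1 \<le> Poly_Mapping.lookup \<mu> s then \<phi> (\<mu> - evar s, x) else 0)"
    if "\<mu> \<in> box n" "x \<in> carrier M" for \<mu> x s
  proof (cases "1 \<le> Poly_Mapping.lookup \<mu> s")
    case True
    then have "(?single \<mu> (lam n (var s) \<odot>\<^bsub>M\<^esub> x) - ?single (\<mu> - evar s) x, 0 :: 'k) \<in> ?var1" using that by blast
    then have "pair (?single \<mu> (lam n (var s) \<odot>\<^bsub>M\<^esub> x) - ?single (\<mu> - evar s) x) \<phi> = 0"
      by (intro solve UnI1 UnI2[of _ _ "?add \<union> ?scale"])
    then show ?thesis using True by simp
  next
    case False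
    then have "Poly_Mapping.lookup \<mu> s = 0" by simp
    then have "(?single \<mu> (lam n (var s) \<odot>\<^bsub>M\<^esub> x), 0 :: 'k) \<in> ?var0" using that by blast
    then have "pair (?single \<mu> (lam n (var s) \<odot>\<^bsub>M\<^esub> x)) \<phi> = 0"
      by (intro solve UnI1 UnI2[of _ _ "?add \<union> ?scale \<union> ?var1"])
    then show ?thesis using False by simp
  qed
  have \<phi>_deg: "\<phi> (\<mu>, x) = 0" if "\<mu> \<in> box n" "x \<in> grade M j" "j \<noteq> int (weight \<mu>)" for \<mu> x j
  proof -
    have "(?single \<mu> x, 0 :: 'k) \<in> ?deg" using that by blast
    then have "pair (?single \<mu> x) \<phi> = 0" by (intro solve UnI1 UnI2[of _ _ "?add \<union> ?scale \<union> ?var1 \<union> ?var0"])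
    then show ?thesis by simp
  qed
  have \<phi>_ext: "\<phi> (\<mu>, d x) = coef n (f x) \<mu>" if "\<mu> \<in> box n" "x \<in> carrier K" for \<mu> x
  proof -
    have "(?single \<mu> (d x), coef n (f x) \<mu>) \<in> ?ext" using that by blast
    then have "pair (?single \<mu> (d x)) \<phi> = coef n (f x) \<mu>" by (intro solve UnI2)
    then show ?thesis by simp
  qed
  have finite_supp: "finite {\<mu>. (if \<mu> \<in> box n then \<phi> (\<mu>, x) else 0) \<noteq> 0}" if x: "x \<in> carrier M" for x
  proof -
    let ?A = "{j. hcomp M x j \<noteq> \<zero>\<^bsub>M\<^esub>}"
    have "int (weight \<mu>) \<in> ?A" if \<mu>: "\<mu> \<in> box n" and nz: "\<phi> (\<mu>, x) \<noteq> 0" for \<mu>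
    proof (rule ccontr)
      assume A: "int (weight \<mu>) \<notin> ?A"
      have "\<phi> (\<mu>, \<Oplus>\<^bsub>M\<^esub>j\<in>?A. hcomp M x j) = (\<Sum>j\<in>?A. \<phi> (\<mu>, hcomp M x j))"
        by (rule additive_finsum_sum[OF M.A.abelian_group_axioms M.hcomp_closed[OF x] _ M.hcomp_finite[OF x]])
          (rule \<phi>_add[OF \<mu>])
      then have "\<phi> (\<mu>, x) = (\<Sum>j\<in>?A. \<phi> (\<mu>, hcomp M x j))" unfolding M.hcomp_sum[OF x, symmetric] .
      also have "\<dots> = 0" using A by (intro sum.neutral ballI \<phi>_deg[OF \<mu> M.hcomp_grade[OF x]]) auto
      finally show False using nz by simp
    qed
    then have "{\<mu>. (if \<mu> \<in> box n then \<phi> (\<mu>, x) else 0) \<noteq> 0} \<subseteq> (\<Union>j\<in>?A. {\<mu>. weight \<mu> = nat j})"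
      by (force split: if_splits)
    then show ?thesis
      by (rule finite_subset) (intro finite_UN_I M.hcomp_finite[OF x] finite_weight)
  qed
  define h where "h x = lam n (Abs_poly_mapping (\<lambda>\<mu>. if \<mu> \<in> box n then \<phi> (\<mu>, x) else 0))" for x
  have h_closed: "h x \<in> carrier (Lam n)" for x by (simp add: h_def)
  have coef_h: "coef n (h x) \<mu> = \<phi> (\<mu>, x)" if "x \<in> carrier M" "\<mu> \<in> box n" for x \<mu>
    using that finite_supp by (simp add: h_def coef_lam lookup_Abs_poly_mapping)
  have h_add: "h (x \<oplus>\<^bsub>M\<^esub> y) = h x \<oplus>\<^bsub>Lam n\<^esub> h y" if "x \<in> carrier M" "y \<in> carrier M" for x y
  proof (rule Lam_eqI[OF h_closed])
    show "h x \<oplus>\<^bsub>Lam n\<^esub> h y \<in> carrier (Lam n)" by (auto simp: h_def simp flip: lam_add)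
  qed (use that h_closed in \<open>simp add: coef_h coef_add \<phi>_add\<close>)
  have h_act: "h (lam n p \<odot>\<^bsub>M\<^esub> x) = lam n p \<otimes>\<^bsub>Lam n\<^esub> h x" if "x \<in> carrier M" for p x
    using that
  proof (induction p rule: poly_var_induct)
    case (const c)
    show ?case
    proof (rule Lam_eqI[OF h_closed])
      show "lam n (cst c) \<otimes>\<^bsub>Lam n\<^esub> h x \<in> carrier (Lam n)" by (auto simp: h_def simp flip: lam_mult)
      show "coef n (h (lam n (cst c) \<odot>\<^bsub>M\<^esub> x)) m = coef n (lam n (cst c) \<otimes>\<^bsub>Lam n\<^esub> h x) m" if "m \<in> box n" for m
        using that const by (simp add: coef_h act_closed[OF M.mod] coef_single_mult[OF h_closed] \<phi>_scale)
    qed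
  next
    case (add p q)
    interpret L: cring "Lam n :: 'k lam ring" by (rule cring_Lam)
    have "h (lam n (p + q) \<odot>\<^bsub>M\<^esub> x) = lam n p \<otimes>\<^bsub>Lam n\<^esub> h x \<oplus>\<^bsub>Lam n\<^esub> lam n q \<otimes>\<^bsub>Lam n\<^esub> h x"
      using add by (simp add: act_add[OF M.mod] h_add act_closed[OF M.mod])
    then show ?case by (simp add: lam_add L.l_distr h_closed)
  next
    case (var s p)
    interpret L: cring "Lam n :: 'k lam ring" by (rule cring_Lam)
    have px: "lam n p \<odot>\<^bsub>M\<^esub> x \<in> carrier M" using var.prems by (simp add: act_closed[OF M.mod])
    have "h (lam n (var s) \<odot>\<^bsub>M\<^esub> (lam n p \<odot>\<^bsub>M\<^esub> x)) = lam n (var s) \<otimes>\<^bsub>Lam n\<^esub> h (lam n p \<odot>\<^bsub>M\<^esub> x)"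
    proof (rule Lam_eqI[OF h_closed])
      show "lam n (var s) \<otimes>\<^bsub>Lam n\<^esub> h (lam n p \<odot>\<^bsub>M\<^esub> x) \<in> carrier (Lam n)" by (simp add: h_closed)
      have le: "(\<forall>i. Poly_Mapping.lookup (evar s) i \<le> Poly_Mapping.lookup m i) \<longleftrightarrow> 1 \<le> Poly_Mapping.lookup m s" for m
        by (auto simp: lookup_single when_def)
      show "coef n (h (lam n (var s) \<odot>\<^bsub>M\<^esub> (lam n p \<odot>\<^bsub>M\<^esub> x))) m = coef n (lam n (var s) \<otimes>\<^bsub>Lam n\<^esub> h (lam n p \<odot>\<^bsub>M\<^esub> x)) m"
        if "m \<in> box n" for m
        unfolding coef_single_mult[OF h_closed that] le
        using that px by (simp add: coef_h act_closed[OF M.mod] \<phi>_var box_diff)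
    qed
    then have "h (lam n (var s * p) \<odot>\<^bsub>M\<^esub> x) = lam n (var s) \<otimes>\<^bsub>Lam n\<^esub> (lam n p \<otimes>\<^bsub>Lam n\<^esub> h x)"
      using var by (simp add: act_mult[OF M.mod])
    then show ?case by (simp add: lam_mult L.m_assoc h_closed)
  qed
  have h_grade: "h x \<in> Lam_grade n j" if x: "x \<in> grade M j" for x j
    unfolding Lam_grade_iff
  proof (intro conjI allI impI h_closed)
    fix m assume m: "coef n (h x) m \<noteq> 0"
    then have "m \<in> box n" unfolding coef_def by presburger
    then show "int (weight m) = j" using m coef_h[OF M.grade_closed[OF x]] \<phi>_deg[OF _ x, of m] by auto
  qed
  have "h \<in> graded_hom n M (Lam_module n)"
    by (rule graded_homI) (simp_all add: Lam_module_def h_closed h_add h_act h_grade)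
  moreover have "h (d x) = f x" if "x \<in> carrier K" for x
    using that by (intro Lam_eqI[OF h_closed f_closed]) (simp_all add: coef_h d_closed \<phi>_ext)
  ultimately show ?thesis by blast
qed

section \<open>Lifting out of semi-free complexes\<close>

lemma free_graded_hom:
  fixes M :: "('k::field lam, 'm) gmodule" and N :: "('k lam, 'l) gmodule"
  assumes M: "graded_module n M" and N: "graded_module n N" and B: "free_basis (Lam n) M B"
    and v: "\<And>b. b \<in> B \<Longrightarrow> \<exists>j. b \<in> grade M j \<and> v b \<in> grade N j"
  shows "\<exists>t\<in>graded_hom n M N. \<forall>b\<in>B. t b = v b"
proof -
  interpret M: gm n M using M by (simp add: gm_def)
  interpret N: gm n N using N by (simp add: gm_def)
  have bM: "b \<in> carrier M" and vN: "v b \<in> carrier N" if "b \<in> B" for b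
    using v[OF that] M.grade_closed N.grade_closed by blast+
  have "\<exists>t. (\<forall>x\<in>carrier M. t x \<in> carrier N) \<and>
    (\<forall>x\<in>carrier M. \<forall>y\<in>carrier M. t (x \<oplus>\<^bsub>M\<^esub> y) = t x \<oplus>\<^bsub>N\<^esub> t y) \<and>
    (\<forall>b\<in>B. \<forall>c\<in>carrier (Lam n). t (c \<odot>\<^bsub>M\<^esub> b) = c \<odot>\<^bsub>N\<^esub> v b)"
    by (rule free_basis_extend[OF M.mod B N.A.abelian_group_axioms])
      (auto simp: carrier_Lam vN act_closed[OF N.mod] act_add[OF N.mod] simp flip: lam_add)
  then obtain t where t: "\<forall>x\<in>carrier M. t x \<in> carrier N"
      "\<forall>x\<in>carrier M. \<forall>y\<in>carrier M. t (x \<oplus>\<^bsub>M\<^esub> y) = t x \<oplus>\<^bsub>N\<^esub> t y"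
      "\<forall>b\<in>B. \<forall>c\<in>carrier (Lam n). t (c \<odot>\<^bsub>M\<^esub> b) = c \<odot>\<^bsub>N\<^esub> v b"
    by (elim exE conjE)
  have t_gen: "t (lam n p \<odot>\<^bsub>M\<^esub> b) = lam n p \<odot>\<^bsub>N\<^esub> v b" if "b \<in> B" for p b using t(3) that by simp
  have t0: "t \<zero>\<^bsub>M\<^esub> = \<zero>\<^bsub>N\<^esub>"
    by (rule additive_zero[OF M.A.abelian_group_axioms N.A.abelian_group_axioms]) (use t in auto)
  have t_act: "t (lam n a \<odot>\<^bsub>M\<^esub> x) = lam n a \<odot>\<^bsub>N\<^esub> t x" if "x \<in> carrier M" for a x
    using M.mod B that
  proof (induction x rule: free_basis_induct)
    case zero
    show ?case by (simp add: t0 act_null[OF M.mod] act_null[OF N.mod])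
  next
    case (add x y)
    then show ?case using t by (simp add: act_distr[OF M.mod] act_distr[OF N.mod] act_closed[OF M.mod])
  next
    case (gen p b)
    then show ?case by (simp add: t_gen bM vN flip: act_mult[OF M.mod] act_mult[OF N.mod])
  qed
  have t_hcomp: "t (hcomp M x q) = hcomp N (t x) q" if "x \<in> carrier M" for x q
    using M.mod B that
  proof (induction x rule: free_basis_induct)
    case zero
    show ?case by (simp add: t0 M.hcomp_homogeneous[OF M.grade_zero[of 0], of q] N.hcomp_homogeneous[OF N.grade_zero[of 0], of q])
  next
    case (add x y)
    then show ?case using t by (simp add: M.hcomp_add N.hcomp_add M.hcomp_closed)
  next
    case (gen p b)
    show ?case
    proof (induction p rule: poly_mapping_add_induct)
      case zero
      show ?case
        by (simp add: act_zero[OF M.mod bM[OF gen]] t0 M.hcomp_homogeneous[OF M.grade_zero[of 0], of q] N.hcomp_homogeneous[OF N.grade_zero[of 0], of q])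
    next
      case (add p p')
      then show ?case
        using t gen
        by (simp add: act_add[OF M.mod] bM vN act_closed[OF M.mod] act_closed[OF N.mod] M.hcomp_add N.hcomp_add M.hcomp_closed)
    next
      case (single m c)
      obtain j where "b \<in> grade M j" "v b \<in> grade N j" using v[OF gen] by blast
      then show ?case
        using M.hcomp_homogeneous[OF M.grade_act[OF single_grade, of b j m c], of q]
          N.hcomp_homogeneous[OF N.grade_act[OF single_grade, of "v b" j m c], of q] gen
        by (simp add: t_gen t0)
    qed
  qed
  have "t \<in> graded_hom n M N"
  proof (rule graded_homI)
    fix j x assume x: "x \<in> grade M j"
    then have "t x = hcomp N (t x) j" using t_hcomp[OF M.grade_closed[OF x], of j] by (simp add: M.hcomp_homogeneous)
    then show "t x \<in> grade N j" using N.hcomp_grade[of "t x" j] t(1) M.grade_closed[OF x] by simp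
  qed (use t t_act in auto)
  moreover have "t b = v b" if "b \<in> B" for b
    using t_gen[OF that, of 1] bM[OF that] vN[OF that] by (simp add: act_one[OF M.mod] act_one[OF N.mod])
  ultimately show ?thesis by blast
qed

lemma lin_span_induct:
  fixes M :: "('k::field lam, 'm) gmodule"
  assumes M: "Module.module (Lam n) M" and S: "S \<subseteq> carrier M" and x: "x \<in> lin_span (Lam n) M S"
    and "Q \<zero>\<^bsub>M\<^esub>" and "\<And>x y. x \<in> carrier M \<Longrightarrow> y \<in> carrier M \<Longrightarrow> Q x \<Longrightarrow> Q y \<Longrightarrow> Q (x \<oplus>\<^bsub>M\<^esub> y)"
    and "\<And>p b. b \<in> S \<Longrightarrow> Q (lam n p \<odot>\<^bsub>M\<^esub> b)"
  shows "x \<in> carrier M \<and> Q x"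
proof -
  interpret Module.module "Lam n" M by (rule M)
  obtain c F where F: "finite F" "F \<subseteq> S" "c \<in> F \<rightarrow> carrier (Lam n)" and x_eq: "x = (\<Oplus>\<^bsub>M\<^esub>b\<in>F. c b \<odot>\<^bsub>M\<^esub> b)"
    using x by (auto simp: lin_span_def)
  show ?thesis unfolding x_eq using F
  proof (induction F)
    case (insert b F)
    then obtain p where p: "c b = lam n p" by (auto simp: carrier_Lam)
    have "(\<lambda>b. c b \<odot>\<^bsub>M\<^esub> b) \<in> F \<rightarrow> carrier M" "c b \<odot>\<^bsub>M\<^esub> b \<in> carrier M" using insert.prems S by auto
    then show ?case using insert assms(5) assms(6)[of b p] p by auto
  qed (use assms(4) in simp)
qed

lemma chain_mapD:
  assumes "f \<in> chain_map n X Y"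
  shows chain_map_hom: "f i \<in> graded_hom n (obj X i) (obj Y i)"
    and chain_map_diff: "x \<in> carrier (obj X i) \<Longrightarrow> i + 1 = j \<Longrightarrow> f j (diff X i x) = diff Y i (f i x)"
  using assms by (auto simp: chain_map_def)

lemma chain_map_comp:
  assumes f: "f \<in> chain_map n X Y" and g: "g \<in> chain_map n Y Z"
  shows "(\<lambda>i. g i \<circ> f i) \<in> chain_map n X Z"
  unfolding chain_map_def mem_Collect_eq
proof (intro allI conjI ballI)
  fix i
  show "g i \<circ> f i \<in> graded_hom n (obj X i) (obj Z i)"
    using graded_homD[OF chain_map_hom[OF f, of i]] graded_homD[OF chain_map_hom[OF g, of i]]
    by (intro graded_homI) simp_all
  fix x assume "x \<in> carrier (obj X i)"
  then show "(g (i + 1) \<circ> f (i + 1)) (diff X i x) = diff Z i ((g i \<circ> f i) x)"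
    using graded_hom_closed[OF chain_map_hom[OF f, of i]] by (simp add: chain_map_diff[OF f] chain_map_diff[OF g])
qed

locale cx_map = X: cx n X + Y: cx n Y
  for n and X :: "('k::field lam, 'm) gcomplex" and Y :: "('k lam, 'l) gcomplex" +
  fixes f :: "int \<Rightarrow> 'm \<Rightarrow> 'l"
  assumes f: "f \<in> chain_map n X Y"
begin

lemma map_closed [simp]: "x \<in> carrier (obj X i) \<Longrightarrow> f i x \<in> carrier (obj Y i)"
  and map_add: "x \<in> carrier (obj X i) \<Longrightarrow> y \<in> carrier (obj X i) \<Longrightarrow> f i (x \<oplus>\<^bsub>obj X i\<^esub> y) = f i x \<oplus>\<^bsub>obj Y i\<^esub> f i y"
  and map_act: "x \<in> carrier (obj X i) \<Longrightarrow> f i (lam n p \<odot>\<^bsub>obj X i\<^esub> x) = lam n p \<odot>\<^bsub>obj Y i\<^esub> f i x"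
  and map_grade: "x \<in> grade (obj X i) j \<Longrightarrow> f i x \<in> grade (obj Y i) j"
  using graded_homD[OF chain_map_hom[OF f, of i]] by auto

lemma map_diff: "x \<in> carrier (obj X i) \<Longrightarrow> i + 1 = j \<Longrightarrow> f j (diff X i x) = diff Y i (f i x)"
  by (rule chain_map_diff[OF f])

lemma map_zero: "f i \<zero>\<^bsub>obj X i\<^esub> = \<zero>\<^bsub>obj Y i\<^esub>"
  by (rule additive_zero) (simp_all add: map_add)

lemma map_uminus: "x \<in> carrier (obj X i) \<Longrightarrow> f i (\<ominus>\<^bsub>obj X i\<^esub> x) = \<ominus>\<^bsub>obj Y i\<^esub> f i x"
  by (rule additive_uminus) (simp_all add: map_add)

lemma map_minus: "x \<in> carrier (obj X i) \<Longrightarrow> y \<in> carrier (obj X i) \<Longrightarrow>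
    f i (x \<ominus>\<^bsub>obj X i\<^esub> y) = f i x \<ominus>\<^bsub>obj Y i\<^esub> f i y"
proof -
  interpret A: abelian_group "obj X i" by simp
  interpret B: abelian_group "obj Y i" by simp
  show "x \<in> carrier (obj X i) \<Longrightarrow> y \<in> carrier (obj X i) \<Longrightarrow>
    f i (x \<ominus>\<^bsub>obj X i\<^esub> y) = f i x \<ominus>\<^bsub>obj Y i\<^esub> f i y"
    unfolding A.minus_eq B.minus_eq by (simp add: map_add map_uminus)
qed

lemma map_cocycle: "x \<in> cocycles X i \<Longrightarrow> f i x \<in> cocycles Y i"
  using map_diff[of x i "i + 1"] by (simp add: X.cocycle_iff Y.cocycle_iff map_zero)

lemma cohomology_map_hcl:
  assumes x: "x \<in> cocycles X i"
  shows "cohomology_map Y f i (X.hcl i x) = Y.hcl i (f i x)"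
proof -
  interpret A: abelian_group "obj Y i" by simp
  have bd: "f i b \<in> coboundaries Y i" if "b \<in> coboundaries X i" for b
    using that by (elim X.coboundaryE) (simp add: map_diff Y.coboundaryI)
  have eq: "cohomology_map Y f i (X.hcl i x) =
      {c \<oplus>\<^bsub>obj Y i\<^esub> f i (b \<oplus>\<^bsub>obj X i\<^esub> x) |c b. c \<in> coboundaries Y i \<and> b \<in> coboundaries X i}"
    by (auto simp: cohomology_map_def set_add_def set_mult_def X.hcl_def)
  show ?thesis
  proof (intro equalityI subsetI)
    fix z assume "z \<in> cohomology_map Y f i (X.hcl i x)"
    then obtain c b where cb: "c \<in> coboundaries Y i" "b \<in> coboundaries X i" "z = c \<oplus>\<^bsub>obj Y i\<^esub> f i (b \<oplus>\<^bsub>obj X i\<^esub> x)"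
      unfolding eq by blast
    then have "z = (c \<oplus>\<^bsub>obj Y i\<^esub> f i b) \<oplus>\<^bsub>obj Y i\<^esub> f i x"
      using x X.coboundary_closed[OF cb(2)] Y.coboundary_closed[OF cb(1)] by (simp add: map_add A.a_assoc)
    then show "z \<in> Y.hcl i (f i x)" using Y.coboundary_add[OF cb(1) bd[OF cb(2)]] by (auto simp: Y.hcl_def)
  next
    fix z assume "z \<in> Y.hcl i (f i x)"
    then obtain c where c: "c \<in> coboundaries Y i" "z = c \<oplus>\<^bsub>obj Y i\<^esub> f i x" by (auto simp: Y.hcl_def)
    interpret AX: abelian_group "obj X i" by simp
    have "z = c \<oplus>\<^bsub>obj Y i\<^esub> f i (\<zero>\<^bsub>obj X i\<^esub> \<oplus>\<^bsub>obj X i\<^esub> x)" using c x by simp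
    then show "z \<in> cohomology_map Y f i (X.hcl i x)" unfolding eq using c X.coboundary_zero by blast
  qed
qed

end

lemma (in cx_map) quasi_isoI:
  assumes inj: "\<And>i x. x \<in> cocycles X i \<Longrightarrow> f i x \<in> coboundaries Y i \<Longrightarrow> x \<in> coboundaries X i"
    and surj: "\<And>i y. y \<in> cocycles Y i \<Longrightarrow> \<exists>x\<in>cocycles X i. f i x \<ominus>\<^bsub>obj Y i\<^esub> y \<in> coboundaries Y i"
  shows "f \<in> quasi_iso n X Y"
  unfolding quasi_iso_def mem_Collect_eq
proof (intro conjI f allI)
  fix i
  interpret AX: abelian_group "obj X i" by simp
  interpret AY: abelian_group "obj Y i" by simp
  show "cohomology_map Y f i \<in> iso (cohomology X i) (cohomology Y i)"
    unfolding iso_def mem_Collect_eq bij_betw_def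
  proof (intro conjI homI inj_onI)
    fix C assume "C \<in> carrier (cohomology X i)"
    then show "cohomology_map Y f i C \<in> carrier (cohomology Y i)"
      by (auto simp: X.carrier_cohomology Y.carrier_cohomology cohomology_map_hcl map_cocycle)
  next
    fix C D assume "C \<in> carrier (cohomology X i)" "D \<in> carrier (cohomology X i)"
    then show "cohomology_map Y f i (C \<otimes>\<^bsub>cohomology X i\<^esub> D) =
        cohomology_map Y f i C \<otimes>\<^bsub>cohomology Y i\<^esub> cohomology_map Y f i D"
      by (auto simp: X.carrier_cohomology X.mult_cohomology Y.mult_cohomology cohomology_map_hcl map_cocycle X.cocycle_add map_add)
  next
    fix C D assume CD: "C \<in> carrier (cohomology X i)" "D \<in> carrier (cohomology X i)" "cohomology_map Y f i C = cohomology_map Y f i D"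
    then obtain x y where xy: "x \<in> cocycles X i" "C = X.hcl i x" "y \<in> cocycles X i" "D = X.hcl i y"
      by (auto simp: X.carrier_cohomology)
    then have "f i x \<ominus>\<^bsub>obj Y i\<^esub> f i y \<in> coboundaries Y i"
      using CD(3) by (simp add: cohomology_map_hcl Y.hcl_eq_iff map_cocycle)
    then have "f i (x \<ominus>\<^bsub>obj X i\<^esub> y) \<in> coboundaries Y i"
      using xy by (simp add: AX.minus_eq AY.minus_eq map_add map_uminus)
    moreover have "x \<ominus>\<^bsub>obj X i\<^esub> y \<in> cocycles X i"
      using xy by (simp add: AX.minus_eq X.cocycle_add X.cocycle_uminus)
    ultimately show "C = D" using inj xy by (simp add: X.hcl_eq_iff)
  next
    show "cohomology_map Y f i ` carrier (cohomology X i) = carrier (cohomology Y i)"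
    proof (intro equalityI subsetI)
      fix D assume "D \<in> cohomology_map Y f i ` carrier (cohomology X i)"
      then show "D \<in> carrier (cohomology Y i)"
        by (auto simp: X.carrier_cohomology Y.carrier_cohomology cohomology_map_hcl map_cocycle)
    next
      fix D assume "D \<in> carrier (cohomology Y i)"
      then obtain y where y: "y \<in> cocycles Y i" "D = Y.hcl i y" by (auto simp: Y.carrier_cohomology)
      obtain x where x: "x \<in> cocycles X i" "f i x \<ominus>\<^bsub>obj Y i\<^esub> y \<in> coboundaries Y i" using surj[OF y(1)] by blast
      then have "D = cohomology_map Y f i (X.hcl i x)"
        using y by (simp add: cohomology_map_hcl Y.hcl_eq_iff[symmetric] map_cocycle)
      then show "D \<in> cohomology_map Y f i ` carrier (cohomology X i)"
        using x by (auto simp: X.carrier_cohomology)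
    qed
  qed
qed

lemma (in cx_map) quasi_isoD:
  assumes qi: "f \<in> quasi_iso n X Y"
  shows quasi_iso_inj: "x \<in> cocycles X i \<Longrightarrow> f i x \<in> coboundaries Y i \<Longrightarrow> x \<in> coboundaries X i"
    and quasi_iso_surj: "y \<in> cocycles Y i \<Longrightarrow> \<exists>x\<in>cocycles X i. f i x \<ominus>\<^bsub>obj Y i\<^esub> y \<in> coboundaries Y i"
proof -
  interpret AX: abelian_group "obj X i" by simp
  interpret AY: abelian_group "obj Y i" by simp
  have iso: "cohomology_map Y f i \<in> iso (cohomology X i) (cohomology Y i)"
    using qi by (simp add: quasi_iso_def)
  show "x \<in> coboundaries X i" if x: "x \<in> cocycles X i" and fx: "f i x \<in> coboundaries Y i"
  proof -
    have "Y.hcl i (f i x) = Y.hcl i (f i \<zero>\<^bsub>obj X i\<^esub>)"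
      using x fx by (simp add: map_zero Y.hcl_eq_iff map_cocycle Y.minus_zero)
    then have "cohomology_map Y f i (X.hcl i x) = cohomology_map Y f i (X.hcl i \<zero>\<^bsub>obj X i\<^esub>)"
      using x by (simp add: cohomology_map_hcl)
    moreover have "inj_on (cohomology_map Y f i) (X.hcl i ` cocycles X i)"
      using iso unfolding iso_def bij_betw_def by (simp add: X.carrier_cohomology)
    ultimately have "X.hcl i x = X.hcl i \<zero>\<^bsub>obj X i\<^esub>"
      using x by (intro inj_onD[where f = "cohomology_map Y f i" and A = "X.hcl i ` cocycles X i"]) simp_all
    then have "x \<ominus>\<^bsub>obj X i\<^esub> \<zero>\<^bsub>obj X i\<^esub> \<in> coboundaries X i" using x by (simp add: X.hcl_eq_iff)
    then show ?thesis using x by (simp add: X.minus_zero)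
  qed
  show "\<exists>x\<in>cocycles X i. f i x \<ominus>\<^bsub>obj Y i\<^esub> y \<in> coboundaries Y i" if y: "y \<in> cocycles Y i"
  proof -
    have "Y.hcl i y \<in> cohomology_map Y f i ` carrier (cohomology X i)"
      using iso y unfolding iso_def bij_betw_def by (simp add: Y.carrier_cohomology)
    then obtain x where "x \<in> cocycles X i" "Y.hcl i y = cohomology_map Y f i (X.hcl i x)"
      by (auto simp: X.carrier_cohomology)
    then show ?thesis using y by (auto simp: cohomology_map_hcl Y.hcl_eq_iff[symmetric] map_cocycle)
  qed
qed

lemma quasi_iso_chain_map: "f \<in> quasi_iso n X Y \<Longrightarrow> f \<in> chain_map n X Y"
  by (simp add: quasi_iso_def)

lemma quasi_iso_homotopic:
  assumes X: "complex n X" and Y: "complex n Y" and f: "f \<in> quasi_iso n X Y" and g: "g \<in> chain_map n X Y"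
    and gf: "homotopic n X Y g f"
  shows "g \<in> quasi_iso n X Y"
proof -
  interpret F: cx_map n X Y f using X Y quasi_iso_chain_map[OF f] by (simp add: cx_map_def cx_def cx_map_axioms_def)
  interpret G: cx_map n X Y g using X Y g by (simp add: cx_map_def cx_def cx_map_axioms_def)
  obtain h where h: "\<And>i. h i \<in> graded_hom n (obj X i) (obj Y (i - 1))"
    and gf: "\<And>i x. x \<in> carrier (obj X i) \<Longrightarrow>
      g i x \<ominus>\<^bsub>obj Y i\<^esub> f i x = diff Y (i - 1) (h i x) \<oplus>\<^bsub>obj Y i\<^esub> h (i + 1) (diff X i x)"
    using gf unfolding homotopic_def by blast
  have bd: "g i x \<ominus>\<^bsub>obj Y i\<^esub> f i x \<in> coboundaries Y i" if x: "x \<in> cocycles X i" for x i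
  proof -
    interpret A: abelian_group "obj Y i" by simp
    have hx: "h i x \<in> carrier (obj Y (i - 1))" by (rule graded_hom_closed[OF h]) (use x in simp)
    have "h (i + 1) \<zero>\<^bsub>obj X (i + 1)\<^esub> = \<zero>\<^bsub>obj Y i\<^esub>"
      using graded_homD[OF h[of "i + 1"]] by (intro additive_zero) simp_all
    then have "g i x \<ominus>\<^bsub>obj Y i\<^esub> f i x = diff Y (i - 1) (h i x)"
      using gf[of x i] x hx by (simp add: F.X.cocycle_iff)
    then show ?thesis using F.Y.coboundaryI[OF hx, of i] by simp
  qed
  show ?thesis
  proof (rule G.quasi_isoI)
    fix i x assume x: "x \<in> cocycles X i" and gx: "g i x \<in> coboundaries Y i"
    interpret A: abelian_group "obj Y i" by simp
    have "f i x = g i x \<oplus>\<^bsub>obj Y i\<^esub> \<ominus>\<^bsub>obj Y i\<^esub> (g i x \<ominus>\<^bsub>obj Y i\<^esub> f i x)"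
      using x by (simp add: A.minus_eq A.minus_add A.r_neg2)
    also have "\<dots> \<in> coboundaries Y i"
      by (intro F.Y.coboundary_add F.Y.coboundary_uminus gx bd x)
    finally show "x \<in> coboundaries X i" by (rule F.quasi_iso_inj[OF f x])
  next
    fix i y assume y: "y \<in> cocycles Y i"
    interpret A: abelian_group "obj Y i" by simp
    obtain x where x: "x \<in> cocycles X i" "f i x \<ominus>\<^bsub>obj Y i\<^esub> y \<in> coboundaries Y i"
      using F.quasi_iso_surj[OF f y] by blast
    have "g i x \<ominus>\<^bsub>obj Y i\<^esub> y = (g i x \<ominus>\<^bsub>obj Y i\<^esub> f i x) \<oplus>\<^bsub>obj Y i\<^esub> (f i x \<ominus>\<^bsub>obj Y i\<^esub> y)"
      using x(1) y by (simp add: A.minus_eq A.a_assoc A.r_neg1 A.r_neg2)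
    also have "\<dots> \<in> coboundaries Y i" by (intro F.Y.coboundary_add bd x)
    finally show "\<exists>x\<in>cocycles X i. g i x \<ominus>\<^bsub>obj Y i\<^esub> y \<in> coboundaries Y i" using x(1) by blast
  qed
qed

lemma lin_span_mono:
  assumes "S \<subseteq> S'"
  shows "lin_span R M S \<subseteq> lin_span R M S'"
proof
  fix x assume "x \<in> lin_span R M S"
  then obtain c F where *: "x = (\<Oplus>\<^bsub>M\<^esub>b\<in>F. c b \<odot>\<^bsub>M\<^esub> b)" "finite F" "F \<subseteq> S" "c \<in> F \<rightarrow> carrier R"
    unfolding lin_span_def mem_Collect_eq by (elim exE conjE)
  have "F \<subseteq> S'" using *(3) assms by (rule order_trans)
  with * show "x \<in> lin_span R M S'"
    unfolding lin_span_def mem_Collect_eq by (intro exI[of _ c] exI[of _ F] conjI)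
qed

text \<open>The lifting of a chain map from a semi-free complex through a quasi-isomorphism is built
  along the filtration of the semi-basis. On a basis element \<open>b\<close> of level \<open>l\<close>, the lift \<open>t\<close> and the homotopy
  \<open>h\<close> are already defined at \<open>d b\<close>; the cocycle \<open>t (d b)\<close> is the coboundary of some \<open>w\<close> because its image is
  one, and \<open>w\<close> can be corrected by a cocycle so that the homotopy extends to \<open>b\<close>.\<close>

theorem semi_free_lift:
  fixes V :: "('k::field lam, 'v) gcomplex" and W :: "('k lam, 'w) gcomplex" and Z :: "('k lam, 'z) gcomplex"
  assumes V: "semi_free n V" and W: "complex n W" and Z: "complex n Z"
    and s: "s \<in> quasi_iso n W Z" and r: "r \<in> chain_map n V Z"
  shows "\<exists>t\<in>chain_map n V W. homotopic n V Z (\<lambda>i. s i \<circ> t i) r"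
proof -
  have Vc: "complex n V" using V by (simp add: semi_free_def)
  interpret R: cx_map n V Z r using Vc Z r by (simp add: cx_map_def cx_def cx_map_axioms_def)
  interpret S: cx_map n W Z s using W Z quasi_iso_chain_map[OF s] by (simp add: cx_map_def cx_def cx_map_axioms_def)
  obtain B :: "nat \<Rightarrow> int \<Rightarrow> 'v set" where
    B_grade: "\<And>l p. B l p \<subseteq> (\<Union>j. grade (obj V p) j)" and disj: "\<And>p. disjoint_family (\<lambda>l. B l p)"
    and basis: "\<And>p. free_basis (Lam n) (obj V p) (\<Union>l. B l p)"
    and filt: "\<And>p l. diff V p ` B l p \<subseteq> lin_span (Lam n) (obj V (p + 1)) (\<Union>l'<l. B l' (p + 1))"
    using V unfolding semi_free_def by (elim conjE exE) blast
  have BV: "b \<in> carrier (obj V p)" if "b \<in> B l p" for b l p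
    using basis[of p] that unfolding free_basis_def by blast
  define lin where "lin = (\<lambda>(t, h). (\<forall>p. t p \<in> graded_hom n (obj V p) (obj W p)) \<and>
      (\<forall>p. h p \<in> graded_hom n (obj V p) (obj Z (p - 1))))"
  define good where "good t h p x \<longleftrightarrow> diff W p (t p x) = t (p + 1) (diff V p x) \<and>
      s p (t p x) \<ominus>\<^bsub>obj Z p\<^esub> r p x = diff Z (p - 1) (h p x) \<oplus>\<^bsub>obj Z p\<^esub> h (p + 1) (diff V p x)" for t h p x
  have good_lin: "good t h p \<zero>\<^bsub>obj V p\<^esub>"
    "x \<in> carrier (obj V p) \<Longrightarrow> y \<in> carrier (obj V p) \<Longrightarrow> good t h p x \<Longrightarrow> good t h p y \<Longrightarrow> good t h p (x \<oplus>\<^bsub>obj V p\<^esub> y)"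
    "x \<in> carrier (obj V p) \<Longrightarrow> good t h p x \<Longrightarrow> good t h p (lam n a \<odot>\<^bsub>obj V p\<^esub> x)"
    if th: "lin (t, h)" for t h p x y a
  proof -
    have t: "t p \<in> graded_hom n (obj V p) (obj W p)" and h: "h p \<in> graded_hom n (obj V p) (obj Z (p - 1))" for p
      using th by (auto simp: lin_def)
    have h': "h (p + 1) \<in> graded_hom n (obj V (p + 1)) (obj Z p)" using h[of "p + 1"] by simp
    interpret A: abelian_group "obj Z p" by simp
    note closed = graded_hom_closed[OF t] graded_hom_closed[OF h] graded_hom_closed[OF h']
    note add = graded_hom_add[OF t] graded_hom_add[OF h] graded_hom_add[OF h']
    note act = graded_hom_act[OF t] graded_hom_act[OF h] graded_hom_act[OF h']
    have t0: "t p \<zero>\<^bsub>obj V p\<^esub> = \<zero>\<^bsub>obj W p\<^esub>" for p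
      by (rule additive_zero) (simp_all add: closed add)
    have h0: "h p \<zero>\<^bsub>obj V p\<^esub> = \<zero>\<^bsub>obj Z (p - 1)\<^esub>" "h (p + 1) \<zero>\<^bsub>obj V (p + 1)\<^esub> = \<zero>\<^bsub>obj Z p\<^esub>"
      by (rule additive_zero; simp add: closed add)+
    show "good t h p \<zero>\<^bsub>obj V p\<^esub>"
      using S.X.diff_zero[of p "p + 1"] R.X.diff_zero[of p "p + 1"] R.Y.diff_zero[of "p - 1" p]
      by (simp add: good_def t0 h0 S.map_zero R.map_zero A.minus_eq A.r_neg)
    show "good t h p (lam n a \<odot>\<^bsub>obj V p\<^esub> x)" if x: "x \<in> carrier (obj V p)" and g: "good t h p x"
    proof -
      have "s p (t p (lam n a \<odot>\<^bsub>obj V p\<^esub> x)) \<ominus>\<^bsub>obj Z p\<^esub> r p (lam n a \<odot>\<^bsub>obj V p\<^esub> x)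
          = lam n a \<odot>\<^bsub>obj Z p\<^esub> (s p (t p x) \<ominus>\<^bsub>obj Z p\<^esub> r p x)"
        using x by (simp add: act closed S.map_act R.map_act A.minus_eq act_distr[OF R.Y.mod] act_minus[OF R.Y.mod])
      also have "\<dots> = lam n a \<odot>\<^bsub>obj Z p\<^esub> (diff Z (p - 1) (h p x) \<oplus>\<^bsub>obj Z p\<^esub> h (p + 1) (diff V p x))"
        using g by (simp add: good_def)
      also have "\<dots> = diff Z (p - 1) (h p (lam n a \<odot>\<^bsub>obj V p\<^esub> x)) \<oplus>\<^bsub>obj Z p\<^esub> h (p + 1) (diff V p (lam n a \<odot>\<^bsub>obj V p\<^esub> x))"
        using x by (simp add: act closed act_distr[OF R.Y.mod] R.Y.diff_act[of _ "p - 1" p] R.X.diff_act[of _ p "p + 1"])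
      finally show ?thesis
        using x g by (simp add: good_def act closed S.X.diff_act[of _ p "p + 1"] R.X.diff_act[of _ p "p + 1"])
    qed
    show "good t h p (x \<oplus>\<^bsub>obj V p\<^esub> y)"
      if x: "x \<in> carrier (obj V p)" and y: "y \<in> carrier (obj V p)" and g: "good t h p x" "good t h p y"
    proof -
      have "s p (t p (x \<oplus>\<^bsub>obj V p\<^esub> y)) \<ominus>\<^bsub>obj Z p\<^esub> r p (x \<oplus>\<^bsub>obj V p\<^esub> y)
          = (s p (t p x) \<ominus>\<^bsub>obj Z p\<^esub> r p x) \<oplus>\<^bsub>obj Z p\<^esub> (s p (t p y) \<ominus>\<^bsub>obj Z p\<^esub> r p y)"
        using x y by (simp add: add closed S.map_add R.map_add A.minus_eq A.minus_add A.a_ac)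
      also have "\<dots> = (diff Z (p - 1) (h p x) \<oplus>\<^bsub>obj Z p\<^esub> h (p + 1) (diff V p x)) \<oplus>\<^bsub>obj Z p\<^esub>
          (diff Z (p - 1) (h p y) \<oplus>\<^bsub>obj Z p\<^esub> h (p + 1) (diff V p y))"
        using g by (simp add: good_def)
      also have "\<dots> = diff Z (p - 1) (h p (x \<oplus>\<^bsub>obj V p\<^esub> y)) \<oplus>\<^bsub>obj Z p\<^esub> h (p + 1) (diff V p (x \<oplus>\<^bsub>obj V p\<^esub> y))"
        using x y by (simp add: add closed R.Y.diff_add[of _ "p - 1" _ p] R.X.diff_add[of _ p _ "p + 1"] A.a_ac)
      finally show ?thesis
        using x y g by (simp add: good_def add closed S.X.diff_add[of _ p _ "p + 1"] R.X.diff_add[of _ p _ "p + 1"])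
    qed
  qed
  have extend_one: "\<exists>w u. w \<in> grade (obj W p) j \<and> u \<in> grade (obj Z (p - 1)) j \<and> diff W p w = t (p + 1) (diff V p b) \<and>
      s p w \<ominus>\<^bsub>obj Z p\<^esub> r p b = diff Z (p - 1) u \<oplus>\<^bsub>obj Z p\<^esub> h (p + 1) (diff V p b)"
    if th: "lin (t, h)" and b: "b \<in> grade (obj V p) j" and g: "good t h (p + 1) (diff V p b)" for t h p b j
  proof -
    have t: "t p \<in> graded_hom n (obj V p) (obj W p)" and h: "h p \<in> graded_hom n (obj V p) (obj Z (p - 1))" for p
      using th by (auto simp: lin_def)
    have h': "h (p + 1) \<in> graded_hom n (obj V (p + 1)) (obj Z p)" using h[of "p + 1"] by simp
    interpret GV: gm n "obj V p" by (simp add: gm_def)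
    interpret GW: gm n "obj W p" by (simp add: gm_def)
    interpret GZ: gm n "obj Z (p - 1)" by (simp add: gm_def)
    interpret A: abelian_group "obj Z p" by simp
    interpret A1: abelian_group "obj Z (p + 1)" by simp
    have bV: "b \<in> carrier (obj V p)" by (rule GV.grade_closed[OF b])
    let ?c = "diff V p b"
    have c: "?c \<in> carrier (obj V (p + 1))" using bV by simp
    have tc: "t (p + 1) ?c \<in> carrier (obj W (p + 1))" by (rule graded_hom_closed[OF t c])
    have hc: "h (p + 1) ?c \<in> carrier (obj Z p)" by (rule graded_hom_closed[OF h' c])
    have dd: "diff V (p + 1) ?c = \<zero>\<^bsub>obj V (p + 2)\<^esub>" by (rule R.X.diff_diff[OF bV]) simp_all
    have t0: "t (p + 2) \<zero>\<^bsub>obj V (p + 2)\<^esub> = \<zero>\<^bsub>obj W (p + 2)\<^esub>"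
      by (rule additive_zero) (simp_all add: graded_homD[OF t])
    have h0: "h (p + 2) \<zero>\<^bsub>obj V (p + 2)\<^esub> = \<zero>\<^bsub>obj Z (p + 1)\<^esub>"
    proof -
      have "p + 2 - 1 = p + 1" by simp
      note h2 = h[of "p + 2", unfolded this]
      show ?thesis by (rule additive_zero) (simp_all add: graded_hom_closed[OF h2] graded_hom_add[OF h2])
    qed
    have p2: "p + 1 + 1 = p + 2" by simp
    have g': "diff W (p + 1) (t (p + 1) ?c) = t (p + 2) (diff V (p + 1) ?c)"
      "s (p + 1) (t (p + 1) ?c) \<ominus>\<^bsub>obj Z (p + 1)\<^esub> r (p + 1) ?c = diff Z p (h (p + 1) ?c) \<oplus>\<^bsub>obj Z (p + 1)\<^esub> h (p + 2) (diff V (p + 1) ?c)"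
      using g unfolding good_def p2 add_diff_cancel_right' by blast+
    have cocyc: "t (p + 1) ?c \<in> cocycles W (p + 1)"
      unfolding S.X.cocycle_iff p2 g'(1) dd t0 using tc by (intro conjI refl)
    have diff_eq: "s (p + 1) (t (p + 1) ?c) \<ominus>\<^bsub>obj Z (p + 1)\<^esub> r (p + 1) ?c = diff Z p (h (p + 1) ?c)"
      using g'(2) hc by (simp add: dd h0)
    have "(x \<ominus>\<^bsub>obj Z (p + 1)\<^esub> y) \<oplus>\<^bsub>obj Z (p + 1)\<^esub> y = x"
      if "x \<in> carrier (obj Z (p + 1))" "y \<in> carrier (obj Z (p + 1))" for x y
      using that by (simp add: A1.minus_eq A1.a_assoc A1.l_neg)
    from this[OF S.map_closed[OF tc] R.map_closed[OF c], unfolded diff_eq, symmetric]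
    have "s (p + 1) (t (p + 1) ?c) = diff Z p (h (p + 1) ?c) \<oplus>\<^bsub>obj Z (p + 1)\<^esub> r (p + 1) ?c" .
    also have "\<dots> = diff Z p (h (p + 1) ?c \<oplus>\<^bsub>obj Z p\<^esub> r p b)"
      using bV hc by (simp add: R.map_diff R.Y.diff_add[of _ p _ "p + 1"])
    finally have stc: "s (p + 1) (t (p + 1) ?c) = diff Z p (h (p + 1) ?c \<oplus>\<^bsub>obj Z p\<^esub> r p b)" .
    also have "\<dots> \<in> coboundaries Z (p + 1)" using hc bV by (intro R.Y.coboundaryI) simp_all
    finally have "t (p + 1) ?c \<in> coboundaries W (p + 1)" by (rule S.quasi_iso_inj[OF s cocyc])
    then obtain w0 where w0: "w0 \<in> carrier (obj W p)" "t (p + 1) ?c = diff W p w0"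
      by (elim S.X.coboundaryE) simp
    let ?y = "s p w0 \<ominus>\<^bsub>obj Z p\<^esub> (h (p + 1) ?c \<oplus>\<^bsub>obj Z p\<^esub> r p b)"
    have y: "?y \<in> carrier (obj Z p)" using w0 hc bV by simp
    have hr: "h (p + 1) ?c \<oplus>\<^bsub>obj Z p\<^esub> r p b \<in> carrier (obj Z p)" using hc bV by simp
    have "diff Z p (s p w0) = diff Z p (h (p + 1) ?c \<oplus>\<^bsub>obj Z p\<^esub> r p b)"
      by (simp only: S.map_diff[OF w0(1) refl, symmetric] w0(2)[symmetric] stc)
    then have "diff Z p ?y = diff Z p (h (p + 1) ?c \<oplus>\<^bsub>obj Z p\<^esub> r p b) \<ominus>\<^bsub>obj Z (p + 1)\<^esub> diff Z p (h (p + 1) ?c \<oplus>\<^bsub>obj Z p\<^esub> r p b)"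
      by (simp only: R.Y.diff_minus[OF S.map_closed[OF w0(1)] hr refl])
    also have "\<dots> = \<zero>\<^bsub>obj Z (p + 1)\<^esub>"
      unfolding A1.minus_eq by (rule A1.r_neg) (rule R.Y.diff_closed[OF hr refl])
    finally have "?y \<in> cocycles Z p" using y by (simp only: R.Y.cocycle_iff simp_thms)
    then obtain w1 where w1: "w1 \<in> cocycles W p" "s p w1 \<ominus>\<^bsub>obj Z p\<^esub> ?y \<in> coboundaries Z p"
      using S.quasi_iso_surj[OF s] by blast
    then obtain u1 where u1: "u1 \<in> carrier (obj Z (p - 1))" "s p w1 \<ominus>\<^bsub>obj Z p\<^esub> ?y = diff Z (p - 1) u1"
      by (elim R.Y.coboundaryE)
    define w where "w = w0 \<ominus>\<^bsub>obj W p\<^esub> w1"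
    define u where "u = \<ominus>\<^bsub>obj Z (p - 1)\<^esub> u1"
    have w1': "w1 \<in> carrier (obj W p)" and dw1: "diff W p w1 = \<zero>\<^bsub>obj W (p + 1)\<^esub>"
      using w1(1) unfolding S.X.cocycle_iff by (rule conjunct1, rule conjunct2)
    have w: "w \<in> carrier (obj W p)" unfolding w_def by (rule GW.A.minus_closed[OF w0(1) w1'])
    have u: "u \<in> carrier (obj Z (p - 1))" unfolding u_def by (rule GZ.A.a_inv_closed[OF u1(1)])
    have dw: "diff W p w = t (p + 1) ?c"
      by (simp only: w_def S.X.diff_minus[OF w0(1) w1' refl] w0(2)[symmetric] dw1 S.X.minus_zero[OF tc])
    have su: "s p w \<ominus>\<^bsub>obj Z p\<^esub> r p b = diff Z (p - 1) u \<oplus>\<^bsub>obj Z p\<^esub> h (p + 1) ?c"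
    proof -
      have du: "diff Z (p - 1) u = ?y \<ominus>\<^bsub>obj Z p\<^esub> s p w1"
      proof -
        have "\<ominus>\<^bsub>obj Z p\<^esub> (a \<ominus>\<^bsub>obj Z p\<^esub> c) = c \<ominus>\<^bsub>obj Z p\<^esub> a" if "a \<in> carrier (obj Z p)" "c \<in> carrier (obj Z p)" for a c
          using that by (simp add: A.minus_eq A.minus_add A.a_comm)
        from this[OF S.map_closed[OF w1'] y] show ?thesis
          using R.Y.diff_uminus[OF u1(1), of p] by (simp only: u_def u1(2)[symmetric])
      qed
      have sw: "s p w = s p w0 \<ominus>\<^bsub>obj Z p\<^esub> s p w1"
        unfolding w_def by (rule S.map_minus[OF w0(1) w1'])
      have "?y \<ominus>\<^bsub>obj Z p\<^esub> s p w1 \<oplus>\<^bsub>obj Z p\<^esub> h (p + 1) ?c = s p w0 \<ominus>\<^bsub>obj Z p\<^esub> s p w1 \<ominus>\<^bsub>obj Z p\<^esub> r p b"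
      proof -
        have "a \<ominus>\<^bsub>obj Z p\<^esub> (c \<oplus>\<^bsub>obj Z p\<^esub> e) \<ominus>\<^bsub>obj Z p\<^esub> d \<oplus>\<^bsub>obj Z p\<^esub> c = a \<ominus>\<^bsub>obj Z p\<^esub> d \<ominus>\<^bsub>obj Z p\<^esub> e"
          if "a \<in> carrier (obj Z p)" "c \<in> carrier (obj Z p)" "e \<in> carrier (obj Z p)" "d \<in> carrier (obj Z p)" for a c d e
        proof -
          have "a \<ominus>\<^bsub>obj Z p\<^esub> (c \<oplus>\<^bsub>obj Z p\<^esub> e) \<ominus>\<^bsub>obj Z p\<^esub> d \<oplus>\<^bsub>obj Z p\<^esub> c
              = (a \<ominus>\<^bsub>obj Z p\<^esub> d \<ominus>\<^bsub>obj Z p\<^esub> e) \<oplus>\<^bsub>obj Z p\<^esub> (\<ominus>\<^bsub>obj Z p\<^esub> c \<oplus>\<^bsub>obj Z p\<^esub> c)"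
            using that by (simp only: A.minus_eq A.minus_add A.a_ac A.a_closed A.a_inv_closed)
          then show ?thesis using that by (simp add: A.l_neg)
        qed
        from this[OF S.map_closed[OF w0(1)] hc R.map_closed[OF bV] S.map_closed[OF w1']] show ?thesis .
      qed
      then show ?thesis by (simp only: du sw)
    qed
    have rb: "r p b \<in> grade (obj Z p) j" by (rule R.map_grade[OF b])
    have cg: "?c \<in> grade (obj V (p + 1)) j" by (rule R.X.diff_grade[OF b refl])
    have hcg: "h (p + 1) ?c \<in> grade (obj Z p) j" by (rule graded_hom_grade[OF h' cg])
    have tcg: "t (p + 1) ?c \<in> grade (obj W (p + 1)) j" by (rule graded_hom_grade[OF t cg])
    interpret GZp: gm n "obj Z p" by (simp add: gm_def)
    interpret GW1: gm n "obj W (p + 1)" by (simp add: gm_def)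
    \<comment> \<open>\<open>w\<close> and \<open>u\<close> may be inhomogeneous, but their components in the degree of \<open>b\<close> satisfy the same equations.\<close>
    have "hcomp (obj W (p + 1)) (diff W p w) (j + 0) = diff W p (hcomp (obj W p) w j)"
      by (rule hcomp_hom[OF S.X.graded S.X.graded _ _ _ w]) (simp_all add: S.X.diff_add S.X.diff_grade)
    then have 1: "diff W p (hcomp (obj W p) w j) = t (p + 1) ?c"
      using dw GW1.hcomp_homogeneous[OF tcg, of j] by simp
    have "hcomp (obj Z p) (diff Z (p - 1) u) (j + 0) = diff Z (p - 1) (hcomp (obj Z (p - 1)) u j)"
      by (rule hcomp_hom[OF R.Y.graded R.Y.graded _ _ _ u]) (simp_all add: R.Y.diff_add[of _ _ _ p] R.Y.diff_grade)
    moreover have "hcomp (obj Z p) (s p w) (j + 0) = s p (hcomp (obj W p) w j)"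
      by (rule hcomp_hom[OF S.X.graded R.Y.graded _ _ _ w]) (simp_all add: S.map_add S.map_grade)
    moreover have "s p w = (diff Z (p - 1) u \<oplus>\<^bsub>obj Z p\<^esub> h (p + 1) ?c) \<oplus>\<^bsub>obj Z p\<^esub> r p b"
      using su[symmetric] w bV by (simp add: A.minus_eq A.a_assoc A.l_neg)
    then have "hcomp (obj Z p) (s p w) j = (hcomp (obj Z p) (diff Z (p - 1) u) j \<oplus>\<^bsub>obj Z p\<^esub> h (p + 1) ?c) \<oplus>\<^bsub>obj Z p\<^esub> r p b"
      using u hc bV GZp.hcomp_homogeneous[OF rb, of j] GZp.hcomp_homogeneous[OF hcg, of j]
      by (simp add: GZp.hcomp_add)
    ultimately have "s p (hcomp (obj W p) w j) = (diff Z (p - 1) (hcomp (obj Z (p - 1)) u j) \<oplus>\<^bsub>obj Z p\<^esub> h (p + 1) ?c) \<oplus>\<^bsub>obj Z p\<^esub> r p b"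
      by simp
    then have 2: "s p (hcomp (obj W p) w j) \<ominus>\<^bsub>obj Z p\<^esub> r p b = diff Z (p - 1) (hcomp (obj Z (p - 1)) u j) \<oplus>\<^bsub>obj Z p\<^esub> h (p + 1) ?c"
      using GZ.hcomp_closed[OF u, of j] hc bV by (simp add: A.minus_eq A.a_assoc A.r_neg)
    show ?thesis
      using 1 2 GW.hcomp_grade[OF w, of j] GZ.hcomp_grade[OF u, of j] by blast
  qed
  have ext: "\<exists>t h. lin (t, h) \<and> (\<forall>l p. \<forall>b\<in>B l p. t p b = \<tau> p b \<and> h p b = \<eta> p b)"
    if val: "\<And>l p b. b \<in> B l p \<Longrightarrow> \<exists>j. b \<in> grade (obj V p) j \<and> \<tau> p b \<in> grade (obj W p) j \<and> \<eta> p b \<in> grade (obj Z (p - 1)) j"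
    for \<tau> :: "int \<Rightarrow> 'v \<Rightarrow> 'w" and \<eta> :: "int \<Rightarrow> 'v \<Rightarrow> 'z"
  proof -
    have val_t: "\<exists>j. b \<in> grade (obj V p) j \<and> \<tau> p b \<in> grade (obj W p) j"
      and val_h: "\<exists>j. b \<in> grade (obj V p) j \<and> \<eta> p b \<in> grade (obj Z (p - 1)) j" if b: "b \<in> (\<Union>l. B l p)" for p b
    proof -
      obtain l where "b \<in> B l p" using b by (rule UN_E)
      from val[OF this] obtain j where "b \<in> grade (obj V p) j \<and> \<tau> p b \<in> grade (obj W p) j \<and> \<eta> p b \<in> grade (obj Z (p - 1)) j" ..
      then show "\<exists>j. b \<in> grade (obj V p) j \<and> \<tau> p b \<in> grade (obj W p) j"
        "\<exists>j. b \<in> grade (obj V p) j \<and> \<eta> p b \<in> grade (obj Z (p - 1)) j"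
        by (intro exI[of _ j]; simp)+
    qed
    have "\<forall>p. \<exists>t. t \<in> graded_hom n (obj V p) (obj W p) \<and> (\<forall>b\<in>(\<Union>l. B l p). t b = \<tau> p b)"
    proof
      fix p
      have "\<exists>t\<in>graded_hom n (obj V p) (obj W p). \<forall>b\<in>(\<Union>l. B l p). t b = \<tau> p b"
        by (rule free_graded_hom[OF R.X.graded S.X.graded basis]) (rule val_t)
      then show "\<exists>t. t \<in> graded_hom n (obj V p) (obj W p) \<and> (\<forall>b\<in>(\<Union>l. B l p). t b = \<tau> p b)"
        by (elim bexE) (rule exI, rule conjI)
    qed
    then have "\<exists>t. \<forall>p. t p \<in> graded_hom n (obj V p) (obj W p) \<and> (\<forall>b\<in>(\<Union>l. B l p). t p b = \<tau> p b)" by (rule choice)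
    then obtain t where t: "\<forall>p. t p \<in> graded_hom n (obj V p) (obj W p) \<and> (\<forall>b\<in>(\<Union>l. B l p). t p b = \<tau> p b)" ..
    have "\<forall>p. \<exists>h. h \<in> graded_hom n (obj V p) (obj Z (p - 1)) \<and> (\<forall>b\<in>(\<Union>l. B l p). h b = \<eta> p b)"
    proof
      fix p
      have "\<exists>h\<in>graded_hom n (obj V p) (obj Z (p - 1)). \<forall>b\<in>(\<Union>l. B l p). h b = \<eta> p b"
        by (rule free_graded_hom[OF R.X.graded R.Y.graded basis]) (rule val_h)
      then show "\<exists>h. h \<in> graded_hom n (obj V p) (obj Z (p - 1)) \<and> (\<forall>b\<in>(\<Union>l. B l p). h b = \<eta> p b)"
        by (elim bexE) (rule exI, rule conjI)
    qed
    then have "\<exists>h. \<forall>p. h p \<in> graded_hom n (obj V p) (obj Z (p - 1)) \<and> (\<forall>b\<in>(\<Union>l. B l p). h p b = \<eta> p b)" by (rule choice)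
    then obtain h where h: "\<forall>p. h p \<in> graded_hom n (obj V p) (obj Z (p - 1)) \<and> (\<forall>b\<in>(\<Union>l. B l p). h p b = \<eta> p b)" ..
    show ?thesis
    proof (intro exI conjI allI ballI)
      show "lin (t, h)" using t h by (simp add: lin_def)
      fix l p b assume "b \<in> B l p"
      then have b: "b \<in> (\<Union>l. B l p)" by blast
      show "t p b = \<tau> p b" by (rule bspec[OF conjunct2[OF spec[OF t]] b])
      show "h p b = \<eta> p b" by (rule bspec[OF conjunct2[OF spec[OF h]] b])
    qed
  qed
  let ?low = "\<lambda>l p. \<Union>l'<l. B l' p"
  have low: "?low l p \<subseteq> carrier (obj V p)" for l p using BV by (intro UN_least subsetI)
  have span_mono: "lin_span (Lam n) (obj V p) (?low l p) \<subseteq> lin_span (Lam n) (obj V p) (?low l' p)" if "l \<le> l'" for l l' p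
    using that by (intro lin_span_mono UN_mono) simp_all
  have db: "diff V p b \<in> lin_span (Lam n) (obj V (p + 1)) (?low l (p + 1))" if "b \<in> B l p" for b l p
    using filt that by blast
  have good_span: "good t h p x"
    if th: "lin (t, h)" and g: "\<forall>l'<l. \<forall>p. \<forall>b\<in>B l' p. good t h p b" and x: "x \<in> lin_span (Lam n) (obj V p) (?low l p)"
    for t h l p x
  proof (rule lin_span_induct[OF R.X.mod low x, THEN conjunct2])
    fix a b assume b: "b \<in> ?low l p"
    then have "good t h p b" using g by (elim UN_E) simp
    then show "good t h p (lam n a \<odot>\<^bsub>obj V p\<^esub> b)"
      by (rule good_lin(3)[OF th rev_subsetD[OF b low]])
  qed (fact good_lin(1)[OF th], rule good_lin(2)[OF th])
  have agree_span: "t p x = t' p x \<and> h p x = h' p x"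
    if th: "lin (t, h)" "lin (t', h')" and eq: "\<forall>l'<l. \<forall>p. \<forall>b\<in>B l' p. t p b = t' p b \<and> h p b = h' p b"
      and x: "x \<in> lin_span (Lam n) (obj V p) (?low l p)" for t h t' h' l p x
  proof (rule lin_span_induct[OF R.X.mod low x, THEN conjunct2])
    have homs: "t p \<in> graded_hom n (obj V p) (obj W p)" "t' p \<in> graded_hom n (obj V p) (obj W p)"
      "h p \<in> graded_hom n (obj V p) (obj Z (p - 1))" "h' p \<in> graded_hom n (obj V p) (obj Z (p - 1))"
      using th by (auto simp: lin_def)
    note closed = homs[THEN graded_hom_closed] and add = homs[THEN graded_hom_add] and act = homs[THEN graded_hom_act]
    have "t p \<zero>\<^bsub>obj V p\<^esub> = \<zero>\<^bsub>obj W p\<^esub>" "t' p \<zero>\<^bsub>obj V p\<^esub> = \<zero>\<^bsub>obj W p\<^esub>"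
      "h p \<zero>\<^bsub>obj V p\<^esub> = \<zero>\<^bsub>obj Z (p - 1)\<^esub>" "h' p \<zero>\<^bsub>obj V p\<^esub> = \<zero>\<^bsub>obj Z (p - 1)\<^esub>"
      by (rule additive_zero; simp add: closed add)+
    then show "t p \<zero>\<^bsub>obj V p\<^esub> = t' p \<zero>\<^bsub>obj V p\<^esub> \<and> h p \<zero>\<^bsub>obj V p\<^esub> = h' p \<zero>\<^bsub>obj V p\<^esub>" by simp
    show "t p (x \<oplus>\<^bsub>obj V p\<^esub> y) = t' p (x \<oplus>\<^bsub>obj V p\<^esub> y) \<and> h p (x \<oplus>\<^bsub>obj V p\<^esub> y) = h' p (x \<oplus>\<^bsub>obj V p\<^esub> y)"
      if "x \<in> carrier (obj V p)" "y \<in> carrier (obj V p)" "t p x = t' p x \<and> h p x = h' p x" "t p y = t' p y \<and> h p y = h' p y" for x y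
      using that by (simp add: add)
    show "t p (lam n a \<odot>\<^bsub>obj V p\<^esub> b) = t' p (lam n a \<odot>\<^bsub>obj V p\<^esub> b) \<and> h p (lam n a \<odot>\<^bsub>obj V p\<^esub> b) = h' p (lam n a \<odot>\<^bsub>obj V p\<^esub> b)"
      if b: "b \<in> ?low l p" for a b
    proof -
      have "b \<in> carrier (obj V p)" using b low by (rule rev_subsetD)
      moreover have "t p b = t' p b \<and> h p b = h' p b" using b eq by (elim UN_E) simp
      ultimately show ?thesis by (simp add: act)
    qed
  qed
  have good_transfer: "good t' h' p b"
    if th: "lin (t, h)" "lin (t', h')" and b: "b \<in> B l p" and eq: "\<forall>l'<Suc l. \<forall>p. \<forall>b\<in>B l' p. t p b = t' p b \<and> h p b = h' p b"
      and g: "good t h p b" for t h t' h' l p b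
  proof -
    have "diff V p b \<in> lin_span (Lam n) (obj V (p + 1)) (?low (Suc l) (p + 1))"
      using db[OF b] span_mono[of l "Suc l" "p + 1"] by auto
    then have "t (p + 1) (diff V p b) = t' (p + 1) (diff V p b) \<and> h (p + 1) (diff V p b) = h' (p + 1) (diff V p b)"
      by (rule agree_span[OF th eq])
    moreover have "t p b = t' p b \<and> h p b = h' p b" using eq b by blast
    ultimately show ?thesis using g by (simp add: good_def)
  qed
  have B_eq: "l = l'" if "b \<in> B l p" "b \<in> B l' p" for b l l' p
    using disj[of p] that unfolding disjoint_family_on_def by blast
  \<comment> \<open>Stage \<open>l\<close> meets the conditions on the levels below \<open>l\<close> and is kept there by all later stages, so
    that the stages have a limit.\<close>
  define stage where "stage l F \<longleftrightarrow> lin F \<and> (\<forall>l'<l. \<forall>p. \<forall>b\<in>B l' p. good (fst F) (snd F) p b)" for l F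
  define agree where "agree l F F' \<longleftrightarrow> (\<forall>l'<l. \<forall>p. \<forall>b\<in>B l' p. fst F p b = fst F' p b \<and> snd F p b = snd F' p b)"
    for l :: nat and F F' :: "(int \<Rightarrow> 'v \<Rightarrow> 'w) \<times> (int \<Rightarrow> 'v \<Rightarrow> 'z)"
  have gr0: "\<zero>\<^bsub>obj W p\<^esub> \<in> grade (obj W p) j" "\<zero>\<^bsub>obj Z p\<^esub> \<in> grade (obj Z p) j" for p j
    using gm.grade_zero[of n "obj W p"] gm.grade_zero[of n "obj Z p"] by (simp_all add: gm_def)
  have "\<exists>F. \<forall>l. stage l (F l) \<and> agree l (F l) (F (Suc l))"
  proof (rule dependent_nat_choice)
    have "\<exists>t h. lin (t, h) \<and> (\<forall>l p. \<forall>b\<in>B l p. t p b = \<zero>\<^bsub>obj W p\<^esub> \<and> h p b = \<zero>\<^bsub>obj Z (p - 1)\<^esub>)"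
    proof (rule ext)
      fix l p b assume "b \<in> B l p"
      then obtain j where "b \<in> grade (obj V p) j" using B_grade by blast
      then show "\<exists>j. b \<in> grade (obj V p) j \<and> \<zero>\<^bsub>obj W p\<^esub> \<in> grade (obj W p) j \<and> \<zero>\<^bsub>obj Z (p - 1)\<^esub> \<in> grade (obj Z (p - 1)) j"
        using gr0 by (intro exI[of _ j] conjI)
    qed
    then obtain t h where "lin (t, h)" by (elim exE conjE)
    then show "\<exists>F. stage 0 F" by (intro exI[of _ "(t, h)"]) (simp add: stage_def)
  next
    fix F l assume st: "stage l F"
    obtain t h where F: "F = (t, h)" by (cases F)
    have th: "lin (t, h)" and g: "\<forall>l'<l. \<forall>p. \<forall>b\<in>B l' p. good t h p b"
      using st by (simp_all add: stage_def F)
    have homs: "t p \<in> graded_hom n (obj V p) (obj W p)" "h p \<in> graded_hom n (obj V p) (obj Z (p - 1))" for p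
      using th by (auto simp: lin_def)
    define new where "new p b wu \<longleftrightarrow> (\<exists>j. b \<in> grade (obj V p) j \<and> fst wu \<in> grade (obj W p) j \<and> snd wu \<in> grade (obj Z (p - 1)) j) \<and>
        diff W p (fst wu) = t (p + 1) (diff V p b) \<and>
        s p (fst wu) \<ominus>\<^bsub>obj Z p\<^esub> r p b = diff Z (p - 1) (snd wu) \<oplus>\<^bsub>obj Z p\<^esub> h (p + 1) (diff V p b)" for p b wu
    have new_ex: "\<exists>wu. new p b wu" if b: "b \<in> B l p" for p b
    proof -
      obtain j where j: "b \<in> grade (obj V p) j" using B_grade b by blast
      have "good t h (p + 1) (diff V p b)" by (rule good_span[OF th g db[OF b]])
      from extend_one[OF th j this] obtain w u where "w \<in> grade (obj W p) j" "u \<in> grade (obj Z (p - 1)) j"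
          "diff W p w = t (p + 1) (diff V p b)"
          "s p w \<ominus>\<^bsub>obj Z p\<^esub> r p b = diff Z (p - 1) u \<oplus>\<^bsub>obj Z p\<^esub> h (p + 1) (diff V p b)"
        by (elim exE conjE)
      then have "new p b (w, u)" unfolding new_def fst_conv snd_conv using j by (intro conjI exI[of _ j])
      then show ?thesis by (rule exI)
    qed
    define wu where "wu p b = (SOME wu. new p b wu)" for p b
    have new: "new p b (wu p b)" if "b \<in> B l p" for p b
      unfolding wu_def by (rule someI_ex[OF new_ex[OF that]])
    have "\<exists>t' h'. lin (t', h') \<and> (\<forall>l' p. \<forall>b\<in>B l' p. t' p b = (if b \<in> B l p then fst (wu p b) else t p b) \<and>
        h' p b = (if b \<in> B l p then snd (wu p b) else h p b))"
    proof (rule ext)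
      fix l' p b assume b: "b \<in> B l' p"
      show "\<exists>j. b \<in> grade (obj V p) j \<and> (if b \<in> B l p then fst (wu p b) else t p b) \<in> grade (obj W p) j \<and>
          (if b \<in> B l p then snd (wu p b) else h p b) \<in> grade (obj Z (p - 1)) j"
      proof (cases "b \<in> B l p")
        case True
        then show ?thesis using new[OF True] by (simp add: new_def)
      next
        case False
        obtain j where j: "b \<in> grade (obj V p) j" using B_grade b by blast
        show ?thesis
          unfolding if_not_P[OF False]
          by (intro exI[of _ j] conjI j graded_hom_grade[OF homs(1) j] graded_hom_grade[OF homs(2) j])
      qed
    qed
    then obtain t' h' where th': "lin (t', h')" and
      val': "\<forall>l' p. \<forall>b\<in>B l' p. t' p b = (if b \<in> B l p then fst (wu p b) else t p b) \<and>
        h' p b = (if b \<in> B l p then snd (wu p b) else h p b)"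
      by (elim exE conjE)
    note val = val'[rule_format]
    have ag: "\<forall>l'<l. \<forall>p. \<forall>b\<in>B l' p. t p b = t' p b \<and> h p b = h' p b"
    proof (intro allI impI ballI)
      fix l' p b assume "l' < l" "b \<in> B l' p"
      then show "t p b = t' p b \<and> h p b = h' p b" using val[of b l' p] B_eq[of b l' p l] by auto
    qed
    have "good t' h' p b" if l': "l' < Suc l" and b: "b \<in> B l' p" for l' p b
    proof (cases "l' = l")
      case True
      then have bl: "b \<in> B l p" using b by simp
      have "t (p + 1) (diff V p b) = t' (p + 1) (diff V p b) \<and> h (p + 1) (diff V p b) = h' (p + 1) (diff V p b)"
        by (rule agree_span[OF th th' ag db[OF bl]])
      then show ?thesis using new[OF bl] val[OF bl] bl by (simp add: good_def new_def)
    next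
      case False
      then have "l' < l" using l' by simp
      then have gb: "good t h p b" using g b by simp
      have "\<forall>l''<Suc l'. \<forall>p. \<forall>b\<in>B l'' p. t p b = t' p b \<and> h p b = h' p b"
      proof (intro allI impI)
        fix l'' assume "l'' < Suc l'"
        then have "l'' < l" using \<open>l' < l\<close> by simp
        then show "\<forall>b\<in>B l'' p. t p b = t' p b \<and> h p b = h' p b" for p using ag by simp
      qed
      from good_transfer[OF th th' b this gb] show ?thesis .
    qed
    then show "\<exists>F'. stage (Suc l) F' \<and> agree l F F'"
      using th' ag by (intro exI[of _ "(t', h')"]) (simp add: stage_def agree_def F)
  qed
  then obtain F where F': "\<forall>l. stage l (F l) \<and> agree l (F l) (F (Suc l))" ..
  note F = conjunct1[OF spec[OF F']] conjunct2[OF spec[OF F']]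
  have F_agree: "agree (Suc l) (F (Suc l)) (F k)" if "Suc l \<le> k" for l k
    using that
  proof (induction k rule: dec_induct)
    case base
    show ?case by (simp add: agree_def)
  next
    case (step k)
    show ?case
      unfolding agree_def
    proof (intro allI impI ballI)
      fix l' p b assume l': "l' < Suc l" and b: "b \<in> B l' p"
      then have "l' < k" using step.hyps by simp
      then show "fst (F (Suc l)) p b = fst (F (Suc k)) p b \<and> snd (F (Suc l)) p b = snd (F (Suc k)) p b"
        using F(2)[of k] step.IH l' b by (simp add: agree_def)
    qed
  qed
  define lev where "lev p b = (SOME l. b \<in> B l p)" for p b
  have lev: "lev p b = l" if "b \<in> B l p" for p b l
    unfolding lev_def by (rule some_equality[where P = "\<lambda>l. b \<in> B l p", OF that]) (rule B_eq[OF _ that])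
  have F_homs: "fst (F l) p \<in> graded_hom n (obj V p) (obj W p)" "snd (F l) p \<in> graded_hom n (obj V p) (obj Z (p - 1))" for l p
    using F(1)[of l] by (auto simp: stage_def lin_def split: prod.splits)
  have "\<exists>t h. lin (t, h) \<and> (\<forall>l p. \<forall>b\<in>B l p. t p b = fst (F (Suc (lev p b))) p b \<and> h p b = snd (F (Suc (lev p b))) p b)"
  proof (rule ext)
    fix l p b assume "b \<in> B l p"
    then obtain j where "b \<in> grade (obj V p) j" using B_grade by blast
    then show "\<exists>j. b \<in> grade (obj V p) j \<and> fst (F (Suc (lev p b))) p b \<in> grade (obj W p) j \<and>
        snd (F (Suc (lev p b))) p b \<in> grade (obj Z (p - 1)) j"
      using graded_hom_grade[OF F_homs(1)] graded_hom_grade[OF F_homs(2)] by blast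
  qed
  then obtain t h where th: "lin (t, h)" and
    val': "\<forall>l p. \<forall>b\<in>B l p. t p b = fst (F (Suc (lev p b))) p b \<and> h p b = snd (F (Suc (lev p b))) p b"
    by (elim exE conjE)
  have val: "t p b = fst (F (Suc l)) p b \<and> h p b = snd (F (Suc l)) p b" if "b \<in> B l p" for l p b
    using val'[rule_format, OF that] lev[OF that] by simp
  have ag: "\<forall>l'<Suc l. \<forall>p. \<forall>b\<in>B l' p. fst (F (Suc l)) p b = t p b \<and> snd (F (Suc l)) p b = h p b" for l
  proof (intro allI impI ballI)
    fix l' p b assume "l' < Suc l" "b \<in> B l' p"
    then show "fst (F (Suc l)) p b = t p b \<and> snd (F (Suc l)) p b = h p b"
      using F_agree[of l' "Suc l"] val[of b l' p] by (auto simp: agree_def)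
  qed
  have good_basis: "good t h p b" if b: "b \<in> B l p" for l p b
  proof (rule good_transfer[OF _ th b ag])
    show "lin (fst (F (Suc l)), snd (F (Suc l)))" "good (fst (F (Suc l))) (snd (F (Suc l))) p b"
      using F(1)[of "Suc l"] b by (auto simp: stage_def)
  qed
  have good: "good t h p x" if "x \<in> carrier (obj V p)" for p x
    using R.X.mod basis that
  proof (induction x rule: free_basis_induct)
    case (gen a b)
    then obtain l where b: "b \<in> B l p" by blast
    show ?case by (rule good_lin(3)[OF th BV[OF b] good_basis[OF b]])
  qed (fact good_lin(1)[OF th], rule good_lin(2)[OF th])
  have homs: "\<And>p. t p \<in> graded_hom n (obj V p) (obj W p)" "\<And>p. h p \<in> graded_hom n (obj V p) (obj Z (p - 1))"
    using th by (auto simp: lin_def)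
  have "t \<in> chain_map n V W" using good homs(1) by (simp add: chain_map_def good_def)
  moreover have "homotopic n V Z (\<lambda>i. s i \<circ> t i) r"
    unfolding homotopic_def using good homs(2) by (intro exI[of _ h]) (simp add: good_def)
  ultimately show ?thesis by blast
qed

section \<open>Shifted complexes\<close>

abbreviation regrade :: "int \<Rightarrow> ('a, 'm) gmodule \<Rightarrow> ('a, 'm) gmodule" where
  "regrade j M \<equiv> M\<lparr>grade := (\<lambda>q. grade M (q - j))\<rparr>"

lemma regrade_ops [simp]:
  "finsum (regrade j M) f A = finsum M f A" "\<ominus>\<^bsub>regrade j M\<^esub> x = \<ominus>\<^bsub>M\<^esub> x" "x \<ominus>\<^bsub>regrade j M\<^esub> y = x \<ominus>\<^bsub>M\<^esub> y"
  by (simp_all add: finsum_def a_inv_def a_minus_def)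

lemma regrade_module:
  assumes "Module.module (Lam n) M"
  shows "Module.module (Lam n) (regrade j M)"
proof -
  interpret Module.module "Lam n" M by fact
  show ?thesis
  proof (rule moduleI)
    show "abelian_group (regrade j M)"
      using M.abelian_group_axioms
      by (simp add: abelian_group_def abelian_group_axioms_def abelian_monoid_def)
  qed (simp_all add: R.is_cring smult_l_distr smult_r_distr smult_assoc1)
qed

lemma regrade_graded:
  assumes M: "graded_module n M"
  shows "graded_module n (regrade j M)"
proof -
  interpret gm n M using M by (simp add: gm_def)
  have dec: "\<exists>!c. (\<forall>q. c q \<in> grade M (q - j)) \<and> finite {q. c q \<noteq> \<zero>\<^bsub>M\<^esub>} \<and> x = (\<Oplus>\<^bsub>M\<^esub>q\<in>{q. c q \<noteq> \<zero>\<^bsub>M\<^esub>}. c q)"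
    if x: "x \<in> carrier M" for x
  proof (rule ex1I)
    let ?c = "\<lambda>q. hcomp M x (q - j)"
    have eq: "{q. ?c q \<noteq> \<zero>\<^bsub>M\<^esub>} = (\<lambda>q. q + j) ` {q. hcomp M x q \<noteq> \<zero>\<^bsub>M\<^esub>}"
      by (auto intro: image_eqI[of _ _ "q - j" for q])
    have "(\<Oplus>\<^bsub>M\<^esub>q\<in>{q. ?c q \<noteq> \<zero>\<^bsub>M\<^esub>}. ?c q) = (\<Oplus>\<^bsub>M\<^esub>q\<in>{q. hcomp M x q \<noteq> \<zero>\<^bsub>M\<^esub>}. hcomp M x q)"
      unfolding eq using hcomp_closed[OF x] by (subst A.add.finprod_reindex) (auto simp: inj_on_def)
    then show "(\<forall>q. ?c q \<in> grade M (q - j)) \<and> finite {q. ?c q \<noteq> \<zero>\<^bsub>M\<^esub>} \<and> x = (\<Oplus>\<^bsub>M\<^esub>q\<in>{q. ?c q \<noteq> \<zero>\<^bsub>M\<^esub>}. ?c q)"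
      using hcomp_grade[OF x] hcomp_sum[OF x] hcomp_finite[OF x] by (simp add: eq)
  next
    fix c assume c: "(\<forall>q. c q \<in> grade M (q - j)) \<and> finite {q. c q \<noteq> \<zero>\<^bsub>M\<^esub>} \<and> x = (\<Oplus>\<^bsub>M\<^esub>q\<in>{q. c q \<noteq> \<zero>\<^bsub>M\<^esub>}. c q)"
    have cc: "c q \<in> carrier M" for q using c grade_closed by blast
    have "hcomp M x = (\<lambda>q. c (q + j))"
    proof (rule hcomp_unique)
      show "c (q + j) \<in> grade M q" for q using c[THEN conjunct1, rule_format, of "q + j"] by simp
      show "finite ((\<lambda>q. q - j) ` {q. c q \<noteq> \<zero>\<^bsub>M\<^esub>})" using c by simp
      show "c (q + j) = \<zero>\<^bsub>M\<^esub>" if "q \<notin> (\<lambda>q. q - j) ` {q. c q \<noteq> \<zero>\<^bsub>M\<^esub>}" for q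
      proof (rule ccontr)
        assume "c (q + j) \<noteq> \<zero>\<^bsub>M\<^esub>"
        then have "q + j - j \<in> (\<lambda>q. q - j) ` {q. c q \<noteq> \<zero>\<^bsub>M\<^esub>}" by (intro imageI) simp
        then show False using that by simp
      qed
      have "x = (\<Oplus>\<^bsub>M\<^esub>q\<in>{q. c q \<noteq> \<zero>\<^bsub>M\<^esub>}. c q)" using c by blast
      also have "\<dots> = (\<Oplus>\<^bsub>M\<^esub>q\<in>(\<lambda>q. q - j) ` {q. c q \<noteq> \<zero>\<^bsub>M\<^esub>}. c (q + j))"
        using cc by (subst A.add.finprod_reindex) (auto simp: inj_on_def)
      finally show "x = (\<Oplus>\<^bsub>M\<^esub>q\<in>(\<lambda>q. q - j) ` {q. c q \<noteq> \<zero>\<^bsub>M\<^esub>}. c (q + j))" .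
    qed
    then show "c = (\<lambda>q. hcomp M x (q - j))" by (simp add: fun_eq_iff)
  qed
  have act: "a \<odot>\<^bsub>M\<^esub> x \<in> grade M (d + q - j)" if "a \<in> Lam_grade n d" "x \<in> grade M (q - j)" for a d x q
    using grade_act[OF that] by (simp add: algebra_simps)
  have sub: "additive_subgroup (grade M (q - j)) (regrade j M)" for q
    using grade_subgroup[of "q - j"] by (simp add: additive_subgroup_def)
  show ?thesis
    unfolding graded_module_def using regrade_module[OF mod] sub dec act by simp
qed

lemma regrade_hom:
  assumes "f \<in> graded_hom n M N"
  shows "f \<in> graded_hom n (regrade j M) (regrade j N)"
  using graded_homD[OF assms] by (intro graded_homI) simp_all

lemma graded_hom_uminus:
  assumes f: "f \<in> graded_hom n M N" and N: "graded_module n N"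
  shows "(\<lambda>x. \<ominus>\<^bsub>N\<^esub> f x) \<in> graded_hom n M N"
proof -
  interpret gm n N using N by (simp add: gm_def)
  show ?thesis
    using graded_homD[OF f]
    by (intro graded_homI) (simp_all add: grade_uminus A.minus_add act_minus[OF mod] A.a_comm)
qed

lemma obj_shift [simp]: "obj (shift i j X) p = regrade j (obj X (p + i))"
  and diff_shift: "diff (shift i j X) p x = (if even i then diff X (p + i) x else \<ominus>\<^bsub>obj X (p + i + 1)\<^esub> diff X (p + i) x)"
  by (simp_all add: shift_def)

lemma shift_0 [simp]: "shift 0 0 X = X"
  by (cases X) (simp add: shift_def)

context cx
begin

lemma complex_shift: "complex n (shift i j X)"
  unfolding complex_def
proof (intro allI conjI ballI)
  fix p
  have idx: "p + 1 + i = p + i + 1" "p + 2 + i = p + i + 2" by simp_all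
  show "graded_module n (obj (shift i j X) p)" by (simp add: regrade_graded)
  have "(\<lambda>x. if even i then diff X (p + i) x else \<ominus>\<^bsub>obj X (p + i + 1)\<^esub> diff X (p + i) x)
      \<in> graded_hom n (obj X (p + i)) (obj X (p + i + 1))"
    using graded_hom_uminus[OF diff_hom graded] diff_hom by (cases "even i") simp_all
  then show "diff (shift i j X) p \<in> graded_hom n (obj (shift i j X) p) (obj (shift i j X) (p + 1))"
    unfolding obj_shift idx by (intro regrade_hom) (simp add: diff_shift[abs_def])
  fix x assume "x \<in> carrier (obj (shift i j X) p)"
  then have x: "x \<in> carrier (obj X (p + i))" by simp
  interpret A: abelian_group "obj X (p + i + 2)" by simp
  have "diff X (p + i + 1) (diff X (p + i) x) = \<zero>\<^bsub>obj X (p + i + 2)\<^esub>" by (rule diff_diff[OF x]) simp_all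
  moreover have "diff X (p + i + 1) (\<ominus>\<^bsub>obj X (p + i + 1)\<^esub> diff X (p + i) x)
      = \<ominus>\<^bsub>obj X (p + i + 2)\<^esub> diff X (p + i + 1) (diff X (p + i) x)"
    by (rule diff_uminus) (simp_all add: x)
  moreover have p2: "p + i + 1 + 1 = p + i + 2" by simp
  moreover have "\<ominus>\<^bsub>obj X (p + i + 2)\<^esub> \<zero>\<^bsub>obj X (p + i + 2)\<^esub> = \<zero>\<^bsub>obj X (p + i + 2)\<^esub>"
    by (rule A.minus_equality) simp_all
  ultimately have "diff (shift i j X) (p + 1) (diff (shift i j X) p x) = \<zero>\<^bsub>obj X (p + i + 2)\<^esub>"
    unfolding diff_shift idx p2 by (cases "even i") (simp_all only: if_True if_False)
  then show "diff (shift i j X) (p + 1) (diff (shift i j X) p x) = \<zero>\<^bsub>obj (shift i j X) (p + 2)\<^esub>"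
    unfolding obj_shift idx by simp
qed

lemma cocycles_shift: "cocycles (shift i j X) p = cocycles X (p + i)"
proof -
  interpret A: abelian_group "obj X (p + i + 1)" by simp
  have idx: "p + 1 + i = p + i + 1" by simp
  have "\<ominus>\<^bsub>obj X (p + i + 1)\<^esub> y = \<zero>\<^bsub>obj X (p + i + 1)\<^esub> \<longleftrightarrow> y = \<zero>\<^bsub>obj X (p + i + 1)\<^esub>"
    if "y \<in> carrier (obj X (p + i + 1))" for y
    using that A.minus_minus[OF that] A.minus_equality[of "\<zero>\<^bsub>obj X (p + i + 1)\<^esub>" "\<zero>\<^bsub>obj X (p + i + 1)\<^esub>"]
    by (metis A.l_zero A.zero_closed)
  then show ?thesis
    unfolding cocycles_def obj_shift idx diff_shift by auto
qed

lemma coboundaries_shift: "coboundaries (shift i j X) p = coboundaries X (p + i)"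
proof -
  have idx: "p - 1 + i = p + i - 1" by simp
  have *: "b \<in> coboundaries (shift i j X) p \<longleftrightarrow>
      (\<exists>w\<in>carrier (obj X (p + i - 1)). b = (if even i then diff X (p + i - 1) w else \<ominus>\<^bsub>obj X (p + i)\<^esub> diff X (p + i - 1) w))" for b
    unfolding coboundaries_def obj_shift idx diff_shift by (auto simp: image_iff)
  have uminus: "\<ominus>\<^bsub>obj X (p + i)\<^esub> diff X (p + i - 1) w = diff X (p + i - 1) (\<ominus>\<^bsub>obj X (p + i - 1)\<^esub> w)"
    if "w \<in> carrier (obj X (p + i - 1))" for w
    by (rule diff_uminus[symmetric, OF that]) simp
  show ?thesis
  proof (intro equalityI subsetI)
    fix b assume "b \<in> coboundaries (shift i j X) p"
    then obtain w where w: "w \<in> carrier (obj X (p + i - 1))"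
      "b = (if even i then diff X (p + i - 1) w else \<ominus>\<^bsub>obj X (p + i)\<^esub> diff X (p + i - 1) w)" unfolding * by blast
    have "diff X (p + i - 1) w \<in> coboundaries X (p + i)" by (rule coboundaryI[OF w(1)]) simp
    then show "b \<in> coboundaries X (p + i)" using w(2) coboundary_uminus by simp
  next
    fix b assume "b \<in> coboundaries X (p + i)"
    then obtain w where w: "w \<in> carrier (obj X (p + i - 1))" "b = diff X (p + i - 1) w" by (rule coboundaryE)
    interpret A: abelian_group "obj X (p + i - 1)" by simp
    show "b \<in> coboundaries (shift i j X) p"
      unfolding *
    proof (cases "even i")
      case False
      then show "\<exists>w\<in>carrier (obj X (p + i - 1)). b = (if even i then diff X (p + i - 1) w else \<ominus>\<^bsub>obj X (p + i)\<^esub> diff X (p + i - 1) w)"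
        using w uminus[of "\<ominus>\<^bsub>obj X (p + i - 1)\<^esub> w"] by (intro bexI[of _ "\<ominus>\<^bsub>obj X (p + i - 1)\<^esub> w"]) simp_all
    qed (use w in auto)
  qed
qed

end

lemma quasi_iso_shift:
  assumes X: "complex n X" and Y: "complex n Y" and f: "f \<in> quasi_iso n X Y"
  shows "(\<lambda>p. f (p + i)) \<in> quasi_iso n (shift i j X) (shift i j Y)"
proof -
  interpret F: cx_map n X Y f using X Y quasi_iso_chain_map[OF f] by (simp add: cx_map_def cx_def cx_map_axioms_def)
  have "(\<lambda>p. f (p + i)) \<in> chain_map n (shift i j X) (shift i j Y)"
    unfolding chain_map_def mem_Collect_eq
  proof (intro allI conjI ballI)
    fix p
    have idx: "p + 1 + i = p + i + 1" by simp
    show "f (p + i) \<in> graded_hom n (obj (shift i j X) p) (obj (shift i j Y) p)"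
      unfolding obj_shift by (rule regrade_hom[OF chain_map_hom[OF F.f]])
    fix x assume "x \<in> carrier (obj (shift i j X) p)"
    then have x: "x \<in> carrier (obj X (p + i))" by simp
    then show "f (p + 1 + i) (diff (shift i j X) p x) = diff (shift i j Y) p (f (p + i) x)"
      unfolding idx diff_shift using F.map_diff[OF x, of "p + i + 1"] F.map_uminus[of "diff X (p + i) x" "p + i + 1"] by simp
  qed
  then interpret S: cx_map n "shift i j X" "shift i j Y" "\<lambda>p. f (p + i)"
    by (simp add: cx_map_def cx_def cx_map_axioms_def F.X.complex_shift F.Y.complex_shift)
  show ?thesis
    by (rule S.quasi_isoI)
      (use F.quasi_iso_inj[OF f] F.quasi_iso_surj[OF f] in \<open>simp_all add: F.X.cocycles_shift F.X.coboundaries_shift F.Y.cocycles_shift F.Y.coboundaries_shift\<close>)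
qed

lemma lin_span_uminus:
  fixes M :: "('k::field lam, 'm) gmodule"
  assumes M: "Module.module (Lam n) M" and S: "S \<subseteq> carrier M" and x: "x \<in> lin_span (Lam n) M S"
  shows "\<ominus>\<^bsub>M\<^esub> x \<in> lin_span (Lam n) M S"
proof -
  interpret Module.module "Lam n" M by (rule M)
  obtain c F where F: "x = (\<Oplus>\<^bsub>M\<^esub>b\<in>F. c b \<odot>\<^bsub>M\<^esub> b)" "finite F" "F \<subseteq> S" "c \<in> F \<rightarrow> carrier (Lam n)"
    using x unfolding lin_span_def mem_Collect_eq by (elim exE conjE)
  have FM: "b \<in> carrier M" "c b \<in> carrier (Lam n)" if "b \<in> F" for b using F(3,4) S that by auto
  have xM: "x \<in> carrier M" unfolding F(1) by (rule M.finsum_closed) (simp add: FM Pi_def)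
  have "\<ominus>\<^bsub>M\<^esub> x = \<ominus>\<^bsub>Lam n\<^esub> \<one>\<^bsub>Lam n\<^esub> \<odot>\<^bsub>M\<^esub> x" using xM by (simp add: smult_l_minus)
  also have "\<dots> = (\<Oplus>\<^bsub>M\<^esub>b\<in>F. \<ominus>\<^bsub>Lam n\<^esub> \<one>\<^bsub>Lam n\<^esub> \<odot>\<^bsub>M\<^esub> (c b \<odot>\<^bsub>M\<^esub> b))"
    unfolding F(1) using F(2) FM by (intro finsum_smult_ldistr) auto
  also have "\<dots> = (\<Oplus>\<^bsub>M\<^esub>b\<in>F. (\<ominus>\<^bsub>Lam n\<^esub> \<one>\<^bsub>Lam n\<^esub> \<otimes>\<^bsub>Lam n\<^esub> c b) \<odot>\<^bsub>M\<^esub> b)"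
    using FM by (intro M.add.finprod_cong') (auto simp: smult_assoc1)
  finally show ?thesis
    unfolding lin_span_def mem_Collect_eq using F FM
    by (intro exI[of _ "\<lambda>b. \<ominus>\<^bsub>Lam n\<^esub> \<one>\<^bsub>Lam n\<^esub> \<otimes>\<^bsub>Lam n\<^esub> c b"] exI[of _ F]) auto
qed

lemma semi_free_shift:
  assumes X: "semi_free n X"
  shows "semi_free n (shift i j X)"
proof -
  interpret cx n X using X by (simp add: cx_def semi_free_def)
  obtain B :: "nat \<Rightarrow> int \<Rightarrow> 'b set" where
    B: "\<forall>p. (\<forall>l. B l p \<subseteq> (\<Union>j. grade (obj X p) j)) \<and> disjoint_family (\<lambda>l. B l p) \<and>
        free_basis (Lam n) (obj X p) (\<Union>l. B l p) \<and>
        (\<forall>l. diff X p ` B l p \<subseteq> lin_span (Lam n) (obj X (p + 1)) (\<Union>l'<l. B l' (p + 1)))"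
    using X unfolding semi_free_def by (elim conjE exE)
  show ?thesis
    unfolding semi_free_def
  proof (intro conjI complex_shift exI[of _ "\<lambda>l p. B l (p + i)"] allI)
    fix p l
    have idx: "p + 1 + i = p + i + 1" by simp
    note Bp = B[rule_format, of "p + i"]
    show "B l (p + i) \<subseteq> (\<Union>q. grade (obj (shift i j X) p) q)"
    proof
      fix b assume "b \<in> B l (p + i)"
      then obtain q where "b \<in> grade (obj X (p + i)) q" using Bp by blast
      then have "b \<in> grade (obj (shift i j X) p) (q + j)" by simp
      then show "b \<in> (\<Union>q. grade (obj (shift i j X) p) q)" by blast
    qed
    show "disjoint_family (\<lambda>l. B l (p + i))" using Bp by blast
    show "free_basis (Lam n) (obj (shift i j X) p) (\<Union>l. B l (p + i))"
      using Bp by (simp add: free_basis_def)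
    have span: "lin_span (Lam n) (obj (shift i j X) (p + 1)) S = lin_span (Lam n) (obj X (p + i + 1)) S" for S
      unfolding obj_shift idx by (simp add: lin_span_def)
    have sub: "(\<Union>l'<l. B l' (p + i + 1)) \<subseteq> carrier (obj X (p + i + 1))"
      using B[rule_format, of "p + i + 1"] unfolding free_basis_def by blast
    show "diff (shift i j X) p ` B l (p + i) \<subseteq> lin_span (Lam n) (obj (shift i j X) (p + 1)) (\<Union>l'<l. B l' (p + 1 + i))"
      unfolding span idx
    proof
      fix y assume "y \<in> diff (shift i j X) p ` B l (p + i)"
      then obtain b where b: "b \<in> B l (p + i)" "y = diff (shift i j X) p b" by blast
      then have "diff X (p + i) b \<in> lin_span (Lam n) (obj X (p + i + 1)) (\<Union>l'<l. B l' (p + i + 1))" using Bp by blast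
      then show "y \<in> lin_span (Lam n) (obj X (p + i + 1)) (\<Union>l'<l. B l' (p + i + 1))"
        using lin_span_uminus[OF mod sub] b(2) by (simp add: diff_shift)
    qed
  qed
qed

section \<open>Chain maps to \<open>\<Lambda>\<close> up to homotopy\<close>

lemma graded_hom_minus:
  assumes f: "f \<in> graded_hom n M N" and g: "g \<in> graded_hom n M N"
    and N: "Module.module (Lam n) N" and sub: "\<And>j. additive_subgroup (grade N j) N"
  shows "(\<lambda>x. f x \<ominus>\<^bsub>N\<^esub> g x) \<in> graded_hom n M N"
proof -
  interpret A: abelian_group N by (rule module_group[OF N])
  note closed = graded_hom_closed[OF f] graded_hom_closed[OF g]
  show ?thesis
  proof (rule graded_homI)
    fix j x assume "x \<in> grade M j"
    then have fg: "f x \<in> grade N j" "g x \<in> grade N j" using graded_hom_grade[OF f] graded_hom_grade[OF g] by blast+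
    interpret S: additive_subgroup "grade N j" N by (rule sub)
    show "f x \<ominus>\<^bsub>N\<^esub> g x \<in> grade N j"
      unfolding A.minus_eq by (intro S.a_closed S.a_inv_closed fg)
  qed (simp_all add: closed graded_hom_add[OF f] graded_hom_add[OF g] graded_hom_act[OF f] graded_hom_act[OF g]
      A.minus_eq A.minus_add A.a_ac act_distr[OF N] act_minus[OF N])
qed

lemma graded_hom_const_zero:
  assumes N: "Module.module (Lam n) N" and sub: "\<And>j. additive_subgroup (grade N j) N"
  shows "(\<lambda>x. \<zero>\<^bsub>N\<^esub>) \<in> graded_hom n M N"
proof -
  interpret A: abelian_group N by (rule module_group[OF N])
  show ?thesis
    by (rule graded_homI) (simp_all add: act_null[OF N] additive_subgroup.zero_closed[OF sub])
qed

text \<open>Homotopies into a target add and subtract as soon as its terms are modules with homogeneous subgroups and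
  its differential is additive. This covers both a complex and \<open>\<Lambda>\<close> placed in degree zero.\<close>

locale additive_target =
  fixes n :: "nat \<Rightarrow> nat" and Y :: "('k::field lam, 'm) gcomplex"
  assumes module: "\<And>i. Module.module (Lam n) (obj Y i)"
    and subgroup: "\<And>i j. additive_subgroup (grade (obj Y i) j) (obj Y i)"
    and closed: "\<And>i x. x \<in> carrier (obj Y (i - 1)) \<Longrightarrow> diff Y (i - 1) x \<in> carrier (obj Y i)"
    and add: "\<And>i x y. x \<in> carrier (obj Y (i - 1)) \<Longrightarrow> y \<in> carrier (obj Y (i - 1)) \<Longrightarrow>
      diff Y (i - 1) (x \<oplus>\<^bsub>obj Y (i - 1)\<^esub> y) = diff Y (i - 1) x \<oplus>\<^bsub>obj Y i\<^esub> diff Y (i - 1) y"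
begin

lemma homotopic_common:
  fixes f f' g :: "int \<Rightarrow> 'l \<Rightarrow> 'm"
  assumes X: "complex n X" and f: "\<And>i x. x \<in> carrier (obj X i) \<Longrightarrow> f i x \<in> carrier (obj Y i)"
    and f': "\<And>i x. x \<in> carrier (obj X i) \<Longrightarrow> f' i x \<in> carrier (obj Y i)"
    and g: "\<And>i x. x \<in> carrier (obj X i) \<Longrightarrow> g i x \<in> carrier (obj Y i)"
    and fg: "homotopic n X Y f g" and fg': "homotopic n X Y f' g"
  shows "homotopic n X Y f f'"
proof -
  interpret X: cx n X by (rule cx.intro[OF X])
  obtain h where h: "\<And>i. h i \<in> graded_hom n (obj X i) (obj Y (i - 1))"
    and hf: "\<And>i x. x \<in> carrier (obj X i) \<Longrightarrow>
      f i x \<ominus>\<^bsub>obj Y i\<^esub> g i x = diff Y (i - 1) (h i x) \<oplus>\<^bsub>obj Y i\<^esub> h (i + 1) (diff X i x)"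
    using fg unfolding homotopic_def by blast
  obtain k where k: "\<And>i. k i \<in> graded_hom n (obj X i) (obj Y (i - 1))"
    and kf: "\<And>i x. x \<in> carrier (obj X i) \<Longrightarrow>
      f' i x \<ominus>\<^bsub>obj Y i\<^esub> g i x = diff Y (i - 1) (k i x) \<oplus>\<^bsub>obj Y i\<^esub> k (i + 1) (diff X i x)"
    using fg' unfolding homotopic_def by blast
  show ?thesis
    unfolding homotopic_def
  proof (intro exI[of _ "\<lambda>i x. h i x \<ominus>\<^bsub>obj Y (i - 1)\<^esub> k i x"] conjI allI ballI)
    fix i
    show "(\<lambda>x. h i x \<ominus>\<^bsub>obj Y (i - 1)\<^esub> k i x) \<in> graded_hom n (obj X i) (obj Y (i - 1))"
      by (rule graded_hom_minus[OF h k module subgroup])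
    fix x assume x: "x \<in> carrier (obj X i)"
    interpret A: abelian_group "obj Y i" by (rule module_group[OF module])
    interpret B: abelian_group "obj Y (i - 1)" by (rule module_group[OF module])
    have idx: "i + 1 - 1 = i" by simp
    have hx: "h i x \<in> carrier (obj Y (i - 1))" "k i x \<in> carrier (obj Y (i - 1))"
      by (rule graded_hom_closed[OF h x], rule graded_hom_closed[OF k x])
    have dx: "diff X i x \<in> carrier (obj X (i + 1))" using x by simp
    have hd: "h (i + 1) (diff X i x) \<in> carrier (obj Y i)" "k (i + 1) (diff X i x) \<in> carrier (obj Y i)"
      using graded_hom_closed[OF h dx] graded_hom_closed[OF k dx] unfolding idx by blast+
    have dk: "diff Y (i - 1) (\<ominus>\<^bsub>obj Y (i - 1)\<^esub> k i x) = \<ominus>\<^bsub>obj Y i\<^esub> diff Y (i - 1) (k i x)"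
      by (rule additive_uminus[OF B.abelian_group_axioms A.abelian_group_axioms closed add hx(2)])
    have diff_minus: "diff Y (i - 1) (h i x \<ominus>\<^bsub>obj Y (i - 1)\<^esub> k i x)
        = diff Y (i - 1) (h i x) \<ominus>\<^bsub>obj Y i\<^esub> diff Y (i - 1) (k i x)"
      unfolding A.minus_eq B.minus_eq add[OF hx(1) B.a_inv_closed[OF hx(2)]] dk by (rule refl)
    have swap: "(a \<oplus>\<^bsub>obj Y i\<^esub> b) \<ominus>\<^bsub>obj Y i\<^esub> (c \<oplus>\<^bsub>obj Y i\<^esub> d) = (a \<ominus>\<^bsub>obj Y i\<^esub> c) \<oplus>\<^bsub>obj Y i\<^esub> (b \<ominus>\<^bsub>obj Y i\<^esub> d)"
      if "a \<in> carrier (obj Y i)" "b \<in> carrier (obj Y i)" "c \<in> carrier (obj Y i)" "d \<in> carrier (obj Y i)" for a b c d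
      using that by (simp add: A.minus_eq A.minus_add A.a_ac)
    have cancel: "a \<ominus>\<^bsub>obj Y i\<^esub> c = (a \<ominus>\<^bsub>obj Y i\<^esub> b) \<ominus>\<^bsub>obj Y i\<^esub> (c \<ominus>\<^bsub>obj Y i\<^esub> b)"
      if "a \<in> carrier (obj Y i)" "b \<in> carrier (obj Y i)" "c \<in> carrier (obj Y i)" for a b c
      using that by (simp add: A.minus_eq A.minus_add A.a_ac A.r_neg1 A.r_neg2 A.r_neg A.l_neg)
    have "f i x \<ominus>\<^bsub>obj Y i\<^esub> f' i x = (f i x \<ominus>\<^bsub>obj Y i\<^esub> g i x) \<ominus>\<^bsub>obj Y i\<^esub> (f' i x \<ominus>\<^bsub>obj Y i\<^esub> g i x)"
      by (rule cancel[OF f[OF x] g[OF x] f'[OF x]])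
    also have "\<dots> = (diff Y (i - 1) (h i x) \<ominus>\<^bsub>obj Y i\<^esub> diff Y (i - 1) (k i x)) \<oplus>\<^bsub>obj Y i\<^esub>
        (h (i + 1) (diff X i x) \<ominus>\<^bsub>obj Y i\<^esub> k (i + 1) (diff X i x))"
      unfolding hf[OF x] kf[OF x] by (rule swap[OF closed[OF hx(1)] hd(1) closed[OF hx(2)] hd(2)])
    finally show "f i x \<ominus>\<^bsub>obj Y i\<^esub> f' i x = diff Y (i - 1) (h i x \<ominus>\<^bsub>obj Y (i - 1)\<^esub> k i x) \<oplus>\<^bsub>obj Y i\<^esub>
        (h (i + 1) (diff X i x) \<ominus>\<^bsub>obj Y (i + 1 - 1)\<^esub> k (i + 1) (diff X i x))"
      unfolding diff_minus idx .
  qed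
qed

end

lemma (in cx) additive_target: "additive_target n X"
proof (rule additive_target.intro)
  show "additive_subgroup (grade (obj X i) j) (obj X i)" for i j
    using graded[of i] unfolding graded_module_def by blast
qed (simp_all add: diff_add[of _ "i - 1" _ i for i])

lemma module_Lam_zero:
  assumes C: "C = carrier (Lam n) \<or> C = {\<zero>\<^bsub>Lam n\<^esub>}"
  shows "Module.module (Lam n) ((Lam_module n :: ('k::field lam, 'k lam) gmodule)\<lparr>carrier := C, grade := G\<rparr>)"
proof -
  interpret L: cring "Lam n :: 'k lam ring" by (rule cring_Lam)
  show ?thesis
  proof (rule moduleI)
    show "abelian_group ((Lam_module n :: ('k::field lam, 'k lam) gmodule)\<lparr>carrier := C, grade := G\<rparr>)"
      by (rule abelian_groupI) (use C in \<open>auto simp: Lam_module_def L.a_ac intro: L.l_neg bexI[of _ "\<ominus>\<^bsub>Lam n\<^esub> x" for x]\<close>)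
  qed (use C in \<open>auto simp: Lam_module_def L.cring_axioms L.l_distr L.r_distr L.m_assoc\<close>)
qed

lemma Lam_grade_subgroup: "additive_subgroup (Lam_grade n j) (Lam_module n :: ('k::field lam, 'k lam) gmodule)"
proof -
  let ?N = "Lam_module n :: ('k lam, 'k lam) gmodule"
  have "Module.module (Lam n) ?N"
    using module_Lam_zero[of "carrier (Lam n)" n "Lam_grade n"] by (simp add: Lam_module_def)
  then interpret A: abelian_group ?N by (rule module_group)
  have grade: "Lam_grade n j = lam n ` homogeneous_polys j" by (simp add: Lam_grade_def lam_def[abs_def])
  have N: "carrier ?N = carrier (Lam n)" "add ?N = add (Lam n)" "\<zero>\<^bsub>?N\<^esub> = lam n 0"
    by (simp_all add: Lam_module_def lam_zero)
  have neg: "\<ominus>\<^bsub>?N\<^esub> lam n p = lam n (- p)" for p :: "'k inf_poly"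
    by (rule A.minus_equality) (simp_all add: N flip: lam_add)
  show ?thesis
    unfolding additive_subgroup_def
  proof (rule A.add.subgroupI)
    show "Lam_grade n j \<subseteq> carrier ?N" by (auto simp: grade N)
    have "0 \<in> homogeneous_polys j" by (simp add: homogeneous_polys_def)
    then show "Lam_grade n j \<noteq> {}" by (auto simp: grade)
  next
    fix a :: "'k lam" assume "a \<in> Lam_grade n j"
    then obtain p where "p \<in> homogeneous_polys j" "a = lam n p" unfolding grade by blast
    then show "\<ominus>\<^bsub>?N\<^esub> a \<in> Lam_grade n j"
      using neg[of p] unfolding grade by (simp add: homogeneous_polys_def)
  next
    fix a b :: "'k lam" assume "a \<in> Lam_grade n j" "b \<in> Lam_grade n j"
    then obtain p q where pq: "p \<in> homogeneous_polys j" "a = lam n p" "q \<in> homogeneous_polys j" "b = lam n q"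
      unfolding grade by blast
    then have "p + q \<in> homogeneous_polys j"
      using keys_add[of p q] by (auto simp: homogeneous_polys_def)
    then show "a \<oplus>\<^bsub>?N\<^esub> b \<in> Lam_grade n j"
      unfolding grade N pq lam_add[symmetric] by (rule imageI)
  qed
qed

lemma obj_Lam_complex:
  "obj (Lam_complex n) i = (Lam_module n)\<lparr>carrier := if i = 0 then carrier (Lam n) else {\<zero>\<^bsub>Lam n\<^esub>},
    grade := if i = 0 then Lam_grade n else (\<lambda>_. {\<zero>\<^bsub>Lam n\<^esub>})\<rparr>"
  by (simp add: Lam_complex_def Lam_module_def)

lemma diff_Lam_complex [simp]: "diff (Lam_complex n) i x = \<zero>\<^bsub>Lam n\<^esub>"
  by (simp add: Lam_complex_def)

lemma zero_Lam_complex [simp]: "\<zero>\<^bsub>obj (Lam_complex n) i\<^esub> = \<zero>\<^bsub>Lam n\<^esub>"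
  by (simp add: Lam_complex_def Lam_module_def)

lemma additive_target_Lam_complex: "additive_target n (Lam_complex n :: ('k::field lam, 'k lam) gcomplex)"
proof (rule additive_target.intro)
  interpret L: cring "Lam n :: 'k lam ring" by (rule cring_Lam)
  fix i j
  have mod: "Module.module (Lam n) (obj (Lam_complex n :: ('k lam, 'k lam) gcomplex) i)" for i
    unfolding obj_Lam_complex by (rule module_Lam_zero) simp
  interpret A: abelian_group "obj (Lam_complex n :: ('k lam, 'k lam) gcomplex) i" by (rule module_group[OF mod])
  show "Module.module (Lam n) (obj (Lam_complex n :: ('k lam, 'k lam) gcomplex) i)" by (rule mod)
  show "additive_subgroup (grade (obj (Lam_complex n) i) j) (obj (Lam_complex n :: ('k lam, 'k lam) gcomplex) i)"
  proof (cases "i = 0")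
    case True
    then have "obj (Lam_complex n :: ('k lam, 'k lam) gcomplex) i = Lam_module n" by (simp add: Lam_complex_def)
    moreover have "grade (Lam_module n :: ('k lam, 'k lam) gmodule) = Lam_grade n" by (simp add: Lam_module_def)
    ultimately show ?thesis by (simp add: Lam_grade_subgroup)
  next
    case False
    then show ?thesis using A.add.triv_subgroup by (simp add: additive_subgroup_def obj_Lam_complex Lam_module_def)
  qed
  fix x y :: "'k lam"
  show "diff (Lam_complex n) (i - 1) x \<in> carrier (obj (Lam_complex n) i)"
    using A.zero_closed by simp
  show "diff (Lam_complex n) (i - 1) (x \<oplus>\<^bsub>obj (Lam_complex n) (i - 1)\<^esub> y)
      = diff (Lam_complex n) (i - 1) x \<oplus>\<^bsub>obj (Lam_complex n) i\<^esub> diff (Lam_complex n) (i - 1) y"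
    using A.l_zero[OF A.zero_closed] by simp
qed

text \<open>A chain map to \<open>\<Lambda>\<close> is a single graded map in degree zero. If it vanishes on cocycles, it factors through the
  image of the differential, and injectivity of \<open>\<Lambda>\<close> extends the factorisation to a homotopy.\<close>

lemma null_homotopic_Lam:
  fixes V :: "('k::field lam, 'v) gcomplex"
  assumes n: "\<And>i. 1 \<le> n (Suc i)" and V: "complex n V" and \<phi>: "\<phi> \<in> chain_map n V (Lam_complex n)"
    and kills: "\<And>x. x \<in> cocycles V 0 \<Longrightarrow> \<phi> 0 x = \<zero>\<^bsub>Lam n\<^esub>"
  shows "homotopic n V (Lam_complex n) \<phi> (\<lambda>i x. \<zero>\<^bsub>Lam n\<^esub>)"
proof -
  interpret V: cx n V by (rule cx.intro[OF V])
  interpret Y: additive_target n "Lam_complex n :: ('k lam, 'k lam) gcomplex" by (rule additive_target_Lam_complex)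
  have obj0: "obj (Lam_complex n) 0 = (Lam_module n :: ('k lam, 'k lam) gmodule)" by (simp add: Lam_complex_def)
  have d: "diff V 0 \<in> graded_hom n (obj V 0) (obj V 1)" using V.diff_hom[of 0] by simp
  have f: "\<phi> 0 \<in> graded_hom n (obj V 0) (Lam_module n)" using chain_map_hom[OF \<phi>, of 0] by (simp add: obj0)
  have "\<exists>h\<in>graded_hom n (obj V 1) (Lam_module n). \<forall>x\<in>carrier (obj V 0). h (diff V 0 x) = \<phi> 0 x"
    by (rule Lam_injective[OF n V.graded V.graded d f]) (simp_all add: kills V.cocycle_iff)
  then obtain h where h: "h \<in> graded_hom n (obj V 1) (Lam_module n)"
    and hd: "\<And>x. x \<in> carrier (obj V 0) \<Longrightarrow> h (diff V 0 x) = \<phi> 0 x" by blast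
  let ?h = "\<lambda>i::int. if i = 1 then h else (\<lambda>_. \<zero>\<^bsub>Lam n\<^esub>)"
  show ?thesis
    unfolding homotopic_def
  proof (intro exI[of _ ?h] conjI allI ballI)
    fix i
    show "?h i \<in> graded_hom n (obj V i) (obj (Lam_complex n) (i - 1))"
      using h graded_hom_const_zero[OF Y.module[of "i - 1"] Y.subgroup[of "i - 1"], where M = "obj V i"] by (simp add: obj0)
    fix x assume x: "x \<in> carrier (obj V i)"
    interpret A: abelian_group "obj (Lam_complex n :: ('k lam, 'k lam) gcomplex) i" by (rule module_group[OF Y.module])
    have zero: "\<zero>\<^bsub>Lam n\<^esub> = \<zero>\<^bsub>obj (Lam_complex n :: ('k lam, 'k lam) gcomplex) i\<^esub>" by simp
    have \<phi>x: "\<phi> i x \<in> carrier (obj (Lam_complex n) i)" by (rule graded_hom_closed[OF chain_map_hom[OF \<phi>] x])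
    have "?h (i + 1) (diff V i x) = \<phi> i x"
    proof (cases "i = 0")
      case True
      then show ?thesis using hd[of x] x by simp
    next
      case False
      then show ?thesis using \<phi>x by (simp add: obj_Lam_complex)
    qed
    then show "\<phi> i x \<ominus>\<^bsub>obj (Lam_complex n) i\<^esub> \<zero>\<^bsub>Lam n\<^esub> = diff (Lam_complex n) (i - 1) (?h i x) \<oplus>\<^bsub>obj (Lam_complex n) i\<^esub> ?h (i + 1) (diff V i x)"
      unfolding diff_Lam_complex A.minus_eq zero using \<phi>x by (simp del: zero_Lam_complex)
  qed
qed

section \<open>Vanishing of the morphism groups\<close>

lemma identity_quasi_iso:
  assumes "complex n X"
  shows "(\<lambda>i x. x) \<in> quasi_iso n X X"
proof -
  interpret X: cx n X by (rule cx.intro[OF assms])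
  have "(\<lambda>i x. x) \<in> chain_map n X X" by (auto simp: chain_map_def intro!: graded_homI)
  then interpret cx_map n X X "\<lambda>i x. x" by unfold_locales
  show ?thesis
  proof (rule quasi_isoI)
    fix i y assume y: "y \<in> cocycles X i"
    interpret A: abelian_group "obj X i" by simp
    have "y \<ominus>\<^bsub>obj X i\<^esub> y = \<zero>\<^bsub>obj X i\<^esub>" using y by (simp add: A.minus_eq A.r_neg)
    then show "\<exists>x\<in>cocycles X i. x \<ominus>\<^bsub>obj X i\<^esub> y \<in> coboundaries X i" using y by (intro bexI[of _ y]) simp_all
  qed
qed

text \<open>Two fractions \<open>Z \<leftarrow> W \<rightarrow> \<Lambda>\<close> and \<open>Z \<leftarrow> W' \<rightarrow> \<Lambda>\<close> both lift to the semi-free resolution \<open>V\<close> of \<open>Z\<close>; there the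
  denominators are homotopic to \<open>\<rho>\<close> and the numerators are null-homotopic, so that the fractions agree.\<close>

lemma Hom_D_trivial:
  fixes V Z :: "('k::field lam, 'u) gcomplex"
  assumes n: "\<And>i. 1 \<le> n (Suc i)" and Z: "complex n Z" and V: "semi_free n V" and \<rho>: "\<rho> \<in> quasi_iso n V Z"
    and kills: "\<And>\<phi> x. \<phi> \<in> chain_map n V (Lam_complex n) \<Longrightarrow> x \<in> cocycles V 0 \<Longrightarrow> \<phi> 0 x = \<zero>\<^bsub>Lam n\<^esub>"
  shows "Hom_D n Z (Lam_complex n) = {zero_D n Z (Lam_complex n)}"
proof -
  let ?L = "Lam_complex n :: ('k lam, 'k lam) gcomplex"
  interpret Z: cx n Z by (rule cx.intro[OF Z])
  interpret TZ: additive_target n Z by (rule Z.additive_target)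
  interpret TL: additive_target n ?L by (rule additive_target_Lam_complex)
  have Vc: "complex n V" using V by (simp add: semi_free_def)
  interpret V: cx n V by (rule cx.intro[OF Vc])
  have zero_closed: "\<zero>\<^bsub>Lam n\<^esub> \<in> carrier (obj ?L i)" for i by (simp add: obj_Lam_complex flip: lam_zero)
  have lift: "\<exists>t. t \<in> chain_map n V W \<and> (\<lambda>i. s i \<circ> t i) \<in> quasi_iso n V Z \<and> homotopic n V Z (\<lambda>i. s i \<circ> t i) \<rho> \<and>
      (\<lambda>i. f i \<circ> t i) \<in> chain_map n V ?L \<and> homotopic n V ?L (\<lambda>i. f i \<circ> t i) (\<lambda>i x. \<zero>\<^bsub>Lam n\<^esub>)"
    if frac: "(W, s, f) \<in> fractions n Z ?L" for W s f
  proof -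
    have W: "complex n W" and s: "s \<in> quasi_iso n W Z" and f: "f \<in> chain_map n W ?L"
      using frac by (simp_all add: fractions_def)
    obtain t where t: "t \<in> chain_map n V W" "homotopic n V Z (\<lambda>i. s i \<circ> t i) \<rho>"
      using semi_free_lift[OF V W Z s quasi_iso_chain_map[OF \<rho>]] by blast
    have st: "(\<lambda>i. s i \<circ> t i) \<in> chain_map n V Z" by (rule chain_map_comp[OF t(1) quasi_iso_chain_map[OF s]])
    have ft: "(\<lambda>i. f i \<circ> t i) \<in> chain_map n V ?L" by (rule chain_map_comp[OF t(1) f])
    have "homotopic n V ?L (\<lambda>i. f i \<circ> t i) (\<lambda>i x. \<zero>\<^bsub>Lam n\<^esub>)"
      by (rule null_homotopic_Lam[where n = n, OF n Vc ft]) (rule kills[OF ft])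
    with t ft quasi_iso_homotopic[OF Vc Z \<rho> st t(2)] show ?thesis by (intro exI[of _ t] conjI)
  qed
  have equiv: "((W, s, f), (W', s', f')) \<in> fraction_equiv n Z ?L"
    if frac: "(W, s, f) \<in> fractions n Z ?L" and frac': "(W', s', f') \<in> fractions n Z ?L" for W s f W' s' f'
  proof -
    obtain t where t: "t \<in> chain_map n V W" "(\<lambda>i. s i \<circ> t i) \<in> quasi_iso n V Z" "homotopic n V Z (\<lambda>i. s i \<circ> t i) \<rho>"
      "(\<lambda>i. f i \<circ> t i) \<in> chain_map n V ?L" "homotopic n V ?L (\<lambda>i. f i \<circ> t i) (\<lambda>i x. \<zero>\<^bsub>Lam n\<^esub>)"
      using lift[OF frac] by (elim exE conjE)
    obtain t' where t': "t' \<in> chain_map n V W'" "(\<lambda>i. s' i \<circ> t' i) \<in> quasi_iso n V Z" "homotopic n V Z (\<lambda>i. s' i \<circ> t' i) \<rho>"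
      "(\<lambda>i. f' i \<circ> t' i) \<in> chain_map n V ?L" "homotopic n V ?L (\<lambda>i. f' i \<circ> t' i) (\<lambda>i x. \<zero>\<^bsub>Lam n\<^esub>)"
      using lift[OF frac'] by (elim exE conjE)
    have "homotopic n V Z (\<lambda>i. s i \<circ> t i) (\<lambda>i. s' i \<circ> t' i)"
      by (rule TZ.homotopic_common[OF Vc graded_hom_closed[OF chain_map_hom[OF quasi_iso_chain_map[OF t(2)]]]
          graded_hom_closed[OF chain_map_hom[OF quasi_iso_chain_map[OF t'(2)]]]
          graded_hom_closed[OF chain_map_hom[OF quasi_iso_chain_map[OF \<rho>]]] t(3) t'(3)])
    moreover have "homotopic n V ?L (\<lambda>i. f i \<circ> t i) (\<lambda>i. f' i \<circ> t' i)"
      by (rule TL.homotopic_common[OF Vc graded_hom_closed[OF chain_map_hom[OF t(4)]]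
          graded_hom_closed[OF chain_map_hom[OF t'(4)]] zero_closed t(5) t'(5)])
    ultimately show ?thesis
      unfolding fraction_equiv_def mem_Collect_eq prod.case
      using frac frac' Vc t(1,2) t'(1) by blast
  qed
  let ?id = "(Z, (\<lambda>i x. x), (\<lambda>i x. \<zero>\<^bsub>obj ?L i\<^esub>))"
  have "(\<lambda>i x. \<zero>\<^bsub>obj ?L i\<^esub>) \<in> chain_map n Z ?L"
    unfolding chain_map_def mem_Collect_eq
    by (intro allI conjI ballI graded_hom_const_zero[OF TL.module TL.subgroup]) simp
  then have id: "?id \<in> fractions n Z ?L"
    unfolding fractions_def mem_Collect_eq prod.case using Z identity_quasi_iso[OF Z] by blast
  have classes: "fraction_equiv n Z ?L `` {a} = fractions n Z ?L" if "a \<in> fractions n Z ?L" for a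
  proof (intro equalityI subsetI)
    fix b assume "b \<in> fraction_equiv n Z ?L `` {a}"
    then show "b \<in> fractions n Z ?L" unfolding fraction_equiv_def by (cases a; cases b) auto
  next
    fix b assume "b \<in> fractions n Z ?L"
    then show "b \<in> fraction_equiv n Z ?L `` {a}" using that equiv by (cases a; cases b) simp
  qed
  have "Hom_D n Z ?L = {fractions n Z ?L}"
    unfolding Hom_D_def quotient_def using classes id by auto
  then show ?thesis unfolding zero_D_def classes[OF id] .
qed

theorem theorem7p1:
  fixes n :: "nat \<Rightarrow> nat"
    and E X :: "('k::field lam, 'u) gcomplex"
    and T :: "('k lam, ((int \<times> 'u \<times> 'u) \<Rightarrow>\<^sub>0 int) set) gcomplex"
  assumes "countable (UNIV :: 'k set)"
    and "\<And>i. 1 \<le> i \<Longrightarrow> 2 \<le> n i"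
    and "complex n E" and "complex n X"
    and "\<not> zero_object E"
    and "derived_tensor n X E T" and "zero_object T"
  shows "RHom_zero n X (Lam_complex n) \<and>
         Hom_D n X (Lam_complex n) = {zero_D n X (Lam_complex n)}"
proof -
  obtain P r where P: "semi_free n P" and r: "r \<in> quasi_iso n P X" and T: "T = tensor n P E"
    using assms(6) unfolding derived_tensor_def by blast
  have Pc: "complex n P" using P by (simp add: semi_free_def)
  interpret tensor_cx n P E using Pc assms(3) by (simp add: tensor_cx_def cx_def)
  interpret X: cx n X by (rule cx.intro[OF assms(4)])
  have n: "1 \<le> n (Suc i)" for i using assms(2)[of "Suc i"] by simp
  have free: "\<exists>B. free_basis (Lam n) (obj P p) B" for p using P unfolding semi_free_def by blast
  have exact: "forms_exact n P E S" for S
    by (rule forms_exact_all[OF assms(7)[unfolded T] n free])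
  have shifted: "Hom_D n (shift i j X) (Lam_complex n) = {zero_D n (shift i j X) (Lam_complex n)}" for i j
  proof (rule Hom_D_trivial[where n = n, OF n X.complex_shift semi_free_shift[OF P] quasi_iso_shift[OF Pc assms(4) r]])
    fix \<phi> :: "int \<Rightarrow> 'u \<Rightarrow> 'k lam" and z
    assume \<phi>: "\<phi> \<in> chain_map n (shift i j P) (Lam_complex n)" and z: "z \<in> cocycles (shift i j P) 0"
    have hom: "\<phi> 0 \<in> graded_hom n (regrade j (obj P i)) (Lam_module n)"
      using chain_map_hom[OF \<phi>, of 0] by (simp add: Lam_complex_def)
    show "\<phi> 0 z = \<zero>\<^bsub>Lam n\<^esub>"
    proof (rule hom_to_Lam_kills_cocycles[OF exact assms(5)])
      fix b assume "b \<in> coboundaries P i"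
      then have "b \<in> coboundaries (shift i j P) 0" by (simp add: P.coboundaries_shift)
      then obtain w where "w \<in> carrier (obj (shift i j P) (0 - 1))" "b = diff (shift i j P) (0 - 1) w"
        unfolding coboundaries_def by blast
      then show "\<phi> 0 b = \<zero>\<^bsub>Lam n\<^esub>" using chain_map_diff[OF \<phi>, of w "0 - 1" 0] by simp
    qed (use graded_homD[OF hom] z in \<open>simp_all add: Lam_module_def P.cocycles_shift\<close>)
  qed
  moreover have "Hom_D n X (Lam_complex n) = {zero_D n X (Lam_complex n)}"
    using shifted[of 0 0] by simp
  ultimately show ?thesis by (simp add: RHom_zero_def RHom_cohomology_def)
qed

end
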